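(* Let $F$ be a free group of finite rank with fixed basis $A$, let $H$ be a non-trivial finitely generated subgroup of $F$, and let $n$ be the number of vertices of $\Gamma(H)$. Let $H_{\mathsf{fi}}$ be the maximum finite-index extension of $H$ in $F$. \begin{itemize} \item $\mathsf{cc}(\Gamma(H_{\mathsf{fi}}))$ is obtained by minimizing the automaton over $\tilde A$ given by the vertices and edges of $\mathsf{cc}(\Gamma(H))$, with all states final (the choice of initial state does not matter). \item One can compute $\Gamma(H_{\mathsf{fi}})$ (from $\Gamma(H)$) in time $O(n\log n)$. \item One can decide in time $O(n\log n)$ whether identifying a given set of pairs of vertices of $\Gamma(H)$ (and reducing the resulting graph) produces a finite-index extension of $H$. \end{itemize}
   Context: Words: $F$ is a free group with finite basis $A$; $\bar A=\{\bar a: a\in A\}$ is a disjoint copy of $A$ and $\tilde A=A\cup\bar A$, with $\bar{\bar a}=a$. Elements of $F$ are identified with reduced words over $\tilde A$ (no factor $a\bar a$, $a\in\tilde A$). Stallings graph: each finitely generated $H\le F$ has a unique representation $\mathcal{A}(H)=(\Gamma(H),1)$, where $\Gamma(H)$ is a finite connected directed graph with edges labeled by $A$ and $1$ is a designated vertex, such that (i) for each $a\in A$ every vertex is the source of at most one and the target of at most one $a$-labeled edge; (ii) every vertex except possibly $1$ has degree (in-degree plus out-degree) at least $2$; (iii) a reduced word is in $H$ iff it labels a loop at $1$. Here an edge $(p,a,q)$, $a\in A$, is read as $p\xrightarrow{a}q$ and $q\xrightarrow{\bar a}p$. Reducing a graph means repeatedly identifying vertices $p,p'$ such that $q\xrightarrow{a}p$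 and $q\xrightarrow{a}p'$ for some vertex $q$ and $a\in\tilde A$. Core: for $H$ non-trivial, if every vertex of $\Gamma(H)$ has degree at least $2$, then $\mathsf{cc}(\Gamma(H))=\Gamma(H)$. Otherwise vertex $1$ has degree $1$; the tail consists of $1$ and all degree-$2$ vertices that can be connected to $1$ through other degree-$2$ vertices, and the core $\mathsf{cc}(\Gamma(H))$ is the rest of $\Gamma(H)$. Finite-index extensions: a finite-index extension of $H$ is a subgroup $G\le F$ with $H\le G$ and $[G:H]<\infty$. It is known that a finitely generated $H$ has a maximum finite-index extension, denoted $H_{\mathsf{fi}}$. Minimization: minimizing a (possibly partial) deterministic finite automaton $(Q,i,E,T)$ in which all states are accessible means identifying all pairs of states $p,q$ such that $(Q,p,E,T)$ and $(Q,q,E,T)$ accept the same language. The automaton here has as states the vertices of $\mathsf{cc}(\Gamma(H))$ and as transitions all $p\xrightarrow{a}q$, $a\in\tilde A$, of $\mathsf{cc}(\Gamma(H))$. Complexity: $F$ and $A$ are fixed, so constants may depend on $|A|$; time is counted in the usual unit-cost model, as a function of $n$.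
   Formalization: In the third item the time proved is O(n log n) plus a constant times the number k of given pairs, since up to n² pairs may be given and all may have to be read; this is O(n log n) whenever k = O(n log n). *)

theory Defs
  imports
    "HOL-Algebra.Coset"
    "HOL-Algebra.Generated_Groups"
    "HOL-Library.Landau_Symbols"
    Complex_Main
begin

text \<open>The letter \<open>(a, True)\<close> is \<open>a\<close>, the letter \<open>(a, False)\<close> is its formal inverse. The basis is the
  whole type \<open>'a\<close>, which is taken of class \<open>finite\<close> where finite rank is needed.\<close>

type_synonym 'a letter = "'a \<times> bool"
type_synonym 'a word = "'a letter list"

definition bar :: "'a letter \<Rightarrow> 'a letter" where
  "bar x = (fst x, \<not> snd x)"

definition reduced :: "'a word \<Rightarrow> bool" where
  "reduced w \<longleftrightarrow> successively (\<lambda>x y. y \<noteq> bar x) w"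

fun red_cons :: "'a letter \<Rightarrow> 'a word \<Rightarrow> 'a word" where
  "red_cons x [] = [x]"
| "red_cons x (y # w) = (if y = bar x then w else x # y # w)"

definition free_group :: "'a word monoid" where
  "free_group = \<lparr>carrier = {w. reduced w}, mult = (\<lambda>u v. foldr red_cons u v), one = []\<rparr>"

lemma bar_bar [simp]: "bar (bar x) = x"
  by (simp add: bar_def)

lemma bar_neq [simp]: "bar x \<noteq> x"
  by (simp add: bar_def prod_eq_iff)

lemma reduced_red_cons: "reduced w \<Longrightarrow> reduced (red_cons x w)"
  by (cases w) (auto simp: reduced_def successively_Cons)

lemma reduced_foldr: "reduced v \<Longrightarrow> reduced (foldr red_cons u v)"
  by (induction u) (auto simp: reduced_red_cons)

lemma red_cons_bar: "reduced w \<Longrightarrow> red_cons x (red_cons (bar x) w) = w"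
  by (cases w rule: remdups_adj.cases) (auto simp: reduced_def)

lemma foldr_red_cons: "reduced w \<Longrightarrow> foldr red_cons (red_cons x t) w = red_cons x (foldr red_cons t w)"
  by (cases t) (auto simp: red_cons_bar reduced_foldr)

lemma foldr_red_cons_assoc:
  "reduced w \<Longrightarrow> foldr red_cons (foldr red_cons u v) w = foldr red_cons u (foldr red_cons v w)"
  by (induction u) (auto simp: foldr_red_cons)

lemma foldr_red_cons_Nil: "reduced u \<Longrightarrow> foldr red_cons u [] = u"
proof (induction u)
  case (Cons x u)
  then show ?case by (cases u) (auto simp: reduced_def)
qed simp

lemma foldr_red_cons_inverse: "reduced w \<Longrightarrow> foldr red_cons (rev (map bar u)) (foldr red_cons u w) = w"
proof (induction u arbitrary: w)
  case (Cons x u)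
  then show ?case using red_cons_bar[of "foldr red_cons u w" "bar x"] by (auto simp: reduced_foldr)
qed simp

lemma group_free_group: "group free_group"
proof (rule groupI)
  fix u :: "'a word" assume u: "u \<in> carrier free_group"
  have "foldr red_cons (foldr red_cons (rev (map bar u)) []) u = []"
    using u foldr_red_cons_inverse[of "[]" u]
    by (simp add: free_group_def foldr_red_cons_assoc foldr_red_cons_Nil reduced_def)
  then show "\<exists>v\<in>carrier free_group. v \<otimes>\<^bsub>free_group\<^esub> u = \<one>\<^bsub>free_group\<^esub>"
    by (intro bexI[of _ "foldr red_cons (rev (map bar u)) []"])
      (auto simp: free_group_def intro!: reduced_foldr, simp add: reduced_def)
qed (simp_all add: free_group_def reduced_foldr foldr_red_cons_assoc, simp add: reduced_def)

definition finite_index_ext :: "'a word set \<Rightarrow> 'a word set \<Rightarrow> bool" where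
  "finite_index_ext H G \<longleftrightarrow> subgroup G free_group \<and> H \<subseteq> G
     \<and> finite (rcosets\<^bsub>free_group\<lparr>carrier := G\<rparr>\<^esub> H)"

text \<open>Subgroups are ordered by inclusion.\<close>

definition H_fi :: "'a word set \<Rightarrow> 'a word set" where
  "H_fi H = (GREATEST G. finite_index_ext H G)"

definition nontrivial_fg_subgroup :: "'a word set \<Rightarrow> bool" where
  "nontrivial_fg_subgroup H \<longleftrightarrow> subgroup H free_group
     \<and> (\<exists>S. finite S \<and> S \<subseteq> carrier free_group \<and> H = generate free_group S)
     \<and> H \<noteq> {\<one>\<^bsub>free_group\<^esub>}"

record ('a, 'v) lgraph =
  verts :: "'v set"
  edges :: "('v \<times> 'a \<times> 'v) set"

definition moves :: "('a, 'v) lgraph \<Rightarrow> ('v \<times> 'a letter \<times> 'v) set" where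
  "moves \<Gamma> = {(p, (a, True), q) | p a q. (p, a, q) \<in> edges \<Gamma>}
           \<union> {(q, (a, False), p) | p a q. (p, a, q) \<in> edges \<Gamma>}"

fun path :: "('q \<times> 'l \<times> 'q) set \<Rightarrow> 'q \<Rightarrow> 'l list \<Rightarrow> 'q \<Rightarrow> bool" where
  "path E p [] q \<longleftrightarrow> p = q"
| "path E p (x # w) q \<longleftrightarrow> (\<exists>r. (p, x, r) \<in> E \<and> path E r w q)"

text \<open>A loop contributes 2 to the degree of its vertex.\<close>

definition degree :: "('a, 'v) lgraph \<Rightarrow> 'v \<Rightarrow> nat" where
  "degree \<Gamma> v = card {(p, a, q) \<in> edges \<Gamma>. p = v} + card {(p, a, q) \<in> edges \<Gamma>. q = v}"

definition loop_group :: "('a, 'v) lgraph \<Rightarrow> 'v \<Rightarrow> 'a word set" where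
  "loop_group \<Gamma> r = {w. reduced w \<and> path (moves \<Gamma>) r w r}"

text \<open>The pair of the labelled graph \<open>\<Gamma>\<close> and its designated vertex \<open>r\<close> represents the subgroup \<open>H\<close>.\<close>

definition stallings :: "'a word set \<Rightarrow> ('a, 'v) lgraph \<Rightarrow> 'v \<Rightarrow> bool" where
  "stallings H \<Gamma> r \<longleftrightarrow>
     finite (verts \<Gamma>) \<and> finite (edges \<Gamma>) \<and> r \<in> verts \<Gamma>
     \<and> edges \<Gamma> \<subseteq> verts \<Gamma> \<times> UNIV \<times> verts \<Gamma>
     \<and> (\<forall>p\<in>verts \<Gamma>. \<forall>q\<in>verts \<Gamma>. \<exists>w. path (moves \<Gamma>) p w q)
     \<and> (\<forall>p a q q'. (p, a, q) \<in> edges \<Gamma> \<and> (p, a, q') \<in> edges \<Gamma> \<longrightarrow> q = q')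
     \<and> (\<forall>p p' a q. (p, a, q) \<in> edges \<Gamma> \<and> (p', a, q) \<in> edges \<Gamma> \<longrightarrow> p = p')
     \<and> (\<forall>v\<in>verts \<Gamma> - {r}. degree \<Gamma> v \<ge> 2)
     \<and> (\<forall>w. reduced w \<longrightarrow> (w \<in> H \<longleftrightarrow> path (moves \<Gamma>) r w r))"

inductive_set tail :: "('a, 'v) lgraph \<Rightarrow> 'v \<Rightarrow> 'v set" for \<Gamma> r where
  root: "r \<in> tail \<Gamma> r"
| step: "v \<in> tail \<Gamma> r \<Longrightarrow> (v, x, u) \<in> moves \<Gamma> \<Longrightarrow> degree \<Gamma> u = 2 \<Longrightarrow> u \<in> tail \<Gamma> r"

definition core :: "('a, 'v) lgraph \<Rightarrow> 'v \<Rightarrow> ('a, 'v) lgraph" where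
  "core \<Gamma> r = (if \<forall>v\<in>verts \<Gamma>. degree \<Gamma> v \<ge> 2 then \<Gamma>
     else let C = verts \<Gamma> - tail \<Gamma> r in \<lparr>verts = C, edges = {(p, a, q) \<in> edges \<Gamma>. p \<in> C \<and> q \<in> C}\<rparr>)"

text \<open>The pairs of vertices of \<open>\<Gamma>\<close> that have the same image after the pairs in \<open>S\<close> are identified
  and the resulting graph is reduced: rule \<open>fold\<close> is one reduction step in the graph obtained so
  far, in which the edges starting at the vertices \<open>q\<close> and \<open>q'\<close> of \<open>\<Gamma>\<close> start at the same vertex.\<close>

inductive_set identified :: "('a, 'v) lgraph \<Rightarrow> ('v \<times> 'v) set \<Rightarrow> ('v \<times> 'v) set" for \<Gamma> S where
  given: "(p, q) \<in> S \<Longrightarrow> (p, q) \<in> identified \<Gamma> S"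
| refl: "p \<in> verts \<Gamma> \<Longrightarrow> (p, p) \<in> identified \<Gamma> S"
| sym: "(p, q) \<in> identified \<Gamma> S \<Longrightarrow> (q, p) \<in> identified \<Gamma> S"
| trans: "(p, q) \<in> identified \<Gamma> S \<Longrightarrow> (q, s) \<in> identified \<Gamma> S \<Longrightarrow> (p, s) \<in> identified \<Gamma> S"
| fold: "(q, q') \<in> identified \<Gamma> S \<Longrightarrow> (q, x, p) \<in> moves \<Gamma> \<Longrightarrow> (q', x, p') \<in> moves \<Gamma>
          \<Longrightarrow> (p, p') \<in> identified \<Gamma> S"

definition quotient_graph :: "('a, 'v) lgraph \<Rightarrow> ('v \<times> 'v) set \<Rightarrow> ('a, 'v set) lgraph" where
  "quotient_graph \<Gamma> R =
     \<lparr>verts = verts \<Gamma> // R, edges = {(R `` {p}, a, R `` {q}) | p a q. (p, a, q) \<in> edges \<Gamma>}\<rparr>"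

definition subgroup_after_identification :: "('a, 'v) lgraph \<Rightarrow> 'v \<Rightarrow> ('v \<times> 'v) set \<Rightarrow> 'a word set" where
  "subgroup_after_identification \<Gamma> r S =
     (let R = identified \<Gamma> S in loop_group (quotient_graph \<Gamma> R) (R `` {r}))"

record ('l, 'q) dfa =
  states :: "'q set"
  init :: 'q
  delta :: "('q \<times> 'l \<times> 'q) set"
  finals :: "'q set"

definition accessible_dfa :: "('l, 'q) dfa \<Rightarrow> bool" where
  "accessible_dfa M \<longleftrightarrow>
     finite (states M) \<and> init M \<in> states M \<and> finals M \<subseteq> states M
     \<and> delta M \<subseteq> states M \<times> UNIV \<times> states M
     \<and> (\<forall>p x q q'. (p, x, q) \<in> delta M \<and> (p, x, q') \<in> delta M \<longrightarrow> q = q')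
     \<and> (\<forall>q\<in>states M. \<exists>w. path (delta M) (init M) w q)"

definition language_from :: "('l, 'q) dfa \<Rightarrow> 'q \<Rightarrow> 'l list set" where
  "language_from M p = {w. \<exists>q\<in>finals M. path (delta M) p w q}"

definition state_equiv :: "('l, 'q) dfa \<Rightarrow> ('q \<times> 'q) set" where
  "state_equiv M = {(p, q). p \<in> states M \<and> q \<in> states M \<and> language_from M p = language_from M q}"

definition minimize :: "('l, 'q) dfa \<Rightarrow> ('l, 'q set) dfa" where
  "minimize M = (let R = state_equiv M in
     \<lparr>states = states M // R,
      init = R `` {init M},
      delta = {(R `` {p}, x, R `` {q}) | p x q. (p, x, q) \<in> delta M},
      finals = {R `` {p} | p. p \<in> finals M}\<rparr>)"

definition dfa_isomorphic :: "('l, 'p) dfa \<Rightarrow> ('l, 'q) dfa \<Rightarrow> bool" where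
  "dfa_isomorphic M N \<longleftrightarrow> (\<exists>f. bij_betw f (states M) (states N)
     \<and> f (init M) = init N
     \<and> delta N = {(f p, x, f q) | p x q. (p, x, q) \<in> delta M}
     \<and> finals N = f ` finals M)"

definition graph_dfa :: "('a, 'v) lgraph \<Rightarrow> 'v \<Rightarrow> ('a letter, 'v) dfa" where
  "graph_dfa \<Gamma> i = \<lparr>states = verts \<Gamma>, init = i, delta = moves \<Gamma>, finals = verts \<Gamma>\<rparr>"

text \<open>Structured programs over finitely many registers and a memory with indirect addressing, all
  cells holding natural numbers. Every operation of an expression, assignment and test costs one
  unit. There is no multiplication, so that unit cost is not abused.\<close>

datatype aexp = Num nat | Reg nat | Mem aexp | Add aexp aexp | Sub aexp aexp

datatype bexp = Less aexp aexp | Eq aexp aexp | Neg bexp | Conj bexp bexp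

datatype com =
    Skip
  | Assign nat aexp
  | Store aexp aexp
  | Seq com com
  | Cond bexp com com
  | While bexp com

text \<open>A state consists of the contents of the registers and the contents of the memory.\<close>

type_synonym state = "(nat \<Rightarrow> nat) \<times> (nat \<Rightarrow> nat)"

fun aval :: "aexp \<Rightarrow> state \<Rightarrow> nat" where
  "aval (Num k) s = k"
| "aval (Reg i) s = fst s i"
| "aval (Mem e) s = snd s (aval e s)"
| "aval (Add e f) s = aval e s + aval f s"
| "aval (Sub e f) s = aval e s - aval f s"

fun bval :: "bexp \<Rightarrow> state \<Rightarrow> bool" where
  "bval (Less e f) s \<longleftrightarrow> aval e s < aval f s"
| "bval (Eq e f) s \<longleftrightarrow> aval e s = aval f s"
| "bval (Neg b) s \<longleftrightarrow> \<not> bval b s"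
| "bval (Conj b c) s \<longleftrightarrow> bval b s \<and> bval c s"

fun acost :: "aexp \<Rightarrow> nat" where
  "acost (Num k) = 1"
| "acost (Reg i) = 1"
| "acost (Mem e) = acost e + 1"
| "acost (Add e f) = acost e + acost f + 1"
| "acost (Sub e f) = acost e + acost f + 1"

fun bcost :: "bexp \<Rightarrow> nat" where
  "bcost (Less e f) = acost e + acost f + 1"
| "bcost (Eq e f) = acost e + acost f + 1"
| "bcost (Neg b) = bcost b + 1"
| "bcost (Conj b c) = bcost b + bcost c + 1"

text \<open>\<open>exec c s t s'\<close>: started in state \<open>s\<close>, the program \<open>c\<close> halts in state \<open>s'\<close> after time \<open>t\<close>.\<close>

inductive exec :: "com \<Rightarrow> state \<Rightarrow> nat \<Rightarrow> state \<Rightarrow> bool" where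
  Skip: "exec Skip s 1 s"
| Assign: "exec (Assign i e) s (acost e + 1) ((fst s)(i := aval e s), snd s)"
| Store: "exec (Store e f) s (acost e + acost f + 1) (fst s, (snd s)(aval e s := aval f s))"
| Seq: "exec c1 s t1 s1 \<Longrightarrow> exec c2 s1 t2 s2 \<Longrightarrow> exec (Seq c1 c2) s (t1 + t2) s2"
| CondTrue: "bval b s \<Longrightarrow> exec c1 s t s' \<Longrightarrow> exec (Cond b c1 c2) s (bcost b + t) s'"
| CondFalse: "\<not> bval b s \<Longrightarrow> exec c2 s t s' \<Longrightarrow> exec (Cond b c1 c2) s (bcost b + t) s'"
| WhileFalse: "\<not> bval b s \<Longrightarrow> exec (While b c) s (bcost b) s"
| WhileTrue: "bval b s \<Longrightarrow> exec c s t1 s1 \<Longrightarrow> exec (While b c) s1 t2 s2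
    \<Longrightarrow> exec (While b c) s (bcost b + t1 + t2) s2"

definition input_state :: "nat list \<Rightarrow> state" where
  "input_state xs = ((\<lambda>_. 0), (\<lambda>i. if i < length xs then xs ! i else 0))"

definition output_prefix :: "nat list \<Rightarrow> state \<Rightarrow> bool" where
  "output_prefix xs s \<longleftrightarrow> (\<forall>i<length xs. snd s i = xs ! i)"

text \<open>Encoding of a rooted graph with vertices \<open>0, \<dots>, n - 1\<close>: the number \<open>n\<close>, the root, then the
  transition table over the letters and their inverses, row by row. An undefined transition is
  encoded as \<open>0\<close> and a transition to \<open>q\<close> as \<open>Suc q\<close>. The list \<open>bs\<close> is an enumeration of the basis.\<close>

definition letters :: "'a list \<Rightarrow> 'a letter list" where
  "letters bs = concat (map (\<lambda>a. [(a, True), (a, False)]) bs)"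

definition move_code :: "('a, nat) lgraph \<Rightarrow> nat \<Rightarrow> 'a letter \<Rightarrow> nat" where
  "move_code \<Gamma> p x = (if \<exists>q. (p, x, q) \<in> moves \<Gamma> then Suc (THE q. (p, x, q) \<in> moves \<Gamma>) else 0)"

definition graph_code :: "'a list \<Rightarrow> ('a, nat) lgraph \<Rightarrow> nat \<Rightarrow> nat list" where
  "graph_code bs \<Gamma> r = card (verts \<Gamma>) # r #
     concat (map (\<lambda>p. map (move_code \<Gamma> p) (letters bs)) [0..<card (verts \<Gamma>)])"

definition pairs_code :: "(nat \<times> nat) list \<Rightarrow> nat list" where
  "pairs_code ps = length ps # concat (map (\<lambda>(p, q). [p, q]) ps)"

definition numbered :: "('a, nat) lgraph \<Rightarrow> bool" where
  "numbered \<Gamma> \<longleftrightarrow> verts \<Gamma> = {..<card (verts \<Gamma>)}"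

end

theory Submission
  imports Defs "HOL-Library.Discrete_Functions"
begin

text \<open>
  Move the base point from the root to a vertex \<open>v\<close> of the core, let \<open>K\<close> be a finite index extension of
  the group of loops at \<open>v\<close>, \<open>z\<close> an element of \<open>K\<close> and \<open>u\<close> a word readable at \<open>v\<close>. Every vertex of the core
  has degree at least two, so \<open>u\<close> has arbitrarily long readable reduced continuations; after one of
  them, a return path and a coset representative, both of bounded length, close the product with \<open>z\<close>
  to a loop at \<open>v\<close>. The bounded correction cannot cancel the long continuation, hence \<open>z u\<close> itself is
  readable at \<open>v\<close>. It follows that \<open>z\<close> leads to a vertex with the same language as \<open>v\<close>. Conversely,
  reduced loops of the minimized core lift to paths of the core, and loops that lift to paths with the same
  end are in the same coset, so the minimized core has finite index over \<open>H\<close>. The tail is never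
  identified with anything.

  The classes are computed as in Hopcroft's minimization: the root is pruned until its degree is at
  least two, and then the classes are used as splitters in the order of their creation. When a class
  is split, the smaller part gets a new number, so a vertex changes its class at most \<open>log n\<close> times.
\<close>

section \<open>Words in the free group\<close>

text \<open>The quotient is treated for an arbitrary map \<open>f\<close> that identifies exactly
  the vertices related by \<open>sim\<close>, since three such maps occur: the class map
  \<open>cls\<close>, its composition with an isomorphism onto a prescribed Stallings graph of
  \<open>H_fi H\<close>, and the array of class numbers that the program leaves in memory. The
  isomorphism exists because the subgroup determines its graph: the reduced words readable at the
  root are the prefixes of its elements, and its cosets tell which of them end in the same vertex.

  The algorithm needs no lists of predecessors. With each letter its inverse is read too, and the
  predecessors of a class along \<open>bar x\<close> are its successors along \<open>x\<close>, at
  most one for each member. Pruned vertices stay in the same array as singleton classes, so that it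
  describes the quotient of the whole graph.

  Time is measured by credits that belong to the assertions. Every guard costs at least one credit,
  which gives termination of all loops, and the amortized bound is a potential kept among the
  credits.\<close>

definition nf :: "'a word \<Rightarrow> 'a word" where
  "nf u = foldr red_cons u []"

definition winv :: "'a word \<Rightarrow> 'a word" where
  "winv u = rev (map bar u)"

lemma winv_simps [simp]:
  "winv [] = []" "winv (x # u) = winv u @ [bar x]" "winv (u @ v) = winv v @ winv u" "winv (winv u) = u"
  by (auto simp: winv_def rev_map o_def)

lemma bar_eq_iff [simp]: "bar x = bar y \<longleftrightarrow> x = y"
  by (metis bar_bar)

lemma reduced_Nil [simp]: "reduced []" and reduced_single [simp]: "reduced [x]"
  by (auto simp: reduced_def)

lemma reduced_Cons_Cons [simp]: "reduced (x # y # w) \<longleftrightarrow> y \<noteq> bar x \<and> reduced (y # w)"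
  by (auto simp: reduced_def)

lemma reduced_append:
  "reduced (u @ v) \<longleftrightarrow> reduced u \<and> reduced v \<and> (u \<noteq> [] \<and> v \<noteq> [] \<longrightarrow> hd v \<noteq> bar (last u))"
  by (auto simp: reduced_def successively_append_iff)

lemma reduced_Cons: "reduced (x # w) \<longleftrightarrow> reduced w \<and> (w \<noteq> [] \<longrightarrow> hd w \<noteq> bar x)"
  using reduced_append[of "[x]" w] by auto

lemma reduced_nf [simp]: "reduced (nf u)"
  by (simp add: nf_def reduced_foldr)

lemma nf_id: "reduced u \<Longrightarrow> nf u = u"
  by (simp add: nf_def foldr_red_cons_Nil)

lemma nf_Nil [simp]: "nf [] = []"
  by (simp add: nf_def)

lemma foldr_nf: "reduced w \<Longrightarrow> foldr red_cons (nf u) w = foldr red_cons u w"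
  using foldr_red_cons_assoc[of w u "[]"] by (simp add: nf_def)

lemma foldr_red_cons_eq_nf: "reduced v \<Longrightarrow> foldr red_cons u v = nf (u @ v)"
  by (metis foldr_append nf_def nf_id)

lemma nf_append: "nf (u @ v) = foldr red_cons u (nf v)"
  by (simp add: nf_def)

lemma nf_nf_left [simp]: "nf (nf u @ v) = nf (u @ v)"
  by (simp add: nf_append foldr_nf)

lemma nf_nf_right [simp]: "nf (u @ nf v) = nf (u @ v)"
  by (simp add: nf_append nf_id)

lemma nf_nf_mid [simp]: "nf (u @ nf v @ w) = nf (u @ v @ w)"
  using nf_nf_right[of u "nf v @ w"] nf_nf_right[of u "v @ w"] by simp

lemma nf_winv_left [simp]: "nf (winv u @ u @ v) = nf v"
  using foldr_red_cons_inverse[of "nf v" u] by (simp add: nf_append winv_def)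

lemma nf_winv_right [simp]: "nf (u @ winv u @ v) = nf v"
  using nf_winv_left[of "winv u" v] by simp

lemma nf_winv_left0 [simp]: "nf (winv u @ u) = []" and nf_winv_right0 [simp]: "nf (u @ winv u) = []"
  using nf_winv_left[of u "[]"] nf_winv_right[of u "[]"] by simp_all

text \<open>Normalization inside a word is invisible to an outer \<open>nf\<close>, and adjacent
  inverse factors vanish under it. As rewrite rules these facts replace calculations in the
  group.\<close>

lemma nf_cancel [simp]: "nf (u @ winv w @ w @ v) = nf (u @ v)" "nf (u @ w @ winv w @ v) = nf (u @ v)"
  "nf (u @ winv w @ w) = nf u" "nf (u @ w @ winv w) = nf u"
proof -
  show "nf (u @ winv w @ w @ v) = nf (u @ v)" "nf (u @ w @ winv w @ v) = nf (u @ v)" for u v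
    using nf_nf_right[of u "winv w @ w @ v"] nf_nf_right[of u "w @ winv w @ v"] by simp_all
  from this[of u "[]"] show "nf (u @ winv w @ w) = nf u" "nf (u @ w @ winv w) = nf u" by simp_all
qed

lemma nf_winv_nf_right [simp]: "nf (u @ winv (nf v)) = nf (u @ winv v)"
proof -
  have "nf (u @ winv (nf v)) = nf (u @ winv v @ v @ winv (nf v))" by simp
  also have "\<dots> = nf ((u @ winv v) @ nf v @ winv (nf v))" using nf_nf_mid[of "u @ winv v" v "winv (nf v)"] by simp
  also have "\<dots> = nf (u @ winv v)" by (rule nf_cancel(4))
  finally show ?thesis .
qed

lemma nf_winv_nf [simp]: "nf (u @ winv (nf v) @ w) = nf (u @ winv v @ w)" "nf (winv (nf v) @ w) = nf (winv v @ w)"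
  "nf (winv (nf v)) = nf (winv v)"
proof -
  show *: "nf (u @ winv (nf v) @ w) = nf (u @ winv v @ w)" for u w :: "'a word"
    using nf_nf_left[of "u @ winv (nf v)" w] nf_nf_left[of "u @ winv v" w] nf_winv_nf_right[of u v] by simp
  show "nf (winv (nf v) @ w) = nf (winv v @ w)" using *[of "[]"] by simp
  show "nf (winv (nf v)) = nf (winv v)" using *[of "[]" "[]"] by simp
qed

lemma reduced_snoc: "reduced (w @ [x]) \<longleftrightarrow> reduced w \<and> (w \<noteq> [] \<longrightarrow> x \<noteq> bar (last w))"
  by (auto simp: reduced_append)

text \<open>The dichotomy behind the inductions on words from the right: a new letter is kept, or it
  removes the last letter.\<close>

lemma nf_snoc_cases:
  assumes "reduced u"
  obtains "reduced (u @ [x])" "nf (u @ [x]) = u @ [x]"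
  | v where "u = v @ [bar x]" "nf (u @ [x]) = v"
proof (cases "reduced (u @ [x])")
  case False
  then obtain v where "u = v @ [bar x]"
    using assms by (metis append_butlast_last_id bar_bar reduced_snoc)
  moreover have "nf (v @ [bar x] @ [x]) = v"
    using nf_cancel(4)[of v "[bar x]"] assms \<open>u = v @ [bar x]\<close> by (simp add: nf_id reduced_append)
  ultimately show ?thesis using that by auto
qed (use that nf_id in blast)

text \<open>Each letter of \<open>m\<close> removes at most one letter from the end, and
  \<open>y\<close> is long enough to absorb all of them. In the induction \<open>y\<close> is a
  buffer that grows or shrinks by one letter at a time.\<close>

lemma nf_prefix_survives:
  "reduced (z @ y) \<Longrightarrow> length m \<le> length y \<Longrightarrow> \<exists>s. nf (z @ y @ m) = z @ s"
proof (induction m arbitrary: y)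
  case Nil
  then show ?case by (simp add: nf_id)
next
  case (Cons x m)
  show ?case
  proof (rule nf_snoc_cases[OF Cons.prems(1), of x])
    assume "reduced ((z @ y) @ [x])"
    then show ?thesis using Cons.IH[of "y @ [x]"] Cons.prems by simp
  next
    fix v assume v: "z @ y = v @ [bar x]" "nf ((z @ y) @ [x]) = v"
    then obtain y' where y: "y = y' @ [bar x]" "v = z @ y'"
      using Cons.prems(2) by (cases y rule: rev_cases) auto
    then have "nf (z @ y @ x # m) = nf (nf ((z @ y) @ [x]) @ m)" unfolding nf_nf_left by simp
    also have "\<dots> = nf (z @ y' @ m)" using v(2) y(2) by simp
    finally have "nf (z @ y @ x # m) = nf (z @ y' @ m)" .
    moreover have "reduced (z @ y')" using Cons.prems(1) v(1) y(2) reduced_append by metis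
    ultimately show ?thesis using Cons.IH[of y'] Cons.prems y by simp
  qed
qed

section \<open>Group operations and subgroups in terms of normal forms\<close>

lemma mult_free_group: "v \<in> carrier free_group \<Longrightarrow> u \<otimes>\<^bsub>free_group\<^esub> v = nf (u @ v)"
  by (simp add: free_group_def foldr_red_cons_eq_nf)

lemma carrier_free_group: "carrier free_group = {w. reduced w}"
  by (simp add: free_group_def)

lemma one_free_group: "\<one>\<^bsub>free_group\<^esub> = []"
  by (simp add: free_group_def)

lemma inv_free_group: "reduced u \<Longrightarrow> inv\<^bsub>free_group\<^esub> u = nf (winv u)"
  by (rule group.inv_equality[OF group_free_group])
    (simp_all add: carrier_free_group one_free_group mult_free_group)

lemma subgroup_free_group_iff:
  "subgroup G free_group \<longleftrightarrow> (\<forall>u\<in>G. reduced u) \<and> [] \<in> G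
    \<and> (\<forall>u\<in>G. \<forall>v\<in>G. nf (u @ v) \<in> G) \<and> (\<forall>u\<in>G. nf (winv u) \<in> G)" (is "_ \<longleftrightarrow> ?R")
proof
  assume G: "subgroup G free_group"
  have red: "\<forall>u\<in>G. reduced u" using subgroup.subset[OF G] by (auto simp: carrier_free_group)
  moreover have "[] \<in> G" using subgroup.one_closed[OF G] by (simp add: one_free_group)
  moreover have "\<forall>u\<in>G. \<forall>v\<in>G. nf (u @ v) \<in> G"
    using subgroup.m_closed[OF G] red by (metis mult_free_group carrier_free_group mem_Collect_eq)
  moreover have "\<forall>u\<in>G. nf (winv u) \<in> G"
    using subgroup.m_inv_closed[OF G] red by (metis inv_free_group)
  ultimately show ?R by blast
next
  assume R: ?R
  show "subgroup G free_group"
    by (rule group.subgroupI[OF group_free_group])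
      (use R in \<open>auto simp: carrier_free_group inv_free_group mult_free_group\<close>)
qed

lemma subgroup_free_groupD:
  assumes "subgroup G free_group"
  shows "u \<in> G \<Longrightarrow> reduced u" "[] \<in> G" "u \<in> G \<Longrightarrow> v \<in> G \<Longrightarrow> nf (u @ v) \<in> G"
    "u \<in> G \<Longrightarrow> nf (winv u) \<in> G"
  using iffD1[OF subgroup_free_group_iff assms] by simp_all

section \<open>Finite index and coset representatives\<close>

lemma finite_index_ext_iff:
  "finite_index_ext H G \<longleftrightarrow> subgroup G free_group \<and> H \<subseteq> G
     \<and> finite ((\<lambda>g. (\<lambda>h. nf (h @ g)) ` H) ` G)"
proof -
  have "rcosets\<^bsub>free_group\<lparr>carrier := G\<rparr>\<^esub> H = (\<lambda>g. (\<lambda>h. nf (h @ g)) ` H) ` G" if "subgroup G free_group"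
  proof -
    have "H #>\<^bsub>free_group\<lparr>carrier := G\<rparr>\<^esub> g = (\<lambda>h. nf (h @ g)) ` H" if "g \<in> G" for g
    proof -
      have "reduced g" using subgroup_free_groupD(1)[OF \<open>subgroup G free_group\<close> that] .
      then show ?thesis by (auto simp: r_coset_def mult_free_group carrier_free_group)
    qed
    then show ?thesis by (auto simp: RCOSETS_def)
  qed
  then show ?thesis unfolding finite_index_ext_def by metis
qed

text \<open>Finitely many elements of \<open>G\<close> already produce all cosets. If
  \<open>k\<close> lies in the coset of \<open>n\<close>, then the quotient of \<open>k\<close> by
  \<open>n\<close> lies in \<open>H\<close>.\<close>

lemma finite_index_ext_reps:
  assumes "finite_index_ext H G" "[] \<in> H"
  obtains N where "finite N" "\<And>k. k \<in> G \<Longrightarrow> \<exists>n\<in>N. nf (k @ winv n) \<in> H"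
proof -
  let ?c = "\<lambda>g. (\<lambda>h. nf (h @ g)) ` H"
  have *: "finite (?c ` G)" "subgroup G free_group" "H \<subseteq> G" using assms(1) by (auto simp: finite_index_ext_iff)
  obtain N where N: "N \<subseteq> G" "finite N" "?c ` G = ?c ` N"
    using finite_subset_image[OF *(1) order_refl] by blast
  show ?thesis
  proof
    fix k assume k: "k \<in> G"
    then obtain n where n: "n \<in> N" "?c k = ?c n" using imageI[OF k, of ?c] unfolding N(3) by auto
    have red: "\<forall>u\<in>G. reduced u" using subgroup_free_groupD(1)[OF *(2)] by simp
    have "k \<in> ?c k" using assms(2) red k by (force simp: nf_id intro: image_eqI[of _ _ "[]"])
    then obtain h where h: "h \<in> H" "k = nf (h @ n)" using n by auto
    then have "nf (k @ winv n) = h" using red \<open>H \<subseteq> G\<close> by (auto simp: nf_id)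
    then show "\<exists>n\<in>N. nf (k @ winv n) \<in> H" by (intro bexI[of _ n]) (use h n in simp_all)
  qed (use N in simp)
qed

text \<open>An invariant \<open>f\<close> with finitely many values bounds the index if it separates
  cosets. It will be the end vertex of a lifted path.\<close>

lemma finite_index_extI:
  fixes f :: "'a word \<Rightarrow> 'b"
  assumes "subgroup G free_group" "H \<subseteq> G" "subgroup H free_group" "finite (f ` G)"
    and f: "\<And>g g'. g \<in> G \<Longrightarrow> g' \<in> G \<Longrightarrow> f g = f g' \<Longrightarrow> nf (g @ winv g') \<in> H"
  shows "finite_index_ext H G"
proof -
  let ?c = "\<lambda>g. (\<lambda>h. nf (h @ g)) ` H"
  have sub: "?c g \<subseteq> ?c g'" if "g \<in> G" "g' \<in> G" "f g = f g'" for g g'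
  proof
    fix y assume "y \<in> ?c g"
    then obtain h where h: "h \<in> H" "y = nf (h @ g)" by auto
    have "nf (h @ nf (g @ winv g')) \<in> H"
      by (rule subgroup_free_groupD(3)[OF assms(3) h(1) f[OF that]])
    moreover have "y = nf (nf (h @ nf (g @ winv g')) @ g')"
      using h(2) nf_cancel(3)[of "h @ g" g'] by simp
    ultimately show "y \<in> ?c g'" by blast
  qed
  \<comment> \<open>The coset of \<open>g\<close> is recovered from the value \<open>f g\<close> by
    choosing any element with that value, so the cosets are among the images of finitely many
    values.\<close>
  have "?c ` G \<subseteq> (\<lambda>y. ?c (SOME g. g \<in> G \<and> f g = y)) ` f ` G"
  proof
    fix A assume "A \<in> ?c ` G"
    then obtain g where g: "g \<in> G" "A = ?c g" by auto
    let ?g = "SOME g'. g' \<in> G \<and> f g' = f g"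
    have sg: "?g \<in> G \<and> f ?g = f g" by (rule someI) (use g in simp)
    have "?c ?g \<subseteq> ?c g" "?c g \<subseteq> ?c ?g" using sub[of ?g g] sub[of g ?g] sg g(1) by simp_all
    then have "A = ?c ?g" using g(2) by (simp only: subset_antisym)
    then show "A \<in> (\<lambda>y. ?c (SOME g. g \<in> G \<and> f g = y)) ` f ` G"
      by (rule image_eqI) (use g in simp)
  qed
  then have "finite (?c ` G)" by (rule finite_subset) (intro finite_imageI assms(4))
  then show ?thesis unfolding finite_index_ext_iff by (intro conjI assms(1,2))
qed

section \<open>Inverse graphs, their languages and pruning\<close>

lemma singleton_pairI: "(\<And>x u. P x u \<Longrightarrow> x = a \<and> u = b) \<Longrightarrow> P a b \<Longrightarrow> {(x, u). P x u} = {(a, b)}"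
  by blast

lemma path_append: "path M p (u @ v) q \<longleftrightarrow> (\<exists>s. path M p u s \<and> path M s v q)"
  by (induction u arbitrary: p) auto

lemma path_appendI: "path M p u s \<Longrightarrow> path M s v q \<Longrightarrow> path M p (u @ v) q"
  by (auto simp: path_append)

lemma path_mono: "path M p w q \<Longrightarrow> M \<subseteq> M' \<Longrightarrow> path M' p w q"
  by (induction w arbitrary: p) auto

text \<open>The language of a partial automaton with all states final: a word is rejected only by
  getting stuck.\<close>

definition lang :: "('q \<times> 'l \<times> 'q) set \<Rightarrow> 'q \<Rightarrow> 'l list set" where
  "lang M p = {w. \<exists>q. path M p w q}"

lemma langI: "path M p w q \<Longrightarrow> w \<in> lang M p"
  by (auto simp: lang_def)

lemma Nil_in_lang [simp]: "[] \<in> lang M p"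
  by (rule langI[of _ _ _ p]) simp

definition restr :: "('q \<times> 'l \<times> 'q) set \<Rightarrow> 'q set \<Rightarrow> ('q \<times> 'l \<times> 'q) set" where
  "restr M C = {(p, x, q). (p, x, q) \<in> M \<and> p \<in> C \<and> q \<in> C}"

lemma restr_iff [simp]: "(p, x, q) \<in> restr M C \<longleftrightarrow> (p, x, q) \<in> M \<and> p \<in> C \<and> q \<in> C"
  by (simp add: restr_def)

definition img :: "('p \<Rightarrow> 'q) \<Rightarrow> ('p \<times> 'l \<times> 'p) set \<Rightarrow> ('q \<times> 'l \<times> 'q) set" where
  "img f M = {(f p, x, f q) | p x q. (p, x, q) \<in> M}"

lemma imgI: "(p, x, q) \<in> M \<Longrightarrow> (f p, x, f q) \<in> img f M"
  by (auto simp: img_def)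

lemma imgE:
  assumes "(p', x, q') \<in> img f M"
  obtains p q where "p' = f p" "q' = f q" "(p, x, q) \<in> M"
  using assms by (auto simp: img_def)

lemma path_img: "path M p w q \<Longrightarrow> path (img f M) (f p) w (f q)"
  by (induction w arbitrary: p) (auto intro: imgI)

lemma path_closed: "path M p w q \<Longrightarrow> M \<subseteq> UNIV \<times> UNIV \<times> C \<Longrightarrow> p \<in> C \<Longrightarrow> q \<in> C"
  by (induction w arbitrary: p) auto

section \<open>Inverse graphs: paths, cancellation and languages\<close>

locale inverse_graph =
  fixes M :: "('v \<times> 'a letter \<times> 'v) set"
  assumes M_sym: "(p, x, q) \<in> M \<Longrightarrow> (q, bar x, p) \<in> M"
    and M_det: "(p, x, q) \<in> M \<Longrightarrow> (p, x, q') \<in> M \<Longrightarrow> q = q'"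
begin

lemma path_winv: "path M p u q \<Longrightarrow> path M q (winv u) p"
  by (induction u arbitrary: p) (auto simp: path_append intro: M_sym)

lemma path_det: "path M p u q \<Longrightarrow> path M p u q' \<Longrightarrow> q = q'"
  by (induction u arbitrary: p) (auto dest: M_det)

text \<open>By determinism the \<open>bar x\<close> move from the end of an \<open>x\<close> move is
  that move read backwards. Cancelling the two letters therefore does not change the end of a
  path.\<close>

lemma path_red_cons: "(p, x, s) \<in> M \<Longrightarrow> path M s w q \<Longrightarrow> path M p (red_cons x w) q"
proof (cases w)
  case (Cons y w')
  assume "(p, x, s) \<in> M" "path M s w q"
  with Cons obtain t where t: "(s, y, t) \<in> M" "path M t w' q" by auto
  show ?thesis
  proof (cases "y = bar x")
    case True
    then have "t = p" using M_det[OF M_sym[OF \<open>(p, x, s) \<in> M\<close>]] t(1) by simp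
    then show ?thesis using t(2) Cons True by simp
  next
    case False
    then show ?thesis using t Cons \<open>(p, x, s) \<in> M\<close> by (auto simp del: split_paired_Ex)
  qed
qed (auto simp del: split_paired_Ex)

lemma path_nf: "path M p u q \<Longrightarrow> path M p (nf u) q"
  by (induction u arbitrary: p) (auto simp: nf_def intro: path_red_cons)

lemma path_nf_append: "path M p u s \<Longrightarrow> path M s v q \<Longrightarrow> path M p (nf (u @ v)) q"
  by (rule path_nf) (rule path_appendI)

lemma lang_step: "(p, x, q) \<in> M \<Longrightarrow> x # w \<in> lang M p \<longleftrightarrow> w \<in> lang M q"
proof
  assume "(p, x, q) \<in> M" "x # w \<in> lang M p"
  then obtain q' s where "(p, x, q') \<in> M" "path M q' w s" by (auto simp: lang_def)
  then show "w \<in> lang M q" using M_det[OF \<open>(p, x, q) \<in> M\<close>, of q'] by (auto intro: langI)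
next
  assume "(p, x, q) \<in> M" "w \<in> lang M q"
  then obtain s where "path M q w s" by (auto simp: lang_def)
  then have "path M p (x # w) s" using \<open>(p, x, q) \<in> M\<close> by auto
  then show "x # w \<in> lang M p" by (rule langI)
qed

lemma lang_succ_eq:
  "(p, x, q) \<in> M \<Longrightarrow> (p', x, q') \<in> M \<Longrightarrow> lang M p = lang M p' \<Longrightarrow> lang M q = lang M q'"
  using lang_step by (metis subsetI subset_antisym)

lemma lang_eqE:
  assumes "lang M p = lang M p'" "(p, x, q) \<in> M"
  obtains q' where "(p', x, q') \<in> M" "lang M q = lang M q'"
proof -
  have "[x] \<in> lang M p" using assms(2) by (auto simp: lang_def)
  then have "[x] \<in> lang M p'" using assms(1) by simp
  then obtain q' where "(p', x, q') \<in> M" by (auto simp: lang_def)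
  then show ?thesis using that lang_succ_eq assms by blast
qed

text \<open>Languages contain unreduced words, but \<open>w\<close> and \<open>nf w\<close> lead to
  the same vertex. If the next letter \<open>x\<close> cancels against \<open>nf w\<close>, that
  vertex was entered by \<open>bar x\<close> and can be left by \<open>x\<close>; otherwise
  \<open>nf w @ [x]\<close> is reduced and the hypothesis applies.\<close>

lemma lang_subset_if_reduced:
  assumes "\<And>w. reduced w \<Longrightarrow> w \<in> lang M p \<Longrightarrow> w \<in> lang M p'"
  shows "lang M p \<subseteq> lang M p'"
proof
  fix w assume "w \<in> lang M p"
  then show "w \<in> lang M p'"
  proof (induction w rule: rev_induct)
    case (snoc x w)
    obtain s q where s: "path M p w s" "(s, x, q) \<in> M" using snoc.prems by (auto simp: lang_def path_append)
    then obtain s' where s': "path M p' w s'" using snoc.IH by (auto simp: lang_def)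
    have "\<exists>q'. (s', x, q') \<in> M"
    proof (rule nf_snoc_cases[of "nf w" x])
      assume *: "reduced (nf w @ [x])"
      have "path M p (nf w @ [x]) q" using path_nf[OF s(1)] s(2) by (auto simp: path_append)
      then have "nf w @ [x] \<in> lang M p'" using assms[OF *] by (auto simp: lang_def)
      then obtain t q' where t: "path M p' (nf w) t" "(t, x, q') \<in> M" by (auto simp: lang_def path_append)
      then have "t = s'" using path_det path_nf[OF s'] by blast
      then show ?thesis using t by blast
    next
      fix v assume "nf w = v @ [bar x]"
      then have "path M p' (v @ [bar x]) s'" using path_nf[OF s'] by simp
      then obtain t where "(t, bar x, s') \<in> M" by (auto simp: path_append)
      then show ?thesis using M_sym by fastforce
    qed simp
    then obtain q' where "path M p' (w @ [x]) q'" using s' by (auto simp: path_append)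
    then show ?case by (rule langI)
  qed simp
qed

lemma inverse_graph_restr: "inverse_graph (restr M C)"
  by unfold_locales (auto intro: M_sym dest: M_det)

text \<open>Vertices with equal languages have the same outgoing letters, with equivalent targets.
  So a path of the quotient can be followed from any vertex above its start.\<close>

lemma path_img_lift:
  assumes "path (img f M) (f p) w b" "p \<in> C" "M \<subseteq> C \<times> UNIV \<times> C"
    and f: "\<And>p q. p \<in> C \<Longrightarrow> q \<in> C \<Longrightarrow> f p = f q \<longleftrightarrow> lang M p = lang M q"
  shows "\<exists>q\<in>C. path M p w q \<and> b = f q"
  using assms(1,2)
proof (induction w arbitrary: p)
  case (Cons x w)
  obtain b' where b': "(f p, x, b') \<in> img f M" "path (img f M) b' w b" using Cons.prems by auto
  obtain p1 q1 where 1: "f p = f p1" "b' = f q1" "(p1, x, q1) \<in> M" using b'(1) by (rule imgE)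
  then have "lang M p1 = lang M p" using f[of p p1] Cons.prems assms(3) by blast
  then obtain q where q: "(p, x, q) \<in> M" "lang M q1 = lang M q" using 1(3) by (rule lang_eqE)
  then have "b' = f q" "q \<in> C" using f[of q1 q] 1 assms(3) by auto
  then show ?case using Cons.IH[of q] b'(2) q by auto
qed auto

end

section \<open>Graphs in which reduced paths never get stuck\<close>

locale core_graph = inverse_graph M for M :: "('v \<times> 'a letter \<times> 'v) set" +
  fixes C :: "'v set" and v :: 'v
  assumes finite_C: "finite C"
    and M_C: "M \<subseteq> C \<times> UNIV \<times> C"
    and v_C: "v \<in> C"
    and conn: "p \<in> C \<Longrightarrow> q \<in> C \<Longrightarrow> \<exists>w. path M p w q"
    and two_letters: "p \<in> C \<Longrightarrow> \<exists>y q. y \<noteq> x \<and> (p, y, q) \<in> M"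
begin

lemma path_C: "path M p w q \<Longrightarrow> p \<in> C \<Longrightarrow> q \<in> C"
  using path_closed[of M p w q C] M_C by blast

text \<open>Every vertex offers a letter different from a prescribed one, in particular from the
  inverse of the letter just read. The condition on the head allows the path to continue a given
  reduced word.\<close>

lemma long_reduced_path:
  "p \<in> C \<Longrightarrow> \<exists>y q. length y = n \<and> reduced y \<and> (y \<noteq> [] \<longrightarrow> hd y \<noteq> x) \<and> path M p y q"
proof (induction n arbitrary: p x)
  case (Suc n)
  obtain z s where z: "z \<noteq> x" "(p, z, s) \<in> M" using two_letters Suc.prems by blast
  then have "s \<in> C" using M_C by blast
  then obtain y q where "length y = n" "reduced y" "y \<noteq> [] \<longrightarrow> hd y \<noteq> bar z" "path M s y q"
    using Suc.IH[of s "bar z"] by blast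
  then show ?case using z by (intro exI[of _ "z # y"] exI[of _ q]) (auto simp: reduced_Cons)
qed auto

lemma long_reduced_extension:
  assumes "p \<in> C"
  obtains y q where "length y = n" "reduced y" "u \<noteq> [] \<and> y \<noteq> [] \<longrightarrow> hd y \<noteq> bar (last u)" "path M p y q"
  using long_reduced_path[OF assms, of n "bar (last u)"] by blast

lemma return_bound: "\<exists>D. \<forall>p\<in>C. \<exists>c. path M p c v \<and> length c \<le> D"
proof -
  have "\<exists>c. \<forall>p\<in>C. path M p (c p) v" by (rule bchoice) (use conn v_C in blast)
  then obtain c where c: "\<forall>p\<in>C. path M p (c p) v" by blast
  show ?thesis
    by (intro exI[of _ "Max (length ` c ` C)"] ballI exI[of _ "c p" for p]) (use c finite_C in auto)
qed

end

text \<open>\<open>K\<close> is a finite index extension of the group of reduced loops at \<open>v\<close>, with \<open>N\<close> containing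
  representatives of all cosets.\<close>

locale core_extension = core_graph M C v for M :: "('v \<times> 'a letter \<times> 'v) set" and C v +
  fixes K N :: "'a word set"
  assumes K_mult: "u \<in> K \<Longrightarrow> w \<in> K \<Longrightarrow> nf (u @ w) \<in> K"
    and K_inv: "u \<in> K \<Longrightarrow> nf (winv u) \<in> K"
    and K_reduced: "u \<in> K \<Longrightarrow> reduced u"
    and loops_K: "reduced h \<Longrightarrow> path M v h v \<Longrightarrow> h \<in> K"
    and N: "finite N" "k \<in> K \<Longrightarrow> \<exists>n\<in>N. path M v (nf (k @ winv n)) v"
begin

text \<open>\<open>L\<close> bounds a return path from the end of \<open>u\<close> to
  \<open>v\<close> plus a coset representative. Multiplying \<open>z u\<close> by these two gives a
  loop at \<open>v\<close>, and they are too short to cancel more than \<open>y\<close>, so the loop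
  starts with \<open>g\<close>. It matters that \<open>L\<close> depends on none of
  \<open>z\<close>, \<open>g\<close>, \<open>y\<close>, \<open>u\<close>: the continuation is chosen
  after \<open>L\<close>.\<close>

lemma readable_if_long_continuation:
  "\<exists>L. \<forall>z g y u p. z \<in> K \<longrightarrow> reduced (g @ y) \<longrightarrow> L \<le> length y \<longrightarrow> nf (g @ y) = nf (z @ u)
     \<longrightarrow> path M v u p \<longrightarrow> g \<in> lang M v"
proof -
  obtain D where D: "\<forall>p\<in>C. \<exists>c. path M p c v \<and> length c \<le> D" using return_bound by blast
  define L where "L = D + Max (insert 0 (length ` N))"
  show ?thesis
  proof (intro exI[of _ L] allI impI)
    fix z g y u p assume z: "z \<in> K" and gy: "reduced (g @ y)" "L \<le> length y" "nf (g @ y) = nf (z @ u)"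
      and u: "path M v u p"
    have "p \<in> C" using path_C[OF u v_C] .
    then obtain c where c: "path M p c v" "length c \<le> D" using D by blast
    have "nf (u @ c) \<in> K" by (rule loops_K) (use path_nf_append[OF u c(1)] in auto)
    then have "nf (z @ nf (u @ c)) \<in> K" using z K_mult by blast
    then obtain n where n: "n \<in> N" "path M v (nf (nf (z @ nf (u @ c)) @ winv n)) v" using N(2) by blast
    have "nf (nf (z @ nf (u @ c)) @ winv n) = nf (nf (z @ u) @ c @ winv n)"
      by (simp only: nf_nf_left nf_nf_right append.assoc)
    also have "\<dots> = nf (g @ y @ c @ winv n)"
      unfolding gy(3)[symmetric] by (simp only: nf_nf_left append.assoc)
    finally have n2: "path M v (nf (g @ y @ c @ winv n)) v" using n(2) by simp
    have "length n \<le> Max (insert 0 (length ` N))" using n(1) N(1) by auto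
    then have "length (c @ winv n) \<le> length y" using c(2) gy(2) by (simp add: L_def winv_def)
    then obtain s where "nf (g @ y @ c @ winv n) = g @ s" using nf_prefix_survives[OF gy(1)] by blast
    then show "g \<in> lang M v" using n2 by (auto simp: lang_def path_append)
  qed
qed

lemma K_readable:
  assumes "z \<in> K"
  shows "z \<in> lang M v"
proof -
  obtain L where L: "\<And>z g y u p. z \<in> K \<Longrightarrow> reduced (g @ y) \<Longrightarrow> L \<le> length y \<Longrightarrow> nf (g @ y) = nf (z @ u)
     \<Longrightarrow> path M v u p \<Longrightarrow> g \<in> lang M v" using readable_if_long_continuation by blast
  obtain y q where y: "length y = L" "reduced y" "z \<noteq> [] \<and> y \<noteq> [] \<longrightarrow> hd y \<noteq> bar (last z)" "path M v y q"
    using long_reduced_extension[OF v_C] .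
  \<comment> \<open>The instance \<open>g = z\<close> and \<open>u = y\<close>: the reduced word
    \<open>z @ y\<close> is the product of \<open>z\<close> with a readable word.\<close>
  show ?thesis by (rule L[OF assms, of z y y q]) (use y K_reduced[OF assms] in \<open>auto simp: reduced_append\<close>)
qed

text \<open>If the new letter is kept in the product, a long readable continuation of
  \<open>u @ [x]\<close> also continues the product reducedly, and the previous lemma applies. If it
  cancels, the product is a prefix of the preceding one.\<close>

lemma K_translate_readable:
  assumes "z \<in> K" "reduced u" "u \<in> lang M v"
  shows "nf (z @ u) \<in> lang M v"
  using assms(2,3)
proof (induction u rule: rev_induct)
  case Nil
  then show ?case using K_readable[OF assms(1)] K_reduced[OF assms(1)] by (simp add: nf_id)
next
  case (snoc x u)
  obtain L where L: "\<And>z g y u p. z \<in> K \<Longrightarrow> reduced (g @ y) \<Longrightarrow> L \<le> length y \<Longrightarrow> nf (g @ y) = nf (z @ u)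
     \<Longrightarrow> path M v u p \<Longrightarrow> g \<in> lang M v" using readable_if_long_continuation by blast
  obtain p where p: "path M v (u @ [x]) p" using snoc.prems by (auto simp: lang_def)
  have IH: "nf (z @ u) \<in> lang M v" using snoc p by (auto simp: lang_def path_append reduced_snoc)
  show ?case
  proof (rule nf_snoc_cases[of "nf (z @ u)" x])
    assume *: "reduced (nf (z @ u) @ [x])" "nf (nf (z @ u) @ [x]) = nf (z @ u) @ [x]"
    obtain y q where y: "length y = L" "reduced y" "u @ [x] \<noteq> [] \<and> y \<noteq> [] \<longrightarrow> hd y \<noteq> bar (last (u @ [x]))"
      "path M p y q" using long_reduced_extension[OF path_C[OF p v_C]] .
    have "nf (z @ u) @ [x] \<in> lang M v"
    proof (rule L[OF assms(1), of _ y "u @ [x] @ y" q])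
      show "reduced ((nf (z @ u) @ [x]) @ y)" unfolding reduced_append[of _ y] using y * by simp
      show "nf ((nf (z @ u) @ [x]) @ y) = nf (z @ u @ [x] @ y)" by simp
      show "path M v (u @ [x] @ y) q" using path_appendI[OF p y(4)] by simp
    qed (use y in simp)
    then show ?thesis using * by simp
  next
    fix g assume g: "nf (z @ u) = g @ [bar x]" "nf (nf (z @ u) @ [x]) = g"
    then obtain p' where "path M v g p'" using IH by (auto simp: lang_def path_append)
    moreover have "nf (z @ u @ [x]) = g" using g(2) by (simp only: nf_nf_left append.assoc)
    ultimately show ?thesis by (auto intro: langI)
  qed simp
qed

text \<open>Translation by \<open>z\<close> carries words readable at \<open>p\<close> to words
  readable at \<open>v\<close>, translation by its inverse carries them back, and both preserve
  readability at \<open>v\<close>.\<close>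

lemma K_lang_eq:
  assumes "z \<in> K" "path M v z p"
  shows "lang M p = lang M v"
proof
  have zinv: "nf (winv z) \<in> K" using K_inv assms(1) .
  show "lang M p \<subseteq> lang M v"
  proof (rule lang_subset_if_reduced)
    fix w assume w: "reduced w" "w \<in> lang M p"
    then obtain q where "path M p w q" by (auto simp: lang_def)
    then have "nf (z @ w) \<in> lang M v" using path_nf_append[OF assms(2)] by (auto simp: lang_def)
    then have "nf (nf (winv z) @ nf (z @ w)) \<in> lang M v" by (intro K_translate_readable[OF zinv]) simp_all
    then show "w \<in> lang M v" using w(1) by (simp add: nf_id)
  qed
  show "lang M v \<subseteq> lang M p"
  proof (rule lang_subset_if_reduced)
    fix w assume w: "reduced w" "w \<in> lang M v"
    then obtain q where "path M v (nf (z @ w)) q"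
      using K_translate_readable[OF assms(1)] by (auto simp: lang_def)
    then have "path M p (nf (winv z @ nf (z @ w))) q" using path_nf_append[OF path_winv[OF assms(2)]] by blast
    then show "w \<in> lang M p" using w(1) by (auto simp: lang_def nf_id)
  qed
qed

end

text \<open>\<open>prune M r T p\<close>: repeatedly deleting a root of degree one and passing to its neighbour,
  starting from \<open>r\<close>, deletes \<open>T\<close> and reaches \<open>p\<close>.\<close>

inductive prune :: "('v \<times> 'a letter \<times> 'v) set \<Rightarrow> 'v \<Rightarrow> 'v set \<Rightarrow> 'v \<Rightarrow> bool" for M r where
  prune_base: "prune M r {} r"
| prune_step: "prune M r T p \<Longrightarrow> {(x, u). (p, x, u) \<in> M \<and> u \<notin> T} = {(y, q)} \<Longrightarrow> prune M r (insert p T) q"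

section \<open>Pruning the tail of a rooted graph\<close>

locale rooted_graph = inverse_graph M for M :: "('v \<times> 'a letter \<times> 'v) set" +
  fixes V :: "'v set" and r :: 'v
  assumes finite_V: "finite V"
    and M_V: "M \<subseteq> V \<times> UNIV \<times> V"
    and r_V: "r \<in> V"
    and connV: "p \<in> V \<Longrightarrow> q \<in> V \<Longrightarrow> \<exists>w. path M p w q"
begin

lemma path_V: "path M p w q \<Longrightarrow> p \<in> V \<Longrightarrow> q \<in> V"
  using path_closed[of M p w q V] M_V by blast

text \<open>The invariants say that \<open>T\<close> hangs at \<open>p\<close> by a single edge and
  begins with a root of degree one. They are matched later with the degrees in the definition of the
  tail.\<close>

lemma prune_props:
  assumes "prune M r T p"
  shows "T \<subseteq> V \<and> p \<in> V - T \<and> (\<forall>q\<in>T. \<forall>x u. (q, x, u) \<in> M \<longrightarrow> u \<in> insert p T)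
    \<and> (T = {} \<longrightarrow> p = r)
    \<and> (T \<noteq> {} \<longrightarrow> r \<in> T \<and> (\<exists>y t. {(x, u). (r, x, u) \<in> M} = {(y, t)})
        \<and> (\<exists>y t. {(x, u). (p, x, u) \<in> M \<and> u \<in> T} = {(y, t)}))"
  using assms
proof induction
  case prune_base
  then show ?case using r_V by auto
next
  case (prune_step T p y q)
  have y: "(p, y, q) \<in> M" "q \<notin> T" and only: "\<And>x u. (p, x, u) \<in> M \<Longrightarrow> u \<notin> T \<Longrightarrow> x = y \<and> u = q"
    using prune_step.hyps(2) by blast+
  have IH: "T \<subseteq> V" "p \<in> V" "T = {} \<Longrightarrow> p = r" "T \<noteq> {} \<Longrightarrow> r \<in> T"
    using prune_step.IH by simp_all
  note IH_r = prune_step.IH[THEN conjunct2, THEN conjunct2, THEN conjunct2, THEN conjunct2, THEN mp,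
      THEN conjunct2, THEN conjunct1]
  have IH_M: "u \<in> insert p T" if "a \<in> T" "(a, x, u) \<in> M" for a x u
    using prune_step.IH[THEN conjunct2, THEN conjunct2, THEN conjunct1] that by blast
  \<comment> \<open>A loop at \<open>p\<close> would provide two moves that leave \<open>p\<close>
    outside \<open>T\<close>, one for each direction.\<close>
  have "q \<noteq> p"
  proof
    assume "q = p"
    then have "(p, bar y, p) \<in> M" using M_sym y by blast
    then show False using only[of "bar y" p] \<open>q = p\<close> y by simp
  qed
  have noT: "u \<notin> T" if "(q, x, u) \<in> M" for x u
  proof
    assume "u \<in> T"
    then have "q \<in> insert p T" using IH_M M_sym[OF that] by blast
    then show False using \<open>q \<noteq> p\<close> y by blast
  qed
  have S: "{(x, u). (q, x, u) \<in> M \<and> u \<in> insert p T} = {(bar y, p)}"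
  proof -
    have "x = bar y \<and> u = p" if "(q, x, u) \<in> M" "u \<in> insert p T" for x u
    proof -
      have "u = p" using that noT by blast
      then have "bar x = y" using only[of "bar x" q] M_sym[OF that(1)] y by blast
      then show ?thesis using \<open>u = p\<close> by auto
    qed
    moreover have "(q, bar y, p) \<in> M \<and> p \<in> insert p T" using M_sym y by blast
    ultimately show ?thesis by (intro singleton_pairI) blast+
  qed
  have R: "r \<in> insert p T \<and> (\<exists>y t. {(x, u). (r, x, u) \<in> M} = {(y, t)})"
  proof (cases "T = {}")
    case True
    then have "p = r" using IH(3) by simp
    then show ?thesis using prune_step.hyps(2) True by simp
  next
    case False
    show ?thesis by (intro conjI insertI2 IH(4) IH_r False)
  qed
  have E: "u \<in> insert q (insert p T)" if "a \<in> insert p T" "(a, x, u) \<in> M" for a x u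
    using that IH_M[of a x u] only[of x u] by blast
  have W: "insert p T \<subseteq> V" "q \<in> V - insert p T" using IH(1,2) y M_V \<open>q \<noteq> p\<close> by blast+
  show ?case
    by (intro conjI impI ballI allI W R[THEN conjunct1] R[THEN conjunct2] exI[of _ "bar y"] exI[of _ p] S)
      (rule E, assumption, assumption, simp)
qed

text \<open>A visit to \<open>p\<close> would have to enter and leave through its only edge outside
  \<open>T\<close>, that is, with two inverse letters in succession.\<close>

lemma prune_path_avoid:
  assumes "path (restr M (V - T)) a w b" "reduced w" "a \<noteq> p" "b \<noteq> p"
    and single: "{(x, u). (p, x, u) \<in> M \<and> u \<notin> T} = {(y, q)}" and "a \<in> V - T"
  shows "path (restr M (V - insert p T)) a w b"
  using assms(1-3,6)
proof (induction w arbitrary: a)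
  case (Cons x w)
  obtain s where s: "(a, x, s) \<in> M" "s \<in> V - T" "path (restr M (V - T)) s w b" using Cons.prems by auto
  have "s \<noteq> p"
  proof
    assume "s = p"
    with s(3) obtain z w' where w: "w = z # w'" using assms(4) by (cases w) auto
    then obtain u where "(p, z, u) \<in> M" "u \<notin> T" using s(3) \<open>s = p\<close> by auto
    moreover have "(p, bar x, a) \<in> M" "a \<notin> T" using M_sym s(1) \<open>s = p\<close> Cons.prems by auto
    ultimately have "(z, u) \<in> {(y, q)}" "(bar x, a) \<in> {(y, q)}" unfolding single[symmetric] by simp_all
    then have "z = bar x" by simp
    then show False using Cons.prems(2) w by simp
  qed
  then show ?case using Cons.IH[of s] Cons.prems s by (auto simp: reduced_Cons)
qed auto

lemma prune_path:
  assumes "prune M r T p" "reduced w" "path M a w b" "a \<in> V - T" "b \<in> V - T"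
  shows "path (restr M (V - T)) a w b"
  using assms(1,4,5)
proof induction
  case prune_base
  have "restr M (V - {}) = M" using M_V by auto
  then show ?case using assms(3) by simp
next
  case (prune_step T p y q)
  then show ?case by (intro prune_path_avoid[OF _ assms(2) _ _ prune_step.hyps(2)]) auto
qed

lemma prune_connected:
  assumes "prune M r T p" "a \<in> V - T" "b \<in> V - T"
  shows "\<exists>w. path (restr M (V - T)) a w b"
proof -
  obtain w where "path M a w b" using connV assms by blast
  then show ?thesis using prune_path[OF assms(1) reduced_nf path_nf assms(2,3)] by blast
qed

text \<open>Conjugating \<open>h\<close> to a loop at \<open>p\<close> and reducing gives a
  non-empty loop that avoids \<open>T\<close>, so \<open>p\<close> has an edge outside
  \<open>T\<close>. Here the non-triviality of the subgroup enters.\<close>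

lemma prune_continues:
  assumes "prune M r T p" "reduced h" "path M r h r" "h \<noteq> []"
  shows "\<exists>x u. (p, x, u) \<in> M \<and> u \<notin> T"
proof (rule ccontr)
  assume none: "\<not> ?thesis"
  have p: "p \<in> V - T" using prune_props[OF assms(1)] by blast
  then obtain w where w: "path M r w p" using connV r_V by blast
  define z where "z = nf (winv w @ h @ w)"
  have "path M p (winv w @ h @ w) p" 
    by (rule path_appendI[OF path_winv[OF w] path_appendI[OF assms(3) w]])
  then have "path (restr M (V - T)) p z p" unfolding z_def by (intro prune_path[OF assms(1)] path_nf p) simp_all
  then have "z = []" using none by (cases z) auto
  moreover have "nf (w @ z @ winv w) = h" unfolding z_def using assms(2) nf_cancel(4)[of h w] by (simp add: nf_id)
  ultimately show False using assms(4) by simp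
qed

definition branching :: "'v set \<Rightarrow> 'v \<Rightarrow> bool" where
  "branching T p \<longleftrightarrow> (\<exists>x y u w. x \<noteq> y \<and> (p, x, u) \<in> M \<and> u \<notin> T \<and> (p, y, w) \<in> M \<and> w \<notin> T)"

lemma prune_step_if_not_branching:
  assumes "prune M r T p" "reduced h" "path M r h r" "h \<noteq> []" "\<not> branching T p"
  obtains y q where "{(x, u). (p, x, u) \<in> M \<and> u \<notin> T} = {(y, q)}" "prune M r (insert p T) q"
proof -
  obtain y q where y: "(p, y, q) \<in> M" "q \<notin> T" using prune_continues[OF assms(1-4)] by blast
  have "{(x, u). (p, x, u) \<in> M \<and> u \<notin> T} = {(y, q)}"
  proof (intro equalityI subsetI)
    fix e assume "e \<in> {(x, u). (p, x, u) \<in> M \<and> u \<notin> T}"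
    then obtain x u where e: "e = (x, u)" "(p, x, u) \<in> M" "u \<notin> T" by blast
    then have "x = y" using y assms(5) unfolding branching_def by blast
    then show "e \<in> {(y, q)}" using e M_det[OF y(1), of u] by simp
  qed (use y in simp)
  then show ?thesis by (rule that[OF _ prune_step[OF assms(1)]]) fact
qed

lemma prune_exists:
  assumes "reduced h" "path M r h r" "h \<noteq> []"
  obtains T p where "prune M r T p" "branching T p"
proof -
  have "prune M r T p \<Longrightarrow> \<exists>T p. prune M r T p \<and> branching T p" for T p
  proof (induction "card (V - T)" arbitrary: T p rule: less_induct)
    case less
    show ?case
    proof (cases "branching T p")
      case False
      obtain y q where q: "prune M r (insert p T) q"
        using prune_step_if_not_branching[OF less.prems assms False] by blast
      have "p \<in> V - T" using prune_props[OF less.prems] by blast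
      then have "card (V - insert p T) < card (V - T)" using finite_V by (intro psubset_card_mono) auto
      then show ?thesis using less.hyps q by blast
    qed (use less in blast)
  qed
  from this[OF prune_base] show ?thesis using that by blast
qed

text \<open>The set \<open>S\<close> on which \<open>f\<close> identifies nothing stays fixed while
  \<open>T\<close> grows in the induction. Every vertex deleted lies in \<open>S\<close>, hence is
  the only one with its image, and the image has a single onward move as well.\<close>

lemma prune_img:
  assumes "prune M r T p" "T \<subseteq> S" and S: "\<And>p q. p \<in> S \<Longrightarrow> q \<in> V \<Longrightarrow> f p = f q \<Longrightarrow> p = q"
  shows "prune (img f M) (f r) (f ` T) (f p)"
  using assms(1,2)
proof induction
  case prune_base
  then show ?case by (simp add: prune.prune_base)
next
  case (prune_step T p y q)
  have y: "(p, y, q) \<in> M" "q \<notin> T" and only: "\<And>x u. (p, x, u) \<in> M \<Longrightarrow> u \<notin> T \<Longrightarrow> x = y \<and> u = q"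
    using prune_step.hyps(2) by blast+
  have "q \<in> V" using y M_V by blast
  have "f q \<notin> f ` T"
  proof
    assume "f q \<in> f ` T"
    then obtain t where "t \<in> T" "f t = f q" by auto
    then show False using S[of t q] \<open>q \<in> V\<close> y prune_step.prems by auto
  qed
  moreover have "x = y \<and> u = f q" if im: "(f p, x, u) \<in> img f M" and nT: "u \<notin> f ` T" for x u
  proof -
    obtain p1 q1 where 1: "f p = f p1" "u = f q1" "(p1, x, q1) \<in> M" using im by (rule imgE)
    then have "p1 \<in> V" using M_V by blast
    then have "p1 = p" using S[of p p1] prune_step.prems 1(1) by simp
    then show ?thesis using only[of x q1] 1 nT by blast
  qed
  ultimately have "{(x, u). (f p, x, u) \<in> img f M \<and> u \<notin> f ` T} = {(y, f q)}"
    using imgI[OF y(1), of f] by (intro singleton_pairI) blast+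
  moreover have "prune (img f M) (f r) (f ` T) (f p)" using prune_step by simp
  ultimately show ?case unfolding image_insert by (intro prune.prune_step)
qed

end

section \<open>Stallings graphs and finite index extensions\<close>

definition map_graph :: "('v \<Rightarrow> 'w) \<Rightarrow> ('a, 'v) lgraph \<Rightarrow> ('a, 'w) lgraph" where
  "map_graph f \<Gamma> = \<lparr>verts = f ` verts \<Gamma>, edges = {(f p, a, f q) | p a q. (p, a, q) \<in> edges \<Gamma>}\<rparr>"

lemma moves_iff [simp]:
  "(p, (a, True), q) \<in> moves \<Gamma> \<longleftrightarrow> (p, a, q) \<in> edges \<Gamma>"
  "(p, (a, False), q) \<in> moves \<Gamma> \<longleftrightarrow> (q, a, p) \<in> edges \<Gamma>"
  by (auto simp: moves_def)

lemma edges_eq_moves: "edges \<Gamma> = {(p, a, q). (p, (a, True), q) \<in> moves \<Gamma>}"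
  by auto

lemma moves_sym: "(p, x, q) \<in> moves \<Gamma> \<Longrightarrow> (q, bar x, p) \<in> moves \<Gamma>"
  by (auto simp: moves_def bar_def)

lemma verts_map_graph [simp]: "verts (map_graph f \<Gamma>) = f ` verts \<Gamma>"
  by (simp add: map_graph_def)

lemma moves_map_graph: "moves (map_graph f \<Gamma>) = img f (moves \<Gamma>)"
  unfolding moves_def img_def map_graph_def by auto

lemma lgraph_eqI: "verts \<Gamma> = verts \<Gamma>' \<Longrightarrow> moves \<Gamma> = moves \<Gamma>' \<Longrightarrow> \<Gamma> = (\<Gamma>' :: ('a, 'v) lgraph)"
  using edges_eq_moves[of \<Gamma>] edges_eq_moves[of \<Gamma>'] by (cases \<Gamma>, cases \<Gamma>') simp

section \<open>Degrees as numbers of outgoing moves\<close>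

definition outs :: "('v \<times> 'l \<times> 'v) set \<Rightarrow> 'v \<Rightarrow> ('l \<times> 'v) set" where
  "outs M p = {(x, u). (p, x, u) \<in> M}"

lemma outs_iff [simp]: "(x, u) \<in> outs M p \<longleftrightarrow> (p, x, u) \<in> M"
  by (simp add: outs_def)

lemma outs_moves:
  "outs (moves \<Gamma>) v = (\<lambda>(p, a, q). ((a, True), q)) ` {(p, a, q) \<in> edges \<Gamma>. p = v}
     \<union> (\<lambda>(p, a, q). ((a, False), p)) ` {(p, a, q) \<in> edges \<Gamma>. q = v}"
  by (force simp: outs_def moves_def)

lemma finite_outs_moves: "finite (edges \<Gamma>) \<Longrightarrow> finite (outs (moves \<Gamma>) v)"
  unfolding outs_moves by (intro finite_UnI finite_imageI) (auto intro: finite_subset)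

text \<open>An edge gives one move at its source and one at its target, with letters of opposite
  sign. A loop therefore gives two moves, in agreement with its contribution to the degree.\<close>

lemma degree_eq:
  assumes "finite (edges \<Gamma>)"
  shows "degree \<Gamma> v = card (outs (moves \<Gamma>) v)"
proof -
  have fin: "finite {(p, a, q) \<in> edges \<Gamma>. p = v}" "finite {(p, a, q) \<in> edges \<Gamma>. q = v}"
    using assms by (auto intro: finite_subset)
  have "card (outs (moves \<Gamma>) v) = card ((\<lambda>(p, a, q). ((a, True), q)) ` {(p, a, q) \<in> edges \<Gamma>. p = v})
     + card ((\<lambda>(p, a, q). ((a, False), p)) ` {(p, a, q) \<in> edges \<Gamma>. q = v})"
    unfolding outs_moves using fin by (intro card_Un_disjoint) auto
  also have "\<dots> = degree \<Gamma> v"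
    unfolding degree_def by (intro arg_cong2[of _ _ _ _ "(+)"] card_image) (auto simp: inj_on_def)
  finally show ?thesis by simp
qed

lemma (in inverse_graph) another_letter:
  assumes "card (outs M p) \<ge> 2"
  shows "\<exists>y q. y \<noteq> x \<and> (p, y, q) \<in> M"
proof (rule ccontr)
  assume no: "\<not> ?thesis"
  have "outs M p \<noteq> {}" using assms by auto
  then obtain y u where "(y, u) \<in> outs M p" by (metis ex_in_conv surj_pair)
  then have "(p, y, u) \<in> M" by simp
  moreover from this have "y = x" using no by blast
  ultimately have u: "(p, x, u) \<in> M" by simp
  have "e \<in> {(x, u)}" if "e \<in> outs M p" for e
  proof -
    obtain y w where e: "e = (y, w)" by (cases e)
    then have w: "(p, y, w) \<in> M" using that by simp
    then have "y = x" using no by blast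
    then show ?thesis using e w M_det[OF u, of w] by simp
  qed
  then have "card (outs M p) \<le> card {(x, u)}" by (intro card_mono) auto
  then show False using assms by simp
qed

lemma (in rooted_graph) prune_attached:
  "prune M r T p \<Longrightarrow> T \<noteq> {} \<Longrightarrow> \<exists>y t. {(x, u). (p, x, u) \<in> M \<and> u \<in> T} = {(y, t)}"
  by (drule prune_props) (elim conjE, drule (1) mp, elim conjE, assumption)

lemma (in rooted_graph) prune_root: "prune M r T p \<Longrightarrow> T \<noteq> {} \<Longrightarrow> \<exists>y t. outs M r = {(y, t)}"
  unfolding outs_def by (drule prune_props) (elim conjE, drule (1) mp, elim conjE, assumption)

lemma (in inverse_graph) subgroup_loops: "subgroup {z. reduced z \<and> path M r z r} free_group"
  unfolding subgroup_free_group_iff by (auto intro: path_nf_append path_nf path_winv)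

lemma finite_index_ext_mono:
  assumes "finite_index_ext H G" "H \<subseteq> K" "K \<subseteq> G" "subgroup K free_group"
  shows "finite_index_ext H K"
  using assms(1) unfolding finite_index_ext_iff
  by (intro conjI assms) (auto intro: finite_subset[OF image_mono[OF assms(3)]])

section \<open>Stallings graphs of a subgroup and their uniqueness\<close>

locale stallings_graph =
  fixes H :: "'a word set" and \<Gamma> :: "('a, 'v) lgraph" and r :: 'v
  assumes stallings: "stallings H \<Gamma> r"
    and subgroup_H: "subgroup H free_group"
begin

abbreviation M where "M \<equiv> moves \<Gamma>"
abbreviation V where "V \<equiv> verts \<Gamma>"

lemma finite_edges: "finite (edges \<Gamma>)" and degree_ge: "p \<in> V \<Longrightarrow> p \<noteq> r \<Longrightarrow> degree \<Gamma> p \<ge> 2"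
  using stallings by (auto simp: stallings_def)

lemma H_iff: "h \<in> H \<longleftrightarrow> reduced h \<and> path M r h r"
proof -
  have "\<forall>w. reduced w \<longrightarrow> (w \<in> H \<longleftrightarrow> path M r w r)" using stallings unfolding stallings_def by (elim conjE)
  then show ?thesis using subgroup_free_groupD(1)[OF subgroup_H] by blast
qed

sublocale rooted_graph "moves \<Gamma>" "verts \<Gamma>" r
proof
  fix p q q' :: 'v and x :: "'a letter"
  show "(p, x, q) \<in> M \<Longrightarrow> (q, bar x, p) \<in> M" by (rule moves_sym)
  have *: "\<forall>p a q q'. (p, a, q) \<in> edges \<Gamma> \<and> (p, a, q') \<in> edges \<Gamma> \<longrightarrow> q = q'"
    "\<forall>p p' a q. (p, a, q) \<in> edges \<Gamma> \<and> (p', a, q) \<in> edges \<Gamma> \<longrightarrow> p = p'"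
    using stallings unfolding stallings_def by blast+
  show "(p, x, q) \<in> M \<Longrightarrow> (p, x, q') \<in> M \<Longrightarrow> q = q'" unfolding moves_def using * by fast
  have "edges \<Gamma> \<subseteq> V \<times> UNIV \<times> V" using stallings unfolding stallings_def by blast
  then show "M \<subseteq> V \<times> UNIV \<times> V" by (auto simp: moves_def)
qed (use stallings in \<open>auto simp: stallings_def\<close>)

text \<open>Only the root may have degree one. A reduced path that cannot be prolonged has thus
  arrived at the root, and its word is then an element of \<open>H\<close>.\<close>

lemma extend_or_close:
  assumes "reduced u" "path M r u p"
  shows "(\<exists>s. u @ s \<in> H) \<or> (\<exists>y q. length y = n \<and> reduced (u @ y) \<and> path M p y q)"
proof (induction n)
  case 0
  then show ?case using assms by (intro disjI2 exI[of _ "[]"] exI[of _ p]) simp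
next
  case (Suc n)
  show ?case
  proof (cases "\<exists>s. u @ s \<in> H")
    case False
    then obtain y q where y: "length y = n" "reduced (u @ y)" "path M p y q" using Suc by blast
    have q: "path M r (u @ y) q" by (rule path_appendI[OF assms(2) y(3)])
    then have "q \<noteq> r" using False y(2) H_iff by blast
    then have "2 \<le> card (outs M q)"
      using degree_ge[OF path_V[OF q r_V]] by (simp add: degree_eq finite_edges)
    then obtain z t where z: "z \<noteq> bar (last (u @ y))" "(q, z, t) \<in> M" using another_letter by blast
    have "path M p (y @ [z]) t" using y(3) z(2) by (auto simp: path_append)
    moreover have "reduced (u @ y @ [z])" using reduced_snoc[of "u @ y" z] y(2) z(1) by simp
    ultimately show ?thesis using y(1) by (intro disjI2 exI[of _ "y @ [z]"] exI[of _ t]) simp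
  qed simp
qed

text \<open>The reduced words readable at the root depend on \<open>H\<close> alone. To close a path
  without damaging \<open>u\<close>, it is first prolonged by as many letters as the longest return
  path may cancel.\<close>

lemma readable_iff_prefix:
  assumes "reduced u"
  shows "u \<in> lang M r \<longleftrightarrow> (\<exists>s. u @ s \<in> H)"
proof
  assume "\<exists>s. u @ s \<in> H"
  then show "u \<in> lang M r" by (auto simp: H_iff path_append intro: langI)
next
  assume "u \<in> lang M r"
  then obtain p where p: "path M r u p" by (auto simp: lang_def)
  have "\<exists>c. \<forall>p\<in>V. path M p (c p) r" by (rule bchoice) (use connV r_V in blast)
  then obtain c where c: "\<forall>p\<in>V. path M p (c p) r" by blast
  define D where "D = Max (length ` c ` V)"
  have D: "length (c p) \<le> D" if "p \<in> V" for p unfolding D_def using that finite_V by (intro Max_ge) auto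
  consider "\<exists>s. u @ s \<in> H" | y q where "length y = D" "reduced (u @ y)" "path M p y q"
    using extend_or_close[OF assms p, of D] by blast
  then show "\<exists>s. u @ s \<in> H"
  proof cases
    case 2
    have q: "path M r (u @ y) q" by (rule path_appendI[OF p 2(3)])
    then have qV: "q \<in> V" using path_V r_V by blast
    obtain s where s: "nf (u @ y @ c q) = u @ s" using nf_prefix_survives[OF 2(2), of "c q"] D[OF qV] 2(1) by auto
    have "path M r (nf ((u @ y) @ c q)) r" using path_nf_append[OF q] c qV by blast
    then have "u @ s \<in> H" using s reduced_nf[of "u @ y @ c q"] by (simp add: H_iff)
    then show ?thesis by blast
  qed
qed

lemma same_end_iff:
  assumes "path M r u p" "path M r u' p'" "reduced u"
  shows "p = p' \<longleftrightarrow> nf (u @ winv u') \<in> H"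
proof
  assume "p = p'"
  then show "nf (u @ winv u') \<in> H" using path_nf_append[OF assms(1) path_winv[OF assms(2)[folded \<open>p = p'\<close>]]]
    by (simp add: H_iff)
next
  assume "nf (u @ winv u') \<in> H"
  then have "path M r (nf (nf (u @ winv u') @ u')) p'" using path_nf_append assms(2) H_iff by blast
  then show "p = p'" using assms(1,3) path_det by (simp add: nf_id)
qed

lemma reduced_path_to: "p \<in> V \<Longrightarrow> \<exists>u. reduced u \<and> path M r u p"
  using connV[OF r_V] path_nf reduced_nf by blast

end

text \<open>A vertex is sent to the end, in the other graph, of any reduced word leading to it. Such
  a word is readable there because readability depends on \<open>H\<close> only, and the end does
  not depend on the word because equality of ends is a condition on cosets of
  \<open>H\<close>.\<close>

lemma stallings_morphism:
  assumes "stallings H \<Gamma> r" "stallings H \<Gamma>' r'" "subgroup H free_group"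
  shows "\<exists>g. \<forall>u p. reduced u \<longrightarrow> path (moves \<Gamma>) r u p \<longrightarrow> path (moves \<Gamma>') r' u (g p)"
proof -
  interpret G: stallings_graph H \<Gamma> r by (rule stallings_graph.intro[OF assms(1,3)])
  interpret G': stallings_graph H \<Gamma>' r' by (rule stallings_graph.intro[OF assms(2,3)])
  have "\<forall>p\<in>G.V. \<exists>q. \<forall>u. reduced u \<longrightarrow> path G.M r u p \<longrightarrow> path G'.M r' u q"
  proof
    fix p assume "p \<in> G.V"
    then obtain u where u: "reduced u" "path G.M r u p" using G.reduced_path_to by blast
    then have "u \<in> lang G'.M r'" using G.readable_iff_prefix[OF u(1)] G'.readable_iff_prefix[OF u(1)] langI by metis
    then obtain q where q: "path G'.M r' u q" by (auto simp: lang_def)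
    have "path G'.M r' u' q" if u': "reduced u'" "path G.M r u' p" for u'
    proof -
      have "u' \<in> lang G'.M r'" using G.readable_iff_prefix[OF u'(1)] G'.readable_iff_prefix[OF u'(1)] langI u'(2) by metis
      then obtain q' where q': "path G'.M r' u' q'" by (auto simp: lang_def)
      have "nf (u @ winv u') \<in> H" using G.same_end_iff[OF u(2) u'(2) u(1)] by simp
      then have "q = q'" using G'.same_end_iff[OF q q' u(1)] by simp
      then show ?thesis using q' by simp
    qed
    then show "\<exists>q. \<forall>u. reduced u \<longrightarrow> path G.M r u p \<longrightarrow> path G'.M r' u q" by blast
  qed
  from bchoice[OF this] obtain g where
    g: "\<forall>p\<in>G.V. \<forall>u. reduced u \<longrightarrow> path G.M r u p \<longrightarrow> path G'.M r' u (g p)" by blast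
  show ?thesis
  proof (intro exI[of _ g] allI impI)
    fix u p assume u: "reduced u" "path G.M r u p"
    show "path G'.M r' u (g p)" using g G.path_V[OF u(2) G.r_V] u by simp
  qed
qed

text \<open>A reduced word leading to \<open>p\<close> is either prolonged by \<open>x\<close> or
  ends with \<open>bar x\<close>; in the second case the move is its last step read
  backwards.\<close>

lemma stallings_morphism_moves:
  assumes "stallings H \<Gamma> r" "stallings H \<Gamma>' r'" "subgroup H free_group"
    and g: "\<And>u p. reduced u \<Longrightarrow> path (moves \<Gamma>) r u p \<Longrightarrow> path (moves \<Gamma>') r' u (g p)"
    and pq: "(p, x, q) \<in> moves \<Gamma>"
  shows "(g p, x, g q) \<in> moves \<Gamma>'"
proof -
  interpret G: stallings_graph H \<Gamma> r by (rule stallings_graph.intro[OF assms(1,3)])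
  interpret G': stallings_graph H \<Gamma>' r' by (rule stallings_graph.intro[OF assms(2,3)])
  have "p \<in> G.V" using pq G.M_V by blast
  then obtain u where u: "reduced u" "path G.M r u p" using G.reduced_path_to by blast
  show ?thesis
  proof (rule nf_snoc_cases[OF u(1), of x])
    assume red: "reduced (u @ [x])"
    have "path G.M r (u @ [x]) q" using u pq by (auto simp: path_append)
    then have "path G'.M r' (u @ [x]) (g q)" using g red by blast
    then obtain s where s: "path G'.M r' u s" "(s, x, g q) \<in> G'.M" by (auto simp: path_append)
    then have "s = g p" using G'.path_det g[OF u] by blast
    then show ?thesis using s by simp
  next
    fix w assume w: "u = w @ [bar x]"
    then obtain s where s: "path G.M r w s" "(s, bar x, p) \<in> G.M" using u by (auto simp: path_append)
    then have "s = q" using G.M_det[OF pq] G.M_sym[OF s(2)] by simp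
    then have "path G'.M r' w (g q)" using g[of w s] s u(1) w by (simp add: reduced_append)
    moreover have "path G'.M r' (w @ [bar x]) (g p)" using g[OF u] w by simp
    ultimately have "(g q, bar x, g p) \<in> G'.M" using G'.path_det by (auto simp: path_append)
    then show ?thesis using G'.M_sym by fastforce
  qed
qed

lemma stallings_unique:
  assumes "stallings H \<Gamma> r" "stallings H \<Gamma>' r'" "subgroup H free_group"
  obtains g where "\<Gamma>' = map_graph g \<Gamma>" "g r = r'" "inj_on g (verts \<Gamma>)"
proof -
  interpret G: stallings_graph H \<Gamma> r by (rule stallings_graph.intro[OF assms(1,3)])
  interpret G': stallings_graph H \<Gamma>' r' by (rule stallings_graph.intro[OF assms(2,3)])
  obtain g where g: "\<And>u p. reduced u \<Longrightarrow> path G.M r u p \<Longrightarrow> path G'.M r' u (g p)"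
    using stallings_morphism[OF assms] by blast
  obtain g' where g': "\<And>u p. reduced u \<Longrightarrow> path G'.M r' u p \<Longrightarrow> path G.M r u (g' p)"
    using stallings_morphism[OF assms(2,1,3)] by blast
  have g'g: "g' (g p) = p" if p: "p \<in> G.V" for p
  proof -
    obtain u where u: "reduced u" "path G.M r u p" using G.reduced_path_to p by blast
    show ?thesis using G.path_det[OF g'[OF u(1) g[OF u]] u(2)] .
  qed
  have gg': "g (g' p) = p" if p: "p \<in> G'.V" for p
  proof -
    obtain u where u: "reduced u" "path G'.M r' u p" using G'.reduced_path_to p by blast
    show ?thesis using G'.path_det[OF g[OF u(1) g'[OF u]] u(2)] .
  qed
  have gV: "g p \<in> G'.V" if p: "p \<in> G.V" for p
  proof -
    obtain u where u: "reduced u" "path G.M r u p" using G.reduced_path_to p by blast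
    show ?thesis using G'.path_V[OF g[OF u] G'.r_V] .
  qed
  have g'V: "g' p \<in> G.V" if p: "p \<in> G'.V" for p
  proof -
    obtain u where u: "reduced u" "path G'.M r' u p" using G'.reduced_path_to p by blast
    show ?thesis using G.path_V[OF g'[OF u] G.r_V] .
  qed
  note gM = stallings_morphism_moves[OF assms g] and g'M = stallings_morphism_moves[OF assms(2,1,3) g']
  have "\<Gamma>' = map_graph g \<Gamma>"
  proof (rule lgraph_eqI)
    show "G'.V = verts (map_graph g \<Gamma>)" using gV g'V gg' by force
    show "G'.M = moves (map_graph g \<Gamma>)"
      unfolding moves_map_graph
    proof (intro equalityI subsetI)
      fix e assume e: "e \<in> G'.M"
      obtain p x q where e2: "e = (p, x, q)" by (cases e) auto
      have "(g (g' p), x, g (g' q)) \<in> img g G.M" by (rule imgI, rule g'M, assumption, assumption) (use e e2 in blast)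
      moreover have "p \<in> G'.V" "q \<in> G'.V" using e e2 G'.M_V by blast+
      ultimately show "e \<in> img g G.M" using e2 gg' by simp
    next
      fix e assume "e \<in> img g G.M"
      then show "e \<in> G'.M" using gM by (auto simp: img_def)
    qed
  qed
  moreover have "g r = r'" using g[of "[]" r] by simp
  moreover have "inj_on g G.V" using g'g by (rule inj_on_inverseI)
  ultimately show ?thesis using that by blast
qed

section \<open>Tail, core and the relation of equal languages\<close>

locale core_decomposition = stallings_graph H \<Gamma> r for H :: "'a word set" and \<Gamma> :: "('a, 'v) lgraph" and r +
  fixes T :: "'v set" and v :: 'v
  assumes prune: "prune (moves \<Gamma>) r T v" and branching: "branching T v"
begin

definition C where "C = V - T"
definition MC where "MC = restr M C"

lemma prune_facts: "T \<subseteq> V" "v \<in> C" "q \<in> T \<Longrightarrow> (q, x, u) \<in> M \<Longrightarrow> u \<in> insert v T" "T = {} \<Longrightarrow> v = r" "T \<noteq> {} \<Longrightarrow> r \<in> T"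
  using prune_props[OF prune] unfolding C_def by blast+

lemma tail_neighbour: "u \<in> T \<Longrightarrow> (p, x, u) \<in> M \<Longrightarrow> p \<in> insert v T"
  using prune_facts(3) M_sym by blast

lemma outs_ge: "p \<in> V \<Longrightarrow> p \<noteq> r \<Longrightarrow> 2 \<le> card (outs M p)"
  using degree_ge by (simp add: degree_eq finite_edges)

lemma MC_subset: "MC \<subseteq> M"
  by (auto simp: MC_def)

lemma MC_M: "(p, x, q) \<in> MC \<longleftrightarrow> (p, x, q) \<in> M \<and> p \<in> C \<and> q \<in> C"
  by (simp add: MC_def)

sublocale core: core_graph MC C v
proof -
  interpret MC: inverse_graph MC unfolding MC_def by (rule inverse_graph_restr)
  show "core_graph MC C v"
  proof
    show "finite C" using finite_V by (simp add: C_def)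
    show "MC \<subseteq> C \<times> UNIV \<times> C" by (auto simp: MC_M)
    show "v \<in> C" by (rule prune_facts)
    show "\<exists>w. path MC p w q" if "p \<in> C" "q \<in> C" for p q
      using prune_connected[OF prune] that unfolding C_def MC_def by blast
    show "\<exists>y q. y \<noteq> x \<and> (p, y, q) \<in> MC" if p: "p \<in> C" for p x
    proof (cases "p = v")
      case True
      obtain y z u w where *: "y \<noteq> z" "(v, y, u) \<in> M" "u \<notin> T" "(v, z, w) \<in> M" "w \<notin> T"
        using branching unfolding branching_def by blast
      then have "u \<in> C" "w \<in> C" using M_V by (auto simp: C_def)
      then show ?thesis using * True p by (cases "y = x") (auto simp: MC_M simp del: split_paired_Ex)
    next
      case False
      \<comment> \<open>Away from \<open>v\<close> no edge leads into the tail, so the further edge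
        guaranteed by the degree stays in the core.\<close>
      then have "p \<noteq> r" "p \<in> V" using p prune_facts(4,5) by (auto simp: C_def)
      then obtain y q where y: "y \<noteq> x" "(p, y, q) \<in> M" using another_letter outs_ge by blast
      then have "q \<in> C" using tail_neighbour[of q p y] False p M_V by (auto simp: C_def)
      then show ?thesis using y p MC_M by blast
    qed
  qed
qed

text \<open>A pruned vertex other than the root has exactly one edge into the part pruned before it
  and one edge onwards. Hence it has degree two and is adjacent to the tail collected so
  far.\<close>

lemma prune_T_tail: "prune M r S p \<Longrightarrow> S \<subseteq> tail \<Gamma> r"
proof (induction rule: prune.induct)
  case (prune_step S p y q)
  have "p \<in> tail \<Gamma> r"
  proof (cases "S = {}")
    case True
    then have "p = r" using prune_props[OF prune_step.hyps(1)] by blast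
    then show ?thesis by (simp add: tail.root)
  next
    case False
    then obtain z t where t: "{(x, u). (p, x, u) \<in> M \<and> u \<in> S} = {(z, t)}"
      using prune_attached[OF prune_step.hyps(1)] by metis
    have "outs M p = {(x, u). (p, x, u) \<in> M \<and> u \<in> S} \<union> {(x, u). (p, x, u) \<in> M \<and> u \<notin> S}"
      by (auto simp: outs_def)
    then have "outs M p = {(z, t), (y, q)}" unfolding t prune_step.hyps(2) by auto
    moreover have "(z, t) \<in> {(x, u). (p, x, u) \<in> M \<and> u \<in> S}" "(y, q) \<in> {(x, u). (p, x, u) \<in> M \<and> u \<notin> S}"
      unfolding t prune_step.hyps(2) by simp_all
    then have zt: "(p, z, t) \<in> M" "t \<in> S" "q \<notin> S" by simp_all
    moreover have "t \<noteq> q" using zt by blast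
    ultimately have "degree \<Gamma> p = 2" by (simp add: degree_eq finite_edges)
    then show ?thesis using tail.step[OF _ M_sym[OF zt(1)]] prune_step.IH zt(2) by blast
  qed
  then show ?case using prune_step.IH by simp
qed simp

text \<open>If something is pruned, \<open>v\<close> has two moves that stay outside
  \<open>T\<close> and one into \<open>T\<close>. Its degree is then at least three, so the tail
  cannot grow past it. If nothing is pruned, branching gives the root degree at least two.\<close>

lemma core_eq: "core \<Gamma> r = \<lparr>verts = C, edges = {(p, a, q) \<in> edges \<Gamma>. p \<in> C \<and> q \<in> C}\<rparr>"
proof -
  obtain y z u w where yz: "y \<noteq> z" "(v, y, u) \<in> M" "u \<notin> T" "(v, z, w) \<in> M" "w \<notin> T"
    using branching unfolding branching_def by blast
  have deg_v: "card A \<le> degree \<Gamma> v" if "A \<subseteq> outs M v" for A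
    unfolding degree_eq[OF finite_edges] by (rule card_mono[OF finite_outs_moves[OF finite_edges] that])
  show ?thesis
  proof (cases "T = {}")
    case True
    then have "v = r" by (rule prune_facts)
    have "2 \<le> degree \<Gamma> v" using deg_v[of "{(y, u), (z, w)}"] yz by auto
    then have "\<forall>p\<in>V. 2 \<le> degree \<Gamma> p" using degree_ge \<open>v = r\<close> by blast
    moreover have "edges \<Gamma> \<subseteq> V \<times> UNIV \<times> V" using stallings unfolding stallings_def by blast
    moreover have "C = V" unfolding C_def using True by simp
    ultimately show ?thesis by (intro lgraph.equality) (auto simp: core_def)
  next
    case False
    then obtain x t where "outs M r = {(x, t)}" using prune_root[OF prune] by metis
    then have "degree \<Gamma> r = 1" using degree_eq[OF finite_edges, of r] by simp
    then have "\<not> (\<forall>p\<in>V. 2 \<le> degree \<Gamma> p)" using r_V by force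
    moreover have "tail \<Gamma> r = T"
    proof
      show "T \<subseteq> tail \<Gamma> r" using prune_T_tail[OF prune] .
      show "tail \<Gamma> r \<subseteq> T"
      proof
        fix p assume "p \<in> tail \<Gamma> r"
        then show "p \<in> T"
        proof induction
          case root
          then show ?case using prune_facts False by blast
        next
          case (step p x u')
          obtain x' t where "{(x, u). (v, x, u) \<in> M \<and> u \<in> T} = {(x', t)}"
            using prune_attached[OF prune False] by metis
          then have "(x', t) \<in> {(x, u). (v, x, u) \<in> M \<and> u \<in> T}" by simp
          then have t: "(v, x', t) \<in> M" "t \<in> T" by simp_all
          have "card {(y, u), (z, w), (x', t)} \<le> degree \<Gamma> v" using yz t by (intro deg_v) auto
          moreover have "t \<noteq> u" "t \<noteq> w" using yz t by blast+
          then have "card {(y, u), (z, w), (x', t)} = 3" using yz(1) by simp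
          ultimately have "u' \<noteq> v" using step.hyps(3) by auto
          then show ?case using prune_facts(3)[OF step.IH step.hyps(2)] by blast
        qed
      qed
    qed
    ultimately show ?thesis by (simp only: core_def C_def Let_def if_False)
  qed
qed

lemma moves_core: "moves (core \<Gamma> r) = MC" and verts_core: "verts (core \<Gamma> r) = C"
  by (auto simp: core_eq moves_def MC_def restr_def)

text \<open>Equivalence of states of the core, extended by equality to the tail so that it acts on
  all of \<open>\<Gamma>\<close>.\<close>

definition sim :: "'v \<Rightarrow> 'v \<Rightarrow> bool" where
  "sim p q \<longleftrightarrow> p = q \<or> p \<in> C \<and> q \<in> C \<and> lang MC p = lang MC q"

text \<open>So \<open>sim\<close> is closed under reduction. The delicate moves are those from the
  core into the tail: they all start at \<open>v\<close>, so two different equivalent vertices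
  cannot both have one with the same letter. If one target is in the core, the letter is readable in
  the core at both vertices.\<close>

lemma sim_step:
  assumes "sim p p'" "(p, x, q) \<in> M" "(p', x, q') \<in> M"
  shows "sim q q'"
proof (cases "p = p'")
  case True
  then show ?thesis using M_det assms by (auto simp: sim_def)
next
  case False
  then have C: "p \<in> C" "p' \<in> C" "lang MC p = lang MC p'" using assms(1) by (auto simp: sim_def)
  have other: "s' \<in> C \<Longrightarrow> s \<in> C" if eq: "lang MC t = lang MC t'" and "t \<in> C" "t' \<in> C" and ts: "(t, x, s) \<in> M" and "(t', x, s') \<in> M"
    for t t' s s'
  proof -
    assume "s' \<in> C"
    then have "(t', x, s') \<in> MC" using that MC_M by simp
    then obtain s'' where "(t, x, s'') \<in> MC" using core.lang_eqE[OF eq[symmetric]] by blast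
    then show "s \<in> C" using M_det[OF ts] by (auto simp: MC_M)
  qed
  have "q \<in> C \<or> q' \<in> C"
  proof (rule ccontr)
    assume "\<not> ?thesis"
    then have "q \<in> T" "q' \<in> T" using assms(2,3) M_V by (auto simp: C_def)
    then have "p \<in> insert v T" "p' \<in> insert v T" 
      using tail_neighbour[OF _ assms(2)] tail_neighbour[OF _ assms(3)] by blast+
    then have "p = v" "p' = v" using C(1,2) unfolding C_def by blast+
    then show False using False by simp
  qed
  then have "q \<in> C" "q' \<in> C" using other[OF C(3) C(1,2) assms(2,3)] other[OF C(3)[symmetric] C(2,1) assms(3,2)] by blast+
  then show ?thesis using core.lang_succ_eq[of p x q p' q'] assms(2,3) C by (simp add: sim_def MC_M)
qed

lemma sim_sym: "sim p q \<Longrightarrow> sim q p" and sim_trans: "sim p q \<Longrightarrow> sim q s \<Longrightarrow> sim p s"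
  by (auto simp: sim_def)

end

section \<open>The quotient by equal languages and the maximum finite index extension\<close>

locale core_quotient = core_decomposition H \<Gamma> r T v
  for H :: "'a word set" and \<Gamma> :: "('a, 'v) lgraph" and r T v +
  fixes f :: "'v \<Rightarrow> 'w"
  assumes f_eq: "p \<in> verts \<Gamma> \<Longrightarrow> q \<in> verts \<Gamma> \<Longrightarrow> f p = f q \<longleftrightarrow> sim p q"
begin

lemma f_tail: "p \<in> T \<Longrightarrow> q \<in> V \<Longrightarrow> f p = f q \<Longrightarrow> p = q"
  using f_eq[of p q] prune_facts(1) by (auto simp: sim_def C_def)

lemma f_C: "p \<in> C \<Longrightarrow> q \<in> C \<Longrightarrow> f p = f q \<longleftrightarrow> lang MC p = lang MC q"
  using f_eq[of p q] by (auto simp: sim_def C_def)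

lemma img_C: "f ` V - f ` T = f ` C"
proof
  show "f ` V - f ` T \<subseteq> f ` C" by (auto simp: C_def)
  show "f ` C \<subseteq> f ` V - f ` T"
  proof
    fix b assume "b \<in> f ` C"
    then obtain p where p: "p \<in> C" "b = f p" by auto
    have "f p \<notin> f ` T"
    proof
      assume "f p \<in> f ` T"
      then obtain t where "t \<in> T" "f t = f p" by auto
      then have "t = p" using f_tail p by (auto simp: C_def)
      then show False using p \<open>t \<in> T\<close> by (simp add: C_def)
    qed
    then show "b \<in> f ` V - f ` T" using p by (auto simp: C_def)
  qed
qed

lemma mem_C_if_img: "p \<in> V \<Longrightarrow> f p \<in> f ` C \<Longrightarrow> p \<in> C"
  using img_C by (auto simp: C_def)

sublocale quot: rooted_graph "img f (moves \<Gamma>)" "f ` verts \<Gamma>" "f r"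
proof
  fix b c c' x
  show "(b, x, c) \<in> img f M \<Longrightarrow> (c, bar x, b) \<in> img f M" by (auto elim!: imgE intro!: imgI M_sym)
  show "c = c'" if 1: "(b, x, c) \<in> img f M" and 2: "(b, x, c') \<in> img f M"
  proof -
    obtain p q where p: "b = f p" "c = f q" "(p, x, q) \<in> M" using 1 by (rule imgE)
    obtain p' q' where p': "b = f p'" "c' = f q'" "(p', x, q') \<in> M" using 2 by (rule imgE)
    have V: "p \<in> V" "p' \<in> V" "q \<in> V" "q' \<in> V" using p p' M_V by blast+
    have "f p = f p'" using p(1) p'(1) by simp
    then have "sim p p'" using f_eq[OF V(1,2)] by simp
    then show ?thesis using sim_step[OF _ p(3) p'(3)] f_eq V p(2) p'(2) by simp
  qed
  show "img f M \<subseteq> f ` V \<times> UNIV \<times> f ` V" using M_V unfolding img_def by blast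
  show "\<exists>w. path (img f M) b w c" if b: "b \<in> f ` V" "c \<in> f ` V" for b c
  proof -
    obtain p q where "p \<in> V" "q \<in> V" "b = f p" "c = f q" using b by blast
    then show ?thesis using connV[of p q] path_img[of M p _ q f] by blast
  qed
qed (use finite_V r_V in auto)

lemma prune_quot: "prune (img f M) (f r) (f ` T) (f v)"
  by (rule prune_img[OF prune subset_refl f_tail])

lemma restr_quot: "restr (img f M) (f ` C) = img f MC"
proof (intro equalityI subsetI)
  fix e assume e: "e \<in> restr (img f M) (f ` C)"
  obtain b x c where b: "e = (b, x, c)" by (cases e) auto
  have bc: "(b, x, c) \<in> img f M" "b \<in> f ` C" "c \<in> f ` C" using e b by simp_all
  obtain p q where p: "b = f p" "c = f q" "(p, x, q) \<in> M" using bc(1) by (rule imgE)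
  then have "p \<in> C" "q \<in> C" using mem_C_if_img bc M_V by blast+
  then show "e \<in> img f MC" unfolding b p using p(3) by (intro imgI) (simp add: MC_M)
next
  fix e assume "e \<in> img f MC"
  then obtain p x q where e: "e = (f p, x, f q)" "(p, x, q) \<in> MC" by (auto simp: img_def)
  then have "(p, x, q) \<in> M" "p \<in> C" "q \<in> C" by (simp_all add: MC_M)
  then show "e \<in> restr (img f M) (f ` C)" unfolding e(1) restr_iff by (intro conjI imgI imageI)
qed

lemma branching_quot: "quot.branching (f ` T) (f v)"
proof -
  obtain y z u w where yz: "y \<noteq> z" "(v, y, u) \<in> M" "u \<notin> T" "(v, z, w) \<in> M" "w \<notin> T"
    using branching unfolding branching_def by blast
  then have "u \<in> C" "w \<in> C" using M_V by (auto simp: C_def)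
  then have "f u \<notin> f ` T" "f w \<notin> f ` T" using img_C by blast+
  then show ?thesis unfolding quot.branching_def using yz imgI by metis
qed

definition G :: "'a word set" where "G = {z. reduced z \<and> path (img f M) (f r) z (f r)}"

lemma subgroup_G: "subgroup G free_group"
  unfolding G_def by (rule quot.subgroup_loops)

lemma H_G: "H \<subseteq> G"
  by (auto simp: G_def H_iff path_img)

lemma path_r_v: "\<exists>w. path M r w v"
  using connV r_V prune_facts(2) by (auto simp: C_def)

lemma finite_index_G: "finite_index_ext H G"
proof -
  obtain w where w: "path M r w v" using path_r_v by blast
  have "\<exists>q\<in>C. path M r (nf (g @ w)) q" if "g \<in> G" for g
  proof -
    have g: "path (img f M) (f r) g (f r)" using that by (simp add: G_def)
    have "path (img f M) (f v) (winv w @ g @ w) (f v)"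
      by (rule path_appendI[OF path_img[OF path_winv[OF w]] path_appendI[OF g path_img[OF w]]])
    \<comment> \<open>The conjugate is reduced and both its ends are in the image of the core, so it
      avoids the image of the tail.\<close>
    then have "path (restr (img f M) (f ` V - f ` T)) (f v) (nf (winv w @ g @ w)) (f v)"
      using img_C prune_facts(2) by (intro quot.prune_path[OF prune_quot reduced_nf quot.path_nf]) auto
    then have "path (img f MC) (f v) (nf (winv w @ g @ w)) (f v)" by (simp only: img_C restr_quot)
    then obtain q where q: "q \<in> C" "path MC v (nf (winv w @ g @ w)) q"
      using core.path_img_lift[OF _ prune_facts(2) core.M_C f_C] by blast
    have "path M v (nf (winv w @ g @ w)) q" by (rule path_mono[OF q(2) MC_subset])
    then have "path M r (nf (w @ nf (winv w @ g @ w))) q" using path_nf_append w by blast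
    then show ?thesis using q(1) by auto
  qed
  then obtain \<phi> where \<phi>: "\<And>g. g \<in> G \<Longrightarrow> \<phi> g \<in> C \<and> path M r (nf (g @ w)) (\<phi> g)" by metis
  show ?thesis
  proof (rule finite_index_extI[OF subgroup_G H_G subgroup_H])
    show "finite (\<phi> ` G)" by (rule finite_subset[OF _ core.finite_C]) (use \<phi> in auto)
    fix g g' assume g: "g \<in> G" "g' \<in> G" "\<phi> g = \<phi> g'"
    have "path M r (nf (nf (g @ w) @ winv (nf (g' @ w)))) r"
      using path_nf_append path_winv \<phi> g by metis
    then show "nf (g @ winv g') \<in> H" by (simp add: H_iff)
  qed
qed

lemma finite_index_ext_le_G:
  assumes "finite_index_ext H K"
  shows "K \<subseteq> G"
proof
  fix z assume z: "z \<in> K"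
  obtain w where w: "path M r w v" using path_r_v by blast
  have K: "subgroup K free_group" "H \<subseteq> K" using assms by (auto simp: finite_index_ext_iff)
  note KD = subgroup_free_groupD[OF K(1)]
  have "[] \<in> H" by (rule subgroup_free_groupD[OF subgroup_H])
  then obtain N where N: "finite N" "\<And>k. k \<in> K \<Longrightarrow> \<exists>n\<in>N. nf (k @ winv n) \<in> H"
    using finite_index_ext_reps[OF assms] by blast
  \<comment> \<open>Conjugation by \<open>w\<close> moves the base point to \<open>v\<close>. The
    coset representatives are conjugated too, without being reduced, since only products with them
    are normalized.\<close>
  define c where "c k = nf (winv w @ k @ w)" for k
  have loop: "path MC v (c h) v" if "h \<in> H" for h
  proof -
    have h: "path M r h r" using that H_iff by simp
    have "path M v (winv w @ h @ w) v" by (rule path_appendI[OF path_winv[OF w] path_appendI[OF h w]])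
    then show ?thesis unfolding c_def MC_def C_def
      by (intro prune_path[OF prune reduced_nf path_nf]) (use prune_facts(2) in \<open>auto simp: C_def\<close>)
  qed
  have cmult: "nf (c k @ c k') = c (nf (k @ k'))" and cinv: "nf (winv (c k)) = c (nf (winv k))" for k k'
    unfolding c_def using nf_cancel(2)[of "winv w @ k" w "k' @ w"] by simp_all
  interpret E: core_extension MC C v "c ` K" "(\<lambda>n. winv w @ n @ w) ` N"
  proof
    show "nf (u @ u') \<in> c ` K" if "u \<in> c ` K" "u' \<in> c ` K" for u u'
      using that KD(3) by (auto simp: cmult)
    show "nf (winv u) \<in> c ` K" if "u \<in> c ` K" for u using that KD(4) by (auto simp: cinv)
    show "reduced u" if "u \<in> c ` K" for u using that by (auto simp: c_def)
    show "h \<in> c ` K" if "reduced h" "path MC v h v" for h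
    proof -
      have "path M v h v" by (rule path_mono[OF that(2) MC_subset])
      then have "path M r (nf (w @ h @ winv w)) r" by (intro path_nf path_appendI[OF w] path_appendI[OF _ path_winv[OF w]])
      then have "nf (w @ h @ winv w) \<in> K" using K(2) H_iff by auto
      moreover have "c (nf (w @ h @ winv w)) = h" unfolding c_def using nf_cancel(3)[of h w] that(1) by (simp add: nf_id)
      ultimately show ?thesis by (metis imageI)
    qed
    show "finite ((\<lambda>n. winv w @ n @ w) ` N)" using N(1) by simp
    show "\<exists>n\<in>(\<lambda>n. winv w @ n @ w) ` N. path MC v (nf (k @ winv n)) v" if k: "k \<in> c ` K" for k
    proof -
      obtain k' where k': "k' \<in> K" "k = c k'" using k by blast
      then obtain n where n: "n \<in> N" "nf (k' @ winv n) \<in> H" using N(2) by blast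
      have "nf (k @ winv (winv w @ n @ w)) = c (nf (k' @ winv n))"
        unfolding k'(2) c_def using nf_cancel(2)[of "winv w @ k'" w "winv n @ w"] by simp
      then show ?thesis using loop[OF n(2)] n(1) by (intro bexI[of _ "winv w @ n @ w"]) simp_all
    qed
  qed
  have cz: "c z \<in> c ` K" using z by simp
  obtain p where p: "path MC v (c z) p" using E.K_readable[OF cz] by (auto simp: lang_def)
  then have "p \<in> C" using core.path_C prune_facts(2) by blast
  \<comment> \<open>Equality of languages closes the path of \<open>c z\<close> to a loop in the
    quotient.\<close>
  then have "f p = f v" using f_C[OF _ prune_facts(2)] E.K_lang_eq[OF cz p] by simp
  moreover have "path M v (c z) p" by (rule path_mono[OF p MC_subset])
  ultimately have "path (img f M) (f v) (c z) (f v)" using path_img by metis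
  then have "path (img f M) (f r) (nf (w @ c z @ winv w)) (f r)"
    by (intro quot.path_nf path_appendI[OF path_img[OF w]] path_appendI[OF _ path_img[OF path_winv[OF w]]])
  moreover have "nf (w @ c z @ winv w) = z" unfolding c_def using nf_cancel(4)[of z w] KD(1)[OF z] by (simp add: nf_id)
  ultimately show "z \<in> G" using KD(1)[OF z] by (simp add: G_def)
qed

lemma H_fi_eq: "H_fi H = G"
  unfolding H_fi_def by (rule Greatest_equality) (use finite_index_G finite_index_ext_le_G in auto)

text \<open>The quotient needs no further reduction or pruning. It is deterministic by
  \<open>sim_step\<close>, and no degree drops, because identifying targets cannot merge moves of
  one vertex with distinct letters.\<close>

lemma stallings_quot: "stallings (H_fi H) (map_graph f \<Gamma>) (f r)"
proof -
  have fe: "finite (edges (map_graph f \<Gamma>))"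
  proof -
    have "edges (map_graph f \<Gamma>) = (\<lambda>(p, a, q). (f p, a, f q)) ` edges \<Gamma>" by (force simp: map_graph_def)
    then show ?thesis using finite_edges by simp
  qed
  have deg: "2 \<le> degree (map_graph f \<Gamma>) b" if b: "b \<in> f ` V - {f r}" for b
  proof -
    obtain p where p: "p \<in> V" "p \<noteq> r" "b = f p" using b by blast
    have "inj_on (\<lambda>(x, u). (x, f u)) (outs M p)"
    proof (rule inj_onI)
      fix e e' assume "e \<in> outs M p" "e' \<in> outs M p" "(case e of (x, u) \<Rightarrow> (x, f u)) = (case e' of (x, u) \<Rightarrow> (x, f u))"
      then show "e = e'" using M_det by (cases e, cases e') auto
    qed
    then have "card (outs M p) = card ((\<lambda>(x, u). (x, f u)) ` outs M p)" by (simp add: card_image)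
    also have "\<dots> \<le> card (outs (img f M) b)"
    proof (rule card_mono)
      show "finite (outs (img f M) b)" using finite_outs_moves[OF fe] by (simp add: moves_map_graph)
      show "(\<lambda>(x, u). (x, f u)) ` outs M p \<subseteq> outs (img f M) b" using p(3) by (auto simp: outs_def intro: imgI)
    qed
    finally have "card (outs M p) \<le> degree (map_graph f \<Gamma>) b" by (simp add: degree_eq[OF fe] moves_map_graph)
    then show ?thesis using outs_ge p by fastforce
  qed
  have mv: "(b, (a, True), c) \<in> img f M \<longleftrightarrow> (b, a, c) \<in> edges (map_graph f \<Gamma>)"
    "(b, (a, False), c) \<in> img f M \<longleftrightarrow> (c, a, b) \<in> edges (map_graph f \<Gamma>)" for a b c
    unfolding moves_map_graph[symmetric] by simp_all
  show ?thesis unfolding stallings_def moves_map_graph verts_map_graph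
  proof (intro conjI allI impI ballI)
    show "edges (map_graph f \<Gamma>) \<subseteq> f ` V \<times> UNIV \<times> f ` V"
      using quot.M_V mv(1) by fast
    fix a b c c'
    show "c = c'" if "(b, a, c) \<in> edges (map_graph f \<Gamma>) \<and> (b, a, c') \<in> edges (map_graph f \<Gamma>)"
      using quot.M_det[of b "(a, True)" c c'] that mv by blast
    show "c = c'" if "(c, a, b) \<in> edges (map_graph f \<Gamma>) \<and> (c', a, b) \<in> edges (map_graph f \<Gamma>)"
      using quot.M_det[of b "(a, False)" c c'] that mv by blast
  qed (use finite_V r_V fe deg quot.connV in \<open>auto simp: H_fi_eq G_def\<close>)
qed

lemma core_quot:
  shows "verts (core (map_graph f \<Gamma>) (f r)) = f ` C" "moves (core (map_graph f \<Gamma>) (f r)) = img f MC"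
proof -
  interpret Q: stallings_graph "H_fi H" "map_graph f \<Gamma>" "f r"
    by (rule stallings_graph.intro) (use stallings_quot subgroup_G H_fi_eq in auto)
  interpret Q: core_decomposition "H_fi H" "map_graph f \<Gamma>" "f r" "f ` T" "f v"
    by unfold_locales (use prune_quot branching_quot in \<open>auto simp: moves_map_graph Q.branching_def quot.branching_def\<close>)
  show "verts (core (map_graph f \<Gamma>) (f r)) = f ` C" unfolding Q.verts_core Q.C_def by (simp add: img_C)
  show "moves (core (map_graph f \<Gamma>) (f r)) = img f MC"
    unfolding Q.moves_core Q.MC_def Q.C_def by (simp add: img_C moves_map_graph restr_quot)
qed

end


section \<open>Identification of given pairs, and minimization\<close>

context core_decomposition
begin

definition cls :: "'v \<Rightarrow> 'v set" where "cls p = {q \<in> V. sim p q}"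

lemma core_quotient_cls: "core_quotient H \<Gamma> r T v cls"
proof
  fix p q assume V: "p \<in> V" "q \<in> V"
  show "cls p = cls q \<longleftrightarrow> sim p q"
  proof
    assume "cls p = cls q"
    moreover have "q \<in> cls q" using V by (simp add: cls_def sim_def)
    ultimately have "q \<in> cls p" by simp
    then show "sim p q" by (simp add: cls_def)
  next
    assume "sim p q"
    then have "sim p s \<longleftrightarrow> sim q s" for s using sim_sym sim_trans by blast
    then show "cls p = cls q" by (simp add: cls_def)
  qed
qed

text \<open>Words leading to the two members of a pair give an element of the new subgroup. If the
  index is finite, it belongs to the maximum extension, and reading it in the quotient by
  \<open>cls\<close> shows that the members have one class. Conversely \<open>sim\<close> respects
  all rules that generate \<open>identified\<close>, so the new subgroup lies between
  \<open>H\<close> and \<open>Q.G\<close>.\<close>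

lemma finite_index_identification:
  assumes S: "S \<subseteq> V \<times> V"
  shows "finite_index_ext H (subgroup_after_identification \<Gamma> r S) \<longleftrightarrow> (\<forall>(p, q)\<in>S. sim p q)"
proof -
  interpret Q: core_quotient H \<Gamma> r T v cls by (rule core_quotient_cls)
  let ?R = "identified \<Gamma> S"
  define f where "f p = ?R `` {p}" for p
  have f_eq: "f p = f q \<longleftrightarrow> (p, q) \<in> ?R" if "p \<in> V" "q \<in> V" for p q
  proof
    assume "f p = f q"
    moreover have "q \<in> f q" unfolding f_def using identified.refl[OF that(2)] by blast
    ultimately show "(p, q) \<in> ?R" unfolding f_def by blast
  next
    assume "(p, q) \<in> ?R"
    then have "(p, s) \<in> ?R \<longleftrightarrow> (q, s) \<in> ?R" for s using identified.sym identified.trans by metis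
    then show "f p = f q" unfolding f_def by blast
  qed
  have "quotient_graph \<Gamma> ?R = map_graph f \<Gamma>"
    unfolding quotient_graph_def map_graph_def f_def quotient_def by auto
  then have K: "subgroup_after_identification \<Gamma> r S = {z. reduced z \<and> path (img f M) (f r) z (f r)}"
    unfolding subgroup_after_identification_def loop_group_def Let_def by (simp add: moves_map_graph f_def)
  interpret R: inverse_graph "img f M"
  proof
    fix b c c' x
    show "(b, x, c) \<in> img f M \<Longrightarrow> (c, bar x, b) \<in> img f M" by (auto elim!: imgE intro!: imgI M_sym)
    show "c = c'" if 1: "(b, x, c) \<in> img f M" and 2: "(b, x, c') \<in> img f M"
    proof -
      obtain p q where p: "b = f p" "c = f q" "(p, x, q) \<in> M" using 1 by (rule imgE)
      obtain p' q' where p': "b = f p'" "c' = f q'" "(p', x, q') \<in> M" using 2 by (rule imgE)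
      have V: "p \<in> V" "p' \<in> V" "q \<in> V" "q' \<in> V" using p p' M_V by blast+
      have "f p = f p'" using p(1) p'(1) by simp
      then have "(p, p') \<in> ?R" using f_eq[OF V(1,2)] by simp
      then have "(q, q') \<in> ?R" by (rule identified.fold[OF _ p(3) p'(3)])
      then show ?thesis using f_eq[OF V(3,4)] p(2) p'(2) by simp
    qed
  qed
  have subK: "subgroup (subgroup_after_identification \<Gamma> r S) free_group"
    unfolding K by (rule R.subgroup_loops)
  have HK: "H \<subseteq> subgroup_after_identification \<Gamma> r S" unfolding K by (auto simp: H_iff path_img)
  show ?thesis
  proof
    assume ext: "finite_index_ext H (subgroup_after_identification \<Gamma> r S)"
    have "sim p q" if pq: "(p, q) \<in> S" for p q
    proof -
      have V: "p \<in> V" "q \<in> V" using S pq by blast+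
      obtain u w where u: "path M r u p" and w: "path M r w q" using reduced_path_to V by blast
      have "f p = f q" using f_eq[OF V] identified.given[OF pq] by simp
      then have "path (img f M) (f r) (nf (u @ winv w)) (f r)"
        using R.path_nf_append[OF path_img[OF u]] path_img[OF path_winv[OF w]] by metis
      then have "nf (u @ winv w) \<in> subgroup_after_identification \<Gamma> r S" unfolding K by simp
      then have "nf (u @ winv w) \<in> Q.G" using Q.finite_index_ext_le_G[OF ext] by blast
      then have "path (img cls M) (cls r) (nf (u @ winv w)) (cls r)" by (simp add: Q.G_def)
      from Q.quot.path_nf_append[OF this path_img[OF w]]
      have "path (img cls M) (cls r) (nf (nf (u @ winv w) @ w)) (cls q)" .
      then have "path (img cls M) (cls r) (nf u) (cls q)" by simp
      then have "cls p = cls q" using Q.quot.path_det[OF _ Q.quot.path_nf[OF path_img[OF u]]] by simp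
      then show ?thesis using Q.f_eq[OF V] by simp
    qed
    then show "\<forall>(p, q)\<in>S. sim p q" by blast
  next
    assume sim: "\<forall>(p, q)\<in>S. sim p q"
    have R_sim: "sim p q" if "(p, q) \<in> ?R" for p q
      using that
    proof induction
      case (given p q)
      then show ?case using sim by blast
    next
      case (refl p)
      show ?case by (simp add: sim_def)
    next
      case (sym p q)
      from sim_sym[OF sym.IH] show ?case .
    next
      case (trans p q s)
      from sim_trans[OF trans.IH] show ?case .
    next
      case (fold q q' x p p')
      from sim_step[OF fold.IH fold.hyps(2,3)] show ?case .
    qed
    \<comment> \<open>The classes of \<open>f\<close> are contained in those of \<open>cls\<close>,
      so paths of the first quotient project to the second.\<close>
    have path_cls: "\<exists>q\<in>V. b = f q \<and> path (img cls M) (cls p) z (cls q)"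
      if "path (img f M) (f p) z b" "p \<in> V" for z b p
      using that
    proof (induction z arbitrary: p)
      case (Cons x z)
      obtain c where c: "(f p, x, c) \<in> img f M" "path (img f M) c z b" using Cons.prems by auto
      obtain p' s where s: "f p = f p'" "c = f s" "(p', x, s) \<in> M" using c(1) by (rule imgE)
      have V: "p' \<in> V" "s \<in> V" using s M_V by blast+
      have "cls p = cls p'" using R_sim f_eq[OF Cons.prems(2) V(1)] s(1) Q.f_eq[OF Cons.prems(2) V(1)] by simp
      then have "(cls p, x, cls s) \<in> img cls M" using imgI[OF s(3), of cls] by simp
      moreover obtain q where "q \<in> V" "b = f q" "path (img cls M) (cls s) z (cls q)"
        using Cons.IH[of s] c(2) s(2) V by blast
      ultimately show ?case by auto
    qed auto
    have "subgroup_after_identification \<Gamma> r S \<subseteq> Q.G"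
    proof
      fix z assume "z \<in> subgroup_after_identification \<Gamma> r S"
      then have z: "reduced z" "path (img f M) (f r) z (f r)" unfolding K by simp_all
      then obtain q where q: "q \<in> V" "f r = f q" "path (img cls M) (cls r) z (cls q)"
        using path_cls r_V by blast
      then have "cls r = cls q" using R_sim f_eq[OF r_V q(1)] Q.f_eq[OF r_V q(1)] by simp
      then show "z \<in> Q.G" using q z by (simp add: Q.G_def)
    qed
    then show "finite_index_ext H (subgroup_after_identification \<Gamma> r S)"
      by (rule finite_index_ext_mono[OF Q.finite_index_G HK _ subK])
  qed
qed

lemma language_from_core: "p \<in> C \<Longrightarrow> language_from (graph_dfa (core \<Gamma> r) i) p = lang MC p"
  by (auto simp: language_from_def graph_dfa_def moves_core verts_core lang_def dest: core.path_C)

lemma accessible_core: "i \<in> C \<Longrightarrow> accessible_dfa (graph_dfa (core \<Gamma> r) i)"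
  unfolding accessible_dfa_def graph_dfa_def
  using core.finite_C core.M_C core.M_det core.conn by (simp add: moves_core verts_core) blast

end

lemma (in core_quotient) dfa_isomorphic_minimize:
  assumes "i \<in> C"
  shows "dfa_isomorphic (minimize (graph_dfa (core \<Gamma> r) i)) (graph_dfa (core (map_graph f \<Gamma>) (f r)) (f i))"
proof -
  let ?D = "graph_dfa (core \<Gamma> r) i"
  let ?R = "state_equiv ?D"
  have D: "states ?D = C" "delta ?D = MC" "finals ?D = C" "init ?D = i"
    by (simp_all add: graph_dfa_def verts_core moves_core)
  have "?R = {(p, q). p \<in> C \<and> q \<in> C \<and> lang MC p = lang MC q}"
    unfolding state_equiv_def D using language_from_core by blast
  then have R: "?R `` {p} = {q \<in> C. lang MC p = lang MC q}" if "p \<in> C" for p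
    using that by auto
  \<comment> \<open>States of the minimized automaton are sets of vertices; \<open>f\<close> is
    evaluated at any member, and its value does not depend on the choice.\<close>
  define F where "F X = f (SOME p. p \<in> X)" for X
  have F: "F (?R `` {p}) = f p" if p: "p \<in> C" for p
  proof -
    have "p \<in> ?R `` {p}" using p R by simp
    then have "(SOME q. q \<in> ?R `` {p}) \<in> ?R `` {p}" by (rule someI)
    then have "(SOME q. q \<in> ?R `` {p}) \<in> C" "lang MC p = lang MC (SOME q. q \<in> ?R `` {p})" using R[OF p] by auto
    then show ?thesis unfolding F_def using f_C p by simp
  qed
  have "states ?D // ?R = (\<lambda>p. ?R `` {p}) ` C" by (auto simp: quotient_def D)
  moreover have bij: "bij_betw F ((\<lambda>p. ?R `` {p}) ` C) (f ` C)"
    unfolding bij_betw_def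
  proof
    show "inj_on F ((\<lambda>p. ?R `` {p}) ` C)"
      by (rule inj_onI) (use F f_C R in auto)
    show "F ` (\<lambda>p. ?R `` {p}) ` C = f ` C" unfolding image_image using F by (rule image_cong[OF HOL.refl])
  qed
  moreover have "img f MC = {(F p, x, F q) | p x q. (p, x, q) \<in> {(?R `` {p}, x, ?R `` {q}) | p x q. (p, x, q) \<in> MC}}"
    (is "_ = ?X")
  proof (intro equalityI subsetI)
    fix e assume "e \<in> img f MC"
    then obtain p x q where e: "e = (f p, x, f q)" "(p, x, q) \<in> MC" by (auto simp: img_def)
    then have "p \<in> C" "q \<in> C" by (simp_all add: MC_M)
    then have "e = (F (?R `` {p}), x, F (?R `` {q}))" using F e by simp
    then show "e \<in> ?X" using e(2) by blast
  next
    fix e assume "e \<in> ?X"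
    then obtain p x q where e: "e = (F (?R `` {p}), x, F (?R `` {q}))" "(p, x, q) \<in> MC" by blast
    then have "e = (f p, x, f q)" using F by (simp add: MC_M)
    then show "e \<in> img f MC" using imgI[OF e(2)] by simp
  qed
  moreover have "f ` C = F ` {?R `` {p} | p. p \<in> C}"
    unfolding Setcompr_eq_image using bij_betw_imp_surj_on[OF bij] by simp
  ultimately show ?thesis
    unfolding dfa_isomorphic_def minimize_def Let_def D
    by (intro exI[of _ F]) (simp add: graph_dfa_def[of "core (map_graph f \<Gamma>) (f r)"] core_quot F assms)
qed

lemma nontrivial_core_decomposition:
  assumes "nontrivial_fg_subgroup H" "stallings H \<Gamma> r"
  obtains T v where "core_decomposition H \<Gamma> r T v"
proof -
  have sub: "subgroup H free_group" using assms(1) by (simp add: nontrivial_fg_subgroup_def)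
  interpret stallings_graph H \<Gamma> r by (rule stallings_graph.intro[OF assms(2) sub])
  have "[] \<in> H" by (rule subgroup_free_groupD[OF sub])
  then obtain h where h: "h \<in> H" "h \<noteq> []"
    using assms(1) unfolding nontrivial_fg_subgroup_def one_free_group by blast
  then obtain T v where "prune M r T v" "branching T v" using prune_exists H_iff by blast
  then show ?thesis using that by (intro that core_decomposition.intro core_decomposition_axioms.intro stallings_graph_axioms)
qed

text \<open>Uniqueness identifies an arbitrary Stallings graph of \<open>H_fi H\<close>, over any
  type of vertices, with the quotient by \<open>cls\<close>. The composed map
  \<open>g \<circ> cls\<close> is again a quotient map of the same kind, so the statement about
  quotients applies to it.\<close>

lemma minimized_core:
  assumes "nontrivial_fg_subgroup H" "stallings H \<Gamma> r" "stallings (H_fi H) \<Gamma>' r'" "i \<in> verts (core \<Gamma> r)"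
  shows "accessible_dfa (graph_dfa (core \<Gamma> r) i) \<and> (\<exists>i'\<in>verts (core \<Gamma>' r'). (i = r \<longrightarrow> i' = r')
                \<and> dfa_isomorphic (minimize (graph_dfa (core \<Gamma> r) i)) (graph_dfa (core \<Gamma>' r') i'))"
proof -
  obtain T v where "core_decomposition H \<Gamma> r T v" using nontrivial_core_decomposition[OF assms(1,2)] .
  then interpret core_decomposition H \<Gamma> r T v .
  interpret Q: core_quotient H \<Gamma> r T v cls by (rule core_quotient_cls)
  obtain g where g: "\<Gamma>' = map_graph g (map_graph cls \<Gamma>)" "g (cls r) = r'" "inj_on g (cls ` V)"
    using stallings_unique[OF Q.stallings_quot assms(3)] Q.subgroup_G Q.H_fi_eq by (metis verts_map_graph)
  have g1: "\<Gamma>' = map_graph (g \<circ> cls) \<Gamma>" unfolding g(1) by (rule lgraph_eqI) (auto simp: moves_map_graph img_def, blast+)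
  interpret Q': core_quotient H \<Gamma> r T v "g \<circ> cls"
  proof
    fix p q assume "p \<in> V" "q \<in> V"
    then show "(g \<circ> cls) p = (g \<circ> cls) q \<longleftrightarrow> sim p q" using Q.f_eq[of p q] inj_on_eq_iff[OF g(3), of "cls p" "cls q"] by simp
  qed
  have i: "i \<in> C" using assms(4) verts_core by simp
  have r': "r' = (g \<circ> cls) r" using g(2) by simp
  have "(g \<circ> cls) i \<in> verts (core (map_graph (g \<circ> cls) \<Gamma>) ((g \<circ> cls) r))"
    unfolding Q'.core_quot using i by (rule imageI)
  then show ?thesis unfolding g1 r'
    by (intro conjI accessible_core[OF i] bexI[of _ "(g \<circ> cls) i"] Q'.dfa_isomorphic_minimize[OF i]) blast+
qed

section \<open>Programs with time credits\<close>

fun loopfree :: "com \<Rightarrow> bool" where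
  "loopfree (Seq c d) \<longleftrightarrow> loopfree c \<and> loopfree d"
| "loopfree (Cond b c d) \<longleftrightarrow> loopfree c \<and> loopfree d"
| "loopfree (While b c) \<longleftrightarrow> False"
| "loopfree _ \<longleftrightarrow> True"

text \<open>The clause for \<open>While\<close> is a dummy, since only loop-free programs are
  evaluated in this way.\<close>

fun run :: "com \<Rightarrow> state \<Rightarrow> state" where
  "run Skip s = s"
| "run (Assign i e) s = ((fst s)(i := aval e s), snd s)"
| "run (Store e f) s = (fst s, (snd s)(aval e s := aval f s))"
| "run (Seq c d) s = run d (run c s)"
| "run (Cond b c d) s = (if bval b s then run c s else run d s)"
| "run (While b c) s = s"

text \<open>A bound rather than the exact time: both branches of a conditional are counted, which
  makes the value independent of the state.\<close>

fun ccost :: "com \<Rightarrow> nat" where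
  "ccost Skip = 1"
| "ccost (Assign i e) = acost e + 1"
| "ccost (Store e f) = acost e + acost f + 1"
| "ccost (Seq c d) = ccost c + ccost d"
| "ccost (Cond b c d) = bcost b + ccost c + ccost d"
| "ccost (While b c) = 0"

lemma exec_run: "loopfree c \<Longrightarrow> \<exists>t\<le>ccost c. exec c s t (run c s)"
proof (induction c arbitrary: s)
  case (Seq c d)
  obtain t where t: "t \<le> ccost c" "exec c s t (run c s)" using Seq.IH(1)[of s] Seq.prems by auto
  moreover obtain t' where "t' \<le> ccost d" "exec d (run c s) t' (run d (run c s))"
    using Seq.IH(2)[of "run c s"] Seq.prems by auto
  ultimately show ?case by (intro exI[of _ "t + t'"]) (auto intro: exec.Seq)
next
  case (Cond b c d)
  show ?case
  proof (cases "bval b s")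
    case True
    then obtain t where "t \<le> ccost c" "exec c s t (run c s)" using Cond.IH(1)[of s] Cond.prems by auto
    then show ?thesis using True by (intro exI[of _ "bcost b + t"]) (auto intro: exec.CondTrue)
  next
    case False
    then obtain t where "t \<le> ccost d" "exec d s t (run d s)" using Cond.IH(2)[of s] Cond.prems by auto
    then show ?thesis using False by (intro exI[of _ "bcost b + t"]) (auto intro: exec.CondFalse)
  qed
next
  case (Assign i e)
  show ?case by (intro exI[of _ "acost e + 1"]) (simp add: exec.Assign[of i e s, simplified])
next
  case (Store e f)
  show ?case by (intro exI[of _ "acost e + acost f + 1"]) (simp add: exec.Store[of e f s, simplified])
next
  case Skip
  have "exec Skip s 1 s" by (rule exec.Skip)
  then show ?case by (intro exI[of _ 1]) simp
qed auto

text \<open>The number \<open>k\<close> is a supply of time credits: started with \<open>k\<close> credits the program pays for its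
  own run and \<open>Q\<close> holds for the final state and some number of the remaining credits.\<close>

definition wp :: "com \<Rightarrow> (state \<Rightarrow> nat \<Rightarrow> bool) \<Rightarrow> state \<Rightarrow> nat \<Rightarrow> bool" where
  "wp c Q s k \<longleftrightarrow> (\<exists>t s' k'. exec c s t s' \<and> t + k' \<le> k \<and> Q s' k')"

lemma wp_loopfree: "loopfree c \<Longrightarrow> ccost c + k' \<le> k \<Longrightarrow> Q (run c s) k' \<Longrightarrow> wp c Q s k"
proof -
  assume "loopfree c" and k: "ccost c + k' \<le> k" and Q: "Q (run c s) k'"
  then obtain t where "t \<le> ccost c" "exec c s t (run c s)" using exec_run by blast
  then show "wp c Q s k" unfolding wp_def using k Q by (intro exI[of _ t] exI[of _ "run c s"] exI[of _ k']) simp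
qed

lemma wp_Seq: "wp c (wp d Q) s k \<Longrightarrow> wp (Seq c d) Q s k"
proof -
  assume "wp c (wp d Q) s k"
  then obtain t s1 k1 t2 s2 k2 where "exec c s t s1" "t + k1 \<le> k" "exec d s1 t2 s2" "t2 + k2 \<le> k1" "Q s2 k2"
    unfolding wp_def by blast
  then show ?thesis unfolding wp_def by (intro exI[of _ "t + t2"] exI[of _ s2] exI[of _ k2]) (auto intro: exec.Seq)
qed

lemma wp_Cond:
  assumes "bcost b + k' \<le> k" "bval b s \<Longrightarrow> wp c Q s k'" "\<not> bval b s \<Longrightarrow> wp d Q s k'"
  shows "wp (Cond b c d) Q s k"
proof (cases "bval b s")
  case True
  then obtain t s' k2 where "exec c s t s'" "t + k2 \<le> k'" "Q s' k2" using assms(2) unfolding wp_def by blast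
  then show ?thesis unfolding wp_def using assms(1) True
    by (intro exI[of _ "bcost b + t"] exI[of _ s'] exI[of _ k2]) (auto intro: exec.CondTrue)
next
  case False
  then obtain t s' k2 where "exec d s t s'" "t + k2 \<le> k'" "Q s' k2" using assms(3) unfolding wp_def by blast
  then show ?thesis unfolding wp_def using assms(1) False
    by (intro exI[of _ "bcost b + t"] exI[of _ s'] exI[of _ k2]) (auto intro: exec.CondFalse)
qed

lemma wp_conseq:
  assumes "wp c Q s k" "\<And>s k. Q s k \<Longrightarrow> Q' s k"
  shows "wp c Q' s k"
  using assms unfolding wp_def by blast

lemma bcost_pos: "0 < bcost b"
  by (cases b) auto

text \<open>No variant is required. Evaluating the guard costs at least one credit, so the credits
  themselves decrease from round to round.\<close>

lemma wp_While:
  assumes "I s k"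
    and step: "\<And>s k. I s k \<Longrightarrow> bval b s \<Longrightarrow> \<exists>k'. bcost b + k' \<le> k \<and> wp c I s k'"
    and exit: "\<And>s k. I s k \<Longrightarrow> \<not> bval b s \<Longrightarrow> \<exists>k'. bcost b + k' \<le> k \<and> Q s k'"
  shows "wp (While b c) Q s k"
  using assms(1)
proof (induction k arbitrary: s rule: less_induct)
  case (less k)
  show ?case
  proof (cases "bval b s")
    case True
    then obtain k' where k': "bcost b + k' \<le> k" "wp c I s k'" using step less.prems by blast
    then obtain t s1 k1 where 1: "exec c s t s1" "t + k1 \<le> k'" "I s1 k1" unfolding wp_def by blast
    then have "k1 < k" using k'(1) bcost_pos[of b] by linarith
    then obtain t2 s2 k2 where 2: "exec (While b c) s1 t2 s2" "t2 + k2 \<le> k1" "Q s2 k2"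
      using less.IH 1(3) unfolding wp_def by blast
    have "exec (While b c) s (bcost b + t + t2) s2" using exec.WhileTrue[OF True 1(1) 2(1)] .
    then show ?thesis unfolding wp_def using k'(1) 1(2) 2
      by (intro exI[of _ "bcost b + t + t2"] exI[of _ s2] exI[of _ k2]) simp
  next
    case False
    then obtain k' where "bcost b + k' \<le> k" "Q s k'" using exit less.prems by blast
    then show ?thesis unfolding wp_def using exec.WhileFalse[OF False, of c] by blast
  qed
qed

fun seqs :: "com list \<Rightarrow> com" where
  "seqs [] = Skip"
| "seqs (c # cs) = Seq c (seqs cs)"

lemma loopfree_seqs [simp]: "loopfree (seqs cs) \<longleftrightarrow> (\<forall>c\<in>set cs. loopfree c)"
  by (induction cs) auto

lemma run_seqs_snoc: "run (seqs (cs @ [c])) s = run c (run (seqs cs) s)"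
  by (induction cs arbitrary: s) auto

text \<open>The number of letters is a constant, so loops over the letters are unrolled and the
  letter number may occur in the program text. One credit at the exit pays for the closing
  \<open>Skip\<close>.\<close>

lemma wp_seqs:
  assumes "I 0 s k"
    and step: "\<And>x s k. x < l \<Longrightarrow> I x s k \<Longrightarrow> wp (f x) (I (Suc x)) s k"
    and exit: "\<And>s k. I l s k \<Longrightarrow> \<exists>k'. 1 + k' \<le> k \<and> Q s k'"
  shows "wp (seqs (map f [0..<l])) Q s k"
proof -
  have "wp (seqs (map f [l - d..<l])) Q s k" if "I (l - d) s k" "d \<le> l" for d s k
    using that
  proof (induction d arbitrary: s k)
    case 0
    then obtain k' where "1 + k' \<le> k" "Q s k'" using exit[of s k] by auto
    then show ?case by (intro wp_loopfree[of _ k']) simp_all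
  next
    case (Suc d)
    have "[l - Suc d..<l] = (l - Suc d) # [l - d..<l]" using Suc.prems(2) by (simp add: upt_conv_Cons Suc_diff_Suc)
    moreover have "wp (f (l - Suc d)) (I (l - d)) s k"
      using step[of "l - Suc d" s k] Suc.prems by (simp add: Suc_diff_Suc)
    then have "wp (f (l - Suc d)) (wp (seqs (map f [l - d..<l])) Q) s k"
      by (rule wp_conseq) (use Suc in simp)
    ultimately show ?case by (simp add: wp_Seq)
  qed
  from this[of l s k] show ?thesis using assms(1) by simp
qed

section \<open>Memory layout and elementary operations\<close>

primrec mulc :: "nat \<Rightarrow> aexp \<Rightarrow> aexp" where
  "mulc 0 e = Num 0"
| "mulc (Suc k) e = Add e (mulc k e)"

lemma aval_mulc [simp]: "aval (mulc k e) s = k * aval e s"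
  by (induction k) auto

text \<open>Register \<open>2\<close> holds the first address of a block of memory that is used for \<open>8 + L\<close> interleaved
  arrays: array \<open>j\<close> is at the addresses congruent to \<open>j\<close>. Arrays \<open>0\<close> to \<open>4\<close> are the components
  \<open>E\<close>, \<open>P\<close>, \<open>D\<close>, \<open>B\<close>, \<open>N\<close> of a partition of the vertices; array \<open>5\<close> counts the marked vertices of each
  class, array \<open>6\<close> is a copy of the current splitter, array \<open>7\<close> lists the classes that have marked
  vertices, and array \<open>8 + x\<close> is the transition table of the letter number \<open>x\<close>. The main registers:
  \<open>3\<close> number of vertices, \<open>4\<close> root, \<open>5\<close> number of pruned vertices (they occupy the first positions of
  \<open>E\<close> and keep singleton classes), \<open>6\<close> current splitter, \<open>7\<close> number of classes, \<open>8\<close> size of the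
  splitter, \<open>10\<close> number of classes with marked vertices, \<open>21\<close> address of the list of pairs.\<close>

locale layout =
  fixes L :: nat
begin

definition mk :: "(nat \<Rightarrow> nat) \<Rightarrow> (nat \<Rightarrow> nat \<Rightarrow> nat) \<Rightarrow> (nat \<Rightarrow> nat) \<Rightarrow> state" where
  "mk \<rho> \<alpha> \<beta> = (\<rho>, \<lambda>a. if a < \<rho> 2 then \<beta> a else \<alpha> ((a - \<rho> 2) mod (8 + L)) ((a - \<rho> 2) div (8 + L)))"

text \<open>By interleaving, every array is infinite and no two cells coincide, so stores need no
  bounds on their indices. The factor \<open>8 + L\<close> is a constant, multiplied by repeated
  addition.\<close>

definition addr :: "nat \<Rightarrow> aexp \<Rightarrow> aexp" where
  "addr j e = Add (Reg 2) (Add (mulc (8 + L) e) (Num j))"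

definition get :: "nat \<Rightarrow> aexp \<Rightarrow> aexp" where
  "get j e = Mem (addr j e)"

definition set :: "nat \<Rightarrow> aexp \<Rightarrow> aexp \<Rightarrow> com" where
  "set j e f = Store (addr j e) f"

lemma fst_mk [simp]: "fst (mk \<rho> \<alpha> \<beta>) = \<rho>"
  by (simp add: mk_def)

lemma aval_get [simp]: "j < 8 + L \<Longrightarrow> aval (get j e) (mk \<rho> \<alpha> \<beta>) = \<alpha> j (aval e (mk \<rho> \<alpha> \<beta>))"
  by (simp add: get_def addr_def mk_def)

lemma run_Assign_mk [simp]: "i \<noteq> 2 \<Longrightarrow> run (Assign i e) (mk \<rho> \<alpha> \<beta>) = mk (\<rho>(i := aval e (mk \<rho> \<alpha> \<beta>))) \<alpha> \<beta>"
  by (auto simp: mk_def fun_eq_iff)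

lemma run_Store_low [simp]:
  "aval e (mk \<rho> \<alpha> \<beta>) < \<rho> 2 \<Longrightarrow>
    run (Store e f) (mk \<rho> \<alpha> \<beta>) = mk \<rho> \<alpha> (\<beta>(aval e (mk \<rho> \<alpha> \<beta>) := aval f (mk \<rho> \<alpha> \<beta>)))"
  by (auto simp: mk_def)

lemma run_set [simp]:
  assumes "j < 8 + L"
  shows "run (set j e f) (mk \<rho> \<alpha> \<beta>) =
    mk \<rho> (\<alpha>(j := (\<alpha> j)(aval e (mk \<rho> \<alpha> \<beta>) := aval f (mk \<rho> \<alpha> \<beta>)))) \<beta>"
proof -
  define i v where "i = aval e (mk \<rho> \<alpha> \<beta>)" and "v = aval f (mk \<rho> \<alpha> \<beta>)"
  have "aval (addr j e) (mk \<rho> \<alpha> \<beta>) = \<rho> 2 + ((8 + L) * i + j)" by (simp add: addr_def i_def)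
  then have 1: "run (set j e f) (mk \<rho> \<alpha> \<beta>) = (\<rho>, (snd (mk \<rho> \<alpha> \<beta>))(\<rho> 2 + ((8 + L) * i + j) := v))"
    by (simp add: set_def v_def)
  have "a = \<rho> 2 + ((8 + L) * i + j) \<longleftrightarrow> \<not> a < \<rho> 2 \<and> (a - \<rho> 2) mod (8 + L) = j \<and> (a - \<rho> 2) div (8 + L) = i" for a
  proof
    assume "a = \<rho> 2 + ((8 + L) * i + j)"
    then show "\<not> a < \<rho> 2 \<and> (a - \<rho> 2) mod (8 + L) = j \<and> (a - \<rho> 2) div (8 + L) = i" using assms by simp
  next
    assume "\<not> a < \<rho> 2 \<and> (a - \<rho> 2) mod (8 + L) = j \<and> (a - \<rho> 2) div (8 + L) = i"
    then show "a = \<rho> 2 + ((8 + L) * i + j)" using mult_div_mod_eq[of "8 + L" "a - \<rho> 2"] by auto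
  qed
  then show ?thesis unfolding 1 i_def[symmetric] v_def[symmetric] by (simp add: mk_def fun_eq_iff)
qed

lemma loopfree_set [simp]: "loopfree (set j e f)"
  by (simp add: set_def)

declare run.simps(2,3) [simp del]

text \<open>Register 11 holds a vertex and register 13 a position. The vertex is brought to this
  position, and arrays 0 and 1 remain inverse to each other.\<close>

definition swap :: com where
  "swap = seqs [Assign 14 (get 0 (Reg 13)), Assign 15 (get 1 (Reg 11)),
     set 0 (Reg 13) (Reg 11), set 0 (Reg 15) (Reg 14), set 1 (Reg 11) (Reg 13), set 1 (Reg 14) (Reg 15)]"

lemma run_swap:
  "run swap (mk \<rho> \<alpha> \<beta>) = mk (\<rho>(14 := \<alpha> 0 (\<rho> 13), 15 := \<alpha> 1 (\<rho> 11)))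
     (\<alpha>(0 := (\<alpha> 0)(\<rho> 13 := \<rho> 11, \<alpha> 1 (\<rho> 11) := \<alpha> 0 (\<rho> 13)), 1 := (\<alpha> 1)(\<rho> 11 := \<rho> 13, \<alpha> 0 (\<rho> 13) := \<alpha> 1 (\<rho> 11)))) \<beta>"
  by (simp add: swap_def fun_upd_twist)

text \<open>Register 13 becomes the first unmarked position of the class of the vertex in register
  11, so marked vertices always form an initial segment of their class. A count of 0 shows that the
  class is touched for the first time.\<close>

definition mark :: com where
  "mark = seqs [Assign 12 (get 2 (Reg 11)), Assign 13 (Add (get 3 (Reg 12)) (get 5 (Reg 12))), swap,
     Cond (Eq (get 5 (Reg 12)) (Num 0)) (seqs [set 7 (Reg 10) (Reg 12), Assign 10 (Add (Reg 10) (Num 1))]) Skip,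
     set 5 (Reg 12) (Add (get 5 (Reg 12)) (Num 1))]"

text \<open>Marks the successor along letter \<open>x\<close> of a member of the splitter, that is,
  a predecessor along the inverse letter. Table entries are shifted by one because 0 means
  undefined, and classes below register 5 are skipped as they belong to pruned vertices.\<close>

definition markstep :: "nat \<Rightarrow> com" where
  "markstep x = seqs [Assign 14 (get (8 + x) (get 6 (Reg 9))),
     Cond (Conj (Neg (Eq (Reg 14) (Num 0))) (Neg (Less (get 2 (Sub (Reg 14) (Num 1))) (Reg 5))))
       (Seq (Assign 11 (Sub (Reg 14) (Num 1))) mark) Skip,
     Assign 9 (Add (Reg 9) (Num 1))]"

lemma loopfree_swap [simp]: "loopfree swap" and loopfree_mark [simp]: "loopfree mark"
  and loopfree_markstep [simp]: "loopfree (markstep x)"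
  by (auto simp: swap_def mark_def markstep_def)

end

section \<open>Partition refinement and its potential\<close>

definition perm :: "nat \<Rightarrow> (nat \<Rightarrow> nat) \<Rightarrow> (nat \<Rightarrow> nat) \<Rightarrow> bool" where
  "perm n E P \<longleftrightarrow> (\<forall>i<n. E i < n \<and> P (E i) = i) \<and> (\<forall>p<n. P p < n \<and> E (P p) = p)"

lemma perm_swap:
  assumes "perm n E P" "p < n" "i < n"
  shows "perm n (E(i := p, P p := E i)) (P(p := i, E i := P p))"
proof -
  have E: "E j < n" "P (E j) = j" if "j < n" for j using assms(1) that by (simp_all add: perm_def)
  have P: "P q < n" "E (P q) = q" if "q < n" for q using assms(1) that by (simp_all add: perm_def)
  show ?thesis unfolding perm_def
  proof (intro conjI allI impI)
    fix j assume j: "j < n"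
    show "(E(i := p, P p := E i)) j < n" using E P assms j by simp
    show "(P(p := i, E i := P p)) ((E(i := p, P p := E i)) j) = j"
      using E[OF j] E[OF assms(3)] P[OF assms(2)] assms j by (auto simp: fun_upd_apply)
  next
    fix q assume q: "q < n"
    show "(P(p := i, E i := P p)) q < n" using E P assms q by simp
    show "(E(i := p, P p := E i)) ((P(p := i, E i := P p)) q) = q"
      using P[OF q] E[OF assms(3)] P[OF assms(2)] assms q by (auto simp: fun_upd_apply)
  qed
qed

text \<open>A partition of \<open>{..<n}\<close> into the classes \<open>0, \<dots>, m - 1\<close>: \<open>D p\<close> is the class of \<open>p\<close>, class \<open>c\<close>
  occupies the positions from \<open>B c\<close> up to \<open>N c\<close> (excluded) of the enumeration \<open>E\<close>, and \<open>P\<close> is the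
  inverse of \<open>E\<close>.\<close>

definition partn :: "nat \<Rightarrow> (nat \<Rightarrow> nat) \<Rightarrow> (nat \<Rightarrow> nat) \<Rightarrow> (nat \<Rightarrow> nat) \<Rightarrow> (nat \<Rightarrow> nat) \<Rightarrow> (nat \<Rightarrow> nat) \<Rightarrow> nat \<Rightarrow> bool" where
  "partn n E P D B N m \<longleftrightarrow> perm n E P \<and> (\<forall>p<n. D p < m \<and> B (D p) \<le> P p \<and> P p < N (D p))
     \<and> (\<forall>c<m. B c < N c \<and> N c \<le> n \<and> (\<forall>i. B c \<le> i \<and> i < N c \<longrightarrow> D (E i) = c))"

lemma partnD:
  assumes "partn n E P D B N m"
  shows "perm n E P" "p < n \<Longrightarrow> D p < m" "p < n \<Longrightarrow> B (D p) \<le> P p" "p < n \<Longrightarrow> P p < N (D p)"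
    "c < m \<Longrightarrow> B c < N c" "c < m \<Longrightarrow> N c \<le> n" "c < m \<Longrightarrow> B c \<le> i \<Longrightarrow> i < N c \<Longrightarrow> D (E i) = c"
    "i < n \<Longrightarrow> E i < n" "i < n \<Longrightarrow> P (E i) = i" "p < n \<Longrightarrow> P p < n" "p < n \<Longrightarrow> E (P p) = p"
  using assms by (auto simp: partn_def perm_def)

lemma partn_class_iff:
  assumes "partn n E P D B N m" "p < n" "c < m"
  shows "D p = c \<longleftrightarrow> B c \<le> P p \<and> P p < N c"
  using partnD[OF assms(1)] assms(2,3) by metis

text \<open>The elements of \<open>X\<close> are the first \<open>M c\<close> elements of each class \<open>c\<close>, and \<open>Q\<close> lists the \<open>tq\<close> classes
  that meet \<open>X\<close>.\<close>

definition marked :: "nat \<Rightarrow> (nat \<Rightarrow> nat) \<Rightarrow> (nat \<Rightarrow> nat) \<Rightarrow> (nat \<Rightarrow> nat) \<Rightarrow> (nat \<Rightarrow> nat) \<Rightarrow> (nat \<Rightarrow> nat) \<Rightarrow> nat \<Rightarrow> (nat \<Rightarrow> nat)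
  \<Rightarrow> nat set \<Rightarrow> (nat \<Rightarrow> nat) \<Rightarrow> nat \<Rightarrow> bool" where
  "marked n E P D B N m M X Q tq \<longleftrightarrow> partn n E P D B N m \<and> X \<subseteq> {..<n} \<and> (\<forall>c<m. M c \<le> N c - B c)
     \<and> (\<forall>p<n. p \<in> X \<longleftrightarrow> P p < B (D p) + M (D p)) \<and> inj_on Q {..<tq} \<and> Q ` {..<tq} = {c. 0 < M c}
     \<and> (\<forall>c. 0 < M c \<longrightarrow> c < m)"

text \<open>Position \<open>i\<close> is the first unmarked one of the class of \<open>p\<close> and
  holds a vertex of the same class. The exchange therefore leaves the partition alone and lengthens
  the marked segment by one.\<close>

lemma marked_step:
  assumes "marked n E P D B N m M X Q tq" "p < n" "p \<notin> X"
  defines "c \<equiv> D p"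
  defines "i \<equiv> B c + M c"
  defines "E' \<equiv> E(i := p, P p := E i)" and "P' \<equiv> P(p := i, E i := P p)" and "M' \<equiv> M(c := Suc (M c))"
  shows "M c = 0 \<Longrightarrow> marked n E' P' D B N m M' (insert p X) (Q(tq := c)) (Suc tq)"
    and "M c \<noteq> 0 \<Longrightarrow> marked n E' P' D B N m M' (insert p X) Q tq"
proof -
  have part: "partn n E P D B N m" and X: "X \<subseteq> {..<n}" "\<And>c. c < m \<Longrightarrow> M c \<le> N c - B c"
    "\<And>p. p < n \<Longrightarrow> p \<in> X \<longleftrightarrow> P p < B (D p) + M (D p)"
    and Q: "inj_on Q {..<tq}" "Q ` {..<tq} = {c. 0 < M c}" "\<And>c. 0 < M c \<Longrightarrow> c < m"
    using assms(1) unfolding marked_def by auto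
  note pd = partnD[OF part]
  have c: "c < m" "B c \<le> P p" "P p < N c" using pd(2,3,4)[OF assms(2)] by (simp_all add: c_def)
  have i: "B c \<le> i" "i \<le> P p" "i < N c" using X(3)[OF assms(2)] assms(3) c by (auto simp: i_def c_def)
  then have "i < n" using pd(6)[OF c(1)] by simp
  have Ei: "E i < n" "P (E i) = i" "D (E i) = c" using pd(8,9)[OF \<open>i < n\<close>] pd(7)[OF c(1) i(1,3)] by simp_all
  have DE: "D (E' j) = D (E j)" if "j < n" for j
    using Ei pd(11)[OF assms(2)] by (auto simp: E'_def c_def)
  have part': "partn n E' P' D B N m" unfolding partn_def
  proof (intro conjI allI impI)
    show "perm n E' P'" unfolding E'_def P'_def by (rule perm_swap[OF pd(1) assms(2) \<open>i < n\<close>])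
    fix q assume q: "q < n"
    show "D q < m" using pd(2)[OF q] .
    show "B (D q) \<le> P' q" "P' q < N (D q)"
      using pd(3,4)[OF q] i c Ei by (auto simp: P'_def c_def)
  next
    fix d assume d: "d < m"
    show "B d < N d" "N d \<le> n" using pd(5,6)[OF d] by simp_all
    fix j assume "B d \<le> j \<and> j < N d"
    then show "D (E' j) = d" using DE[of j] pd(6,7)[OF d] by simp
  qed
  have M': "M' d \<le> N d - B d" if "d < m" for d
    using X(2)[OF that] i by (auto simp: M'_def i_def)
  have X': "q \<in> insert p X \<longleftrightarrow> P' q < B (D q) + M' (D q)" if q: "q < n" for q
  proof (cases "q = p")
    case True
    then show ?thesis using Ei pd(11)[OF assms(2)] by (auto simp: P'_def M'_def c_def i_def)
  next
    case False
    show ?thesis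
    proof (cases "q = E i")
      case True
      then have "q \<notin> X" using X(3)[OF q] Ei by (simp add: i_def)
      moreover have "P p \<noteq> i" using True False pd(11)[OF assms(2)] by auto
      ultimately show ?thesis using True False i Ei by (auto simp: P'_def M'_def i_def)
    next
      case neq: False
      then have "P q \<noteq> i" using pd(11)[OF q] by auto
      then show ?thesis using X(3)[OF q] neq False by (auto simp: P'_def M'_def i_def)
    qed
  qed
  have Xn: "insert p X \<subseteq> {..<n}" using X(1) assms(2) by simp
  have less: "d < m" if "0 < M' d" for d using that Q(3) c(1) by (auto simp: M'_def split: if_splits)
  show "marked n E' P' D B N m M' (insert p X) (Q(tq := c)) (Suc tq)" if "M c = 0"
  proof -
    have "c \<notin> Q ` {..<tq}" using that Q(2) by simp
    then have "inj_on (Q(tq := c)) {..<Suc tq}" using Q(1) by (auto simp: inj_on_def lessThan_Suc)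
    moreover have "(Q(tq := c)) ` {..<Suc tq} = insert c (Q ` {..<tq})" by (auto simp: lessThan_Suc)
    moreover have "insert c (Q ` {..<tq}) = {d. 0 < M' d}" unfolding Q(2) by (auto simp: M'_def)
    ultimately show ?thesis unfolding marked_def using part' M' X' Xn less by simp
  qed
  show "marked n E' P' D B N m M' (insert p X) Q tq" if "M c \<noteq> 0"
  proof -
    have "Q ` {..<tq} = {d. 0 < M' d}" unfolding Q(2) using that by (auto simp: M'_def)
    then show ?thesis unfolding marked_def using part' M' X' Xn less Q(1) by simp
  qed
qed

text \<open>The positions from \<open>u\<close> to \<open>v\<close> delimit the part that gets the
  new number \<open>m\<close>, an initial or a final segment of class \<open>c\<close>;
  \<open>b'\<close> and \<open>e'\<close> delimit the part that keeps the number
  \<open>c\<close>.\<close>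

lemma partn_split:
  assumes part: "partn n E P D B N m" and c: "c < m" and uv: "u < v"
    and cases: "u = B c \<and> v = b' \<and> e' = N c \<or> b' = B c \<and> e' = u \<and> v = N c" and be: "b' < e'"
  defines "D' \<equiv> \<lambda>p. if p \<in> E ` {u..<v} then m else D p"
  shows "partn n E P D' (B(m := u, c := b')) (N(m := v, c := e')) (Suc m)"
    "p < n \<Longrightarrow> p \<in> E ` {u..<v} \<longleftrightarrow> u \<le> P p \<and> P p < v"
    "p < n \<Longrightarrow> p \<in> E ` {u..<v} \<Longrightarrow> D p = c"
proof -
  note pd = partnD[OF part]
  have in_c: "B c \<le> u" "v \<le> N c" using cases uv be pd(5)[OF c] by auto
  have vn: "v \<le> n" using in_c pd(6)[OF c] by simp
  show iff: "p \<in> E ` {u..<v} \<longleftrightarrow> u \<le> P p \<and> P p < v" if "p < n" for p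
  proof
    assume "p \<in> E ` {u..<v}"
    then show "u \<le> P p \<and> P p < v" using pd(9) vn by auto
  next
    assume "u \<le> P p \<and> P p < v"
    then show "p \<in> E ` {u..<v}" using pd(11)[OF that] by (metis atLeastLessThan_iff imageI)
  qed
  show Dc: "D p = c" if "p < n" "p \<in> E ` {u..<v}" for p
    using partn_class_iff[OF part that(1) c] iff[OF that(1)] that(2) in_c by simp
  show "partn n E P D' (B(m := u, c := b')) (N(m := v, c := e')) (Suc m)"
    unfolding partn_def
  proof (intro conjI allI impI)
    show "perm n E P" by (rule pd)
    fix p assume p: "p < n"
    show "D' p < Suc m" using pd(2)[OF p] by (auto simp: D'_def)
    have 1: "D p = c \<Longrightarrow> B c \<le> P p \<and> P p < N c" using pd(3,4)[OF p] by auto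
    show "(B(m := u, c := b')) (D' p) \<le> P p" "P p < (N(m := v, c := e')) (D' p)"
      using iff[OF p] pd(2-4)[OF p] c 1 cases by (auto simp: D'_def)
  next
    fix d assume d: "d < Suc m"
    show "(B(m := u, c := b')) d < (N(m := v, c := e')) d" "(N(m := v, c := e')) d \<le> n"
      using d c pd(5,6)[of d] pd(6)[OF c] vn uv be cases by (auto simp: less_Suc_eq)
    fix i assume i: "(B(m := u, c := b')) d \<le> i \<and> i < (N(m := v, c := e')) d"
    then have "i < n" using \<open>(N(m := v, c := e')) d \<le> n\<close> by simp
    then have Ei: "E i < n" "P (E i) = i" using pd(8,9) by simp_all
    have "D (E i) = (if d = m then c else d)"
    proof (cases "d = m")
      case True
      then show ?thesis using pd(7)[OF c, of i] i c in_c by auto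
    next
      case False
      then have "B d \<le> i \<and> i < N d" using i cases uv be in_c by (auto split: if_splits)
      then show ?thesis using pd(7)[of d i] d False by simp
    qed
    moreover have "E i \<in> E ` {u..<v} \<longleftrightarrow> d = m"
    proof (cases "d = m")
      case True
      then show ?thesis using iff[OF Ei(1)] Ei i c by simp
    next
      case False
      show ?thesis
      proof (cases "d = c")
        case True
        then show ?thesis using iff[OF Ei(1)] Ei i False cases by auto
      next
        case neq: False
        then show ?thesis using Dc[OF Ei(1)] calculation False by auto
      qed
    qed
    ultimately show "D' (E i) = d" by (auto simp: D'_def)
  qed
qed

text \<open>Time still to be paid for: \<open>a\<close> for each vertex in a class not yet used as a splitter, and \<open>g\<close> for
  each future halving of the class of a vertex. Only the smaller part of a split class gets a new
  number and has to be used as a splitter again, so the halvings pay for it.\<close>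

definition pot :: "nat \<Rightarrow> nat \<Rightarrow> nat \<Rightarrow> (nat \<Rightarrow> nat) \<Rightarrow> (nat \<Rightarrow> nat) \<Rightarrow> (nat \<Rightarrow> nat) \<Rightarrow> nat \<Rightarrow> nat" where
  "pot a g n D B N k = (\<Sum>p<n. (if k \<le> D p then a else 0) + g * floor_log (N (D p) - B (D p)))"

lemma floor_log_half: "0 < s \<Longrightarrow> 2 * s \<le> l \<Longrightarrow> Suc (floor_log s) \<le> floor_log l"
  using floor_log_twice[of s] monoD[OF floor_log_mono, of "2 * s" l] by simp

lemma card_positions:
  assumes "perm n E P" "v \<le> n"
  shows "card {p. p < n \<and> u \<le> P p \<and> P p < v} = v - u"
proof -
  have "{p. p < n \<and> u \<le> P p \<and> P p < v} = E ` {u..<v}"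
  proof (intro equalityI subsetI)
    fix p assume "p \<in> {p. p < n \<and> u \<le> P p \<and> P p < v}"
    then have "p = E (P p)" "P p \<in> {u..<v}" using assms(1) by (auto simp: perm_def)
    then show "p \<in> E ` {u..<v}" by blast
  qed (use assms in \<open>auto simp: perm_def\<close>)
  moreover have "inj_on E {u..<v}" using assms by (intro inj_on_inverseI[of _ P]) (auto simp: perm_def)
  ultimately show ?thesis by (simp add: card_image)
qed

text \<open>A vertex of the new class loses at least one level of \<open>floor_log\<close>, which
  frees \<open>g\<close>: the share \<open>a\<close> pays for the new class as a splitter, the share
  \<open>h\<close> for giving the vertex its new number. The share of no other vertex grows.\<close>

lemma pot_split:
  assumes part: "partn n E P D B N m" and c: "c < m" and uv: "u < v"
    and cases: "u = B c \<and> v = b' \<and> e' = N c \<or> b' = B c \<and> e' = u \<and> v = N c" and be: "b' < e'"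
    and half: "2 * (v - u) \<le> N c - B c" and g: "a + h \<le> g"
  defines "D' \<equiv> \<lambda>p. if p \<in> E ` {u..<v} then m else D p"
  shows "pot a g n D' (B(m := u, c := b')) (N(m := v, c := e')) k + h * (v - u) \<le> pot a g n D B N k"
proof -
  note sp = partn_split[OF part c uv cases be]
  note pd = partnD[OF part]
  let ?B = "B(m := u, c := b')" and ?N = "N(m := v, c := e')"
  have vn: "v \<le> n" using cases be pd(6)[OF c] by auto
  have le: "(if k \<le> D' p then a else 0) + g * floor_log (?N (D' p) - ?B (D' p)) + (if u \<le> P p \<and> P p < v then h else 0)
      \<le> (if k \<le> D p then a else 0) + g * floor_log (N (D p) - B (D p))" if p: "p < n" for p
  proof (cases "p \<in> E ` {u..<v}")
    case True
    then have "D p = c" "u \<le> P p \<and> P p < v" "D' p = m" using sp(2,3)[OF p] by (simp_all add: D'_def)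
    moreover have "Suc (floor_log (v - u)) \<le> floor_log (N c - B c)" by (rule floor_log_half) (use uv half in auto)
    then have "g * Suc (floor_log (v - u)) \<le> g * floor_log (N c - B c)" by (rule mult_le_mono2)
    ultimately show ?thesis using c g by auto
  next
    case False
    then have "\<not> (u \<le> P p \<and> P p < v)" "D' p = D p" using sp(2)[OF p] by (auto simp: D'_def)
    moreover have "D p < m" using pd(2)[OF p] .
    moreover have "g * floor_log (e' - b') \<le> g * floor_log (N c - B c)"
      by (intro mult_le_mono2 monoD[OF floor_log_mono]) (use cases uv in auto)
    ultimately show ?thesis by auto
  qed
  \<comment> \<open>The extra cost is distributed over the vertices of the new class, so that the
    inequality can be checked vertex by vertex.\<close>
  have "h * (v - u) = (\<Sum>p<n. if u \<le> P p \<and> P p < v then h else 0)"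
    using card_positions[OF pd(1) vn, of u] by (simp add: sum.If_cases Int_def mult.commute)
  then have "pot a g n D' ?B ?N k + h * (v - u) =
      (\<Sum>p<n. (if k \<le> D' p then a else 0) + g * floor_log (?N (D' p) - ?B (D' p)) + (if u \<le> P p \<and> P p < v then h else 0))"
    unfolding pot_def by (simp add: sum.distrib)
  also have "\<dots> \<le> pot a g n D B N k" unfolding pot_def by (rule sum_mono) (use le in simp)
  finally show ?thesis .
qed

lemma pot_Suc:
  assumes part: "partn n E P D B N m" and k: "k < m"
  shows "pot a g n D B N (Suc k) + a * (N k - B k) \<le> pot a g n D B N k"
proof -
  note pd = partnD[OF part]
  have "a * (N k - B k) = (\<Sum>p<n. if B k \<le> P p \<and> P p < N k then a else 0)"
    using card_positions[OF pd(1) pd(6)[OF k], of "B k"] by (simp add: sum.If_cases Int_def mult.commute)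
  then have "pot a g n D B N (Suc k) + a * (N k - B k) = (\<Sum>p<n. (if Suc k \<le> D p then a else 0)
      + g * floor_log (N (D p) - B (D p)) + (if B k \<le> P p \<and> P p < N k then a else 0))"
    unfolding pot_def by (simp add: sum.distrib)
  also have "\<dots> \<le> pot a g n D B N k" unfolding pot_def
  proof (rule sum_mono)
    fix p assume "p \<in> {..<n}"
    then show "(if Suc k \<le> D p then a else 0) + g * floor_log (N (D p) - B (D p))
        + (if B k \<le> P p \<and> P p < N k then a else 0)
      \<le> (if k \<le> D p then a else 0) + g * floor_log (N (D p) - B (D p))"
      using partn_class_iff[OF part _ k, of p] by auto
  qed
  finally show ?thesis .
qed

section \<open>Splitting all classes along one set\<close>

definition refines :: "nat \<Rightarrow> (nat \<Rightarrow> nat) \<Rightarrow> nat \<Rightarrow> nat set set \<Rightarrow> (nat \<Rightarrow> nat) \<Rightarrow> nat \<Rightarrow> bool" where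
  "refines n D0 m0 Xs D m \<longleftrightarrow> m0 \<le> m
     \<and> (\<forall>p<n. D p \<noteq> D0 p \<longrightarrow> m0 \<le> D p \<and> (\<exists>q<n. D0 q = D0 p \<and> q \<in> \<Union>Xs))
     \<and> (\<forall>p<n. \<forall>q<n. D p = D q \<longleftrightarrow> D0 p = D0 q \<and> (\<forall>X\<in>Xs. p \<in> X \<longleftrightarrow> q \<in> X))"

lemma refines_refl: "refines n D m {} D m"
  by (simp add: refines_def)

lemma refines_trans:
  assumes 1: "refines n D0 m0 Xs D1 m1" and 2: "refines n D1 m1 {X} D m"
  shows "refines n D0 m0 (insert X Xs) D m"
  unfolding refines_def
proof (intro conjI allI impI)
  show "m0 \<le> m" using 1 2 by (simp add: refines_def)
  have eq1: "D1 p = D1 q \<longleftrightarrow> D0 p = D0 q \<and> (\<forall>X\<in>Xs. p \<in> X \<longleftrightarrow> q \<in> X)" if "p < n" "q < n" for p q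
    using 1 that by (simp add: refines_def)
  fix p assume p: "p < n"
  show "D p = D q \<longleftrightarrow> D0 p = D0 q \<and> (\<forall>X\<in>insert X Xs. p \<in> X \<longleftrightarrow> q \<in> X)" if "q < n" for q
    using 2 eq1[OF p that] p that by (auto simp: refines_def)
  assume ne: "D p \<noteq> D0 p"
  show "m0 \<le> D p"
  proof (cases "D p = D1 p")
    case True
    then show ?thesis using 1 p ne by (auto simp: refines_def)
  next
    case False
    then have "m1 \<le> D p" using 2 p by (auto simp: refines_def)
    then show ?thesis using 1 by (simp add: refines_def)
  qed
  show "\<exists>q<n. D0 q = D0 p \<and> q \<in> \<Union>(insert X Xs)"
  proof (cases "D p = D1 p")
    case True
    then have "\<exists>q<n. D0 q = D0 p \<and> q \<in> \<Union>Xs" using 1 p ne by (simp add: refines_def)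
    then show ?thesis by auto
  next
    case False
    then obtain q where "q < n" "D1 q = D1 p" "q \<in> X" using 2 p by (auto simp: refines_def)
    then show ?thesis using eq1[of q p] p by auto
  qed
qed

text \<open>The situation while the classes in \<open>Q\<close> still wait: \<open>D0\<close> is the
  partition before, and each of its classes is either listed and unchanged or already separated
  along \<open>X\<close>.\<close>

definition splitting :: "nat \<Rightarrow> (nat \<Rightarrow> nat) \<Rightarrow> (nat \<Rightarrow> nat) \<Rightarrow> (nat \<Rightarrow> nat) \<Rightarrow> nat \<Rightarrow> nat set \<Rightarrow> (nat \<Rightarrow> nat) \<Rightarrow> (nat \<Rightarrow> nat) \<Rightarrow> (nat \<Rightarrow> nat)
  \<Rightarrow> nat \<Rightarrow> (nat \<Rightarrow> nat) \<Rightarrow> (nat \<Rightarrow> nat) \<Rightarrow> nat \<Rightarrow> bool" where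
  "splitting n E P D0 m0 X D B N m M Q tq \<longleftrightarrow> partn n E P D B N m \<and> m0 \<le> m \<and> inj_on Q {..<tq}
     \<and> (\<forall>c. c \<notin> Q ` {..<tq} \<longrightarrow> M c = 0)
     \<and> (\<forall>c\<in>Q ` {..<tq}. c < m0 \<and> 0 < M c \<and> M c \<le> N c - B c \<and> (\<forall>p<n. D p = c \<longleftrightarrow> D0 p = c)
           \<and> (\<forall>p<n. D p = c \<longrightarrow> (p \<in> X \<longleftrightarrow> P p < B c + M c)))
     \<and> (\<forall>p<n. D p \<noteq> D0 p \<longrightarrow> m0 \<le> D p \<and> (\<exists>q<n. D0 q = D0 p \<and> q \<in> X))
     \<and> (\<forall>p<n. \<forall>q<n. D p = D q \<longrightarrow> D0 p = D0 q \<and> (D0 p \<notin> Q ` {..<tq} \<longrightarrow> (p \<in> X \<longleftrightarrow> q \<in> X)))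
     \<and> (\<forall>p<n. \<forall>q<n. D0 p = D0 q \<longrightarrow> (p \<in> X \<longleftrightarrow> q \<in> X) \<longrightarrow> D p = D q)"

lemma splitting_init:
  assumes "marked n E P D B N m M X Q tq"
  shows "splitting n E P D m X D B N m M Q tq"
proof -
  have part: "partn n E P D B N m" using assms by (simp add: marked_def)
  define S where "S = Q ` {..<tq}"
  have a: "X \<subseteq> {..<n}" "inj_on Q {..<tq}" "S = {c. 0 < M c}" "\<And>c. 0 < M c \<Longrightarrow> c < m"
    "\<And>c. c < m \<Longrightarrow> M c \<le> N c - B c" "\<And>p. p < n \<Longrightarrow> p \<in> X \<longleftrightarrow> P p < B (D p) + M (D p)"
    using assms unfolding marked_def S_def by auto
  have "p \<notin> X" if "p < n" "D p \<notin> S" for p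
    using a(3) a(6)[OF that(1)] partnD(3)[OF part that(1)] that(2) by simp
  then show ?thesis unfolding splitting_def S_def[symmetric] using part a by simp metis
qed

lemma splitting_final:
  assumes "splitting n E P D0 m0 X D B N m M Q 0"
  shows "partn n E P D B N m" "M = (\<lambda>_. 0)" "refines n D0 m0 {X} D m"
proof -
  show "partn n E P D B N m" using assms by (simp add: splitting_def)
  show "M = (\<lambda>_. 0)" using assms by (simp add: splitting_def fun_eq_iff)
  have a: "\<forall>p<n. D p \<noteq> D0 p \<longrightarrow> m0 \<le> D p \<and> (\<exists>q<n. D0 q = D0 p \<and> q \<in> X)" "m0 \<le> m"
    "\<forall>p<n. \<forall>q<n. D p = D q \<longrightarrow> D0 p = D0 q \<and> (p \<in> X \<longleftrightarrow> q \<in> X)"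
    "\<forall>p<n. \<forall>q<n. D0 p = D0 q \<longrightarrow> (p \<in> X \<longleftrightarrow> q \<in> X) \<longrightarrow> D p = D q"
    using assms unfolding splitting_def lessThan_0 image_empty by (elim conjE, blast)+
  then have "D p = D q \<longleftrightarrow> D0 p = D0 q \<and> (p \<in> X \<longleftrightarrow> q \<in> X)" if "p < n" "q < n" for p q
    using that by metis
  then show "refines n D0 m0 {X} D m" unfolding refines_def using a(1,2) by simp
qed

text \<open>A listed class whose members are all marked lies inside \<open>X\<close>, so nothing is
  left to separate in it.\<close>

lemma splitting_skip:
  assumes sp: "splitting n E P D0 m0 X D B N m M Q (Suc tq)" and full: "N (Q tq) - B (Q tq) \<le> M (Q tq)"
  shows "splitting n E P D0 m0 X D B N m (M(Q tq := 0)) Q tq"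
proof -
  let ?c = "Q tq"
  have part: "partn n E P D B N m" and m0: "m0 \<le> m" and inj: "inj_on Q {..<Suc tq}"
    and Mz: "\<And>c. c \<notin> Q ` {..<Suc tq} \<Longrightarrow> M c = 0"
    and Qc: "\<And>c. c \<in> Q ` {..<Suc tq} \<Longrightarrow> c < m0 \<and> 0 < M c \<and> M c \<le> N c - B c \<and> (\<forall>p<n. D p = c \<longleftrightarrow> D0 p = c)
           \<and> (\<forall>p<n. D p = c \<longrightarrow> (p \<in> X \<longleftrightarrow> P p < B c + M c))"
    and ch: "\<And>p. p < n \<Longrightarrow> D p \<noteq> D0 p \<Longrightarrow> m0 \<le> D p \<and> (\<exists>q<n. D0 q = D0 p \<and> q \<in> X)"
    and eq: "\<And>p q. p < n \<Longrightarrow> q < n \<Longrightarrow> D p = D q \<Longrightarrow> D0 p = D0 q \<and> (D0 p \<notin> Q ` {..<Suc tq} \<longrightarrow> (p \<in> X \<longleftrightarrow> q \<in> X))"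
    and eq': "\<And>p q. p < n \<Longrightarrow> q < n \<Longrightarrow> D0 p = D0 q \<Longrightarrow> (p \<in> X \<longleftrightarrow> q \<in> X) \<Longrightarrow> D p = D q"
    using sp unfolding splitting_def by blast+
  have img: "Q ` {..<Suc tq} = insert ?c (Q ` {..<tq})" by (simp add: lessThan_Suc)
  have nin: "?c \<notin> Q ` {..<tq}" using inj_on_image_mem_iff[OF inj, of tq "{..<tq}"] by auto
  have cX: "p \<in> X" if "p < n" "D0 p = ?c" for p
  proof -
    have "D p = ?c" "p \<in> X \<longleftrightarrow> P p < B ?c + M ?c" using Qc[of ?c] that by auto
    then show ?thesis using partnD(3,4)[OF part that(1)] full by auto
  qed
  show ?thesis unfolding splitting_def
  proof (intro conjI allI impI ballI)
    show "inj_on Q {..<tq}" using inj by (auto simp: inj_on_def)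
    fix c
    show "(M(?c := 0)) c = 0" if "c \<notin> Q ` {..<tq}" using that Mz[of c] img by auto
    assume c: "c \<in> Q ` {..<tq}"
    then have "c \<noteq> ?c" "c \<in> Q ` {..<Suc tq}" using nin img by blast+
    note this(1) Qc[OF this(2)]
    then show "c < m0" "0 < (M(?c := 0)) c" "(M(?c := 0)) c \<le> N c - B c" by simp_all
    fix p assume "p < n"
    then show "D p = c \<longleftrightarrow> D0 p = c" "D p = c \<Longrightarrow> p \<in> X \<longleftrightarrow> P p < B c + (M(?c := 0)) c"
      using \<open>c \<noteq> ?c\<close> Qc[OF \<open>c \<in> Q ` {..<Suc tq}\<close>] by simp_all
  next
    fix p q assume pq: "p < n" "q < n" "D p = D q"
    then show "D0 p = D0 q" using eq by blast
    assume "D0 p \<notin> Q ` {..<tq}"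
    then have "D0 p = ?c \<or> D0 p \<notin> Q ` {..<Suc tq}" unfolding img by blast
    then show "p \<in> X \<longleftrightarrow> q \<in> X" using eq[OF pq] cX[OF pq(1)] cX[OF pq(2)] by metis
  qed (use part m0 ch eq' in blast)+
qed

lemma splitting_split:
  assumes sp: "splitting n E P D0 m0 X D B N m M Q (Suc tq)"
    and c: "c = Q tq" and mid: "M c < N c - B c"
    and cases: "u = B c \<and> v = B c + M c \<and> b' = B c + M c \<and> e' = N c
      \<or> b' = B c \<and> e' = B c + M c \<and> u = B c + M c \<and> v = N c"
  defines "D' \<equiv> \<lambda>p. if p \<in> E ` {u..<v} then m else D p"
  shows "splitting n E P D0 m0 X D' (B(m := u, c := b')) (N(m := v, c := e')) (Suc m) (M(c := 0)) Q tq"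
proof -
  have part: "partn n E P D B N m" and m0: "m0 \<le> m" and inj: "inj_on Q {..<Suc tq}"
    and Mz: "\<And>c. c \<notin> Q ` {..<Suc tq} \<Longrightarrow> M c = 0"
    and Qc: "\<And>c. c \<in> Q ` {..<Suc tq} \<Longrightarrow> c < m0 \<and> 0 < M c \<and> M c \<le> N c - B c \<and> (\<forall>p<n. D p = c \<longleftrightarrow> D0 p = c)
           \<and> (\<forall>p<n. D p = c \<longrightarrow> (p \<in> X \<longleftrightarrow> P p < B c + M c))"
    and ch: "\<And>p. p < n \<Longrightarrow> D p \<noteq> D0 p \<Longrightarrow> m0 \<le> D p \<and> (\<exists>q<n. D0 q = D0 p \<and> q \<in> X)"
    and eq: "\<And>p q. p < n \<Longrightarrow> q < n \<Longrightarrow> D p = D q \<Longrightarrow> D0 p = D0 q \<and> (D0 p \<notin> Q ` {..<Suc tq} \<longrightarrow> (p \<in> X \<longleftrightarrow> q \<in> X))"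
    and eq': "\<And>p q. p < n \<Longrightarrow> q < n \<Longrightarrow> D0 p = D0 q \<Longrightarrow> (p \<in> X \<longleftrightarrow> q \<in> X) \<Longrightarrow> D p = D q"
    using sp unfolding splitting_def by blast+
  have img: "Q ` {..<Suc tq} = insert c (Q ` {..<tq})" by (simp add: lessThan_Suc c)
  have nin: "c \<notin> Q ` {..<tq}" using inj_on_image_mem_iff[OF inj, of tq "{..<tq}"] by (auto simp: c)
  have Qc0: "c < m0" "0 < M c" "M c \<le> N c - B c" using Qc[of c] img by auto
  have DD0: "D p = c \<longleftrightarrow> D0 p = c" if "p < n" for p using Qc[of c] img that by auto
  have DX: "p \<in> X \<longleftrightarrow> P p < B c + M c" if "p < n" "D p = c" for p using Qc[of c] img that by auto
  have cm: "c < m" using Qc0 m0 by simp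
  have uv: "u < v" and be: "b' < e'" using cases mid Qc0 by auto
  have cases': "u = B c \<and> v = b' \<and> e' = N c \<or> b' = B c \<and> e' = u \<and> v = N c" using cases by auto
  note ps = partn_split[OF part cm uv cases' be]
  \<comment> \<open>Both cases at once: since \<open>M c\<close> is positive, \<open>u = B c\<close>
    holds exactly when the new class is the part inside \<open>X\<close>.\<close>
  have new: "p \<in> E ` {u..<v} \<longleftrightarrow> D p = c \<and> (p \<in> X \<longleftrightarrow> u = B c)" if p: "p < n" for p
  proof
    assume new: "p \<in> E ` {u..<v}"
    then have "D p = c" "u \<le> P p \<and> P p < v" using ps(2,3)[OF p] by simp_all
    then show "D p = c \<and> (p \<in> X \<longleftrightarrow> u = B c)" using DX[OF p] cases Qc0 by auto
  next
    assume "D p = c \<and> (p \<in> X \<longleftrightarrow> u = B c)"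
    then show "p \<in> E ` {u..<v}" unfolding ps(2)[OF p] using DX[OF p] partn_class_iff[OF part p cm] cases Qc0 by auto
  qed
  have Dm: "D p < m" if "p < n" for p by (rule partnD(2)[OF part that])
  \<comment> \<open>The count of a listed class is positive, so its first position is
    marked.\<close>
  have exX: "\<exists>q<n. D0 q = c \<and> q \<in> X"
  proof -
    have i: "B c < n" using partnD(5,6)[OF part cm] by simp
    then have "E (B c) < n" "P (E (B c)) = B c" using partnD(8,9)[OF part i] by simp_all
    moreover have "D (E (B c)) = c" using partnD(7)[OF part cm, of "B c"] partnD(5)[OF part cm] by simp
    ultimately show ?thesis using DX[of "E (B c)"] DD0[of "E (B c)"] Qc0 by auto
  qed
  show ?thesis unfolding splitting_def
  proof (intro conjI allI impI ballI)
    show "partn n E P D' (B(m := u, c := b')) (N(m := v, c := e')) (Suc m)"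
      unfolding D'_def by (rule ps(1))
    show "m0 \<le> Suc m" using m0 by simp
    show "inj_on Q {..<tq}" using inj by (auto simp: inj_on_def)
    fix d
    show "(M(c := 0)) d = 0" if "d \<notin> Q ` {..<tq}" using that Mz[of d] img by auto
    assume d: "d \<in> Q ` {..<tq}"
    then have d2: "d \<noteq> c" "d \<in> Q ` {..<Suc tq}" using nin img by blast+
    note Qd = Qc[OF d2(2)]
    then have "d \<noteq> m" using m0 by auto
    show "d < m0" "0 < (M(c := 0)) d" "(M(c := 0)) d \<le> (N(m := v, c := e')) d - (B(m := u, c := b')) d"
      using Qd d2 \<open>d \<noteq> m\<close> by simp_all
    fix p assume p: "p < n"
    have "D' p = d \<longleftrightarrow> D p = d" using new[OF p] d2(1) \<open>d \<noteq> m\<close> by (auto simp: D'_def)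
    then show "D' p = d \<longleftrightarrow> D0 p = d"
      "D' p = d \<Longrightarrow> p \<in> X \<longleftrightarrow> P p < (B(m := u, c := b')) d + (M(c := 0)) d"
      using Qd p d2(1) \<open>d \<noteq> m\<close> by auto
  next
    fix p assume p: "p < n" and ne: "D' p \<noteq> D0 p"
    have *: "D' p = m \<and> D0 p = c \<or> D' p = D p"
      using new[OF p] DD0[OF p] by (auto simp: D'_def)
    then show "m0 \<le> D' p" using ne ch[OF p] m0 by auto
    show "\<exists>q<n. D0 q = D0 p \<and> q \<in> X" using * ne ch[OF p] exX by auto
  next
    fix p q assume pq: "p < n" "q < n" and eqD: "D' p = D' q"
    note eq = eq[OF pq]
    have same: "D p = D q \<and> (D p = c \<longrightarrow> (p \<in> X \<longleftrightarrow> q \<in> X))"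
      using eqD new[OF pq(1)] new[OF pq(2)] Dm[OF pq(1)] Dm[OF pq(2)] by (auto simp: D'_def split: if_splits)
    then show "D0 p = D0 q" using eq by blast
    assume "D0 p \<notin> Q ` {..<tq}"
    then have "D0 p = c \<or> D0 p \<notin> Q ` {..<Suc tq}" unfolding img by blast
    then show "p \<in> X \<longleftrightarrow> q \<in> X" using eq same DD0[OF pq(1)] by metis
  next
    fix p q assume pq: "p < n" "q < n" and "D0 p = D0 q" "p \<in> X \<longleftrightarrow> q \<in> X"
    then show "D' p = D' q" using eq'[OF pq] new[OF pq(1)] new[OF pq(2)] by (auto simp: D'_def)
  qed
qed

section \<open>Splitters: invariant and correctness\<close>

context core_graph
begin

text \<open>The shift by one leaves 0 for an undefined transition, which thereby compares like a
  class that has already been processed.\<close>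

definition target :: "('v \<Rightarrow> nat) \<Rightarrow> 'a letter \<Rightarrow> 'v \<Rightarrow> nat" where
  "target D x p = (if \<exists>s. (p, x, s) \<in> M then Suc (D (THE s. (p, x, s) \<in> M)) else 0)"

lemma target_eq: "(p, x, s) \<in> M \<Longrightarrow> target D x p = Suc (D s)"
proof -
  assume *: "(p, x, s) \<in> M"
  then have "(THE s. (p, x, s) \<in> M) = s" using M_det by (intro the_equality) blast+
  then show ?thesis using * by (auto simp: target_def)
qed

lemma target_0: "\<not> (\<exists>s. (p, x, s) \<in> M) \<Longrightarrow> target D x p = 0"
  unfolding target_def by (rule if_not_P)

text \<open>The vertices entered by \<open>x\<close> from class \<open>k\<close>; in an inverse
  graph these are the predecessors of the class along \<open>bar x\<close>.\<close>

definition preds :: "('v \<Rightarrow> nat) \<Rightarrow> nat \<Rightarrow> 'a letter \<Rightarrow> 'v set" where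
  "preds D k x = {p. \<exists>s. (s, x, p) \<in> M \<and> D s = k}"

definition sound :: "('v \<Rightarrow> nat) \<Rightarrow> bool" where
  "sound D \<longleftrightarrow> (\<forall>p\<in>C. \<forall>q\<in>C. lang M p = lang M q \<longrightarrow> D p = D q)"

text \<open>The classes \<open>0, \<dots>, k - 1\<close> have been processed as splitters.\<close>

definition processed :: "('v \<Rightarrow> nat) \<Rightarrow> nat \<Rightarrow> bool" where
  "processed D k \<longleftrightarrow> (\<forall>p\<in>C. \<forall>q\<in>C. \<forall>x. D p = D q \<longrightarrow> target D x p \<noteq> target D x q
     \<longrightarrow> k < target D x p \<or> k < target D x q)"

text \<open>Stepping back by \<open>bar x\<close> from an equivalent vertex leads to a vertex
  equivalent to the original source, which a sound partition also puts into class \<open>k\<close>.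
  Splitting by such sets thus never separates equivalent vertices.\<close>

lemma preds_lang:
  assumes "sound D" "p \<in> preds D k x" "lang M p = lang M q"
  shows "q \<in> preds D k x"
proof -
  obtain s where s: "(s, x, p) \<in> M" "D s = k" using assms(2) by (auto simp: preds_def)
  obtain s' where s': "(q, bar x, s') \<in> M" "lang M s = lang M s'" using lang_eqE[OF assms(3) M_sym[OF s(1)]] .
  then have "s \<in> C" "s' \<in> C" using s M_C by blast+
  then have "D s' = k" using assms(1) s' s unfolding sound_def by metis
  moreover have "(s', x, q) \<in> M" using M_sym[OF s'(1)] by simp
  ultimately show ?thesis by (auto simp: preds_def)
qed

text \<open>Once all classes are processed no target exceeds \<open>k\<close>. Vertices of one class
  then agree in their targets, including undefined ones, and an induction on the word transfers
  readability.\<close>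

lemma lang_eq_if_processed:
  assumes "processed D k" "\<And>p. p \<in> C \<Longrightarrow> D p < k" "p \<in> C" "q \<in> C" "D p = D q"
  shows "lang M p = lang M q"
proof -
  have "w \<in> lang M p \<Longrightarrow> w \<in> lang M q" if "p \<in> C" "q \<in> C" "D p = D q" for w p q
    using that
  proof (induction w arbitrary: p q)
    case (Cons x w)
    obtain s e where e: "(p, x, s) \<in> M" "path M s w e" using Cons.prems(1) by (auto simp: lang_def)
    then have s: "(p, x, s) \<in> M" "w \<in> lang M s" by (simp_all add: langI)
    then have sC: "s \<in> C" using M_C by blast
    have tp: "target D x p = Suc (D s)" by (rule target_eq[OF s(1)])
    have "target D x q \<le> k"
    proof (cases "\<exists>s. (q, x, s) \<in> M")
      case True
      then obtain s' where s': "(q, x, s') \<in> M" by blast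
      then have "s' \<in> C" using M_C by blast
      then show ?thesis using target_eq[OF s'] assms(2) by (simp add: Suc_leI)
    qed (simp add: target_0)
    moreover have "target D x p \<le> k" using tp assms(2)[OF sC] by simp
    ultimately have eq: "target D x p = target D x q"
      using assms(1) Cons.prems unfolding processed_def by (meson leD)
    have "\<exists>s. (q, x, s) \<in> M"
    proof (rule ccontr)
      assume "\<not> ?thesis"
      then show False using target_0[of q x D] eq tp by simp
    qed
    then obtain s' where s': "(q, x, s') \<in> M" by blast
    then have "D s = D s'" using eq tp target_eq[OF s'] by simp
    moreover have "s' \<in> C" using s' M_C by blast
    ultimately have "w \<in> lang M s'" using Cons.IH[of s s'] s(2) sC by blast
    then show ?case using lang_step[OF s'] by simp
  qed simp
  from this[OF assms(3,4,5)] this[OF assms(4,3) assms(5)[symmetric]] show ?thesis by blast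
qed

end

text \<open>This is why only one part of a split class has to be queued. A changed class number is
  at least \<open>m\<close> and hence still pending, so targets up to \<open>Suc k\<close> are the
  same before and after. If two such targets of a pair in one class differed, one of them would be
  \<open>Suc k\<close> by the old invariant, and splitting by the predecessors of class
  \<open>k\<close> has separated such pairs.\<close>

lemma (in core_graph) processed_step:
  fixes D :: "'v \<Rightarrow> nat"
  assumes "sound D" "processed D k" "k < m"
    and ch: "\<And>p. p \<in> C \<Longrightarrow> D' p \<noteq> D p \<Longrightarrow> m \<le> D' p"
    and eq: "\<And>p q. p \<in> C \<Longrightarrow> q \<in> C \<Longrightarrow> D' p = D' q \<longleftrightarrow> D p = D q \<and> (\<forall>x. p \<in> preds D k x \<longleftrightarrow> q \<in> preds D k x)"
  shows "sound D'" "processed D' (Suc k)"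
proof -
  show "sound D'" unfolding sound_def
  proof (intro ballI impI)
    fix p q assume pq: "p \<in> C" "q \<in> C" "lang M p = lang M q"
    then have "D p = D q" using assms(1) unfolding sound_def by blast
    moreover have "p \<in> preds D k x \<longleftrightarrow> q \<in> preds D k x" for x using preds_lang[OF assms(1)] pq(3) by metis
    ultimately show "D' p = D' q" using eq[OF pq(1,2)] by blast
  qed
  have same: "target D x p = target D' x p" if "target D' x p \<le> Suc k" for x p
  proof (cases "\<exists>s. (p, x, s) \<in> M")
    case True
    then obtain s where s: "(p, x, s) \<in> M" by blast
    then have "s \<in> C" using M_C by blast
    then show ?thesis using that ch[of s] assms(3) target_eq[OF s] by force
  qed (simp add: target_0)
  have transfer: "target D x q = Suc k"
    if pq: "p \<in> C" "q \<in> C" "D' p = D' q" and tp: "target D x p = Suc k" for x p q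
  proof -
    obtain s where s: "(p, x, s) \<in> M" using tp target_0[of p x D] by fastforce
    then have "D s = k" using tp target_eq[OF s] by simp
    then have "p \<in> preds D k (bar x)" using M_sym[OF s] by (auto simp: preds_def)
    then have "q \<in> preds D k (bar x)" using eq[OF pq(1,2)] pq(3) by blast
    then obtain s' where s': "(s', bar x, q) \<in> M" "D s' = k" by (auto simp: preds_def)
    then have "(q, x, s') \<in> M" using M_sym[OF s'(1)] by simp
    then show ?thesis using target_eq s'(2) by simp
  qed
  show "processed D' (Suc k)" unfolding processed_def
  proof (intro ballI allI impI, rule ccontr)
    fix p q x
    assume pq: "p \<in> C" "q \<in> C" "D' p = D' q" and ne: "target D' x p \<noteq> target D' x q"
      and "\<not> (Suc k < target D' x p \<or> Suc k < target D' x q)"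
    then have le: "target D' x p \<le> Suc k" "target D' x q \<le> Suc k" by simp_all
    note s = same[OF le(1)] same[OF le(2)]
    have "D p = D q" using eq[OF pq(1,2)] pq(3) by blast
    then have "k < target D x p \<or> k < target D x q"
      using assms(2) pq(1,2) ne s unfolding processed_def by metis
    then have "target D x p = Suc k \<or> target D x q = Suc k" using s le by linarith
    then have "target D x p = target D x q" using transfer[OF pq] transfer[OF pq(2,1) pq(3)[symmetric]] by metis
    then show False using ne s by simp
  qed
qed

section \<open>The refinement program\<close>

lemma wp_Seq_loopfree:
  "loopfree c \<Longrightarrow> ccost c + k' \<le> k \<Longrightarrow> wp d Q (run c s) k' \<Longrightarrow> wp (Seq c d) Q s k"
  by (rule wp_Seq, rule wp_loopfree)

context layout
begin

definition "markloop x = Seq (Assign 10 (Num 0)) (Seq (Assign 9 (Num 0)) (While (Less (Reg 9) (Reg 8)) (markstep x)))"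

text \<open>Register 13 is the boundary between marked and unmarked members. The smaller part gets
  the new number, as the potential requires.\<close>

definition "newclass = Seq (Assign 13 (Add (get 3 (Reg 12)) (get 5 (Reg 12))))
  (Cond (Less (Sub (Sub (get 4 (Reg 12)) (get 3 (Reg 12))) (get 5 (Reg 12))) (get 5 (Reg 12)))
     (seqs [set 3 (Reg 7) (Reg 13), set 4 (Reg 7) (get 4 (Reg 12)), set 4 (Reg 12) (Reg 13)])
     (seqs [set 3 (Reg 7) (get 3 (Reg 12)), set 4 (Reg 7) (Reg 13), set 3 (Reg 12) (Reg 13)]))"

definition "relabelstep = Seq (set 2 (get 0 (Reg 19)) (Reg 7)) (Assign 19 (Add (Reg 19) (Num 1)))"

definition "relabel = Seq (Assign 19 (get 3 (Reg 7))) (Seq (Assign 20 (get 4 (Reg 7)))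
  (Seq (While (Less (Reg 19) (Reg 20)) relabelstep) (Assign 7 (Add (Reg 7) (Num 1)))))"

definition "poptouched = Seq (Assign 10 (Sub (Reg 10) (Num 1))) (Assign 12 (get 7 (Reg 10)))"

text \<open>Resetting the count of each popped class takes time proportional to the number of
  touched classes, not to \<open>n\<close>, and leaves all counts zero for the next letter.\<close>

definition "splitstep = Seq poptouched (Seq
  (Cond (Less (get 5 (Reg 12)) (Sub (get 4 (Reg 12)) (get 3 (Reg 12)))) (Seq newclass relabel) Skip)
  (set 5 (Reg 12) (Num 0)))"

definition "splitloop = While (Less (Num 0) (Reg 10)) splitstep"

text \<open>The members of the splitter are copied because marking permutes the enumeration, and
  because the splitter may itself be split while it is in use.\<close>

definition "copystep = Seq (set 6 (Reg 9) (get 0 (Add (get 3 (Reg 6)) (Reg 9)))) (Assign 9 (Add (Reg 9) (Num 1)))"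

definition "classinit = Seq (Assign 8 (Sub (get 4 (Reg 6)) (get 3 (Reg 6)))) (Assign 9 (Num 0))"

definition "classstep = Seq classinit (Seq (While (Less (Reg 9) (Reg 8)) copystep)
  (Seq (seqs (map (\<lambda>x. Seq (markloop x) splitloop) [0..<L])) (Assign 6 (Add (Reg 6) (Num 1)))))"

definition "refine = While (Less (Reg 6) (Reg 7)) classstep"

lemma loopfree_steps [simp]: "loopfree newclass" "loopfree relabelstep" "loopfree poptouched"
  "loopfree copystep" "loopfree classinit"
  by (simp_all add: newclass_def relabelstep_def poptouched_def copystep_def classinit_def)

text \<open>The sum over the letters bounds the cost for each single letter; the 3 is the cost of
  the loop guard.\<close>

definition "cost_mark = (\<Sum>x<L. ccost (markstep x)) + 3"
definition "cost_relabel = ccost relabelstep + 3"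
definition "cost_split = ccost poptouched + ccost newclass + ccost (set 5 (Reg 12) (Num 0)) + 3
  + bcost (Less (get 5 (Reg 12)) (Sub (get 4 (Reg 12)) (get 3 (Reg 12)))) + 1
  + ccost (Assign 19 (get 3 (Reg 7))) + ccost (Assign 20 (get 4 (Reg 7))) + 3 + ccost (Assign 7 (Add (Reg 7) (Num 1)))"

lemma run_markstep_skip:
  assumes "x < L" "\<alpha> (8 + x) (\<alpha> 6 (\<rho> 9)) = 0 \<or> \<alpha> 2 (\<alpha> (8 + x) (\<alpha> 6 (\<rho> 9)) - 1) < \<rho> 5"
  shows "run (markstep x) (mk \<rho> \<alpha> \<beta>) = mk (\<rho>(14 := \<alpha> (8 + x) (\<alpha> 6 (\<rho> 9)), 9 := \<rho> 9 + 1)) \<alpha> \<beta>"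
  using assms by (auto simp: markstep_def)

lemma run_markstep_mark:
  assumes "x < L" "\<alpha> (8 + x) (\<alpha> 6 (\<rho> 9)) = Suc p" "\<rho> 5 \<le> \<alpha> 2 p"
  defines "c \<equiv> \<alpha> 2 p"
  defines "i \<equiv> \<alpha> 3 c + \<alpha> 5 c"
  shows "\<exists>\<rho>'. run (markstep x) (mk \<rho> \<alpha> \<beta>) = mk \<rho>' (\<alpha>(0 := (\<alpha> 0)(i := p, \<alpha> 1 p := \<alpha> 0 i),
      1 := (\<alpha> 1)(p := i, \<alpha> 0 i := \<alpha> 1 p), 7 := (if \<alpha> 5 c = 0 then (\<alpha> 7)(\<rho> 10 := c) else \<alpha> 7), 5 := (\<alpha> 5)(c := Suc (\<alpha> 5 c)))) \<beta>
    \<and> (\<forall>j. j \<notin> {9, 10, 11, 12, 13, 14, 15} \<longrightarrow> \<rho>' j = \<rho> j) \<and> \<rho>' 9 = \<rho> 9 + 1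
    \<and> \<rho>' 10 = (if \<alpha> 5 c = 0 then Suc (\<rho> 10) else \<rho> 10)"
proof (cases "\<alpha> 5 c = 0")
  case True
  then have "i = \<alpha> 3 c" by (simp add: i_def)
  with True show ?thesis using assms(1-3) unfolding markstep_def mark_def
    by (simp add: run_swap flip: c_def) (intro exI conjI, rule HOL.refl, simp_all)
next
  case False
  then show ?thesis using assms(1-3) unfolding markstep_def mark_def
    by (simp add: run_swap fun_upd_idem flip: c_def i_def) (intro exI conjI, rule HOL.refl, simp_all)
qed

end

section \<open>Effect and cost of marking, relabelling and splitting\<close>

locale refine_program = layout L for L +
  fixes n :: nat and \<tau> :: "nat \<Rightarrow> nat \<Rightarrow> nat" and t :: nat
  assumes \<tau>_le: "x < L \<Longrightarrow> p < n \<Longrightarrow> \<tau> x p \<le> n"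
    and \<tau>_inj: "x < L \<Longrightarrow> p < n \<Longrightarrow> q < n \<Longrightarrow> \<tau> x p = Suc s \<Longrightarrow> \<tau> x q = Suc s \<Longrightarrow> p = q"
begin

definition tab :: "(nat \<Rightarrow> nat \<Rightarrow> nat) \<Rightarrow> bool" where
  "tab \<alpha> \<longleftrightarrow> (\<forall>x<L. \<forall>p<n. \<alpha> (8 + x) p = \<tau> x p)"

definition found :: "(nat \<Rightarrow> nat) \<Rightarrow> nat \<Rightarrow> (nat \<Rightarrow> nat) \<Rightarrow> nat \<Rightarrow> nat set" where
  "found D x S l = {p. p < n \<and> t \<le> D p \<and> (\<exists>j<l. \<tau> x (S j) = Suc p)}"

lemma found_Suc:
  "found D x S (Suc l) = (if \<tau> x (S l) \<noteq> 0 \<and> \<tau> x (S l) \<le> n \<and> t \<le> D (\<tau> x (S l) - 1)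
     then insert (\<tau> x (S l) - 1) (found D x S l) else found D x S l)"
  by (auto simp: found_def less_Suc_eq)

text \<open>Each member of the splitter touches at most one new class, so a deposit of
  \<open>c\<close> per member leaves \<open>c\<close> credits for every touched class, to be spent
  when it is split. The 7 pays for two assignments and the last guard.\<close>

lemma wp_markloop:
  assumes x: "x < L" and part: "partn n (\<alpha> 0) (\<alpha> 1) (\<alpha> 2) (\<alpha> 3) (\<alpha> 4) m" and M0: "\<alpha> 5 = (\<lambda>_. 0)"
    and tab: "tab \<alpha>" and \<rho>: "\<rho> 5 = t" "\<rho> 8 = sz" and S: "inj_on (\<alpha> 6) {..<sz}" "\<alpha> 6 ` {..<sz} \<subseteq> {..<n}"
    and k: "7 + sz * (cost_mark + c) + k' \<le> k"
    and Q: "\<And>\<rho>' \<alpha>'. marked n (\<alpha>' 0) (\<alpha>' 1) (\<alpha> 2) (\<alpha> 3) (\<alpha> 4) m (\<alpha>' 5) (found (\<alpha> 2) x (\<alpha> 6) sz) (\<alpha>' 7) (\<rho>' 10)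
      \<Longrightarrow> (\<And>j. j \<notin> {0, 1, 5, 7} \<Longrightarrow> \<alpha>' j = \<alpha> j) \<Longrightarrow> (\<And>j. j \<notin> {9, 10, 11, 12, 13, 14, 15} \<Longrightarrow> \<rho>' j = \<rho> j)
      \<Longrightarrow> Q (mk \<rho>' \<alpha>' \<beta>) (k' + \<rho>' 10 * c)"
  shows "wp (markloop x) Q (mk \<rho> \<alpha> \<beta>) k"
proof -
  define I where "I s k \<longleftrightarrow> (\<exists>\<rho>' \<alpha>'. s = mk \<rho>' \<alpha>' \<beta> \<and> \<rho>' 9 \<le> sz
     \<and> marked n (\<alpha>' 0) (\<alpha>' 1) (\<alpha> 2) (\<alpha> 3) (\<alpha> 4) m (\<alpha>' 5) (found (\<alpha> 2) x (\<alpha> 6) (\<rho>' 9)) (\<alpha>' 7) (\<rho>' 10)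
     \<and> (\<forall>j. j \<notin> {0, 1, 5, 7} \<longrightarrow> \<alpha>' j = \<alpha> j) \<and> (\<forall>j. j \<notin> {9, 10, 11, 12, 13, 14, 15} \<longrightarrow> \<rho>' j = \<rho> j)
     \<and> 3 + (sz - \<rho>' 9) * (cost_mark + c) + \<rho>' 10 * c + k' \<le> k)" for s k
  have cm: "ccost (markstep x) + 3 \<le> cost_mark"
    unfolding cost_mark_def using x member_le_sum[of x "{..<L}" "\<lambda>x. ccost (markstep x)"] by simp
  have While: "wp (While (Less (Reg 9) (Reg 8)) (markstep x)) Q s k" if "I s k" for s k
    using that
  proof (rule wp_While)
    fix s k assume "I s k" and b: "bval (Less (Reg 9) (Reg 8)) s"
    then obtain \<rho>' \<alpha>' where s: "s = mk \<rho>' \<alpha>' \<beta>" "\<rho>' 9 \<le> sz"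
      and mk: "marked n (\<alpha>' 0) (\<alpha>' 1) (\<alpha> 2) (\<alpha> 3) (\<alpha> 4) m (\<alpha>' 5) (found (\<alpha> 2) x (\<alpha> 6) (\<rho>' 9)) (\<alpha>' 7) (\<rho>' 10)"
      and fr: "\<forall>j. j \<notin> {0, 1, 5, 7} \<longrightarrow> \<alpha>' j = \<alpha> j" "\<forall>j. j \<notin> {9, 10, 11, 12, 13, 14, 15} \<longrightarrow> \<rho>' j = \<rho> j"
      and cr: "3 + (sz - \<rho>' 9) * (cost_mark + c) + \<rho>' 10 * c + k' \<le> k"
      unfolding I_def by blast
    let ?i = "\<rho>' 9"
    have i: "?i < sz" using b s fr(2) \<rho> by simp
    then have "sz - ?i = Suc (sz - Suc ?i)" by simp
    then have cr': "3 + (cost_mark + c) + (sz - Suc ?i) * (cost_mark + c) + \<rho>' 10 * c + k' \<le> k" using cr by simp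
    have Sn: "\<alpha> 6 ?i < n" using S(2) i by blast
    have regs: "\<rho>' 5 = t" using fr(2) \<rho> by simp
    have arr: "\<alpha>' 2 = \<alpha> 2" "\<alpha>' 3 = \<alpha> 3" "\<alpha>' 6 = \<alpha> 6" using fr(1) by simp_all
    have \<tau>: "\<alpha>' (8 + x) (\<alpha>' 6 ?i) = \<tau> x (\<alpha> 6 ?i)"
      using fr(1) tab x Sn unfolding tab_def by simp
    define q where "q = \<tau> x (\<alpha> 6 ?i)"
    have qn: "q \<le> n" unfolding q_def by (rule \<tau>_le[OF x Sn])
    show "\<exists>k'. bcost (Less (Reg 9) (Reg 8)) + k' \<le> k \<and> wp (markstep x) I s k'"
    proof (cases "q = 0 \<or> \<alpha> 2 (q - 1) < t")
      case True
      then have F: "found (\<alpha> 2) x (\<alpha> 6) (Suc ?i) = found (\<alpha> 2) x (\<alpha> 6) ?i"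
        by (auto simp: found_Suc q_def)
      have run: "run (markstep x) s = mk (\<rho>'(14 := q, 9 := ?i + 1)) \<alpha>' \<beta>"
        unfolding s using run_markstep_skip[OF x, of \<alpha>' \<rho>'] True \<tau> arr regs by (simp add: q_def)
      have "I (run (markstep x) s) (3 + (sz - Suc ?i) * (cost_mark + c) + \<rho>' 10 * c + k')"
        unfolding I_def run using mk fr i F
        by (intro exI[of _ "\<rho>'(14 := q, 9 := ?i + 1)"] exI[of _ \<alpha>']) simp
      then show ?thesis
        by (intro exI[of _ "k - 3"] conjI wp_loopfree[of _ "3 + (sz - Suc ?i) * (cost_mark + c) + \<rho>' 10 * c + k'"])
          (use cr' cm in \<open>simp_all\<close>)
    next
      case False
      then obtain p where p: "q = Suc p" by (cases q) auto
      then have tp: "t \<le> \<alpha> 2 p" using False by simp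
      have F: "found (\<alpha> 2) x (\<alpha> 6) (Suc ?i) = insert p (found (\<alpha> 2) x (\<alpha> 6) ?i)"
        using p tp qn by (simp add: found_Suc flip: q_def)
      have pn: "p < n" using p qn by simp
      \<comment> \<open>Transitions along one letter are injective, so no vertex is marked
        twice.\<close>
      have new: "p \<notin> found (\<alpha> 2) x (\<alpha> 6) ?i"
      proof
        assume "p \<in> found (\<alpha> 2) x (\<alpha> 6) ?i"
        then obtain j where j: "j < ?i" "\<tau> x (\<alpha> 6 j) = Suc p" by (auto simp: found_def)
        then have "\<alpha> 6 j < n" using S(2) i by (auto simp: image_subset_iff)
        then have "\<alpha> 6 j = \<alpha> 6 ?i" using \<tau>_inj[OF x _ Sn j(2)] p by (simp add: q_def)
        then show False using inj_onD[OF S(1), of j ?i] j(1) i by simp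
      qed
      let ?c = "\<alpha> 2 p"
      let ?j = "\<alpha> 3 ?c + \<alpha>' 5 ?c"
      let ?\<alpha> = "\<alpha>'(0 := (\<alpha>' 0)(?j := p, \<alpha>' 1 p := \<alpha>' 0 ?j),
        1 := (\<alpha>' 1)(p := ?j, \<alpha>' 0 ?j := \<alpha>' 1 p), 7 := (if \<alpha>' 5 ?c = 0 then (\<alpha>' 7)(\<rho>' 10 := ?c) else \<alpha>' 7), 5 := (\<alpha>' 5)(?c := Suc (\<alpha>' 5 ?c)))"
      obtain \<rho>2 where r2: "run (markstep x) s = mk \<rho>2 ?\<alpha> \<beta>"
        "\<forall>j. j \<notin> {9, 10, 11, 12, 13, 14, 15} \<longrightarrow> \<rho>2 j = \<rho>' j" "\<rho>2 9 = ?i + 1"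
        "\<rho>2 10 = (if \<alpha>' 5 ?c = 0 then Suc (\<rho>' 10) else \<rho>' 10)"
      proof -
        have pre: "\<alpha>' (8 + x) (\<alpha>' 6 ?i) = Suc p" "\<rho>' 5 \<le> \<alpha>' 2 p" using \<tau> p q_def tp regs arr by simp_all
        show ?thesis using that run_markstep_mark[OF x pre, of \<beta>, unfolded arr] unfolding s(1) by blast
      qed
      have "marked n (?\<alpha> 0) (?\<alpha> 1) (\<alpha> 2) (\<alpha> 3) (\<alpha> 4) m (?\<alpha> 5) (found (\<alpha> 2) x (\<alpha> 6) (\<rho>2 9)) (?\<alpha> 7) (\<rho>2 10)"
        using marked_step[OF mk pn new] F r2(3,4) by (cases "\<alpha>' 5 ?c = 0") simp_all
      moreover have "\<rho>2 10 * c \<le> \<rho>' 10 * c + c" using r2(4) by simp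
      ultimately have "I (run (markstep x) s) (3 + (sz - Suc ?i) * (cost_mark + c) + \<rho>' 10 * c + c + k')"
        unfolding I_def r2(1) using fr i r2 by (intro exI[of _ \<rho>2] exI[of _ ?\<alpha>]) simp
      then show ?thesis
        by (intro exI[of _ "k - 3"] conjI wp_loopfree[of _ "3 + (sz - Suc ?i) * (cost_mark + c) + \<rho>' 10 * c + c + k'"])
          (use cr' cm in \<open>simp_all\<close>)
    qed
  next
    fix s k assume "I s k" and b: "\<not> bval (Less (Reg 9) (Reg 8)) s"
    then obtain \<rho>' \<alpha>' where s: "s = mk \<rho>' \<alpha>' \<beta>" "\<rho>' 9 \<le> sz"
      and mk: "marked n (\<alpha>' 0) (\<alpha>' 1) (\<alpha> 2) (\<alpha> 3) (\<alpha> 4) m (\<alpha>' 5) (found (\<alpha> 2) x (\<alpha> 6) (\<rho>' 9)) (\<alpha>' 7) (\<rho>' 10)"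
      and fr: "\<forall>j. j \<notin> {0, 1, 5, 7} \<longrightarrow> \<alpha>' j = \<alpha> j" "\<forall>j. j \<notin> {9, 10, 11, 12, 13, 14, 15} \<longrightarrow> \<rho>' j = \<rho> j"
      and cr: "3 + (sz - \<rho>' 9) * (cost_mark + c) + \<rho>' 10 * c + k' \<le> k"
      unfolding I_def by blast
    have "\<rho>' 9 = sz" using b s fr(2) \<rho> by simp
    then have "Q s (k' + \<rho>' 10 * c)" unfolding s(1) using mk fr by (intro Q) simp_all
    then show "\<exists>k'. bcost (Less (Reg 9) (Reg 8)) + k' \<le> k \<and> Q s k'"
      by (intro exI[of _ "k' + \<rho>' 10 * c"]) (use cr in simp)
  qed
  have init: "marked n (\<alpha> 0) (\<alpha> 1) (\<alpha> 2) (\<alpha> 3) (\<alpha> 4) m (\<alpha> 5) (found (\<alpha> 2) x (\<alpha> 6) 0) (\<alpha> 7) 0"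
    using part partnD(3)[OF part] by (auto simp: marked_def found_def M0 not_less)
  have "I (mk (\<rho>(10 := 0, 9 := 0)) \<alpha> \<beta>) (k - 4)"
    unfolding I_def using init k by (intro exI[of _ "\<rho>(10 := 0, 9 := 0)"] exI[of _ \<alpha>]) simp
  then have "wp (While (Less (Reg 9) (Reg 8)) (markstep x)) Q (mk (\<rho>(10 := 0, 9 := 0)) \<alpha> \<beta>) (k - 4)"
    by (rule While)
  then show ?thesis unfolding markloop_def
    by (intro wp_Seq_loopfree[of "Assign 10 (Num 0)" "k - 2"] wp_Seq_loopfree[of "Assign 9 (Num 0)" "k - 4"]) (use k in simp_all)
qed

lemma wp_relabel:
  assumes \<rho>: "\<rho> 7 = m" and uv: "\<alpha> 3 m = u" "\<alpha> 4 m = v" "u \<le> v"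
    and k: "ccost (Assign 19 (get 3 (Reg 7))) + ccost (Assign 20 (get 4 (Reg 7))) + 3
      + ccost (Assign 7 (Add (Reg 7) (Num 1))) + (v - u) * cost_relabel + k' \<le> k"
    and Q: "\<And>\<rho>'. (\<And>j. j \<notin> {7, 19, 20} \<Longrightarrow> \<rho>' j = \<rho> j) \<Longrightarrow> \<rho>' 7 = Suc m
      \<Longrightarrow> Q (mk \<rho>' (\<alpha>(2 := \<lambda>p. if p \<in> \<alpha> 0 ` {u..<v} then m else \<alpha> 2 p)) \<beta>) k'"
  shows "wp relabel Q (mk \<rho> \<alpha> \<beta>) k"
proof -
  let ?\<alpha> = "\<lambda>j. \<alpha>(2 := \<lambda>p. if p \<in> \<alpha> 0 ` {u..<j} then m else \<alpha> 2 p)"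
  let ?fin = "ccost (Assign 7 (Add (Reg 7) (Num 1)))"
  define I where "I s k \<longleftrightarrow> (\<exists>j. u \<le> j \<and> j \<le> v \<and> s = mk (\<rho>(19 := j, 20 := v)) (?\<alpha> j) \<beta>
     \<and> 3 + (v - j) * cost_relabel + ?fin + k' \<le> k)" for s k
  have While: "wp (While (Less (Reg 19) (Reg 20)) relabelstep) (wp (Assign 7 (Add (Reg 7) (Num 1))) Q) s k"
    if "I s k" for s k
    using that
  proof (rule wp_While)
    fix s k assume "I s k" and b: "bval (Less (Reg 19) (Reg 20)) s"
    then obtain j where j: "u \<le> j" "j \<le> v" "s = mk (\<rho>(19 := j, 20 := v)) (?\<alpha> j) \<beta>"
      "3 + (v - j) * cost_relabel + ?fin + k' \<le> k" unfolding I_def by blast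
    then have "j < v" using b by simp
    then have "v - j = Suc (v - Suc j)" by simp
    then have cr: "3 + (cost_relabel + (v - Suc j) * cost_relabel) + ?fin + k' \<le> k" using j(4) by simp
    have "(\<lambda>p. if p \<in> \<alpha> 0 ` {u..<Suc j} then m else \<alpha> 2 p) = (\<lambda>p. if p \<in> \<alpha> 0 ` {u..<j} then m else \<alpha> 2 p)(\<alpha> 0 j := m)"
      using j(1) by (auto simp: fun_eq_iff atLeastLessThanSuc)
    then have run: "run relabelstep s = mk (\<rho>(19 := Suc j, 20 := v)) (?\<alpha> (Suc j)) \<beta>"
      unfolding j(3) relabelstep_def by (simp add: \<rho> fun_upd_twist)
    have "I (run relabelstep s) (3 + (v - Suc j) * cost_relabel + ?fin + k')"
      unfolding run I_def using j(1) \<open>j < v\<close> by (intro exI[of _ "Suc j"]) simp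
    then show "\<exists>k'. bcost (Less (Reg 19) (Reg 20)) + k' \<le> k \<and> wp relabelstep I s k'"
      by (intro exI[of _ "k - 3"] conjI wp_loopfree[of _ "3 + (v - Suc j) * cost_relabel + ?fin + k'"])
        (use cr in \<open>simp_all add: cost_relabel_def\<close>)
  next
    fix s k assume "I s k" and b: "\<not> bval (Less (Reg 19) (Reg 20)) s"
    then obtain j where j: "u \<le> j" "j \<le> v" "s = mk (\<rho>(19 := j, 20 := v)) (?\<alpha> j) \<beta>"
      "3 + (v - j) * cost_relabel + ?fin + k' \<le> k" unfolding I_def by blast
    then have "j = v" using b by simp
    have "Q (mk (\<rho>(19 := v, 20 := v, 7 := Suc m)) (?\<alpha> v) \<beta>) k'" by (rule Q) simp_all
    then have "wp (Assign 7 (Add (Reg 7) (Num 1))) Q s (?fin + k')"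
      unfolding j(3) \<open>j = v\<close> by (intro wp_loopfree[of _ k']) (simp_all add: \<rho>)
    then show "\<exists>k'. bcost (Less (Reg 19) (Reg 20)) + k' \<le> k \<and> wp (Assign 7 (Add (Reg 7) (Num 1))) Q s k'"
      by (intro exI[of _ "?fin + k'"]) (use j(4) in simp)
  qed
  have "(\<lambda>p. if p \<in> \<alpha> 0 ` {u..<u} then m else \<alpha> 2 p) = \<alpha> 2" by simp
  then have a0: "?\<alpha> u = \<alpha>" by simp
  have "I (mk (\<rho>(19 := u, 20 := v)) \<alpha> \<beta>) (3 + (v - u) * cost_relabel + ?fin + k')"
    unfolding I_def by (rule exI[of _ u]) (use a0 uv in simp)
  from wp_Seq[OF While[OF this]] show ?thesis unfolding relabel_def
    by (intro wp_Seq_loopfree[of "Assign 19 (get 3 (Reg 7))" "k - ccost (Assign 19 (get 3 (Reg 7)))"]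
        wp_Seq_loopfree[of "Assign 20 (get 4 (Reg 7))" "3 + (v - u) * cost_relabel + ?fin + k'"])
      (use k uv in \<open>simp_all add: \<rho>\<close>)
qed


lemma run_newclass:
  assumes "\<rho> 7 = m" "\<rho> 12 = c" "c \<noteq> m" "\<alpha> 5 c < \<alpha> 4 c - \<alpha> 3 c" "0 < \<alpha> 5 c"
  shows "\<exists>\<rho>' u v b' e'. run newclass (mk \<rho> \<alpha> \<beta>) = mk \<rho>' (\<alpha>(3 := (\<alpha> 3)(m := u, c := b'), 4 := (\<alpha> 4)(m := v, c := e'))) \<beta>
    \<and> (u = \<alpha> 3 c \<and> v = \<alpha> 3 c + \<alpha> 5 c \<and> b' = \<alpha> 3 c + \<alpha> 5 c \<and> e' = \<alpha> 4 c
      \<or> b' = \<alpha> 3 c \<and> e' = \<alpha> 3 c + \<alpha> 5 c \<and> u = \<alpha> 3 c + \<alpha> 5 c \<and> v = \<alpha> 4 c)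
    \<and> 2 * (v - u) \<le> \<alpha> 4 c - \<alpha> 3 c \<and> (\<forall>j. j \<noteq> 13 \<longrightarrow> \<rho>' j = \<rho> j)"
proof (cases "\<alpha> 4 c - \<alpha> 3 c - \<alpha> 5 c < \<alpha> 5 c")
  case True
  let ?mid = "\<alpha> 3 c + \<alpha> 5 c"
  have "run newclass (mk \<rho> \<alpha> \<beta>) = mk (\<rho>(13 := ?mid))
      (\<alpha>(3 := (\<alpha> 3)(m := ?mid, c := \<alpha> 3 c), 4 := (\<alpha> 4)(m := \<alpha> 4 c, c := ?mid))) \<beta>"
    using True assms(1-3) by (simp add: newclass_def fun_upd_twist fun_upd_idem)
  then show ?thesis using True assms(4)
    by (intro exI[of _ "\<rho>(13 := ?mid)"] exI[of _ ?mid] exI[of _ "\<alpha> 4 c"] exI[of _ "\<alpha> 3 c"]) auto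
next
  case False
  let ?mid = "\<alpha> 3 c + \<alpha> 5 c"
  have "run newclass (mk \<rho> \<alpha> \<beta>) = mk (\<rho>(13 := ?mid))
      (\<alpha>(3 := (\<alpha> 3)(m := \<alpha> 3 c, c := ?mid), 4 := (\<alpha> 4)(m := ?mid, c := \<alpha> 4 c))) \<beta>"
    using False assms(1-3) by (simp add: newclass_def fun_upd_twist fun_upd_idem)
  then show ?thesis using False assms(4)
    by (intro exI[of _ "\<rho>(13 := ?mid)"] exI[of _ "\<alpha> 3 c"] exI[of _ ?mid] exI[of _ ?mid] exI[of _ "\<alpha> 4 c"]) auto
qed

text \<open>The fixed cost of a touched class comes from the deposits made while marking.
  Relabelling is paid by the potential: with \<open>a + cost_relabel\<close> for each halving,
  \<open>cost_relabel\<close> remains for every vertex of the new class after \<open>a\<close> is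
  set aside.\<close>

lemma wp_splitloop:
  assumes sp: "splitting n (\<alpha> 0) (\<alpha> 1) D0 m0 X (\<alpha> 2) (\<alpha> 3) (\<alpha> 4) m (\<alpha> 5) (\<alpha> 7) (\<rho> 10)"
    and \<rho>: "\<rho> 7 = m"
    and k: "3 + \<rho> 10 * cost_split + pot a (a + cost_relabel) n (\<alpha> 2) (\<alpha> 3) (\<alpha> 4) K + e \<le> k"
    and Q: "\<And>\<rho>' \<alpha>' m'. partn n (\<alpha> 0) (\<alpha> 1) (\<alpha>' 2) (\<alpha>' 3) (\<alpha>' 4) m' \<Longrightarrow> \<alpha>' 5 = (\<lambda>_. 0) \<Longrightarrow> \<rho>' 7 = m'
      \<Longrightarrow> refines n D0 m0 {X} (\<alpha>' 2) m'
      \<Longrightarrow> (\<And>j. j \<notin> {2, 3, 4, 5} \<Longrightarrow> \<alpha>' j = \<alpha> j) \<Longrightarrow> (\<And>j. j \<notin> {7, 10, 12, 13, 19, 20} \<Longrightarrow> \<rho>' j = \<rho> j)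
      \<Longrightarrow> Q (mk \<rho>' \<alpha>' \<beta>) (pot a (a + cost_relabel) n (\<alpha>' 2) (\<alpha>' 3) (\<alpha>' 4) K + e)"
  shows "wp splitloop Q (mk \<rho> \<alpha> \<beta>) k"
proof -
  let ?g = "a + cost_relabel"
  let ?b = "Less (get 5 (Reg 12)) (Sub (get 4 (Reg 12)) (get 3 (Reg 12)))"
  let ?set = "set 5 (Reg 12) (Num 0)"
  define I where "I s k \<longleftrightarrow> (\<exists>\<rho>' \<alpha>' m'. s = mk \<rho>' \<alpha>' \<beta> \<and> \<rho>' 7 = m'
     \<and> splitting n (\<alpha> 0) (\<alpha> 1) D0 m0 X (\<alpha>' 2) (\<alpha>' 3) (\<alpha>' 4) m' (\<alpha>' 5) (\<alpha> 7) (\<rho>' 10)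
     \<and> (\<forall>j. j \<notin> {2, 3, 4, 5} \<longrightarrow> \<alpha>' j = \<alpha> j) \<and> (\<forall>j. j \<notin> {7, 10, 12, 13, 19, 20} \<longrightarrow> \<rho>' j = \<rho> j)
     \<and> 3 + \<rho>' 10 * cost_split + pot a ?g n (\<alpha>' 2) (\<alpha>' 3) (\<alpha>' 4) K + e \<le> k)" for s k
  have "I (mk \<rho> \<alpha> \<beta>) k" unfolding I_def using assms by (intro exI[of _ \<rho>] exI[of _ \<alpha>] exI[of _ m]) simp
  then show ?thesis unfolding splitloop_def
  proof (rule wp_While)
    fix s k assume "I s k" and b: "bval (Less (Num 0) (Reg 10)) s"
    then obtain \<rho>1 \<alpha>1 m1 where s: "s = mk \<rho>1 \<alpha>1 \<beta>" "\<rho>1 7 = m1"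
      and sp1: "splitting n (\<alpha> 0) (\<alpha> 1) D0 m0 X (\<alpha>1 2) (\<alpha>1 3) (\<alpha>1 4) m1 (\<alpha>1 5) (\<alpha> 7) (\<rho>1 10)"
      and fr: "\<And>j. j \<notin> {2, 3, 4, 5} \<Longrightarrow> \<alpha>1 j = \<alpha> j" "\<And>j. j \<notin> {7, 10, 12, 13, 19, 20} \<Longrightarrow> \<rho>1 j = \<rho> j"
      and cr: "3 + \<rho>1 10 * cost_split + pot a ?g n (\<alpha>1 2) (\<alpha>1 3) (\<alpha>1 4) K + e \<le> k"
      unfolding I_def by blast
    obtain q where q: "\<rho>1 10 = Suc q" using b s by (cases "\<rho>1 10") auto
    define c where "c = \<alpha> 7 q"
    let ?\<rho> = "\<rho>1(10 := q, 12 := c)"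
    let ?pot = "pot a ?g n (\<alpha>1 2) (\<alpha>1 3) (\<alpha>1 4) K"
    have pop: "run poptouched s = mk ?\<rho> \<alpha>1 \<beta>" using fr(1)[of 7] q by (simp add: poptouched_def s c_def)
    note sp1 = sp1[unfolded q]
    have cm0: "c < m0" "m0 \<le> m1" "0 < \<alpha>1 5 c" "\<alpha>1 5 c \<le> \<alpha>1 4 c - \<alpha>1 3 c"
    proof -
      have "c \<in> \<alpha> 7 ` {..<Suc q}" by (simp add: c_def)
      then show "c < m0" "m0 \<le> m1" "0 < \<alpha>1 5 c" "\<alpha>1 5 c \<le> \<alpha>1 4 c - \<alpha>1 3 c" using sp1 unfolding splitting_def by blast+
    qed
    have part1: "partn n (\<alpha> 0) (\<alpha> 1) (\<alpha>1 2) (\<alpha>1 3) (\<alpha>1 4) m1" using sp1 unfolding splitting_def by blast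
    define kr where "kr = 3 + q * cost_split + e"
    have fin: "wp ?set I (mk \<rho>2 \<alpha>2 \<beta>) k2"
      if "splitting n (\<alpha> 0) (\<alpha> 1) D0 m0 X (\<alpha>2 2) (\<alpha>2 3) (\<alpha>2 4) (\<rho>2 7) ((\<alpha>2 5)(c := 0)) (\<alpha> 7) q"
        "\<rho>2 10 = q" "\<rho>2 12 = c" "\<And>j. j \<notin> {2, 3, 4, 5} \<Longrightarrow> \<alpha>2 j = \<alpha> j"
        "\<And>j. j \<notin> {7, 10, 12, 13, 19, 20} \<Longrightarrow> \<rho>2 j = \<rho> j"
        "ccost ?set + kr + pot a ?g n (\<alpha>2 2) (\<alpha>2 3) (\<alpha>2 4) K \<le> k2" for \<rho>2 \<alpha>2 k2
    proof (rule wp_loopfree[of _ "k2 - ccost ?set"])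
      have "run ?set (mk \<rho>2 \<alpha>2 \<beta>) = mk \<rho>2 (\<alpha>2(5 := (\<alpha>2 5)(c := 0))) \<beta>" using that(3) by simp
      then show "I (run ?set (mk \<rho>2 \<alpha>2 \<beta>)) (k2 - ccost ?set)"
        unfolding I_def using that by (intro exI[of _ \<rho>2] exI[of _ "\<alpha>2(5 := (\<alpha>2 5)(c := 0))"] exI[of _ "\<rho>2 7"]) (simp add: kr_def)
    qed (use that in simp_all)
    have cr2: "cost_split + kr + ?pot \<le> k" using cr q by (simp add: kr_def)
    have main: "wp (Cond ?b (Seq newclass relabel) Skip) (wp ?set I) (mk ?\<rho> \<alpha>1 \<beta>) (k - 3 - ccost poptouched)"
    proof (rule wp_Cond)
      show "bcost ?b + (k - 3 - ccost poptouched - bcost ?b) \<le> k - 3 - ccost poptouched"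
        using cr2 by (simp add: cost_split_def)
    next
      assume "\<not> bval ?b (mk ?\<rho> \<alpha>1 \<beta>)"
      then have "\<alpha>1 4 c - \<alpha>1 3 c \<le> \<alpha>1 5 c" by simp
      then have sk: "splitting n (\<alpha> 0) (\<alpha> 1) D0 m0 X (\<alpha>1 2) (\<alpha>1 3) (\<alpha>1 4) m1 ((\<alpha>1 5)(c := 0)) (\<alpha> 7) q"
        using splitting_skip[OF sp1] by (simp add: c_def)
      have skip: "wp ?set I (mk ?\<rho> \<alpha>1 \<beta>) (ccost ?set + kr + ?pot)"
        by (rule fin) (use sk s fr in simp_all)
      show "wp Skip (wp ?set I) (mk ?\<rho> \<alpha>1 \<beta>) (k - 3 - ccost poptouched - bcost ?b)"
        by (rule wp_loopfree[of Skip "ccost ?set + kr + ?pot"]) (use skip cr2 in \<open>simp_all add: cost_split_def\<close>)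
    next
      assume "bval ?b (mk ?\<rho> \<alpha>1 \<beta>)"
      then have mid: "\<alpha>1 5 c < \<alpha>1 4 c - \<alpha>1 3 c" by simp
      have "?\<rho> 7 = m1" "?\<rho> 12 = c" "c \<noteq> m1" using s cm0 by simp_all
      then obtain \<rho>2 u v b' e' where r2:
        "run newclass (mk ?\<rho> \<alpha>1 \<beta>) = mk \<rho>2 (\<alpha>1(3 := (\<alpha>1 3)(m1 := u, c := b'), 4 := (\<alpha>1 4)(m1 := v, c := e'))) \<beta>"
        and uv: "u = \<alpha>1 3 c \<and> v = \<alpha>1 3 c + \<alpha>1 5 c \<and> b' = \<alpha>1 3 c + \<alpha>1 5 c \<and> e' = \<alpha>1 4 c
          \<or> b' = \<alpha>1 3 c \<and> e' = \<alpha>1 3 c + \<alpha>1 5 c \<and> u = \<alpha>1 3 c + \<alpha>1 5 c \<and> v = \<alpha>1 4 c"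
        and half: "2 * (v - u) \<le> \<alpha>1 4 c - \<alpha>1 3 c" and fr2: "\<And>j. j \<noteq> 13 \<Longrightarrow> \<rho>2 j = ?\<rho> j"
        using run_newclass[of ?\<rho> m1 c \<alpha>1 \<beta>] mid cm0(3) by blast
      let ?\<alpha> = "\<alpha>1(3 := (\<alpha>1 3)(m1 := u, c := b'), 4 := (\<alpha>1 4)(m1 := v, c := e'))"
      let ?\<alpha>2 = "?\<alpha>(2 := \<lambda>p. if p \<in> ?\<alpha> 0 ` {u..<v} then m1 else ?\<alpha> 2 p)"
      have a0: "\<alpha>1 0 = \<alpha> 0" using fr(1) by simp
      note split = splitting_split[OF sp1 c_def mid uv]
      have uv': "u < v" "b' < e'" "u = \<alpha>1 3 c \<and> v = b' \<and> e' = \<alpha>1 4 c \<or> b' = \<alpha>1 3 c \<and> e' = u \<and> v = \<alpha>1 4 c"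
        using uv mid cm0(3) by auto
      have "c < m1" using cm0 by simp
      from pot_split[OF part1 this uv'(1,3,2) half order_refl, of a cost_relabel K]
      have pot: "pot a ?g n (?\<alpha>2 2) (?\<alpha>2 3) (?\<alpha>2 4) K + cost_relabel * (v - u) \<le> ?pot" by (simp add: a0 cong: if_cong)
      have rel: "wp relabel (wp ?set I) (mk \<rho>2 ?\<alpha> \<beta>) (k - 3 - ccost poptouched - bcost ?b - ccost newclass)"
      proof (rule wp_relabel[where m = m1 and u = u and v = v and k' = "ccost ?set + kr + pot a ?g n (?\<alpha>2 2) (?\<alpha>2 3) (?\<alpha>2 4) K"])
        show "\<rho>2 7 = m1" using fr2[of 7] s by simp
        show "?\<alpha> 3 m1 = u" "?\<alpha> 4 m1 = v" "u \<le> v" using \<open>c \<noteq> m1\<close> uv'(1) by simp_all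
        show "ccost (Assign 19 (get 3 (Reg 7))) + ccost (Assign 20 (get 4 (Reg 7))) + 3 + ccost (Assign 7 (Add (Reg 7) (Num 1)))
          + (v - u) * cost_relabel + (ccost ?set + kr + pot a ?g n (?\<alpha>2 2) (?\<alpha>2 3) (?\<alpha>2 4) K)
          \<le> k - 3 - ccost poptouched - bcost ?b - ccost newclass"
          using cr2 pot unfolding cost_split_def mult.commute[of "v - u"] by linarith
        fix \<rho>3 assume fr3: "\<And>j. j \<notin> {7, 19, 20} \<Longrightarrow> \<rho>3 j = \<rho>2 j" and r7: "\<rho>3 7 = Suc m1"
        show "wp ?set I (mk \<rho>3 ?\<alpha>2 \<beta>) (ccost ?set + kr + pot a ?g n (?\<alpha>2 2) (?\<alpha>2 3) (?\<alpha>2 4) K)"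
        proof (rule fin)
          show "splitting n (\<alpha> 0) (\<alpha> 1) D0 m0 X (?\<alpha>2 2) (?\<alpha>2 3) (?\<alpha>2 4) (\<rho>3 7) ((?\<alpha>2 5)(c := 0)) (\<alpha> 7) q"
            using split by (simp add: a0 r7 cong: if_cong)
        qed (use fr fr2 fr3 in simp_all)
      qed
      show "wp (Seq newclass relabel) (wp ?set I) (mk ?\<rho> \<alpha>1 \<beta>) (k - 3 - ccost poptouched - bcost ?b)"
        by (rule wp_Seq_loopfree[of newclass "k - 3 - ccost poptouched - bcost ?b - ccost newclass"])
          (use rel r2 cr2 in \<open>simp_all add: cost_split_def\<close>)
    qed
    show "\<exists>k'. bcost (Less (Num 0) (Reg 10)) + k' \<le> k \<and> wp splitstep I s k'"
      unfolding splitstep_def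
      by (intro exI[of _ "k - 3"] conjI wp_Seq_loopfree[of poptouched "k - 3 - ccost poptouched"])
        (use cr2 pop wp_Seq[OF main] in \<open>simp_all add: cost_split_def\<close>)
  next
    fix s k assume "I s k" and b: "\<not> bval (Less (Num 0) (Reg 10)) s"
    then obtain \<rho>1 \<alpha>1 m1 where s: "s = mk \<rho>1 \<alpha>1 \<beta>" "\<rho>1 7 = m1"
      and sp1: "splitting n (\<alpha> 0) (\<alpha> 1) D0 m0 X (\<alpha>1 2) (\<alpha>1 3) (\<alpha>1 4) m1 (\<alpha>1 5) (\<alpha> 7) (\<rho>1 10)"
      and fr: "\<And>j. j \<notin> {2, 3, 4, 5} \<Longrightarrow> \<alpha>1 j = \<alpha> j" "\<And>j. j \<notin> {7, 10, 12, 13, 19, 20} \<Longrightarrow> \<rho>1 j = \<rho> j"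
      and cr: "3 + \<rho>1 10 * cost_split + pot a ?g n (\<alpha>1 2) (\<alpha>1 3) (\<alpha>1 4) K + e \<le> k"
      unfolding I_def by blast
    have "\<rho>1 10 = 0" using b s by simp
    note f = splitting_final[OF sp1[unfolded this]]
    have "Q s (pot a ?g n (\<alpha>1 2) (\<alpha>1 3) (\<alpha>1 4) K + e)"
      unfolding s(1) by (rule Q[OF f(1,2) s(2) f(3) fr])
    then show "\<exists>k'. bcost (Less (Num 0) (Reg 10)) + k' \<le> k \<and> Q s k'"
      by (intro exI[of _ "pot a ?g n (\<alpha>1 2) (\<alpha>1 3) (\<alpha>1 4) K + e"]) (use cr in simp)
  qed
qed

end


text \<open>A number changes only inside a class that meets one of the splitting sets. These lie in
  the core, so pruned vertices keep their numbers, while changed numbers are at least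
  \<open>m0\<close> and hence at least \<open>t\<close>.\<close>

lemma refines_core:
  assumes "refines n D0 m0 Xs D m" "\<Union>Xs \<subseteq> C" "t \<le> m0" "\<And>p. p < n \<Longrightarrow> p \<in> C \<longleftrightarrow> t \<le> D0 p" "p < n"
  shows "p \<in> C \<longleftrightarrow> t \<le> D p"
proof (cases "D p = D0 p")
  case False
  then obtain q where q: "q < n" "D0 q = D0 p" "q \<in> \<Union>Xs" and "m0 \<le> D p"
    using assms(1,5) unfolding refines_def by blast
  then show ?thesis using assms(2,3) assms(4)[of p] assms(4)[of q] assms(5) by auto
qed (use assms(4,5) in simp)

section \<open>Treating one splitter, and the whole refinement\<close>

locale refine_core = refine_program L n \<tau> t + core_graph M C v
  for L n \<tau> t and M :: "(nat \<times> 'a letter \<times> nat) set" and C v +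
  fixes ls :: "'a letter list"
  assumes C_n: "C \<subseteq> {..<n}"
    and \<tau>_iff: "x < L \<Longrightarrow> p \<in> C \<Longrightarrow> s \<in> C \<Longrightarrow> \<tau> x p = Suc s \<longleftrightarrow> (p, ls ! x, s) \<in> M"
    and ls: "length ls = L" "List.set ls = UNIV"
begin

text \<open>The cost per member of a splitter. A class is never empty, so the fixed costs are
  charged to each member as well; 10 is the overhead for one letter, 7 for marking and 3 for the
  last guard of the splitting loop.\<close>

definition "cost_class = L * (10 + cost_mark + cost_split) + ccost copystep + 3
  + (ccost classinit + 3 + 1 + ccost (Assign 6 (Add (Reg 6) (Num 1))) + 3)"

abbreviation "pot' \<equiv> pot cost_class (cost_class + cost_relabel) n"

text \<open>The classes below \<open>t\<close> are those of the pruned vertices. They are singletons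
  and never serve as splitters, since the queue pointer \<open>\<rho> 6\<close> is at least
  \<open>t\<close>.\<close>

definition RI :: "(nat \<Rightarrow> nat) \<Rightarrow> (nat \<Rightarrow> nat \<Rightarrow> nat) \<Rightarrow> bool" where
  "RI \<rho> \<alpha> \<longleftrightarrow> partn n (\<alpha> 0) (\<alpha> 1) (\<alpha> 2) (\<alpha> 3) (\<alpha> 4) (\<rho> 7) \<and> \<alpha> 5 = (\<lambda>_. 0) \<and> tab \<alpha> \<and> \<rho> 5 = t
     \<and> t \<le> \<rho> 6 \<and> \<rho> 6 \<le> \<rho> 7 \<and> (\<forall>p<n. p \<in> C \<longleftrightarrow> t \<le> \<alpha> 2 p)
     \<and> (\<forall>p<n. \<forall>q<n. \<alpha> 2 p < t \<longrightarrow> \<alpha> 2 p = \<alpha> 2 q \<longrightarrow> p = q) \<and> sound (\<alpha> 2) \<and> processed (\<alpha> 2) (\<rho> 6)"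

lemma wp_copy:
  assumes \<rho>: "\<rho> 8 = sz" "\<rho> 6 = k0" "\<rho> 9 = 0" and k: "3 + sz * (ccost copystep + 3) + k' \<le> k"
    and Q: "\<And>\<rho>' S. (\<And>j. j \<noteq> 9 \<Longrightarrow> \<rho>' j = \<rho> j) \<Longrightarrow> (\<And>j. j < sz \<Longrightarrow> S j = \<alpha> 0 (\<alpha> 3 k0 + j)) \<Longrightarrow> Q (mk \<rho>' (\<alpha>(6 := S)) \<beta>) k'"
  shows "wp (While (Less (Reg 9) (Reg 8)) copystep) Q (mk \<rho> \<alpha> \<beta>) k"
proof -
  define I where "I s k \<longleftrightarrow> (\<exists>i S. i \<le> sz \<and> s = mk (\<rho>(9 := i)) (\<alpha>(6 := S)) \<beta>
     \<and> (\<forall>j<i. S j = \<alpha> 0 (\<alpha> 3 k0 + j)) \<and> 3 + (sz - i) * (ccost copystep + 3) + k' \<le> k)" for s k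
  have "I (mk \<rho> \<alpha> \<beta>) k" unfolding I_def
    by (rule exI[of _ 0], rule exI[of _ "\<alpha> 6"]) (use k \<rho> fun_upd_triv[of \<rho> 9] in simp)
  then show ?thesis
  proof (rule wp_While)
    fix s k assume "I s k" and b: "bval (Less (Reg 9) (Reg 8)) s"
    then obtain i S where i: "i \<le> sz" "s = mk (\<rho>(9 := i)) (\<alpha>(6 := S)) \<beta>"
      "\<forall>j<i. S j = \<alpha> 0 (\<alpha> 3 k0 + j)" "3 + (sz - i) * (ccost copystep + 3) + k' \<le> k" unfolding I_def by blast
    have "i < sz" using b i(2) \<rho> by simp
    then have "sz - i = Suc (sz - Suc i)" by simp
    then have cr: "3 + (ccost copystep + 3) + (sz - Suc i) * (ccost copystep + 3) + k' \<le> k" using i(4) by simp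
    have run: "run copystep s = mk (\<rho>(9 := Suc i)) (\<alpha>(6 := S(i := \<alpha> 0 (\<alpha> 3 k0 + i)))) \<beta>"
      unfolding i(2) copystep_def using \<rho> by simp
    have "I (run copystep s) (3 + (sz - Suc i) * (ccost copystep + 3) + k')" unfolding run I_def
      using i \<open>i < sz\<close> by (intro exI[of _ "Suc i"] exI[of _ "S(i := \<alpha> 0 (\<alpha> 3 k0 + i))"]) (simp add: less_Suc_eq)
    then show "\<exists>k'. bcost (Less (Reg 9) (Reg 8)) + k' \<le> k \<and> wp copystep I s k'"
      by (intro exI[of _ "k - 3"] conjI wp_loopfree[of _ "3 + (sz - Suc i) * (ccost copystep + 3) + k'"]) (use cr in simp_all)
  next
    fix s k assume "I s k" and b: "\<not> bval (Less (Reg 9) (Reg 8)) s"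
    then obtain i S where i: "i \<le> sz" "s = mk (\<rho>(9 := i)) (\<alpha>(6 := S)) \<beta>"
      "\<forall>j<i. S j = \<alpha> 0 (\<alpha> 3 k0 + j)" "3 + (sz - i) * (ccost copystep + 3) + k' \<le> k" unfolding I_def by blast
    have "i = sz" using b i(1,2) \<rho> by simp
    then have "Q s k'" unfolding i(2) using i(3) by (intro Q) simp_all
    then show "\<exists>k'. bcost (Less (Reg 9) (Reg 8)) + k' \<le> k \<and> Q s k'" using i(4) by (intro exI[of _ k']) simp
  qed
qed

lemma wp_classstep:
  assumes RI: "RI \<rho> \<alpha>" and lt: "\<rho> 6 < \<rho> 7"
    and k: "pot' (\<alpha> 2) (\<alpha> 3) (\<alpha> 4) (\<rho> 6) + e \<le> k"
    and Q: "\<And>\<rho>' \<alpha>'. RI \<rho>' \<alpha>' \<Longrightarrow> (\<And>j. j \<in> {2, 3, 4, 21} \<Longrightarrow> \<rho>' j = \<rho> j)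
      \<Longrightarrow> Q (mk \<rho>' \<alpha>' \<beta>) (3 + pot' (\<alpha>' 2) (\<alpha>' 3) (\<alpha>' 4) (\<rho>' 6) + e)"
  shows "wp classstep Q (mk \<rho> \<alpha> \<beta>) k"
proof -
  define k0 m0 where "k0 = \<rho> 6" and "m0 = \<rho> 7"
  have part: "partn n (\<alpha> 0) (\<alpha> 1) (\<alpha> 2) (\<alpha> 3) (\<alpha> 4) m0" and M0: "\<alpha> 5 = (\<lambda>_. 0)" and tab: "tab \<alpha>" and t: "\<rho> 5 = t" "t \<le> k0"
    and Cc: "\<And>p. p < n \<Longrightarrow> p \<in> C \<longleftrightarrow> t \<le> \<alpha> 2 p"
    and inj: "\<And>p q. p < n \<Longrightarrow> q < n \<Longrightarrow> \<alpha> 2 p < t \<Longrightarrow> \<alpha> 2 p = \<alpha> 2 q \<Longrightarrow> p = q"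
    and snd: "sound (\<alpha> 2)" and proc: "processed (\<alpha> 2) k0"
    using RI unfolding RI_def k0_def m0_def by blast+
  note pd = partnD[OF part]
  have km: "k0 < m0" using lt by (simp add: k0_def m0_def)
  define sz where "sz = \<alpha> 4 k0 - \<alpha> 3 k0"
  have sz: "0 < sz" using pd(5)[OF km] by (simp add: sz_def)
  let ?inc = "Assign 6 (Add (Reg 6) (Num 1))"
  define lc where "lc = 10 + sz * (cost_mark + cost_split)"
  define fx where "fx = ccost ?inc + 3 + e"
  have cost: "ccost classinit + (3 + sz * (ccost copystep + 3)) + (L * lc + 1) + fx + pot' (\<alpha> 2) (\<alpha> 3) (\<alpha> 4) (Suc k0) \<le> k"
  proof -
    \<comment> \<open>Fixed costs are multiplied by the size of the splitter, which is at least
      one.\<close>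
    have "L * 10 \<le> L * 10 * sz" using sz by simp
    then have "L * lc \<le> L * (10 + cost_mark + cost_split) * sz" by (simp add: lc_def algebra_simps)
    moreover have "ccost classinit + 3 + 1 + ccost ?inc + 3 \<le> (ccost classinit + 3 + 1 + ccost ?inc + 3) * sz"
      using sz by (metis Suc_leI One_nat_def mult.right_neutral mult_le_mono2)
    ultimately have "ccost classinit + (3 + sz * (ccost copystep + 3)) + (L * lc + 1) + ccost ?inc + 3 \<le> cost_class * sz"
      unfolding cost_class_def by (simp only: add_mult_distrib mult.commute[of sz])
    moreover have "pot' (\<alpha> 2) (\<alpha> 3) (\<alpha> 4) (Suc k0) + cost_class * sz \<le> pot' (\<alpha> 2) (\<alpha> 3) (\<alpha> 4) k0"
      unfolding sz_def by (rule pot_Suc[OF part km])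
    ultimately show ?thesis using k unfolding fx_def k0_def by linarith
  qed
  \<comment> \<open>All splitting sets refer to the partition found when this splitter was taken up,
    although the classes change from letter to letter.\<close>
  define Xs where "Xs x = (\<lambda>y. preds (\<alpha> 2) k0 (ls ! y)) ` {..<x}" for x
  have Xs_C: "\<Union>(Xs x) \<subseteq> C" for x unfolding Xs_def preds_def using M_C by blast
  define I where "I x s k \<longleftrightarrow> (\<exists>\<rho>1 \<alpha>1. s = mk \<rho>1 \<alpha>1 \<beta> \<and> partn n (\<alpha>1 0) (\<alpha>1 1) (\<alpha>1 2) (\<alpha>1 3) (\<alpha>1 4) (\<rho>1 7)
     \<and> \<alpha>1 5 = (\<lambda>_. 0) \<and> tab \<alpha>1 \<and> (\<forall>j<sz. \<alpha>1 6 j = \<alpha> 0 (\<alpha> 3 k0 + j)) \<and> \<rho>1 8 = sz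
     \<and> (\<forall>j\<in>{2, 3, 4, 5, 6, 21}. \<rho>1 j = \<rho> j) \<and> refines n (\<alpha> 2) m0 (Xs x) (\<alpha>1 2) (\<rho>1 7)
     \<and> (L - x) * lc + 1 + fx + pot' (\<alpha>1 2) (\<alpha>1 3) (\<alpha>1 4) (Suc k0) \<le> k)" for x s k
  have letters: "wp (seqs (map (\<lambda>x. Seq (markloop x) splitloop) [0..<L])) (wp ?inc Q) s k" if "I 0 s k" for s k
    using that
  proof (rule wp_seqs)
    fix x s k assume x: "x < L" and "I x s k"
    then obtain \<rho>1 \<alpha>1 where s: "s = mk \<rho>1 \<alpha>1 \<beta>" and part1: "partn n (\<alpha>1 0) (\<alpha>1 1) (\<alpha>1 2) (\<alpha>1 3) (\<alpha>1 4) (\<rho>1 7)"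
      and M1: "\<alpha>1 5 = (\<lambda>_. 0)" and tab1: "tab \<alpha>1" and S: "\<And>j. j < sz \<Longrightarrow> \<alpha>1 6 j = \<alpha> 0 (\<alpha> 3 k0 + j)" and r8: "\<rho>1 8 = sz"
      and fr: "\<And>j. j \<in> {2, 3, 4, 5, 6, 21} \<Longrightarrow> \<rho>1 j = \<rho> j" and ref: "refines n (\<alpha> 2) m0 (Xs x) (\<alpha>1 2) (\<rho>1 7)"
      and cr: "(L - x) * lc + 1 + fx + pot' (\<alpha>1 2) (\<alpha>1 3) (\<alpha>1 4) (Suc k0) \<le> k" unfolding I_def by blast
    have le: "\<alpha> 3 k0 + j < \<alpha> 4 k0" if "j < sz" for j using that by (simp add: sz_def)
    have len: "\<alpha> 3 k0 + j < n" if "j < sz" for j using le[OF that] pd(6)[OF km] by simp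
    have Sn: "\<alpha>1 6 ` {..<sz} \<subseteq> {..<n}" using S len pd(8) by auto
    have Sinj: "inj_on (\<alpha>1 6) {..<sz}"
    proof (rule inj_onI)
      fix i j assume ij: "i \<in> {..<sz}" "j \<in> {..<sz}" "\<alpha>1 6 i = \<alpha>1 6 j"
      then have "\<alpha> 1 (\<alpha> 0 (\<alpha> 3 k0 + i)) = \<alpha> 1 (\<alpha> 0 (\<alpha> 3 k0 + j))" using S by simp
      then show "i = j" using pd(9)[OF len] ij(1,2) by simp
    qed
    have C1: "p \<in> C \<longleftrightarrow> t \<le> \<alpha>1 2 p" if "p < n" for p
      by (rule refines_core[OF ref Xs_C _ Cc that]) (use t km in simp)
    \<comment> \<open>The copy in array 6 still lists the splitter as it was at the beginning,
      however it has been split since.\<close>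
    have snap: "(\<exists>j<sz. \<alpha>1 6 j = s) \<longleftrightarrow> s \<in> C \<and> \<alpha> 2 s = k0" for s
    proof
      assume "\<exists>j<sz. \<alpha>1 6 j = s"
      then obtain j where j: "j < sz" "s = \<alpha> 0 (\<alpha> 3 k0 + j)" using S by auto
      then have "\<alpha> 2 s = k0" "s < n" using pd(7)[OF km, of "\<alpha> 3 k0 + j"] le[OF j(1)] pd(8)[OF len[OF j(1)]] by simp_all
      then show "s \<in> C \<and> \<alpha> 2 s = k0" using Cc t by simp
    next
      assume *: "s \<in> C \<and> \<alpha> 2 s = k0"
      then have sn: "s < n" using C_n by auto
      have "\<alpha> 3 k0 \<le> \<alpha> 1 s" "\<alpha> 1 s < \<alpha> 4 k0" using pd(3,4)[OF sn] * by simp_all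
      then have "\<alpha> 1 s - \<alpha> 3 k0 < sz" "\<alpha> 0 (\<alpha> 3 k0 + (\<alpha> 1 s - \<alpha> 3 k0)) = s" using pd(11)[OF sn] by (simp_all add: sz_def)
      then show "\<exists>j<sz. \<alpha>1 6 j = s" using S by metis
    qed
    \<comment> \<open>The table also contains the moves into the tail, which are absent from
      \<open>M\<close>; the comparison with \<open>t\<close> discards them.\<close>
    have found: "found (\<alpha>1 2) x (\<alpha>1 6) sz = preds (\<alpha> 2) k0 (ls ! x)"
    proof (intro equalityI subsetI)
      fix p assume "p \<in> found (\<alpha>1 2) x (\<alpha>1 6) sz"
      then obtain j where p: "p < n" "t \<le> \<alpha>1 2 p" "j < sz" "\<tau> x (\<alpha>1 6 j) = Suc p" by (auto simp: found_def)
      then have "p \<in> C" "\<alpha>1 6 j \<in> C \<and> \<alpha> 2 (\<alpha>1 6 j) = k0" using C1 snap by blast+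
      then show "p \<in> preds (\<alpha> 2) k0 (ls ! x)" using \<tau>_iff[OF x, of "\<alpha>1 6 j" p] p(4) by (auto simp: preds_def)
    next
      fix p assume "p \<in> preds (\<alpha> 2) k0 (ls ! x)"
      then obtain s where s: "(s, ls ! x, p) \<in> M" "\<alpha> 2 s = k0" by (auto simp: preds_def)
      then have sp: "s \<in> C" "p \<in> C" using M_C by blast+
      then obtain j where "j < sz" "\<alpha>1 6 j = s" using snap s(2) by blast
      then show "p \<in> found (\<alpha>1 2) x (\<alpha>1 6) sz"
        using \<tau>_iff[OF x sp] s(1) sp C_n C1[of p] by (auto simp: found_def)
    qed
    have "L - x = Suc (L - Suc x)" using x by simp
    then have cr1: "lc + (L - Suc x) * lc + 1 + fx + pot' (\<alpha>1 2) (\<alpha>1 3) (\<alpha>1 4) (Suc k0) \<le> k" using cr by simp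
    show "wp (Seq (markloop x) splitloop) (I (Suc x)) s k" unfolding s
    proof (rule wp_Seq, rule wp_markloop[where \<alpha> = \<alpha>1 and \<rho> = \<rho>1 and c = cost_split
        and k' = "3 + (L - Suc x) * lc + 1 + fx + pot' (\<alpha>1 2) (\<alpha>1 3) (\<alpha>1 4) (Suc k0)",
        OF x part1 M1 tab1 _ r8 Sinj Sn])
      show "\<rho>1 5 = t" using fr t by simp
      show "7 + sz * (cost_mark + cost_split) + (3 + (L - Suc x) * lc + 1 + fx + pot' (\<alpha>1 2) (\<alpha>1 3) (\<alpha>1 4) (Suc k0)) \<le> k"
        using cr1 by (simp add: lc_def)
      fix \<rho>2 \<alpha>2
      assume mk: "marked n (\<alpha>2 0) (\<alpha>2 1) (\<alpha>1 2) (\<alpha>1 3) (\<alpha>1 4) (\<rho>1 7) (\<alpha>2 5) (found (\<alpha>1 2) x (\<alpha>1 6) sz) (\<alpha>2 7) (\<rho>2 10)"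
        and fra: "\<And>j. j \<notin> {0, 1, 5, 7} \<Longrightarrow> \<alpha>2 j = \<alpha>1 j" and frr: "\<And>j. j \<notin> {9, 10, 11, 12, 13, 14, 15} \<Longrightarrow> \<rho>2 j = \<rho>1 j"
      have a2: "\<alpha>2 2 = \<alpha>1 2" "\<alpha>2 3 = \<alpha>1 3" "\<alpha>2 4 = \<alpha>1 4" "\<rho>2 7 = \<rho>1 7" using fra frr by simp_all
      note spl = splitting_init[OF mk, unfolded found, folded a2]
      show "wp splitloop (I (Suc x)) (mk \<rho>2 \<alpha>2 \<beta>)
          (3 + (L - Suc x) * lc + 1 + fx + pot' (\<alpha>1 2) (\<alpha>1 3) (\<alpha>1 4) (Suc k0) + \<rho>2 10 * cost_split)"
      proof (rule wp_splitloop[where \<alpha> = \<alpha>2 and \<rho> = \<rho>2 and e = "(L - Suc x) * lc + 1 + fx" and K = "Suc k0"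
          and a = cost_class, OF spl HOL.refl])
        show "3 + \<rho>2 10 * cost_split + pot' (\<alpha>2 2) (\<alpha>2 3) (\<alpha>2 4) (Suc k0) + ((L - Suc x) * lc + 1 + fx)
          \<le> 3 + (L - Suc x) * lc + 1 + fx + pot' (\<alpha>1 2) (\<alpha>1 3) (\<alpha>1 4) (Suc k0) + \<rho>2 10 * cost_split" by (simp add: a2)
        fix \<rho>3 \<alpha>3 m3
        assume 3: "partn n (\<alpha>2 0) (\<alpha>2 1) (\<alpha>3 2) (\<alpha>3 3) (\<alpha>3 4) m3" "\<alpha>3 5 = (\<lambda>_. 0)" "\<rho>3 7 = m3"
          "refines n (\<alpha>2 2) (\<rho>2 7) {preds (\<alpha> 2) k0 (ls ! x)} (\<alpha>3 2) m3"
          and fra3: "\<And>j. j \<notin> {2, 3, 4, 5} \<Longrightarrow> \<alpha>3 j = \<alpha>2 j" and frr3: "\<And>j. j \<notin> {7, 10, 12, 13, 19, 20} \<Longrightarrow> \<rho>3 j = \<rho>2 j"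
        have "refines n (\<alpha> 2) m0 (Xs (Suc x)) (\<alpha>3 2) (\<rho>3 7)"
          using refines_trans[OF ref] 3(3,4) a2 by (simp add: Xs_def lessThan_Suc)
        moreover have "partn n (\<alpha>3 0) (\<alpha>3 1) (\<alpha>3 2) (\<alpha>3 3) (\<alpha>3 4) (\<rho>3 7)" using 3(1,3) fra3[of 0] fra3[of 1] by simp
        moreover have "tab \<alpha>3" using tab1 fra fra3 by (simp add: tab_def)
        moreover have "\<forall>j<sz. \<alpha>3 6 j = \<alpha> 0 (\<alpha> 3 k0 + j)" using S fra fra3 by simp
        moreover have "\<rho>3 8 = sz" "\<forall>j\<in>{2, 3, 4, 5, 6, 21}. \<rho>3 j = \<rho> j" using r8 fr frr frr3 by auto
        ultimately show "I (Suc x) (mk \<rho>3 \<alpha>3 \<beta>) (pot' (\<alpha>3 2) (\<alpha>3 3) (\<alpha>3 4) (Suc k0) + ((L - Suc x) * lc + 1 + fx))"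
          unfolding I_def using 3(2) by (intro exI[of _ \<rho>3] exI[of _ \<alpha>3]) simp
      qed
    qed
  next
    fix s k assume "I L s k"
    then obtain \<rho>1 \<alpha>1 where s: "s = mk \<rho>1 \<alpha>1 \<beta>" and part1: "partn n (\<alpha>1 0) (\<alpha>1 1) (\<alpha>1 2) (\<alpha>1 3) (\<alpha>1 4) (\<rho>1 7)"
      and M1: "\<alpha>1 5 = (\<lambda>_. 0)" and tab1: "tab \<alpha>1"
      and fr: "\<And>j. j \<in> {2, 3, 4, 5, 6, 21} \<Longrightarrow> \<rho>1 j = \<rho> j" and ref: "refines n (\<alpha> 2) m0 (Xs L) (\<alpha>1 2) (\<rho>1 7)"
      and cr: "1 + fx + pot' (\<alpha>1 2) (\<alpha>1 3) (\<alpha>1 4) (Suc k0) \<le> k" unfolding I_def by auto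
    have C1: "p \<in> C \<longleftrightarrow> t \<le> \<alpha>1 2 p" if "p < n" for p
      by (rule refines_core[OF ref Xs_C _ Cc that]) (use t km in simp)
    have all: "(\<forall>X\<in>Xs L. p \<in> X \<longleftrightarrow> q \<in> X) \<longleftrightarrow> (\<forall>x. p \<in> preds (\<alpha> 2) k0 x \<longleftrightarrow> q \<in> preds (\<alpha> 2) k0 x)" for p q
    proof -
      have "Xs L = preds (\<alpha> 2) k0 ` List.set ls"
        unfolding Xs_def ls(1)[symmetric] set_conv_nth by (auto simp: image_iff)
      then show ?thesis by (simp add: ls(2))
    qed
    have "sound (\<alpha>1 2)" "processed (\<alpha>1 2) (Suc k0)"
    proof -
      have ch: "m0 \<le> \<alpha>1 2 p" if "p \<in> C" "\<alpha>1 2 p \<noteq> \<alpha> 2 p" for p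
        using ref that C_n unfolding refines_def by blast
      have eq: "\<alpha>1 2 p = \<alpha>1 2 q \<longleftrightarrow> \<alpha> 2 p = \<alpha> 2 q \<and> (\<forall>x. p \<in> preds (\<alpha> 2) k0 x \<longleftrightarrow> q \<in> preds (\<alpha> 2) k0 x)"
        if "p \<in> C" "q \<in> C" for p q
      proof -
        have "p < n" "q < n" using that C_n by auto
        then show ?thesis using ref unfolding refines_def all by blast
      qed
      show "sound (\<alpha>1 2)" "processed (\<alpha>1 2) (Suc k0)" using processed_step[OF snd proc km ch eq] by blast+
    qed
    moreover have "p = q" if pq: "p < n" "q < n" "\<alpha>1 2 p < t" "\<alpha>1 2 p = \<alpha>1 2 q" for p q
    proof -
      have "\<alpha> 2 p = \<alpha> 2 q" using ref pq unfolding refines_def by blast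
      moreover have "\<alpha> 2 p < t" using C1[OF pq(1)] Cc[OF pq(1)] pq(3) by simp
      ultimately show ?thesis using inj pq(1,2) by blast
    qed
    moreover have "m0 \<le> \<rho>1 7" using ref by (simp add: refines_def)
    ultimately have "RI (\<rho>1(6 := Suc k0)) \<alpha>1"
      unfolding RI_def using part1 M1 tab1 C1 t km fr[of 5] by simp
    then have "Q (mk (\<rho>1(6 := Suc k0)) \<alpha>1 \<beta>) (3 + pot' (\<alpha>1 2) (\<alpha>1 3) (\<alpha>1 4) ((\<rho>1(6 := Suc k0)) 6) + e)"
    proof (rule Q)
      fix j :: nat assume "j \<in> {2, 3, 4, 21}"
      then show "(\<rho>1(6 := Suc k0)) j = \<rho> j" using fr[of j] by auto
    qed
    moreover have "run ?inc s = mk (\<rho>1(6 := Suc k0)) \<alpha>1 \<beta>" using fr[of 6] by (simp add: s k0_def)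
    ultimately have "wp ?inc Q s (fx + pot' (\<alpha>1 2) (\<alpha>1 3) (\<alpha>1 4) (Suc k0))"
      by (intro wp_loopfree[of ?inc "3 + pot' (\<alpha>1 2) (\<alpha>1 3) (\<alpha>1 4) (Suc k0) + e"]) (simp_all add: fx_def)
    then show "\<exists>k'. 1 + k' \<le> k \<and> wp ?inc Q s k'" using cr by (intro exI[of _ "fx + pot' (\<alpha>1 2) (\<alpha>1 3) (\<alpha>1 4) (Suc k0)"]) simp
  qed
  show ?thesis unfolding classstep_def
  proof (rule wp_Seq_loopfree[of classinit "k - ccost classinit"])
    have run: "run classinit (mk \<rho> \<alpha> \<beta>) = mk (\<rho>(8 := sz, 9 := 0)) \<alpha> \<beta>" by (simp add: classinit_def sz_def k0_def)
    show "wp (Seq (While (Less (Reg 9) (Reg 8)) copystep) (Seq (seqs (map (\<lambda>x. Seq (markloop x) splitloop) [0..<L])) ?inc)) Q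
       (run classinit (mk \<rho> \<alpha> \<beta>)) (k - ccost classinit)" unfolding run
    proof (rule wp_Seq, rule wp_copy[where k' = "L * lc + 1 + fx + pot' (\<alpha> 2) (\<alpha> 3) (\<alpha> 4) (Suc k0)"])
      show "3 + sz * (ccost copystep + 3) + (L * lc + 1 + fx + pot' (\<alpha> 2) (\<alpha> 3) (\<alpha> 4) (Suc k0)) \<le> k - ccost classinit"
        using cost by linarith
      show "(\<rho>(8 := sz, 9 := 0)) 6 = k0" by (simp add: k0_def)
      fix \<rho>' S assume fr: "\<And>j. j \<noteq> 9 \<Longrightarrow> \<rho>' j = (\<rho>(8 := sz, 9 := 0)) j" and S: "\<And>j. j < sz \<Longrightarrow> S j = \<alpha> 0 (\<alpha> 3 k0 + j)"
      have tab': "tab (\<alpha>(6 := S))" using tab by (simp add: tab_def)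
      have "I 0 (mk \<rho>' (\<alpha>(6 := S)) \<beta>) (L * lc + 1 + fx + pot' (\<alpha> 2) (\<alpha> 3) (\<alpha> 4) (Suc k0))"
        unfolding I_def using part M0 tab' S fr refines_refl[of n "\<alpha> 2" m0]
        by (intro exI[of _ \<rho>'] exI[of _ "\<alpha>(6 := S)"]) (simp add: m0_def Xs_def)
      from letters[OF this] show "wp (Seq (seqs (map (\<lambda>x. Seq (markloop x) splitloop) [0..<L])) ?inc) Q (mk \<rho>' (\<alpha>(6 := S)) \<beta>)
          (L * lc + 1 + fx + pot' (\<alpha> 2) (\<alpha> 3) (\<alpha> 4) (Suc k0))" by (rule wp_Seq)
    qed simp_all
  qed (use cost in simp_all)
qed

lemma wp_refine:
  assumes RI: "RI \<rho> \<alpha>" and k: "3 + pot' (\<alpha> 2) (\<alpha> 3) (\<alpha> 4) (\<rho> 6) + e \<le> k"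
    and Q: "\<And>\<rho>' \<alpha>'. partn n (\<alpha>' 0) (\<alpha>' 1) (\<alpha>' 2) (\<alpha>' 3) (\<alpha>' 4) (\<rho>' 7) \<Longrightarrow> tab \<alpha>'
      \<Longrightarrow> (\<And>p q. p < n \<Longrightarrow> q < n \<Longrightarrow> \<alpha>' 2 p = \<alpha>' 2 q \<longleftrightarrow> p = q \<or> p \<in> C \<and> q \<in> C \<and> lang M p = lang M q)
      \<Longrightarrow> (\<And>j. j \<in> {2, 3, 4, 21} \<Longrightarrow> \<rho>' j = \<rho> j) \<Longrightarrow> Q (mk \<rho>' \<alpha>' \<beta>) e"
  shows "wp refine Q (mk \<rho> \<alpha> \<beta>) k"
proof -
  define I where "I s k \<longleftrightarrow> (\<exists>\<rho>' \<alpha>'. s = mk \<rho>' \<alpha>' \<beta> \<and> RI \<rho>' \<alpha>' \<and> (\<forall>j\<in>{2, 3, 4, 21}. \<rho>' j = \<rho> j)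
     \<and> 3 + pot' (\<alpha>' 2) (\<alpha>' 3) (\<alpha>' 4) (\<rho>' 6) + e \<le> k)" for s k
  have "I (mk \<rho> \<alpha> \<beta>) k" unfolding I_def using assms by (intro exI[of _ \<rho>] exI[of _ \<alpha>]) simp
  then show ?thesis unfolding refine_def
  proof (rule wp_While)
    fix s k assume "I s k" and b: "bval (Less (Reg 6) (Reg 7)) s"
    then obtain \<rho>' \<alpha>' where s: "s = mk \<rho>' \<alpha>' \<beta>" "RI \<rho>' \<alpha>'" "\<And>j. j \<in> {2, 3, 4, 21} \<Longrightarrow> \<rho>' j = \<rho> j"
      "3 + pot' (\<alpha>' 2) (\<alpha>' 3) (\<alpha>' 4) (\<rho>' 6) + e \<le> k" unfolding I_def by blast
    have "\<rho>' 6 < \<rho>' 7" using b s(1) by simp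
    have "wp classstep I s (k - 3)" unfolding s(1)
    proof (rule wp_classstep[OF s(2) \<open>\<rho>' 6 < \<rho>' 7\<close>, where e = e])
      show "pot' (\<alpha>' 2) (\<alpha>' 3) (\<alpha>' 4) (\<rho>' 6) + e \<le> k - 3" using s(4) by simp
      fix \<rho>2 \<alpha>2 assume "RI \<rho>2 \<alpha>2" "\<And>j. j \<in> {2, 3, 4, 21} \<Longrightarrow> \<rho>2 j = \<rho>' j"
      then show "I (mk \<rho>2 \<alpha>2 \<beta>) (3 + pot' (\<alpha>2 2) (\<alpha>2 3) (\<alpha>2 4) (\<rho>2 6) + e)"
        unfolding I_def using s(3) by (intro exI[of _ \<rho>2] exI[of _ \<alpha>2]) simp
    qed
    then show "\<exists>k'. bcost (Less (Reg 6) (Reg 7)) + k' \<le> k \<and> wp classstep I s k'"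
      using s(4) by (intro exI[of _ "k - 3"]) simp
  next
    fix s k assume "I s k" and b: "\<not> bval (Less (Reg 6) (Reg 7)) s"
    then obtain \<rho>' \<alpha>' where s: "s = mk \<rho>' \<alpha>' \<beta>" "RI \<rho>' \<alpha>'" "\<And>j. j \<in> {2, 3, 4, 21} \<Longrightarrow> \<rho>' j = \<rho> j"
      "3 + pot' (\<alpha>' 2) (\<alpha>' 3) (\<alpha>' 4) (\<rho>' 6) + e \<le> k" unfolding I_def by blast
    have R: "partn n (\<alpha>' 0) (\<alpha>' 1) (\<alpha>' 2) (\<alpha>' 3) (\<alpha>' 4) (\<rho>' 7)" "tab \<alpha>'" "\<rho>' 6 \<le> \<rho>' 7" "sound (\<alpha>' 2)" "processed (\<alpha>' 2) (\<rho>' 6)"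
      and Cc: "\<And>p. p < n \<Longrightarrow> p \<in> C \<longleftrightarrow> t \<le> \<alpha>' 2 p"
      and inj: "\<And>p q. p < n \<Longrightarrow> q < n \<Longrightarrow> \<alpha>' 2 p < t \<Longrightarrow> \<alpha>' 2 p = \<alpha>' 2 q \<Longrightarrow> p = q"
      using s(2) unfolding RI_def by blast+
    have eq: "\<rho>' 6 = \<rho>' 7" using b s(1) R(3) by simp
    have "Q s e" unfolding s(1)
    proof (rule Q[OF R(1,2) _ s(3)])
      fix p q assume pq: "p < n" "q < n"
      show "\<alpha>' 2 p = \<alpha>' 2 q \<longleftrightarrow> p = q \<or> p \<in> C \<and> q \<in> C \<and> lang M p = lang M q"
      proof
        assume D: "\<alpha>' 2 p = \<alpha>' 2 q"
        show "p = q \<or> p \<in> C \<and> q \<in> C \<and> lang M p = lang M q"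
        proof (cases "p \<in> C")
          case True
          then have "q \<in> C" using Cc pq D by simp
          have "\<alpha>' 2 s < \<rho>' 6" if "s \<in> C" for s using partnD(2)[OF R(1), of s] that C_n eq by auto
          then show ?thesis using lang_eq_if_processed[OF R(5) _ True \<open>q \<in> C\<close> D] True \<open>q \<in> C\<close> by blast
        next
          case False
          then have "\<alpha>' 2 p < t" using Cc[OF pq(1)] by simp
          then show ?thesis using inj[OF pq] D by blast
        qed
      next
        assume "p = q \<or> p \<in> C \<and> q \<in> C \<and> lang M p = lang M q"
        then show "\<alpha>' 2 p = \<alpha>' 2 q" using R(4) unfolding sound_def by blast
      qed
    qed
    then show "\<exists>k'. bcost (Less (Reg 6) (Reg 7)) + k' \<le> k \<and> Q s k'" using s(4) by (intro exI[of _ e]) simp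
  qed
qed

end

section \<open>Pruning the graph\<close>

context layout
begin

text \<open>Register 21 is the address of the number of pairs, just behind the table, and the work
  area starts behind the pairs. If there is no list of pairs, the number read is 0.\<close>

definition "setup_prog = seqs [Assign 3 (Mem (Num 0)), Assign 4 (Mem (Num 1)), Assign 21 (Add (Num 2) (mulc L (Reg 3))),
  Assign 22 (Mem (Reg 21)), Assign 2 (Add (Add (Reg 21) (Num 1)) (Add (Reg 22) (Reg 22)))]"

definition "entry x e = Add (Num (2 + x)) (mulc L e)"

text \<open>Erasing the copied entries prepares the place of the output table: 0 means undefined, so
  only defined transitions have to be written later.\<close>

definition "initletter x = Seq (set (8 + x) (Reg 9) (Mem (entry x (Reg 9)))) (Store (entry x (Reg 9)) (Num 0))"

definition "initstep = Seq (set 0 (Reg 9) (Reg 9)) (Seq (set 1 (Reg 9) (Reg 9))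
  (Seq (seqs (map initletter [0..<L])) (Assign 9 (Add (Reg 9) (Num 1)))))"

definition "initloop = While (Less (Reg 9) (Reg 3)) initstep"

text \<open>Counts the moves from the current root, register 18, to unpruned vertices and remembers
  the last target. If there is only one such move, the target is the next root. Unpruned vertices
  are those with positions not below register 5.\<close>

definition "scanletter x = Seq (Assign 14 (get (8 + x) (Reg 18)))
  (Cond (Conj (Neg (Eq (Reg 14) (Num 0))) (Neg (Less (get 1 (Sub (Reg 14) (Num 1))) (Reg 5))))
    (Seq (Assign 16 (Add (Reg 16) (Num 1))) (Assign 17 (Sub (Reg 14) (Num 1)))) Skip)"

definition "scan = Seq (Assign 16 (Num 0)) (seqs (map scanletter [0..<L]))"

definition "prunestep = Seq (seqs [Assign 11 (Reg 18), Assign 13 (Reg 5), swap,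
  Assign 5 (Add (Reg 5) (Num 1)), Assign 18 (Reg 17)]) scan"

definition "pruneloop = Seq (Seq (Assign 18 (Reg 4)) scan) (While (Less (Reg 16) (Num 2)) prunestep)"

definition "clsstep = seqs [Assign 11 (get 0 (Reg 9)), Cond (Less (Reg 9) (Reg 5))
    (seqs [set 2 (Reg 11) (Reg 9), set 3 (Reg 9) (Reg 9), set 4 (Reg 9) (Add (Reg 9) (Num 1))])
    (set 2 (Reg 11) (Reg 5)),
  Assign 9 (Add (Reg 9) (Num 1))]"

definition "clsfinish = seqs [set 3 (Reg 5) (Reg 5), set 4 (Reg 5) (Reg 3), Assign 7 (Add (Reg 5) (Num 1)), Assign 6 (Reg 5)]"

definition "clsinit = Seq (Assign 9 (Num 0)) (Seq (While (Less (Reg 9) (Reg 3)) clsstep) clsfinish)"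

definition "partition_prog = Seq setup_prog (Seq initloop (Seq pruneloop (Seq clsinit refine)))"

text \<open>Every vertex writes into the row of its class. Members of one class write equal values,
  so no representatives have to be chosen.\<close>

definition "outletter x = Seq (Assign 14 (get (8 + x) (Reg 9))) (Cond (Eq (Reg 14) (Num 0)) Skip
  (Store (entry x (get 2 (Reg 9))) (Add (get 2 (Sub (Reg 14) (Num 1))) (Num 1))))"

definition "outstep = Seq (seqs (map outletter [0..<L])) (Assign 9 (Add (Reg 9) (Num 1)))"

definition "outfinish = Seq (Store (Num 0) (Reg 7)) (Store (Num 1) (get 2 (Reg 4)))"

definition "output_prog = Seq (Assign 9 (Num 0)) (Seq (While (Less (Reg 9) (Reg 3)) outstep) outfinish)"

definition "checkstep = seqs [Cond (Eq (get 2 (Mem (Reg 12))) (get 2 (Mem (Add (Reg 12) (Num 1))))) Skip (Assign 0 (Num 0)),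
  Assign 12 (Add (Reg 12) (Num 2)), Assign 9 (Add (Reg 9) (Num 1))]"

definition "checkinit = seqs [Assign 0 (Num 1), Assign 9 (Num 0), Assign 12 (Add (Reg 21) (Num 1))]"

definition "check_prog = Seq checkinit (While (Less (Reg 9) (Mem (Reg 21))) checkstep)"

lemma loopfree_steps2 [simp]: "loopfree setup_prog" "loopfree initstep" "loopfree scan" "loopfree prunestep" "loopfree clsstep"
  "loopfree clsfinish" "loopfree outstep" "loopfree outfinish" "loopfree checkstep" "loopfree checkinit"
  by (auto simp: setup_prog_def initstep_def initletter_def scan_def scanletter_def prunestep_def clsstep_def clsfinish_def
      outstep_def outletter_def outfinish_def checkstep_def checkinit_def)

lemma aval_entry [simp]: "aval (entry x e) s = 2 + x + L * aval e s"
  by (simp add: entry_def)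

lemma run_setup:
  assumes "length xs = 3 + L * n + 2 * l" "xs ! 0 = n" "xs ! 1 = r" "xs ! (2 + L * n) = l"
  shows "run setup_prog (input_state xs) = mk ((\<lambda>_. 0)(3 := n, 4 := r, 21 := 2 + L * n, 22 := l, 2 := length xs)) (\<lambda>_ _. 0) (\<lambda>a. xs ! a)"
proof -
  have len: "length xs = Suc (Suc (Suc (L * n + (l + l))))" using assms(1) by simp
  then have lt: "0 < length xs" "Suc 0 < length xs" "Suc (Suc (L * n)) < length xs" by simp_all
  have "run setup_prog (input_state xs) = ((\<lambda>_. 0)(3 := n, 4 := r, 21 := 2 + L * n, 22 := l, 2 := length xs), snd (input_state xs))"
    unfolding setup_prog_def using assms(2-4) lt by (simp add: run.simps(2) input_state_def flip: len)
  then show ?thesis by (auto simp: mk_def input_state_def)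
qed

lemma snd_mk_low [simp]: "a < \<rho> 2 \<Longrightarrow> snd (mk \<rho> \<alpha> \<beta>) a = \<beta> a"
  by (simp add: mk_def)

lemma mk_cong: "(\<And>j. \<alpha> j = \<alpha>' j) \<Longrightarrow> (\<And>a. \<beta> a = \<beta>' a) \<Longrightarrow> mk \<rho> \<alpha> \<beta> = mk \<rho> \<alpha>' \<beta>'"
  by (metis ext)

lemma run_initletters:
  assumes "2 + L * \<rho> 9 + L \<le> \<rho> 2" "l \<le> L"
  shows "run (seqs (map initletter [0..<l])) (mk \<rho> \<alpha> \<beta>) =
    mk \<rho> (\<lambda>j. if 8 \<le> j \<and> j < 8 + l then (\<alpha> j)(\<rho> 9 := \<beta> (2 + L * \<rho> 9 + (j - 8))) else \<alpha> j)
      (\<lambda>a. if 2 + L * \<rho> 9 \<le> a \<and> a < 2 + L * \<rho> 9 + l then 0 else \<beta> a)"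
  using assms(2)
proof (induction l)
  case 0
  show ?case by simp (rule mk_cong, auto)
next
  case (Suc l)
  let ?\<alpha> = "\<lambda>l j. if 8 \<le> j \<and> j < 8 + l then (\<alpha> j)(\<rho> 9 := \<beta> (2 + L * \<rho> 9 + (j - 8))) else \<alpha> j"
  let ?\<beta> = "\<lambda>l a. if 2 + L * \<rho> 9 \<le> a \<and> a < 2 + L * \<rho> 9 + l then 0 else \<beta> a"
  have "run (seqs (map initletter [0..<Suc l])) (mk \<rho> \<alpha> \<beta>) = run (initletter l) (mk \<rho> (?\<alpha> l) (?\<beta> l))"
    using Suc by (simp add: run_seqs_snoc)
  also have "\<dots> = mk \<rho> ((?\<alpha> l)(8 + l := (?\<alpha> l (8 + l))(\<rho> 9 := \<beta> (2 + L * \<rho> 9 + l)))) ((?\<beta> l)(2 + l + L * \<rho> 9 := 0))"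
    using Suc.prems assms(1) by (simp add: initletter_def add.commute add.left_commute)
  also have "(?\<alpha> l)(8 + l := (?\<alpha> l (8 + l))(\<rho> 9 := \<beta> (2 + L * \<rho> 9 + l))) = ?\<alpha> (Suc l)"
    by (auto simp: fun_eq_iff less_Suc_eq)
  also have "(?\<beta> l)(2 + l + L * \<rho> 9 := 0) = ?\<beta> (Suc l)" by (auto simp: fun_eq_iff)
  finally show ?case .
qed

end

section \<open>Correctness of copying and pruning\<close>

locale numbered_graph = stallings_graph H \<Gamma> r + layout L
  for H :: "'a word set" and \<Gamma> :: "('a, nat) lgraph" and r L +
  fixes ls :: "'a letter list" and n :: nat and h :: "'a word"
  assumes V_n: "verts \<Gamma> = {..<n}"
    and ls: "length ls = L" "List.set ls = UNIV" "distinct ls"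
    and h: "reduced h" "path (moves \<Gamma>) r h r" "h \<noteq> []"
begin

definition \<tau> :: "nat \<Rightarrow> nat \<Rightarrow> nat" where "\<tau> x p = move_code \<Gamma> p (ls ! x)"

lemma \<tau>_Suc: "\<tau> x p = Suc s \<longleftrightarrow> (p, ls ! x, s) \<in> M"
proof
  assume "\<tau> x p = Suc s"
  then have ex: "\<exists>q. (p, ls ! x, q) \<in> M" and the: "(THE q. (p, ls ! x, q) \<in> M) = s"
    unfolding \<tau>_def move_code_def by (auto split: if_splits)
  obtain q where q: "(p, ls ! x, q) \<in> M" using ex by blast
  then have "(THE q. (p, ls ! x, q) \<in> M) = q" using M_det by (intro the_equality) blast+
  then show "(p, ls ! x, s) \<in> M" using q the by simp
next
  assume *: "(p, ls ! x, s) \<in> M"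
  then have "(THE q. (p, ls ! x, q) \<in> M) = s" using M_det by (intro the_equality) blast+
  then show "\<tau> x p = Suc s" unfolding \<tau>_def move_code_def using * by auto
qed

lemma M_n: "(p, x, q) \<in> M \<Longrightarrow> p < n \<and> q < n"
  using M_V V_n by auto

lemma refine_program_\<tau>: "refine_program L n \<tau>"
proof
  show "\<tau> x p \<le> n" for x p
  proof (cases "\<tau> x p")
    case (Suc s)
    then have "s < n" using M_n \<tau>_Suc by blast
    then show ?thesis by (simp add: Suc)
  qed simp
  show "p = q" if "\<tau> x p = Suc s" "\<tau> x q = Suc s" for x p q s
    using that M_sym[of p "ls ! x" s] M_sym[of q "ls ! x" s] M_det[of s "bar (ls ! x)" p q] by (simp add: \<tau>_Suc)
qed

lemma ex_index: "\<exists>x'<L. ls ! x' = x"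
  using ls(1,2) by (metis UNIV_I in_set_conv_nth)

definition tabG :: "(nat \<Rightarrow> nat \<Rightarrow> nat) \<Rightarrow> bool" where
  "tabG \<alpha> \<longleftrightarrow> (\<forall>x<L. \<forall>p<n. \<alpha> (8 + x) p = \<tau> x p)"

lemma wp_initloop:
  assumes \<beta>: "\<And>p x. p < n \<Longrightarrow> x < L \<Longrightarrow> \<beta> (2 + L * p + x) = \<tau> x p"
    and \<rho>: "\<rho> 3 = n" "\<rho> 9 = 0" "2 + L * n \<le> \<rho> 2"
    and k: "3 + n * (ccost initstep + 3) + k' \<le> k"
    and Q: "\<And>\<rho>' \<alpha>'. (\<forall>i<n. \<alpha>' 0 i = i \<and> \<alpha>' 1 i = i) \<Longrightarrow> \<alpha>' 5 = (\<lambda>_. 0) \<Longrightarrow> tabG \<alpha>' \<Longrightarrow> (\<And>j. j \<noteq> 9 \<Longrightarrow> \<rho>' j = \<rho> j)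
      \<Longrightarrow> Q (mk \<rho>' \<alpha>' (\<lambda>a. if 2 \<le> a \<and> a < 2 + L * n then 0 else \<beta> a)) k'"
  shows "wp initloop Q (mk \<rho> (\<lambda>_ _. 0) \<beta>) k"
proof -
  let ?\<beta> = "\<lambda>i a. if 2 \<le> a \<and> a < 2 + L * i then 0 else \<beta> a"
  define I where "I s k \<longleftrightarrow> (\<exists>i \<alpha>. i \<le> n \<and> s = mk (\<rho>(9 := i)) \<alpha> (?\<beta> i) \<and> (\<forall>j<i. \<alpha> 0 j = j \<and> \<alpha> 1 j = j)
     \<and> \<alpha> 5 = (\<lambda>_. 0) \<and> (\<forall>x<L. \<forall>p<i. \<alpha> (8 + x) p = \<tau> x p) \<and> 3 + (n - i) * (ccost initstep + 3) + k' \<le> k)" for s k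
  have "(\<lambda>a. if 2 \<le> a \<and> a < 2 then 0 else \<beta> a) = \<beta>" by auto
  then have "I (mk \<rho> (\<lambda>_ _. 0) \<beta>) k" unfolding I_def
    by (intro exI[of _ 0] exI[of _ "\<lambda>_ _. 0"]) (use k \<rho>(2) fun_upd_triv[of \<rho> 9] in simp)
  then show ?thesis unfolding initloop_def
  proof (rule wp_While)
    fix s k assume "I s k" and b: "bval (Less (Reg 9) (Reg 3)) s"
    then obtain i \<alpha> where i: "i \<le> n" "s = mk (\<rho>(9 := i)) \<alpha> (?\<beta> i)" "\<forall>j<i. \<alpha> 0 j = j \<and> \<alpha> 1 j = j"
      "\<alpha> 5 = (\<lambda>_. 0)" "\<forall>x<L. \<forall>p<i. \<alpha> (8 + x) p = \<tau> x p" "3 + (n - i) * (ccost initstep + 3) + k' \<le> k" unfolding I_def by blast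
    have "i < n" using b i(2) \<rho> by simp
    then have "L * Suc i \<le> L * n" by (intro mult_le_mono2) simp
    then have bd: "2 + L * i + L \<le> \<rho> 2" using \<rho>(3) by simp
    have "n - i = Suc (n - Suc i)" using \<open>i < n\<close> by simp
    then have cr: "3 + (ccost initstep + 3) + (n - Suc i) * (ccost initstep + 3) + k' \<le> k" using i(6) by simp
    let ?\<alpha>1 = "\<alpha>(0 := (\<alpha> 0)(i := i), 1 := (\<alpha> 1)(i := i))"
    let ?\<alpha> = "\<lambda>j. if 8 \<le> j \<and> j < 8 + L then (?\<alpha>1 j)(i := ?\<beta> i (2 + L * i + (j - 8))) else ?\<alpha>1 j"
    have "run initstep s = mk (\<rho>(9 := Suc i)) ?\<alpha> (\<lambda>a. if 2 + L * i \<le> a \<and> a < 2 + L * i + L then 0 else ?\<beta> i a)"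
      unfolding i(2) initstep_def using run_initletters[of "\<rho>(9 := i)" L ?\<alpha>1 "?\<beta> i", unfolded fun_upd_same] bd by simp
    also have "(\<lambda>a. if 2 + L * i \<le> a \<and> a < 2 + L * i + L then 0 else ?\<beta> i a) = ?\<beta> (Suc i)" by (auto simp: fun_eq_iff)
    finally have run: "run initstep s = mk (\<rho>(9 := Suc i)) ?\<alpha> (?\<beta> (Suc i))" .
    have "?\<alpha> (8 + x) p = \<tau> x p" if "x < L" "p < Suc i" for x p
      using that i(5) \<beta>[OF \<open>i < n\<close> that(1)] by (auto simp: less_Suc_eq)
    then have "I (run initstep s) (3 + (n - Suc i) * (ccost initstep + 3) + k')" unfolding run I_def
      using \<open>i < n\<close> i(3,4) by (intro exI[of _ "Suc i"] exI[of _ ?\<alpha>]) (simp add: less_Suc_eq)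
    then show "\<exists>k'. bcost (Less (Reg 9) (Reg 3)) + k' \<le> k \<and> wp initstep I s k'"
      by (intro exI[of _ "k - 3"] conjI wp_loopfree[of _ "3 + (n - Suc i) * (ccost initstep + 3) + k'"]) (use cr in simp_all)
  next
    fix s k assume "I s k" and b: "\<not> bval (Less (Reg 9) (Reg 3)) s"
    then obtain i \<alpha> where i: "i \<le> n" "s = mk (\<rho>(9 := i)) \<alpha> (?\<beta> i)" "\<forall>j<i. \<alpha> 0 j = j \<and> \<alpha> 1 j = j"
      "\<alpha> 5 = (\<lambda>_. 0)" "\<forall>x<L. \<forall>p<i. \<alpha> (8 + x) p = \<tau> x p" "3 + (n - i) * (ccost initstep + 3) + k' \<le> k" unfolding I_def by blast
    have "i = n" using b i(1,2) \<rho> by simp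
    have "Q s k'" unfolding i(2) \<open>i = n\<close>
      by (rule Q) (use i(3-5) \<open>i = n\<close> in \<open>simp_all add: tabG_def\<close>)
    then show "\<exists>k'. bcost (Less (Reg 9) (Reg 3)) + k' \<le> k \<and> Q s k'" using i(6) by (intro exI[of _ k']) simp
  qed
qed

lemma run_scan:
  assumes tab: "tabG \<alpha>" and p: "\<rho> 18 = p" "p < n" and t: "\<rho> 5 = t"
  shows "\<exists>\<rho>'. run scan (mk \<rho> \<alpha> \<beta>) = mk \<rho>' \<alpha> \<beta> \<and> (\<forall>j. j \<notin> {14, 16, 17} \<longrightarrow> \<rho>' j = \<rho> j)
    \<and> \<rho>' 16 = card {x. x < L \<and> (\<exists>s. \<tau> x p = Suc s \<and> t \<le> \<alpha> 1 s)}
    \<and> (0 < \<rho>' 16 \<longrightarrow> (\<exists>x<L. \<tau> x p = Suc (\<rho>' 17) \<and> t \<le> \<alpha> 1 (\<rho>' 17)))"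
proof -
  let ?X = "\<lambda>l. {x. x < l \<and> (\<exists>s. \<tau> x p = Suc s \<and> t \<le> \<alpha> 1 s)}"
  have "\<exists>\<rho>'. run (seqs (map scanletter [0..<l])) (mk (\<rho>(16 := 0)) \<alpha> \<beta>) = mk \<rho>' \<alpha> \<beta> \<and> (\<forall>j. j \<notin> {14, 16, 17} \<longrightarrow> \<rho>' j = \<rho> j)
    \<and> \<rho>' 16 = card (?X l) \<and> (0 < \<rho>' 16 \<longrightarrow> (\<exists>x<L. \<tau> x p = Suc (\<rho>' 17) \<and> t \<le> \<alpha> 1 (\<rho>' 17)))" if "l \<le> L" for l
    using that
  proof (induction l)
    case 0
    then show ?case by (intro exI[of _ "\<rho>(16 := 0)"]) simp
  next
    case (Suc l)
    from Suc.IH[OF Suc_leD[OF Suc.prems]] obtain \<rho>' where r: "run (seqs (map scanletter [0..<l])) (mk (\<rho>(16 := 0)) \<alpha> \<beta>) = mk \<rho>' \<alpha> \<beta>"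
      "\<forall>j. j \<notin> {14, 16, 17} \<longrightarrow> \<rho>' j = \<rho> j" "\<rho>' 16 = card (?X l)"
      "0 < \<rho>' 16 \<longrightarrow> (\<exists>x<L. \<tau> x p = Suc (\<rho>' 17) \<and> t \<le> \<alpha> 1 (\<rho>' 17))"
      by - (elim exE conjE, rule that, assumption+)
    have X: "?X (Suc l) = (if \<exists>s. \<tau> l p = Suc s \<and> t \<le> \<alpha> 1 s then insert l (?X l) else ?X l)"
      by (auto simp: less_Suc_eq)
    have run: "run (seqs (map scanletter [0..<Suc l])) (mk (\<rho>(16 := 0)) \<alpha> \<beta>) = run (scanletter l) (mk \<rho>' \<alpha> \<beta>)"
      using r(1) by (simp add: run_seqs_snoc)
    have val: "\<alpha> (8 + l) p = \<tau> l p" using tab Suc.prems p(2) by (simp add: tabG_def)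
    have regs: "\<rho>' 18 = p" "\<rho>' 5 = t" using r(2) p t by simp_all
    show ?case
    proof (cases "\<exists>s. \<tau> l p = Suc s \<and> t \<le> \<alpha> 1 s")
      case True
      then obtain s where s: "\<tau> l p = Suc s" "t \<le> \<alpha> 1 s" by blast
      have run2: "run (scanletter l) (mk \<rho>' \<alpha> \<beta>) = mk (\<rho>'(14 := Suc s, 16 := Suc (\<rho>' 16), 17 := s)) \<alpha> \<beta>"
        using Suc.prems val s regs by (simp add: scanletter_def)
      have "finite (?X l)" by simp
      then have card: "card (?X (Suc l)) = Suc (card (?X l))" using X True by simp
      have w: "\<exists>x<L. \<tau> x p = Suc s \<and> t \<le> \<alpha> 1 s" using s Suc.prems by (intro exI[of _ l]) simp
      show ?thesis unfolding run run2 card using r(2,3) w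
        by (intro exI[of _ "\<rho>'(14 := Suc s, 16 := Suc (\<rho>' 16), 17 := s)"] conjI) (rule HOL.refl, simp_all)
    next
      case False
      then have run2: "run (scanletter l) (mk \<rho>' \<alpha> \<beta>) = mk (\<rho>'(14 := \<tau> l p)) \<alpha> \<beta>"
        using Suc.prems val regs by (cases "\<tau> l p") (auto simp: scanletter_def)
      have X2: "?X (Suc l) = ?X l" using X unfolding if_not_P[OF False] .
      show ?thesis unfolding run run2 X2 using r(2-4)
        by (intro exI[of _ "\<rho>'(14 := \<tau> l p)"] conjI) (rule HOL.refl, simp_all)
    qed
  qed
  from this[of L] show ?thesis by (simp add: scan_def)
qed

text \<open>The non-trivial loop \<open>h\<close> guarantees a next root as long as the current one
  is not branching. Every round prunes one vertex, so credits for \<open>n\<close> rounds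
  suffice.\<close>

lemma wp_pruneloop:
  assumes perm: "perm n (\<alpha> 0) (\<alpha> 1)" and tab: "tabG \<alpha>" and \<rho>: "\<rho> 5 = 0" "\<rho> 4 = r"
    and k: "ccost scan + 2 + 3 + n * (ccost prunestep + 3) + k' \<le> k"
    and Q: "\<And>\<rho>' \<alpha>' T v. core_decomposition H \<Gamma> r T v \<Longrightarrow> perm n (\<alpha>' 0) (\<alpha>' 1) \<Longrightarrow> \<rho>' 5 < n
      \<Longrightarrow> T = {q. q < n \<and> \<alpha>' 1 q < \<rho>' 5} \<Longrightarrow> (\<And>j. j \<notin> {0, 1} \<Longrightarrow> \<alpha>' j = \<alpha> j) \<Longrightarrow> (\<And>j. j \<in> {2, 3, 4, 21} \<Longrightarrow> \<rho>' j = \<rho> j)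
      \<Longrightarrow> Q (mk \<rho>' \<alpha>' \<beta>) k'"
  shows "wp pruneloop Q (mk \<rho> \<alpha> \<beta>) k"
proof -
  let ?X = "\<lambda>P p t. {x. x < L \<and> (\<exists>s. \<tau> x p = Suc s \<and> t \<le> (P s :: nat))}"
  define J where "J \<rho>' \<alpha>' T k \<longleftrightarrow> perm n (\<alpha>' 0) (\<alpha>' 1) \<and> prune M r T (\<rho>' 18)
     \<and> T = {q. q < n \<and> \<alpha>' 1 q < \<rho>' 5} \<and> (\<forall>j. j \<notin> {0, 1} \<longrightarrow> \<alpha>' j = \<alpha> j) \<and> (\<forall>j\<in>{2, 3, 4, 21}. \<rho>' j = \<rho> j)
     \<and> \<rho>' 16 = card (?X (\<alpha>' 1) (\<rho>' 18) (\<rho>' 5))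
     \<and> (0 < \<rho>' 16 \<longrightarrow> (\<exists>x<L. \<tau> x (\<rho>' 18) = Suc (\<rho>' 17) \<and> \<rho>' 5 \<le> \<alpha>' 1 (\<rho>' 17)))
     \<and> 3 + (n - \<rho>' 5) * (ccost prunestep + 3) + k' \<le> k" for \<rho>' :: "nat \<Rightarrow> nat" and \<alpha>' T k
  define I where "I s k \<longleftrightarrow> (\<exists>\<rho>' \<alpha>' T. s = mk \<rho>' \<alpha>' \<beta> \<and> J \<rho>' \<alpha>' T k)" for s k
  \<comment> \<open>The letters are enumerated without repetition, so two letter numbers in the set
    stand for two different letters.\<close>
  have branching_iff: "branching T p \<longleftrightarrow> 2 \<le> card (?X P p t)"
    if T: "T = {q. q < n \<and> P q < t}" for T P p t
  proof -
    have X: "x \<in> ?X P p t \<longleftrightarrow> x < L \<and> (\<exists>s. (p, ls ! x, s) \<in> M \<and> s \<notin> T)" for x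
    proof -
      have "s \<notin> T \<longleftrightarrow> t \<le> P s" if "(p, ls ! x, s) \<in> M" for s using M_n[OF that] unfolding T by (auto simp: not_less)
      then show ?thesis unfolding mem_Collect_eq \<tau>_Suc by blast
    qed
    have fin: "finite (?X P p t)" by simp
    show ?thesis
    proof
      assume "branching T p"
      then obtain x y u w where xy: "x \<noteq> y" "(p, x, u) \<in> M" "u \<notin> T" "(p, y, w) \<in> M" "w \<notin> T"
        unfolding branching_def by blast
      obtain i where i: "i < L" "ls ! i = x" using ex_index by blast
      obtain j where j: "j < L" "ls ! j = y" using ex_index by blast
      have "i \<in> ?X P p t" "j \<in> ?X P p t" unfolding X using i j xy by blast+
      moreover have "i \<noteq> j" using i j xy(1) by blast
      ultimately have "card {i, j} \<le> card (?X P p t)" by (intro card_mono fin) blast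
      then show "2 \<le> card (?X P p t)" using \<open>i \<noteq> j\<close> by simp
    next
      assume c2: "2 \<le> card (?X P p t)"
      have "?X P p t \<noteq> {}"
      proof
        assume "?X P p t = {}"
        then show False using c2 by (metis card.empty not_numeral_le_zero)
      qed
      then obtain i where i: "i \<in> ?X P p t" by blast
      have "\<not> ?X P p t \<subseteq> {i}"
      proof
        assume "?X P p t \<subseteq> {i}"
        then have "card (?X P p t) \<le> card {i}" by (intro card_mono) simp_all
        then show False using c2 by simp
      qed
      then obtain j where j: "j \<in> ?X P p t" "j \<noteq> i" by blast
      have "ls ! i \<noteq> ls ! j" using i j ls by (auto simp: nth_eq_iff_index_eq)
      then show "branching T p" unfolding branching_def using X[of i] X[of j] i j by blast
    qed
  qed
  have While: "wp (While (Less (Reg 16) (Num 2)) prunestep) Q s k" if "I s k" for s k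
    using that
  proof (rule wp_While)
    fix s k assume "I s k" and b: "bval (Less (Reg 16) (Num 2)) s"
    then obtain \<rho>1 \<alpha>1 T where s1: "s = mk \<rho>1 \<alpha>1 \<beta>" and J: "J \<rho>1 \<alpha>1 T k" unfolding I_def by (elim exE conjE)
    note j = J[unfolded J_def]
    note s = s1 j[THEN conjunct1] j[THEN conjunct2, THEN conjunct1] j[THEN conjunct2, THEN conjunct2, THEN conjunct1]
    note j2 = j[THEN conjunct2, THEN conjunct2, THEN conjunct2]
    have fra: "\<And>j. j \<notin> {0, 1} \<Longrightarrow> \<alpha>1 j = \<alpha> j" using j2[THEN conjunct1] by blast
    note j3 = j2[THEN conjunct2]
    have frr: "\<And>j. j \<in> {2, 3, 4, 21} \<Longrightarrow> \<rho>1 j = \<rho> j" using j3[THEN conjunct1] by blast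
    note deg = j3[THEN conjunct2, THEN conjunct1] and nxt = j3[THEN conjunct2, THEN conjunct2, THEN conjunct1]
      and cr = j3[THEN conjunct2, THEN conjunct2, THEN conjunct2]
    let ?p = "\<rho>1 18" and ?t = "\<rho>1 5" and ?q = "\<rho>1 17"
    have pT: "?p \<in> V - T" using prune_props[OF s(3)] by blast
    have memT: "q \<in> T \<longleftrightarrow> q < n \<and> \<alpha>1 1 q < ?t" for q by (subst s(4)) simp
    have "?p \<in> {..<n}" "?p \<notin> T" using pT unfolding V_n by blast+
    then have pn: "?p < n" "?t \<le> \<alpha>1 1 ?p" unfolding memT by simp_all
    have "\<alpha>1 1 ?p < n" using s(2) pn(1) unfolding perm_def by simp
    then have tn: "?t < n" using pn(2) by (rule le_less_trans[rotated])
    have "\<rho>1 16 < 2" using b s(1) by simp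
    then have "\<not> branching T ?p" using branching_iff[OF s(4), of ?p] deg by simp
    then obtain y q where step: "{(x, u). (?p, x, u) \<in> M \<and> u \<notin> T} = {(y, q)}" "prune M r (insert ?p T) q"
      using prune_step_if_not_branching[OF s(3) h] by blast
    have "(y, q) \<in> {(x, u). (?p, x, u) \<in> M \<and> u \<notin> T}" unfolding step(1) by simp
    then have y: "(?p, y, q) \<in> M" "q \<notin> T" by simp_all
    obtain i where i: "i < L" "ls ! i = y" using ex_index by blast
    have "?t \<le> \<alpha>1 1 q" using y(2) M_n[OF y(1)] unfolding memT by simp
    then have "i \<in> ?X (\<alpha>1 1) ?p ?t" using i y(1) \<tau>_Suc[of i ?p q] by blast
    moreover have "finite (?X (\<alpha>1 1) ?p ?t)" by simp
    ultimately have "0 < card (?X (\<alpha>1 1) ?p ?t)" unfolding card_gt_0_iff by blast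
    then have "0 < \<rho>1 16" unfolding deg .
    then obtain x where x: "(?p, ls ! x, ?q) \<in> M" "?t \<le> \<alpha>1 1 ?q" using nxt \<tau>_Suc by blast
    then have "(ls ! x, ?q) \<in> {(x, u). (?p, x, u) \<in> M \<and> u \<notin> T}" by (simp add: memT not_less)
    then have qq: "?q = q" unfolding step(1) by simp
    let ?E = "(\<alpha>1 0)(?t := ?p, \<alpha>1 1 ?p := \<alpha>1 0 ?t)" and ?P = "(\<alpha>1 1)(?p := ?t, \<alpha>1 0 ?t := \<alpha>1 1 ?p)"
    let ?\<alpha>2 = "\<alpha>1(0 := ?E, 1 := ?P)"
    let ?\<rho>2 = "\<rho>1(11 := ?p, 13 := ?t, 14 := \<alpha>1 0 ?t, 15 := \<alpha>1 1 ?p, 5 := Suc ?t, 18 := ?q)"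
    have run1: "run (seqs [Assign 11 (Reg 18), Assign 13 (Reg 5), swap, Assign 5 (Add (Reg 5) (Num 1)), Assign 18 (Reg 17)]) s
      = mk ?\<rho>2 ?\<alpha>2 \<beta>" unfolding s(1) by (simp add: run_swap)
    have perm': "perm n ?E ?P" by (rule perm_swap[OF s(2) pn(1) tn])
    \<comment> \<open>Exchanging the current root with the vertex at the first unpruned position
      makes the pruned vertices an initial segment of the positions again.\<close>
    have T': "insert ?p T = {q. q < n \<and> ?P q < Suc ?t}"
    proof (rule Set.set_eqI)
      fix a
      have Et: "\<alpha>1 0 ?t < n" "\<alpha>1 1 (\<alpha>1 0 ?t) = ?t" using s(2) tn by (auto simp: perm_def)
      have inj: "\<alpha>1 1 a = ?t \<Longrightarrow> a < n \<Longrightarrow> a = \<alpha>1 0 ?t" using s(2) unfolding perm_def by metis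
      have injp: "\<alpha>1 1 ?p = ?t \<Longrightarrow> ?p = \<alpha>1 0 ?t" using s(2) pn(1) unfolding perm_def by metis
      consider "a = ?p" | "a \<noteq> ?p" "a = \<alpha>1 0 ?t" | "a \<noteq> ?p" "a \<noteq> \<alpha>1 0 ?t" by blast
      then have "a = ?p \<or> (a < n \<and> \<alpha>1 1 a < ?t) \<longleftrightarrow> a < n \<and> ?P a < Suc ?t"
      proof cases
        case 1
        then show ?thesis using pn(1) Et injp by (cases "?p = \<alpha>1 0 ?t") simp_all
      next
        case 2
        have "\<alpha>1 1 ?p \<noteq> ?t" using injp 2 by metis
        then have "\<not> \<alpha>1 1 ?p < Suc ?t" using pn(2) by simp
        moreover have "?P a = \<alpha>1 1 ?p" using 2(2) by simp
        moreover have "\<alpha>1 1 a = ?t" using 2(2) Et(2) by simp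
        ultimately show ?thesis using 2(1) by simp
      next
        case 3
        then have "?P a = \<alpha>1 1 a" by simp
        moreover have "a < n \<Longrightarrow> \<alpha>1 1 a \<noteq> ?t" using inj 3(2) by blast
        ultimately show ?thesis using 3(1) by (auto simp: less_Suc_eq)
      qed
      then show "a \<in> insert ?p T \<longleftrightarrow> a \<in> {q. q < n \<and> ?P q < Suc ?t}"
        unfolding insert_iff memT mem_Collect_eq .
    qed
    have tab2: "tabG ?\<alpha>2" using tab fra by (simp add: tabG_def)
    have qn: "q < n" using M_n[OF y(1)] by simp
    obtain \<rho>3 where r3: "run scan (mk ?\<rho>2 ?\<alpha>2 \<beta>) = mk \<rho>3 ?\<alpha>2 \<beta>" "\<forall>j. j \<notin> {14, 16, 17} \<longrightarrow> \<rho>3 j = ?\<rho>2 j"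
      "\<rho>3 16 = card (?X (?\<alpha>2 1) q (Suc ?t))"
      "0 < \<rho>3 16 \<longrightarrow> (\<exists>x<L. \<tau> x q = Suc (\<rho>3 17) \<and> Suc ?t \<le> ?\<alpha>2 1 (\<rho>3 17))"
      using run_scan[OF tab2, of ?\<rho>2 q "Suc ?t" \<beta>] qq qn by auto
    have r318: "\<rho>3 18 = q" "\<rho>3 5 = Suc ?t" using r3(2) qq by simp_all
    have fra2: "\<forall>j. j \<notin> {0, 1} \<longrightarrow> ?\<alpha>2 j = \<alpha> j" using fra by simp
    have frr2: "\<forall>j\<in>{2, 3, 4, 21}. \<rho>3 j = \<rho> j" using frr r3(2) by simp
    have run: "run prunestep s = mk \<rho>3 ?\<alpha>2 \<beta>" unfolding prunestep_def run.simps(4) run1 r3(1) ..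
    have "n - ?t = Suc (n - Suc ?t)" using tn by simp
    then have cr2: "3 + (ccost prunestep + 3) + (n - Suc ?t) * (ccost prunestep + 3) + k' \<le> k" using cr by simp
    have "I (run prunestep s) (3 + (n - Suc ?t) * (ccost prunestep + 3) + k')"
      unfolding run I_def J_def
      by (intro exI[of _ \<rho>3] exI[of _ ?\<alpha>2] exI[of _ "insert ?p T"] conjI)
        (use perm' step(2) T' r3(3,4) r318 fra2 frr2 in \<open>simp_all\<close>)
    then show "\<exists>k'. bcost (Less (Reg 16) (Num 2)) + k' \<le> k \<and> wp prunestep I s k'"
      by (intro exI[of _ "k - 3"] conjI wp_loopfree[of _ "3 + (n - Suc ?t) * (ccost prunestep + 3) + k'"]) (use cr2 in simp_all)
  next
    fix s k assume "I s k" and b: "\<not> bval (Less (Reg 16) (Num 2)) s"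
    then obtain \<rho>1 \<alpha>1 T where s1: "s = mk \<rho>1 \<alpha>1 \<beta>" and J: "J \<rho>1 \<alpha>1 T k" unfolding I_def by (elim exE conjE)
    note j = J[unfolded J_def]
    note s = s1 j[THEN conjunct1] j[THEN conjunct2, THEN conjunct1] j[THEN conjunct2, THEN conjunct2, THEN conjunct1]
    note j2 = j[THEN conjunct2, THEN conjunct2, THEN conjunct2]
    have fra: "\<And>j. j \<notin> {0, 1} \<Longrightarrow> \<alpha>1 j = \<alpha> j" using j2[THEN conjunct1] by blast
    note j3 = j2[THEN conjunct2]
    have frr: "\<And>j. j \<in> {2, 3, 4, 21} \<Longrightarrow> \<rho>1 j = \<rho> j" using j3[THEN conjunct1] by blast
    note deg = j3[THEN conjunct2, THEN conjunct1] and nxt = j3[THEN conjunct2, THEN conjunct2, THEN conjunct1]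
      and cr = j3[THEN conjunct2, THEN conjunct2, THEN conjunct2]
    have "2 \<le> \<rho>1 16" using b s(1) by simp
    then have br: "branching T (\<rho>1 18)" using branching_iff[OF s(4), of "\<rho>1 18"] deg by simp
    have pT: "\<rho>1 18 \<in> V - T" using prune_props[OF s(3)] by blast
    have memT: "q \<in> T \<longleftrightarrow> q < n \<and> \<alpha>1 1 q < \<rho>1 5" for q by (subst s(4)) simp
    have "\<rho>1 18 \<in> {..<n}" "\<rho>1 18 \<notin> T" using pT unfolding V_n by blast+
    then have pn: "\<rho>1 18 < n" "\<rho>1 5 \<le> \<alpha>1 1 (\<rho>1 18)" unfolding memT by simp_all
    have "\<alpha>1 1 (\<rho>1 18) < n" using s(2) pn(1) unfolding perm_def by simp
    then have tn: "\<rho>1 5 < n" using pn(2) by (rule le_less_trans[rotated])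
    have "core_decomposition H \<Gamma> r T (\<rho>1 18)"
      by (intro core_decomposition.intro core_decomposition_axioms.intro stallings_graph_axioms s(3) br)
    from Q[OF this s(2) tn s(4) fra frr] have "Q s k'" unfolding s(1) by simp
    then show "\<exists>k'. bcost (Less (Reg 16) (Num 2)) + k' \<le> k \<and> Q s k'" using cr by (intro exI[of _ k']) simp
  qed
  have rn: "r < n" using r_V V_n by simp
  obtain \<rho>1 where r1: "run scan (mk (\<rho>(18 := r)) \<alpha> \<beta>) = mk \<rho>1 \<alpha> \<beta>" "\<forall>j. j \<notin> {14, 16, 17} \<longrightarrow> \<rho>1 j = (\<rho>(18 := r)) j"
    "\<rho>1 16 = card (?X (\<alpha> 1) r 0)" "0 < \<rho>1 16 \<longrightarrow> (\<exists>x<L. \<tau> x r = Suc (\<rho>1 17) \<and> 0 \<le> \<alpha> 1 (\<rho>1 17))"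
    using run_scan[OF tab, of "\<rho>(18 := r)" r 0 \<beta>] rn \<rho> by auto
  have regs: "\<rho>1 18 = r" "\<rho>1 5 = 0" "\<forall>j\<in>{2, 3, 4, 21}. \<rho>1 j = \<rho> j" using r1(2) \<rho> by simp_all
  have "I (mk \<rho>1 \<alpha> \<beta>) (3 + n * (ccost prunestep + 3) + k')" unfolding I_def J_def
    by (intro exI[of _ \<rho>1] exI[of _ \<alpha>] exI[of _ "{}"] conjI) (use perm r1(3,4) regs prune_base in simp_all)
  from While[OF this] have W: "wp (While (Less (Reg 16) (Num 2)) prunestep) Q (mk \<rho>1 \<alpha> \<beta>) (3 + n * (ccost prunestep + 3) + k')" .
  have run0: "run (Seq (Assign 18 (Reg 4)) scan) (mk \<rho> \<alpha> \<beta>) = mk \<rho>1 \<alpha> \<beta>" using r1(1) \<rho>(2) by simp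
  show ?thesis unfolding pruneloop_def
    by (rule wp_Seq_loopfree[of "Seq (Assign 18 (Reg 4)) scan" "3 + n * (ccost prunestep + 3) + k'"])
      (use k W run0 in simp_all)
qed

end

section \<open>From the graph to its partition\<close>

lemma perm_inj: "perm n E P \<Longrightarrow> p < n \<Longrightarrow> q < n \<Longrightarrow> P p = P q \<Longrightarrow> p = q"
  unfolding perm_def by metis

text \<open>The minimum gives a pruned vertex its own position as its class, and the number
  \<open>t\<close> to all vertices of the core.\<close>

lemma partn_init:
  assumes perm: "perm n E P" and t: "t < n" and D: "\<And>p. p < n \<Longrightarrow> D p = min (P p) t"
    and B: "\<And>c. c \<le> t \<Longrightarrow> B c = c" and N: "\<And>c. c < t \<Longrightarrow> N c = Suc c" "N t = n"
  shows "partn n E P D B N (Suc t)"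
  unfolding partn_def
proof (intro conjI allI impI)
  show "perm n E P" by fact
  fix p assume p: "p < n"
  have P: "P p < n" using perm p by (simp add: perm_def)
  show "D p < Suc t" "B (D p) \<le> P p" using D[OF p] B by simp_all
  show "P p < N (D p)" using D[OF p] N P by (cases "P p < t") (simp_all add: min_def)
next
  fix c assume "c < Suc t"
  then have c: "c \<le> t" by simp
  show "B c < N c" "N c \<le> n" using B[OF c] N t c by (cases "c = t"; simp)+
  fix i assume i: "B c \<le> i \<and> i < N c"
  have "i < n" using i N t c by (cases "c = t") simp_all
  then have "E i < n" "P (E i) = i" using perm by (simp_all add: perm_def)
  then show "D (E i) = c" using D[of "E i"] B[OF c] N i c by (cases "c = t") simp_all
qed

lemma partn_surj:
  assumes "partn n E P D B N m" "c < m"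
  shows "\<exists>p<n. D p = c"
proof -
  have "B c < n" using partnD(5,6)[OF assms(1,2)] by simp
  then show ?thesis using partnD(7)[OF assms, of "B c"] partnD(5)[OF assms] partnD(8)[OF assms(1)] by blast
qed

lemma partn_card:
  assumes "partn n E P D B N m"
  shows "D ` {..<n} = {..<m}" "m \<le> n"
proof -
  show *: "D ` {..<n} = {..<m}" using partnD(2)[OF assms] partn_surj[OF assms] by auto
  have "card (D ` {..<n}) \<le> card {..<n}" by (rule card_image_le) simp
  then show "m \<le> n" unfolding * by simp
qed

text \<open>Source of the logarithm: a class has at most \<open>n\<close> members, so a vertex
  stores at most \<open>floor_log n\<close> halvings.\<close>

lemma pot_le:
  assumes "partn n E P D B N m"
  shows "pot a g n D B N k \<le> n * (a + g * floor_log n)"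
proof -
  have "pot a g n D B N k \<le> (\<Sum>p<n. a + g * floor_log n)" unfolding pot_def
  proof (rule sum_mono)
    fix p assume "p \<in> {..<n}"
    then have "N (D p) - B (D p) \<le> n" using partnD(2)[OF assms, of p] partnD(6)[OF assms, of "D p"] by simp
    then have "floor_log (N (D p) - B (D p)) \<le> floor_log n" by (rule monoD[OF floor_log_mono])
    then show "(if k \<le> D p then a else 0) + g * floor_log (N (D p) - B (D p)) \<le> a + g * floor_log n"
      by (intro add_mono mult_le_mono2) simp_all
  qed
  then show ?thesis by simp
qed

section \<open>The initial partition and the time for partitioning\<close>

context layout
begin

definition "time_partition n = ccost setup_prog + (3 + n * (ccost initstep + 3)) + (ccost scan + 2 + 3 + n * (ccost prunestep + 3))
  + (2 + 3 + n * (ccost clsstep + 3) + ccost clsfinish)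
  + 3 + n * (refine_core.cost_class L + (refine_core.cost_class L + cost_relabel) * floor_log n)"

lemma wp_clsinit:
  assumes perm: "perm n (\<alpha> 0) (\<alpha> 1)" and \<rho>: "\<rho> 5 = t" "t < n" "\<rho> 3 = n"
    and k: "2 + 3 + n * (ccost clsstep + 3) + ccost clsfinish + k' \<le> k"
    and Q: "\<And>\<rho>' \<alpha>'. partn n (\<alpha> 0) (\<alpha> 1) (\<alpha>' 2) (\<alpha>' 3) (\<alpha>' 4) (Suc t) \<Longrightarrow> (\<And>p. p < n \<Longrightarrow> \<alpha>' 2 p = min (\<alpha> 1 p) t)
      \<Longrightarrow> \<rho>' 6 = t \<Longrightarrow> \<rho>' 7 = Suc t \<Longrightarrow> (\<And>j. j \<notin> {2, 3, 4} \<Longrightarrow> \<alpha>' j = \<alpha> j) \<Longrightarrow> (\<And>j. j \<in> {2, 3, 4, 5, 21} \<Longrightarrow> \<rho>' j = \<rho> j)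
      \<Longrightarrow> Q (mk \<rho>' \<alpha>' \<beta>) k'"
  shows "wp clsinit Q (mk \<rho> \<alpha> \<beta>) k"
proof -
  have P: "\<alpha> 1 q < n" "\<alpha> 0 (\<alpha> 1 q) = q" if "q < n" for q using perm that by (simp_all add: perm_def)
  have E: "\<alpha> 0 q < n" "\<alpha> 1 (\<alpha> 0 q) = q" if "q < n" for q using perm that by (simp_all add: perm_def)
  define I where "I s k \<longleftrightarrow> (\<exists>\<rho>' \<alpha>' i. i \<le> n \<and> s = mk \<rho>' \<alpha>' \<beta> \<and> \<rho>' 9 = i \<and> (\<forall>j<i. \<alpha>' 2 (\<alpha> 0 j) = min j t)
     \<and> (\<forall>j<i. j < t \<longrightarrow> \<alpha>' 3 j = j \<and> \<alpha>' 4 j = Suc j) \<and> (\<forall>j. j \<notin> {2, 3, 4} \<longrightarrow> \<alpha>' j = \<alpha> j) \<and> (\<forall>j. j \<noteq> 9 \<and> j \<noteq> 11 \<longrightarrow> \<rho>' j = \<rho> j)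
     \<and> 3 + (n - i) * (ccost clsstep + 3) + ccost clsfinish + k' \<le> k)" for s k
  have While: "wp (While (Less (Reg 9) (Reg 3)) clsstep) (wp clsfinish Q) s k" if "I s k" for s k
    using that
  proof (rule wp_While)
    fix s k assume "I s k" and b: "bval (Less (Reg 9) (Reg 3)) s"
    then obtain \<rho>' \<alpha>' i where i: "i \<le> n" "s = mk \<rho>' \<alpha>' \<beta>" "\<rho>' 9 = i" "\<forall>j<i. \<alpha>' 2 (\<alpha> 0 j) = min j t"
      "\<forall>j<i. j < t \<longrightarrow> \<alpha>' 3 j = j \<and> \<alpha>' 4 j = Suc j" "\<forall>j. j \<notin> {2, 3, 4} \<longrightarrow> \<alpha>' j = \<alpha> j" "\<forall>j. j \<noteq> 9 \<and> j \<noteq> 11 \<longrightarrow> \<rho>' j = \<rho> j"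
      "3 + (n - i) * (ccost clsstep + 3) + ccost clsfinish + k' \<le> k" unfolding I_def by blast
    have "i < n" using b i(2,3,7) \<rho> by simp
    then have "n - i = Suc (n - Suc i)" by simp
    then have cr: "3 + (ccost clsstep + 3) + (n - Suc i) * (ccost clsstep + 3) + ccost clsfinish + k' \<le> k" using i(8) by simp
    have regs: "\<rho>' 5 = t" "\<alpha>' 0 = \<alpha> 0" using i(6,7) \<rho> by simp_all
    define p where "p = \<alpha> 0 i"
    have D: "((\<alpha>' 2)(p := min i t)) (\<alpha> 0 j) = min j t" if "j < Suc i" for j
    proof (cases "j = i")
      case False
      then have "\<alpha> 0 j \<noteq> p" using E(2)[of j] E(2)[of i] that \<open>i < n\<close> unfolding p_def by auto
      then show ?thesis using i(4) that False by simp
    qed (simp add: p_def)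
    have "I (run clsstep s) (3 + (n - Suc i) * (ccost clsstep + 3) + ccost clsfinish + k')"
    proof (cases "i < t")
      case True
      let ?\<alpha> = "\<alpha>'(2 := (\<alpha>' 2)(p := min i t), 3 := (\<alpha>' 3)(i := i), 4 := (\<alpha>' 4)(i := Suc i))"
      have run: "run clsstep s = mk (\<rho>'(11 := p, 9 := Suc i)) ?\<alpha> \<beta>"
        unfolding i(2) clsstep_def using True i(3) regs by (simp add: p_def)
      show ?thesis unfolding run I_def using D i(5-7) \<open>i < n\<close>
        by (intro exI[of _ "\<rho>'(11 := p, 9 := Suc i)"] exI[of _ ?\<alpha>] exI[of _ "Suc i"]) (simp add: less_Suc_eq)
    next
      case False
      let ?\<alpha> = "\<alpha>'(2 := (\<alpha>' 2)(p := min i t))"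
      have run: "run clsstep s = mk (\<rho>'(11 := p, 9 := Suc i)) ?\<alpha> \<beta>"
        unfolding i(2) clsstep_def using False i(3) regs by (simp add: p_def min_def)
      show ?thesis unfolding run I_def using D i(5-7) \<open>i < n\<close> False
        by (intro exI[of _ "\<rho>'(11 := p, 9 := Suc i)"] exI[of _ ?\<alpha>] exI[of _ "Suc i"]) (simp add: less_Suc_eq)
    qed
    then show "\<exists>k'. bcost (Less (Reg 9) (Reg 3)) + k' \<le> k \<and> wp clsstep I s k'"
      by (intro exI[of _ "k - 3"] conjI wp_loopfree[of clsstep "3 + (n - Suc i) * (ccost clsstep + 3) + ccost clsfinish + k'"])
        (use cr in simp_all)
  next
    fix s k assume "I s k" and b: "\<not> bval (Less (Reg 9) (Reg 3)) s"
    then obtain \<rho>' \<alpha>' i where i: "i \<le> n" "s = mk \<rho>' \<alpha>' \<beta>" "\<rho>' 9 = i" "\<forall>j<i. \<alpha>' 2 (\<alpha> 0 j) = min j t"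
      "\<forall>j<i. j < t \<longrightarrow> \<alpha>' 3 j = j \<and> \<alpha>' 4 j = Suc j" "\<forall>j. j \<notin> {2, 3, 4} \<longrightarrow> \<alpha>' j = \<alpha> j" "\<forall>j. j \<noteq> 9 \<and> j \<noteq> 11 \<longrightarrow> \<rho>' j = \<rho> j"
      "3 + (n - i) * (ccost clsstep + 3) + ccost clsfinish + k' \<le> k" unfolding I_def by blast
    have "i = n" using b i(1-3,7) \<rho> by simp
    let ?\<alpha> = "\<alpha>'(3 := (\<alpha>' 3)(t := t), 4 := (\<alpha>' 4)(t := n))"
    let ?\<rho> = "\<rho>'(7 := Suc t, 6 := t)"
    have run: "run clsfinish s = mk ?\<rho> ?\<alpha> \<beta>"
      unfolding i(2) clsfinish_def using i(7) \<rho> by simp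
    have D: "?\<alpha> 2 p = min (\<alpha> 1 p) t" if "p < n" for p
      using i(4) P[OF that] \<open>i = n\<close> by (metis fun_upd_apply numeral_eq_iff semiring_norm(83,87,88,89))
    have B: "?\<alpha> 3 c = c" if "c \<le> t" for c using that i(5) \<rho>(2) \<open>i = n\<close> by (cases "c = t") simp_all
    have N: "?\<alpha> 4 c = Suc c" if "c < t" for c using that i(5) \<rho>(2) \<open>i = n\<close> by simp
    have "Q (mk ?\<rho> ?\<alpha> \<beta>) k'"
    proof (rule Q)
      show "partn n (\<alpha> 0) (\<alpha> 1) (?\<alpha> 2) (?\<alpha> 3) (?\<alpha> 4) (Suc t)"
        by (rule partn_init[OF perm \<rho>(2) D B N]) simp_all
      show "?\<alpha> 2 p = min (\<alpha> 1 p) t" if "p < n" for p by (rule D[OF that])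
      show "?\<alpha> j = \<alpha> j" if "j \<notin> {2, 3, 4}" for j using i(6) that by simp
      show "?\<rho> j = \<rho> j" if "j \<in> {2, 3, 4, 5, 21}" for j using i(7) that by auto
    qed simp_all
    then have "wp clsfinish Q s (ccost clsfinish + k')" by (intro wp_loopfree[of clsfinish k']) (simp_all add: run)
    then show "\<exists>k'. bcost (Less (Reg 9) (Reg 3)) + k' \<le> k \<and> wp clsfinish Q s k'"
      using i(8) by (intro exI[of _ "ccost clsfinish + k'"]) simp
  qed
  have "I (mk (\<rho>(9 := 0)) \<alpha> \<beta>) (k - 2)" unfolding I_def
    by (intro exI[of _ "\<rho>(9 := 0)"] exI[of _ \<alpha>] exI[of _ 0]) (use k in simp)
  from wp_Seq[OF While[OF this]] show ?thesis unfolding clsinit_def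
    by (intro wp_Seq_loopfree[of "Assign 9 (Num 0)" "k - 2"]) (use k in simp_all)
qed

end

section \<open>Composition of the phases\<close>

context numbered_graph
begin

lemma wp_partition:
  assumes xs: "length xs = 3 + L * n + 2 * l" "xs ! 0 = n" "xs ! 1 = r" "xs ! (2 + L * n) = l"
    and \<tau>xs: "\<And>p x. p < n \<Longrightarrow> x < L \<Longrightarrow> xs ! (2 + L * p + x) = \<tau> x p"
    and k: "time_partition n + k' \<le> k"
    and Q: "\<And>\<rho> \<alpha> T v. core_quotient H \<Gamma> r T v (\<alpha> 2) \<Longrightarrow> partn n (\<alpha> 0) (\<alpha> 1) (\<alpha> 2) (\<alpha> 3) (\<alpha> 4) (\<rho> 7) \<Longrightarrow> tabG \<alpha>
      \<Longrightarrow> \<rho> 2 = length xs \<Longrightarrow> \<rho> 3 = n \<Longrightarrow> \<rho> 4 = r \<Longrightarrow> \<rho> 21 = 2 + L * n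
      \<Longrightarrow> Q (mk \<rho> \<alpha> (\<lambda>a. if 2 \<le> a \<and> a < 2 + L * n then 0 else xs ! a)) k'"
  shows "wp partition_prog Q (input_state xs) k"
proof -
  let ?\<rho>0 = "(\<lambda>_. 0)(3 :: nat := n, 4 := r, 21 := 2 + L * n, 22 := l, 2 := length xs)"
  let ?\<beta> = "\<lambda>a. if 2 \<le> a \<and> a < 2 + L * n then 0 else xs ! a"
  define k4 where "k4 = 3 + n * (refine_core.cost_class L + (refine_core.cost_class L + cost_relabel) * floor_log n) + k'"
  define k3 where "k3 = 2 + 3 + n * (ccost clsstep + 3) + ccost clsfinish + k4"
  define k2 where "k2 = ccost scan + 2 + 3 + n * (ccost prunestep + 3) + k3"
  define k1 where "k1 = 3 + n * (ccost initstep + 3) + k2"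
  have k1: "ccost setup_prog + k1 \<le> k"
    using k unfolding time_partition_def k1_def k2_def k3_def k4_def by linarith
  have main: "wp (Seq initloop (Seq pruneloop (Seq clsinit refine))) Q (mk ?\<rho>0 (\<lambda>_ _. 0) (\<lambda>a. xs ! a)) k1"
  proof (rule wp_Seq, rule wp_initloop[where k' = k2])
    show "xs ! (2 + L * p + x) = \<tau> x p" if "p < n" "x < L" for p x using \<tau>xs that .
    show "3 + n * (ccost initstep + 3) + k2 \<le> k1" by (simp add: k1_def)
    show "?\<rho>0 3 = n" "?\<rho>0 9 = 0" "2 + L * n \<le> ?\<rho>0 2" using xs(1) by simp_all
    fix \<rho>1 \<alpha>1
    assume 1: "\<forall>i<n. \<alpha>1 0 i = i \<and> \<alpha>1 1 i = i" "\<alpha>1 5 = (\<lambda>_. 0)" "tabG \<alpha>1"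
      and fr1: "\<And>j. j \<noteq> 9 \<Longrightarrow> \<rho>1 j = ?\<rho>0 j"
    have perm1: "perm n (\<alpha>1 0) (\<alpha>1 1)" using 1(1) by (simp add: perm_def)
    show "wp (Seq pruneloop (Seq clsinit refine)) Q (mk \<rho>1 \<alpha>1 ?\<beta>) k2"
    proof (rule wp_Seq, rule wp_pruneloop[where k' = k3, OF perm1 1(3)])
      show "\<rho>1 5 = 0" "\<rho>1 4 = r" using fr1 by simp_all
      show "ccost scan + 2 + 3 + n * (ccost prunestep + 3) + k3 \<le> k2" by (simp add: k2_def)
      fix \<rho>2 \<alpha>2 T v
      assume cd: "core_decomposition H \<Gamma> r T v" and perm2: "perm n (\<alpha>2 0) (\<alpha>2 1)" and tn: "\<rho>2 5 < n"
        and T: "T = {q. q < n \<and> \<alpha>2 1 q < \<rho>2 5}"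
        and fra2: "\<And>j. j \<notin> {0, 1} \<Longrightarrow> \<alpha>2 j = \<alpha>1 j" and frr2: "\<And>j. j \<in> {2, 3, 4, 21} \<Longrightarrow> \<rho>2 j = \<rho>1 j"
      interpret D: core_decomposition H \<Gamma> r T v by (rule cd)
      define t where "t = \<rho>2 5"
      interpret R: refine_core L n \<tau> t D.MC D.C v ls
      proof (intro refine_core.intro refine_core_axioms.intro refine_program_\<tau> D.core.core_graph_axioms)
        show "D.C \<subseteq> {..<n}" unfolding D.C_def V_n by blast
        show "\<tau> x p = Suc s \<longleftrightarrow> (p, ls ! x, s) \<in> D.MC" if "p \<in> D.C" "s \<in> D.C" for x p s
          using that \<tau>_Suc D.MC_M by blast
      qed (use ls in simp_all)
      have memC: "p \<in> D.C \<longleftrightarrow> t \<le> \<alpha>2 1 p" if "p < n" for p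
        unfolding D.C_def V_n t_def by (subst T) (use that in auto)
      have tab2: "tabG \<alpha>2" using 1(3) fra2 by (simp add: tabG_def)
      show "wp (Seq clsinit refine) Q (mk \<rho>2 \<alpha>2 ?\<beta>) k3"
      proof (rule wp_Seq, rule wp_clsinit[where k' = k4 and t = t and n = n, OF perm2])
        show "\<rho>2 5 = t" "t < n" "\<rho>2 3 = n" using tn frr2[of 3] fr1[of 3] by (simp_all add: t_def)
        show "2 + 3 + n * (ccost clsstep + 3) + ccost clsfinish + k4 \<le> k3" by (simp add: k3_def)
        fix \<rho>3 \<alpha>3
        assume part3: "partn n (\<alpha>2 0) (\<alpha>2 1) (\<alpha>3 2) (\<alpha>3 3) (\<alpha>3 4) (Suc t)"
          and D3: "\<And>p. p < n \<Longrightarrow> \<alpha>3 2 p = min (\<alpha>2 1 p) t" and r3: "\<rho>3 6 = t" "\<rho>3 7 = Suc t"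
          and fra3: "\<And>j. j \<notin> {2, 3, 4} \<Longrightarrow> \<alpha>3 j = \<alpha>2 j" and frr3: "\<And>j. j \<in> {2, 3, 4, 5, 21} \<Longrightarrow> \<rho>3 j = \<rho>2 j"
        have part3': "partn n (\<alpha>3 0) (\<alpha>3 1) (\<alpha>3 2) (\<alpha>3 3) (\<alpha>3 4) (\<rho>3 7)" using part3 fra3[of 0] fra3[of 1] r3 by simp
        have tab3: "R.tab \<alpha>3" using tab2 fra3 by (simp add: tabG_def R.tab_def)
        have C3: "p \<in> D.C \<longleftrightarrow> t \<le> \<alpha>3 2 p" if "p < n" for p using memC[OF that] D3[OF that] by simp
        have Ct: "\<alpha>3 2 p = t" if "p \<in> D.C" for p
        proof -
          have "p < n" using that R.C_n by blast
          then show ?thesis using memC D3 that by simp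
        qed
        have "R.RI \<rho>3 \<alpha>3" unfolding R.RI_def
        proof (intro conjI allI impI)
          show "\<alpha>3 5 = (\<lambda>_. 0)" using 1(2) fra2[of 5] fra3[of 5] by simp
          show "\<rho>3 5 = t" using frr3[of 5] by (simp add: t_def)
          show "p \<in> D.C \<longleftrightarrow> t \<le> \<alpha>3 2 p" if "p < n" for p by (rule C3[OF that])
          show "p = q" if "p < n" "q < n" "\<alpha>3 2 p < t" "\<alpha>3 2 p = \<alpha>3 2 q" for p q
            using that D3[OF that(1)] D3[OF that(2)] perm_inj[OF perm2 that(1,2)] by (simp add: min_def split: if_splits)
          show "D.core.sound (\<alpha>3 2)" unfolding D.core.sound_def using Ct by simp
          show "D.core.processed (\<alpha>3 2) (\<rho>3 6)" unfolding D.core.processed_def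
          proof (intro ballI allI impI)
            fix p q x assume "D.core.target (\<alpha>3 2) x p \<noteq> D.core.target (\<alpha>3 2) x q"
            \<comment> \<open>The whole core is one class at the start, so every defined target is
              \<open>Suc t\<close>, and of two different targets one exceeds
              \<open>t\<close>.\<close>
            moreover have "D.core.target (\<alpha>3 2) x p = 0 \<or> D.core.target (\<alpha>3 2) x p = Suc t" for p
            proof (cases "\<exists>s. (p, x, s) \<in> D.MC")
              case True
              then obtain s where s: "(p, x, s) \<in> D.MC" by blast
              then have "s \<in> D.C" by (simp add: D.MC_M)
              then show ?thesis using D.core.target_eq[OF s, of "\<alpha>3 2"] Ct by simp
            next
              case False
              then show ?thesis using D.core.target_0 by blast
            qed
            ultimately show "\<rho>3 6 < D.core.target (\<alpha>3 2) x p \<or> \<rho>3 6 < D.core.target (\<alpha>3 2) x q" using r3(1) by (metis lessI)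
          qed
        qed (use part3' tab3 r3 in simp_all)
        then show "wp refine Q (mk \<rho>3 \<alpha>3 ?\<beta>) k4"
        proof (rule R.wp_refine[where e = k'])
          show "3 + pot (refine_core.cost_class L) (refine_core.cost_class L + cost_relabel) n (\<alpha>3 2) (\<alpha>3 3) (\<alpha>3 4) (\<rho>3 6) + k' \<le> k4"
            using pot_le[OF part3] by (simp add: k4_def)
          fix \<rho>4 \<alpha>4
          assume 4: "partn n (\<alpha>4 0) (\<alpha>4 1) (\<alpha>4 2) (\<alpha>4 3) (\<alpha>4 4) (\<rho>4 7)" "R.tab \<alpha>4"
            and eq: "\<And>p q. p < n \<Longrightarrow> q < n \<Longrightarrow> \<alpha>4 2 p = \<alpha>4 2 q \<longleftrightarrow> p = q \<or> p \<in> D.C \<and> q \<in> D.C \<and> lang D.MC p = lang D.MC q"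
            and frr4: "\<And>j. j \<in> {2, 3, 4, 21} \<Longrightarrow> \<rho>4 j = \<rho>3 j"
          have regs: "\<rho>4 j = ?\<rho>0 j" if "j \<in> {2, 3, 4, 21}" for j
          proof -
            have "j \<in> {2, 3, 4, 5, 21}" "j \<noteq> 9" using that by auto
            then show ?thesis using frr4[OF that] frr3[of j] frr2[OF that] fr1[of j] by simp
          qed
          show "Q (mk \<rho>4 \<alpha>4 ?\<beta>) k'"
          proof (rule Q)
            show "core_quotient H \<Gamma> r T v (\<alpha>4 2)"
              by (intro core_quotient.intro core_quotient_axioms.intro cd) (use eq V_n in \<open>simp add: D.sim_def\<close>)
            show "tabG \<alpha>4" using 4(2) by (simp add: tabG_def R.tab_def)
          qed (use 4(1) regs in simp_all)
        qed
      qed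
    qed
  qed
  show ?thesis unfolding partition_prog_def
    by (rule wp_Seq_loopfree[of setup_prog k1]) (use k1 main run_setup[OF xs] in simp_all)
qed

end

section \<open>Output and test\<close>

context numbered_graph
begin

lemma mult_add_eq_iff:
  assumes "x < L" "x' < L"
  shows "L * c + x = L * c' + x' \<longleftrightarrow> c = c' \<and> x = x'"
proof
  assume eq: "L * c + x = L * c' + x'"
  have "(L * c + x) div L = c" "(L * c' + x') div L = c'" "(L * c + x) mod L = x" "(L * c' + x') mod L = x'"
    using assms by simp_all
  then show "c = c' \<and> x = x'" using eq by metis
qed simp

text \<open>\<open>filled D m dn \<beta>\<close>: the transition table with \<open>m\<close> rows stored in \<open>\<beta>\<close> contains the images under \<open>D\<close>
  of the transitions of \<open>\<Gamma>\<close> that are selected by \<open>dn\<close>, and no other transitions.\<close>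

definition filled :: "(nat \<Rightarrow> nat) \<Rightarrow> nat \<Rightarrow> (nat \<Rightarrow> nat \<Rightarrow> bool) \<Rightarrow> (nat \<Rightarrow> nat) \<Rightarrow> bool" where
  "filled D m dn \<beta> \<longleftrightarrow> (\<forall>c<m. \<forall>x<L.
     (\<forall>p<n. \<forall>s. dn p x \<longrightarrow> D p = c \<longrightarrow> \<tau> x p = Suc s \<longrightarrow> \<beta> (2 + L * c + x) = Suc (D s))
     \<and> ((\<forall>p<n. dn p x \<longrightarrow> D p = c \<longrightarrow> \<tau> x p = 0) \<longrightarrow> \<beta> (2 + L * c + x) = 0))"

lemma filledD:
  assumes "filled D m dn \<beta>" "c < m" "x < L"
  shows "p < n \<Longrightarrow> dn p x \<Longrightarrow> D p = c \<Longrightarrow> \<tau> x p = Suc s \<Longrightarrow> \<beta> (2 + L * c + x) = Suc (D s)"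
    "(\<And>p. p < n \<Longrightarrow> dn p x \<Longrightarrow> D p = c \<Longrightarrow> \<tau> x p = 0) \<Longrightarrow> \<beta> (2 + L * c + x) = 0"
  using assms unfolding filled_def by blast+

lemma filled_step:
  assumes f: "filled D m dn \<beta>" and i: "i < n" "D i < m" "y < L"
    and cons: "\<forall>p<n. \<forall>p'<n. \<forall>x s s'. D p = D p' \<longrightarrow> \<tau> x p = Suc s \<longrightarrow> \<tau> x p' = Suc s' \<longrightarrow> D s = D s'"
  shows "\<tau> y i = 0 \<Longrightarrow> filled D m (\<lambda>p x. dn p x \<or> p = i \<and> x = y) \<beta>"
    and "\<tau> y i = Suc s \<Longrightarrow> filled D m (\<lambda>p x. dn p x \<or> p = i \<and> x = y) (\<beta>(2 + L * D i + y := Suc (D s)))"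
proof -
  show "filled D m (\<lambda>p x. dn p x \<or> p = i \<and> x = y) \<beta>" if "\<tau> y i = 0"
    unfolding filled_def
  proof (intro allI impI conjI)
    fix c x p s' assume c: "c < m" "x < L" and p: "p < n" "dn p x \<or> p = i \<and> x = y" "D p = c" "\<tau> x p = Suc s'"
    then have "dn p x" using that by auto
    then show "\<beta> (2 + L * c + x) = Suc (D s')" using filledD(1)[OF f c p(1) _ p(3,4)] by blast
  next
    fix c x assume c: "c < m" "x < L" and "\<forall>p<n. dn p x \<or> p = i \<and> x = y \<longrightarrow> D p = c \<longrightarrow> \<tau> x p = 0"
    then show "\<beta> (2 + L * c + x) = 0" using filledD(2)[OF f c] by blast
  qed
  show "filled D m (\<lambda>p x. dn p x \<or> p = i \<and> x = y) (\<beta>(2 + L * D i + y := Suc (D s)))" if s: "\<tau> y i = Suc s"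
    unfolding filled_def
  proof (intro allI impI conjI)
    fix c x p s' assume c: "c < m" "x < L" and p: "p < n" "dn p x \<or> p = i \<and> x = y" "D p = c" "\<tau> x p = Suc s'"
    show "(\<beta>(2 + L * D i + y := Suc (D s))) (2 + L * c + x) = Suc (D s')"
    proof (cases "c = D i \<and> x = y")
      case True
      then have "D s' = D s" using cons p(1,3,4) i(1) s by blast
      then show ?thesis using True by simp
    next
      case False
      then have "2 + L * c + x \<noteq> 2 + L * D i + y" using mult_add_eq_iff[OF c(2) i(3), of c "D i"] by simp
      moreover have "dn p x" using p(2,3) False by blast
      ultimately show ?thesis using filledD(1)[OF f c p(1) _ p(3,4)] by simp
    qed
  next
    fix c x assume c: "c < m" "x < L" and z: "\<forall>p<n. dn p x \<or> p = i \<and> x = y \<longrightarrow> D p = c \<longrightarrow> \<tau> x p = 0"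
    have "\<not> (c = D i \<and> x = y)" using z i(1) s by auto
    then have "2 + L * c + x \<noteq> 2 + L * D i + y" using mult_add_eq_iff[OF c(2) i(3), of c "D i"] by simp
    moreover have "\<beta> (2 + L * c + x) = 0" using filledD(2)[OF f c] z by blast
    ultimately show "(\<beta>(2 + L * D i + y := Suc (D s))) (2 + L * c + x) = 0" by simp
  qed
qed

lemma filled_cong: "filled D m dn \<beta> \<Longrightarrow> (\<And>p x. p < n \<Longrightarrow> x < L \<Longrightarrow> dn p x \<longleftrightarrow> dn' p x) \<Longrightarrow> filled D m dn' \<beta>"
  unfolding filled_def by simp

lemma run_outletters:
  assumes tab: "tabG \<alpha>" and i: "\<rho> 9 = i" "i < n" and W: "2 + L * m \<le> \<rho> 2" and m: "\<And>p. p < n \<Longrightarrow> \<alpha> 2 p < m"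
    and cons: "\<forall>p<n. \<forall>p'<n. \<forall>x s s'. \<alpha> 2 p = \<alpha> 2 p' \<longrightarrow> \<tau> x p = Suc s \<longrightarrow> \<tau> x p' = Suc s' \<longrightarrow> \<alpha> 2 s = \<alpha> 2 s'"
    and f: "filled (\<alpha> 2) m (\<lambda>p x. p < i) \<beta>" and l: "l \<le> L"
  shows "\<exists>\<rho>' \<beta>'. run (seqs (map outletter [0..<l])) (mk \<rho> \<alpha> \<beta>) = mk \<rho>' \<alpha> \<beta>'
    \<and> filled (\<alpha> 2) m (\<lambda>p x. p < i \<or> p = i \<and> x < l) \<beta>' \<and> (\<forall>j. j \<noteq> 14 \<longrightarrow> \<rho>' j = \<rho> j)"
  using l
proof (induction l)
  case 0
  show ?case using f by (intro exI[of _ \<rho>] exI[of _ \<beta>]) simp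
next
  case (Suc l)
  then obtain \<rho>' \<beta>' where r: "run (seqs (map outletter [0..<l])) (mk \<rho> \<alpha> \<beta>) = mk \<rho>' \<alpha> \<beta>'"
    "filled (\<alpha> 2) m (\<lambda>p x. p < i \<or> p = i \<and> x < l) \<beta>'" "\<forall>j. j \<noteq> 14 \<longrightarrow> \<rho>' j = \<rho> j" using Suc_leD by blast
  have run: "run (seqs (map outletter [0..<Suc l])) (mk \<rho> \<alpha> \<beta>) = run (outletter l) (mk \<rho>' \<alpha> \<beta>')"
    using r(1) by (simp add: run_seqs_snoc)
  have val: "\<alpha> (8 + l) i = \<tau> l i" using tab Suc.prems i by (simp add: tabG_def)
  have regs: "\<rho>' 9 = i" "\<rho>' 2 = \<rho> 2" using r(3) i by simp_all
  have lL: "l < L" using Suc.prems by simp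
  note step = filled_step[where D = "\<alpha> 2" and i = i and y = l, OF r(2) i(2) m[OF i(2)] lL cons]
  have dn: "(p < i \<or> p = i \<and> x < l) \<or> p = i \<and> x = l \<longleftrightarrow> p < i \<or> p = i \<and> x < Suc l" for p x by auto
  show ?case
  proof (cases "\<tau> l i")
    case 0
    have "run (outletter l) (mk \<rho>' \<alpha> \<beta>') = mk (\<rho>'(14 := 0)) \<alpha> \<beta>'"
      using val regs 0 lL by (simp add: outletter_def)
    moreover have "filled (\<alpha> 2) m (\<lambda>p x. p < i \<or> p = i \<and> x < Suc l) \<beta>'" using step(1)[OF 0, unfolded dn] .
    moreover have "\<forall>j. j \<noteq> 14 \<longrightarrow> (\<rho>'(14 := 0)) j = \<rho> j" using r(3) by simp
    ultimately show ?thesis unfolding run by blast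
  next
    case (Suc s)
    have "L * \<alpha> 2 i + L \<le> L * m" using m[OF i(2)] mult_le_mono2[of "Suc (\<alpha> 2 i)" m L] by simp
    then have lt: "2 + l + L * \<alpha> 2 i < \<rho> 2" using lL W by simp
    have "run (outletter l) (mk \<rho>' \<alpha> \<beta>') = mk (\<rho>'(14 := Suc s)) \<alpha> (\<beta>'(2 + l + L * \<alpha> 2 i := Suc (\<alpha> 2 s)))"
      using val regs Suc lL lt by (simp add: outletter_def)
    also have "2 + l + L * \<alpha> 2 i = 2 + L * \<alpha> 2 i + l" by simp
    finally have run2: "run (outletter l) (mk \<rho>' \<alpha> \<beta>') = mk (\<rho>'(14 := Suc s)) \<alpha> (\<beta>'(2 + L * \<alpha> 2 i + l := Suc (\<alpha> 2 s)))" .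
    have "filled (\<alpha> 2) m (\<lambda>p x. p < i \<or> p = i \<and> x < Suc l) (\<beta>'(2 + L * \<alpha> 2 i + l := Suc (\<alpha> 2 s)))"
      using step(2)[OF Suc, unfolded dn] by simp
    moreover have "\<forall>j. j \<noteq> 14 \<longrightarrow> (\<rho>'(14 := Suc s)) j = \<rho> j" using r(3) by simp
    ultimately show ?thesis unfolding run run2 by blast
  qed
qed

lemma wp_output:
  assumes cq: "core_quotient H \<Gamma> r T v (\<alpha> 2)" and part: "partn n (\<alpha> 0) (\<alpha> 1) (\<alpha> 2) (\<alpha> 3) (\<alpha> 4) m" and tab: "tabG \<alpha>"
    and \<rho>: "3 + L * n \<le> \<rho> 2" "\<rho> 3 = n" "\<rho> 4 = r" "\<rho> 7 = m" and \<beta>: "\<And>a. 2 \<le> a \<Longrightarrow> a < 2 + L * n \<Longrightarrow> \<beta> a = 0"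
    and k: "2 + 3 + n * (ccost outstep + 3) + ccost outfinish \<le> k"
    and Q: "\<And>\<rho>' \<beta>'. \<beta>' 0 = m \<Longrightarrow> \<beta>' 1 = \<alpha> 2 r \<Longrightarrow> \<rho>' 2 = \<rho> 2
      \<Longrightarrow> (\<And>c x. c < m \<Longrightarrow> x < L \<Longrightarrow> \<beta>' (2 + L * c + x) = move_code (map_graph (\<alpha> 2) \<Gamma>) c (ls ! x)) \<Longrightarrow> Q (mk \<rho>' \<alpha> \<beta>') 0"
  shows "wp output_prog Q (mk \<rho> \<alpha> \<beta>) k"
proof -
  interpret Q: core_quotient H \<Gamma> r T v "\<alpha> 2" by (rule cq)
  have mn: "m \<le> n" by (rule partn_card(2)[OF part])
  then have "L * m \<le> L * n" by (rule mult_le_mono2)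
  then have W: "2 + L * m \<le> \<rho> 2" using \<rho>(1) by linarith
  \<comment> \<open>Determinism of the quotient: values written to one cell on behalf of different
    vertices agree.\<close>
  have cons: "\<alpha> 2 s = \<alpha> 2 s'" if "p < n" "p' < n" "\<alpha> 2 p = \<alpha> 2 p'" "\<tau> x p = Suc s" "\<tau> x p' = Suc s'" for p p' x s s'
  proof -
    have m1: "(p, ls ! x, s) \<in> M" "(p', ls ! x, s') \<in> M" using that(4,5) \<tau>_Suc by blast+
    have "(\<alpha> 2 p, ls ! x, \<alpha> 2 s) \<in> img (\<alpha> 2) M" "(\<alpha> 2 p', ls ! x, \<alpha> 2 s') \<in> img (\<alpha> 2) M"
      using imgI[OF m1(1)] imgI[OF m1(2)] by blast+
    then show ?thesis using Q.quot.M_det that(3) by metis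
  qed
  then have cons: "\<forall>p<n. \<forall>p'<n. \<forall>x s s'. \<alpha> 2 p = \<alpha> 2 p' \<longrightarrow> \<tau> x p = Suc s \<longrightarrow> \<tau> x p' = Suc s' \<longrightarrow> \<alpha> 2 s = \<alpha> 2 s'"
    by blast
  define I where "I s k \<longleftrightarrow> (\<exists>\<rho>' \<beta>' i. i \<le> n \<and> s = mk \<rho>' \<alpha> \<beta>' \<and> \<rho>' 9 = i \<and> filled (\<alpha> 2) m (\<lambda>p x. p < i) \<beta>'
     \<and> (\<forall>j. j \<noteq> 9 \<and> j \<noteq> 14 \<longrightarrow> \<rho>' j = \<rho> j) \<and> 3 + (n - i) * (ccost outstep + 3) + ccost outfinish \<le> k)" for s k
  have While: "wp (While (Less (Reg 9) (Reg 3)) outstep) (wp outfinish Q) s k" if "I s k" for s k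
    using that
  proof (rule wp_While)
    fix s k assume "I s k" and b: "bval (Less (Reg 9) (Reg 3)) s"
    then obtain \<rho>' \<beta>' i where i: "i \<le> n" "s = mk \<rho>' \<alpha> \<beta>'" "\<rho>' 9 = i" "filled (\<alpha> 2) m (\<lambda>p x. p < i) \<beta>'"
      "\<forall>j. j \<noteq> 9 \<and> j \<noteq> 14 \<longrightarrow> \<rho>' j = \<rho> j" "3 + (n - i) * (ccost outstep + 3) + ccost outfinish \<le> k" unfolding I_def by blast
    have "i < n" using b i(2,3,5) \<rho> by simp
    then have "n - i = Suc (n - Suc i)" by simp
    then have cr: "3 + (ccost outstep + 3) + (n - Suc i) * (ccost outstep + 3) + ccost outfinish \<le> k" using i(6) by simp
    have W': "2 + L * m \<le> \<rho>' 2" using W i(5) by simp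
    have mem: "\<And>p. p < n \<Longrightarrow> \<alpha> 2 p < m" by (rule partnD(2)[OF part])
    obtain \<rho>2 \<beta>2 where r2: "run (seqs (map outletter [0..<L])) (mk \<rho>' \<alpha> \<beta>') = mk \<rho>2 \<alpha> \<beta>2"
      "filled (\<alpha> 2) m (\<lambda>p x. p < i \<or> p = i \<and> x < L) \<beta>2" "\<forall>j. j \<noteq> 14 \<longrightarrow> \<rho>2 j = \<rho>' j"
      using run_outletters[where l = L and \<rho> = \<rho>' and \<alpha> = \<alpha> and \<beta> = \<beta>', OF tab i(3) \<open>i < n\<close> W' mem cons i(4)] by blast
    have run: "run outstep s = mk (\<rho>2(9 := Suc i)) \<alpha> \<beta>2" unfolding i(2) outstep_def using r2(1,3) i(3) by simp
    have "filled (\<alpha> 2) m (\<lambda>p x. p < Suc i) \<beta>2" by (rule filled_cong[OF r2(2)]) auto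
    then have "I (run outstep s) (3 + (n - Suc i) * (ccost outstep + 3) + ccost outfinish)" unfolding run I_def
      using \<open>i < n\<close> i(5) r2(3) by (intro exI[of _ "\<rho>2(9 := Suc i)"] exI[of _ \<beta>2] exI[of _ "Suc i"]) simp
    then show "\<exists>k'. bcost (Less (Reg 9) (Reg 3)) + k' \<le> k \<and> wp outstep I s k'"
      by (intro exI[of _ "k - 3"] conjI wp_loopfree[of outstep "3 + (n - Suc i) * (ccost outstep + 3) + ccost outfinish"])
        (use cr in simp_all)
  next
    fix s k assume "I s k" and b: "\<not> bval (Less (Reg 9) (Reg 3)) s"
    then obtain \<rho>' \<beta>' i where i: "i \<le> n" "s = mk \<rho>' \<alpha> \<beta>'" "\<rho>' 9 = i" "filled (\<alpha> 2) m (\<lambda>p x. p < i) \<beta>'"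
      "\<forall>j. j \<noteq> 9 \<and> j \<noteq> 14 \<longrightarrow> \<rho>' j = \<rho> j" "3 + (n - i) * (ccost outstep + 3) + ccost outfinish \<le> k" unfolding I_def by blast
    have "i = n" using b i(1-3,5) \<rho> by simp
    have f: "filled (\<alpha> 2) m (\<lambda>p x. True) \<beta>'" by (rule filled_cong[OF i(4)]) (simp add: \<open>i = n\<close>)
    let ?\<beta> = "\<beta>'(0 := m, 1 := \<alpha> 2 r)"
    have run: "run outfinish s = mk \<rho>' \<alpha> ?\<beta>"
      unfolding i(2) outfinish_def using i(5) \<rho> by simp
    have "Q (mk \<rho>' \<alpha> ?\<beta>) 0"
    proof (rule Q)
      fix c x assume c: "c < m" "x < L"
      have mv: "(c, ls ! x, d) \<in> moves (map_graph (\<alpha> 2) \<Gamma>) \<longleftrightarrow> (\<exists>p s. \<alpha> 2 p = c \<and> \<alpha> 2 s = d \<and> (p, ls ! x, s) \<in> M)" for d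
      proof
        assume "(c, ls ! x, d) \<in> moves (map_graph (\<alpha> 2) \<Gamma>)"
        then have "(c, ls ! x, d) \<in> img (\<alpha> 2) M" unfolding moves_map_graph .
        then obtain p q where pq: "c = \<alpha> 2 p" "d = \<alpha> 2 q" "(p, ls ! x, q) \<in> M" by (rule imgE)
        then show "\<exists>p s. \<alpha> 2 p = c \<and> \<alpha> 2 s = d \<and> (p, ls ! x, s) \<in> M"
          by (intro exI[of _ p] exI[of _ q] conjI pq(3) pq(1,2)[symmetric])
      next
        assume "\<exists>p s. \<alpha> 2 p = c \<and> \<alpha> 2 s = d \<and> (p, ls ! x, s) \<in> M"
        then obtain p s where ps: "\<alpha> 2 p = c" "\<alpha> 2 s = d" "(p, ls ! x, s) \<in> M" by (elim exE conjE)
        show "(c, ls ! x, d) \<in> moves (map_graph (\<alpha> 2) \<Gamma>)"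
          unfolding moves_map_graph using imgI[OF ps(3), of "\<alpha> 2"] unfolding ps(1,2) .
      qed
      have "\<beta>' (2 + L * c + x) = move_code (map_graph (\<alpha> 2) \<Gamma>) c (ls ! x)"
      proof (cases "\<exists>p<n. \<alpha> 2 p = c \<and> \<tau> x p \<noteq> 0")
        case True
        then obtain p s where p: "p < n" "\<alpha> 2 p = c" "\<tau> x p = Suc s" using not0_implies_Suc by blast
        then have "\<beta>' (2 + L * c + x) = Suc (\<alpha> 2 s)" using filledD(1)[OF f c] by blast
        moreover have mp: "(c, ls ! x, \<alpha> 2 s) \<in> moves (map_graph (\<alpha> 2) \<Gamma>)" using p mv \<tau>_Suc by blast
        moreover have "(THE d. (c, ls ! x, d) \<in> moves (map_graph (\<alpha> 2) \<Gamma>)) = \<alpha> 2 s"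
        proof (rule the_equality)
          fix d assume "(c, ls ! x, d) \<in> moves (map_graph (\<alpha> 2) \<Gamma>)"
          then show "d = \<alpha> 2 s" using Q.quot.M_det mp unfolding moves_map_graph by blast
        qed (rule mp)
        ultimately show ?thesis unfolding move_code_def by auto
      next
        case False
        then have "\<beta>' (2 + L * c + x) = 0" by (intro filledD(2)[OF f c]) blast
        moreover have "\<not> (\<exists>d. (c, ls ! x, d) \<in> moves (map_graph (\<alpha> 2) \<Gamma>))"
        proof
          assume "\<exists>d. (c, ls ! x, d) \<in> moves (map_graph (\<alpha> 2) \<Gamma>)"
          then obtain p s where p: "\<alpha> 2 p = c" "(p, ls ! x, s) \<in> M" using mv by blast
          then have "\<tau> x p = Suc s" "p < n" using \<tau>_Suc M_n by blast+
          then show False using False p(1) by simp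
        qed
        ultimately show ?thesis unfolding move_code_def by simp
      qed
      then show "?\<beta> (2 + L * c + x) = move_code (map_graph (\<alpha> 2) \<Gamma>) c (ls ! x)" by simp
    qed (use i(5) in simp_all)
    then have "wp outfinish Q s (ccost outfinish)" by (intro wp_loopfree[of outfinish 0]) (simp_all add: run)
    then show "\<exists>k'. bcost (Less (Reg 9) (Reg 3)) + k' \<le> k \<and> wp outfinish Q s k'"
      using i(6) by (intro exI[of _ "ccost outfinish"]) simp
  qed
  \<comment> \<open>Nothing is written yet. The erased table covers all rows that will be used,
    because there are at most \<open>n\<close> classes.\<close>
  have "filled (\<alpha> 2) m (\<lambda>p x. p < 0) \<beta>" unfolding filled_def
  proof (intro allI impI conjI)
    fix c x assume c: "c < m" "x < L"
    have "L * Suc c \<le> L * n" using c mn by (intro mult_le_mono2) simp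
    then have "2 + L * c + x < 2 + L * n" using c by simp
    then show "\<beta> (2 + L * c + x) = 0" by (intro \<beta>) simp_all
  qed simp
  then have "I (mk (\<rho>(9 := 0)) \<alpha> \<beta>) (k - 2)" unfolding I_def
    by (intro exI[of _ "\<rho>(9 := 0)"] exI[of _ \<beta>] exI[of _ 0]) (use k in simp)
  from wp_Seq[OF While[OF this]] show ?thesis unfolding output_prog_def
    by (intro wp_Seq_loopfree[of "Assign 9 (Num 0)" "k - 2"]) (use k in simp_all)
qed

end

section \<open>The test of the given pairs\<close>

context layout
begin

lemma all_less_Suc_conv: "(\<forall>j<Suc i. P j) \<longleftrightarrow> (\<forall>j<i. P j) \<and> P i"
  by (auto simp: less_Suc_eq)

lemma wp_check:
  assumes \<rho>: "\<rho> 21 = w" "w + 1 + 2 * length ps \<le> \<rho> 2" and \<beta>: "\<beta> w = length ps"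
    and ps: "\<And>i. i < length ps \<Longrightarrow> \<beta> (w + 1 + 2 * i) = fst (ps ! i) \<and> \<beta> (w + 2 + 2 * i) = snd (ps ! i)"
    and k: "ccost checkinit + 4 + length ps * (ccost checkstep + 4) \<le> k"
    and Q: "\<And>\<rho>'. \<rho>' 0 = (if \<forall>(p, q)\<in>List.set ps. \<alpha> 2 p = \<alpha> 2 q then 1 else 0) \<Longrightarrow> Q (mk \<rho>' \<alpha> \<beta>) 0"
  shows "wp check_prog Q (mk \<rho> \<alpha> \<beta>) k"
proof -
  let ?b = "Less (Reg 9) (Mem (Reg 21))"
  let ?ok = "\<lambda>i. \<forall>j<i. \<alpha> 2 (fst (ps ! j)) = \<alpha> 2 (snd (ps ! j))"
  define I where "I s k \<longleftrightarrow> (\<exists>\<rho>' i. i \<le> length ps \<and> s = mk \<rho>' \<alpha> \<beta> \<and> \<rho>' 9 = i \<and> \<rho>' 12 = w + 1 + 2 * i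
     \<and> \<rho>' 0 = (if ?ok i then 1 else 0) \<and> \<rho>' 21 = w \<and> \<rho>' 2 = \<rho> 2 \<and> 4 + (length ps - i) * (ccost checkstep + 4) \<le> k)" for s k
  have w: "w < \<rho> 2" using \<rho>(2) by simp
  have While: "wp (While ?b checkstep) Q s k" if "I s k" for s k
    using that
  proof (rule wp_While)
    fix s k assume "I s k" and b: "bval ?b s"
    then obtain \<rho>' i where i: "i \<le> length ps" "s = mk \<rho>' \<alpha> \<beta>" "\<rho>' 9 = i" "\<rho>' 12 = w + 1 + 2 * i"
      "\<rho>' 0 = (if ?ok i then 1 else 0)" "\<rho>' 21 = w" "\<rho>' 2 = \<rho> 2" "4 + (length ps - i) * (ccost checkstep + 4) \<le> k"
      unfolding I_def by blast
    have il: "i < length ps" using b i(2,3,6,7) w \<beta> by simp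
    then have "length ps - i = Suc (length ps - Suc i)" by simp
    then have cr: "4 + (ccost checkstep + 4) + (length ps - Suc i) * (ccost checkstep + 4) \<le> k" using i(8) by simp
    have a: "w + 1 + 2 * i < \<rho> 2" "w + 2 + 2 * i < \<rho> 2" using il \<rho>(2) by simp_all
    let ?p = "fst (ps ! i)" and ?q = "snd (ps ! i)"
    have v: "\<beta> (Suc (w + 2 * i)) = ?p" "\<beta> (Suc (Suc (w + 2 * i))) = ?q" using ps[OF il] by simp_all
    have ok: "?ok (Suc i) \<longleftrightarrow> ?ok i \<and> \<alpha> 2 ?p = \<alpha> 2 ?q" by (auto simp: less_Suc_eq)
    let ?\<rho> = "\<rho>'(0 := (if \<alpha> 2 ?p = \<alpha> 2 ?q then \<rho>' 0 else 0), 12 := \<rho>' 12 + 2, 9 := Suc i)"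
    have run: "run checkstep s = mk ?\<rho> \<alpha> \<beta>"
      unfolding i(2) checkstep_def using i(3,4,7) a v by (auto simp: fun_upd_idem)
    have "I (run checkstep s) (4 + (length ps - Suc i) * (ccost checkstep + 4))"
      unfolding run I_def ok using il i
      by (intro exI[of _ ?\<rho>] exI[of _ "Suc i"]) (simp add: all_less_Suc_conv)
    then show "\<exists>k'. bcost ?b + k' \<le> k \<and> wp checkstep I s k'"
      by (intro exI[of _ "k - 4"] conjI wp_loopfree[of checkstep "4 + (length ps - Suc i) * (ccost checkstep + 4)"])
        (use cr in simp_all)
  next
    fix s k assume "I s k" and b: "\<not> bval ?b s"
    then obtain \<rho>' i where i: "i \<le> length ps" "s = mk \<rho>' \<alpha> \<beta>" "\<rho>' 9 = i" "\<rho>' 12 = w + 1 + 2 * i"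
      "\<rho>' 0 = (if ?ok i then 1 else 0)" "\<rho>' 21 = w" "\<rho>' 2 = \<rho> 2" "4 + (length ps - i) * (ccost checkstep + 4) \<le> k"
      unfolding I_def by blast
    have "i = length ps" using b i(1-3,6,7) w \<beta> by simp
    moreover have "(\<forall>(p, q)\<in>List.set ps. \<alpha> 2 p = \<alpha> 2 q) \<longleftrightarrow> ?ok (length ps)"
      by (auto simp: all_set_conv_all_nth case_prod_beta)
    ultimately have "Q s 0" unfolding i(2) using i(5) by (intro Q) simp
    then show "\<exists>k'. bcost ?b + k' \<le> k \<and> Q s k'" using i(8) by (intro exI[of _ 0]) simp
  qed
  let ?\<rho>0 = "\<rho>(0 := 1, 9 := 0, 12 := w + 1)"
  have run0: "run checkinit (mk \<rho> \<alpha> \<beta>) = mk ?\<rho>0 \<alpha> \<beta>" using \<rho>(1) by (simp add: checkinit_def)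
  have "I (mk ?\<rho>0 \<alpha> \<beta>) (4 + length ps * (ccost checkstep + 4))" unfolding I_def
    by (intro exI[of _ ?\<rho>0] exI[of _ 0]) (use \<rho>(1) in simp)
  from While[OF this] show ?thesis unfolding check_prog_def
    by (intro wp_Seq_loopfree[of checkinit "4 + length ps * (ccost checkstep + 4)"]) (use k in \<open>simp_all add: run0\<close>)
qed

end

section \<open>Encodings and time bounds\<close>

lemma set_letters: "set (letters bs) = set bs \<times> UNIV"
  by (auto simp: letters_def UNIV_bool)

lemma distinct_letters: "distinct bs \<Longrightarrow> distinct (letters bs)"
  by (induction bs) (auto simp: letters_def)

lemma length_concat_rows: "length (concat (map (\<lambda>i. map (f i) ys) [0..<m])) = length ys * m"
  by (induction m) simp_all

lemma nth_concat_rows: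
  assumes "i < m" "x < length ys"
  shows "concat (map (\<lambda>i. map (f i) ys) [0..<m]) ! (length ys * i + x) = f i (ys ! x)"
  using assms
proof (induction m)
  case (Suc m)
  show ?case
  proof (cases "i = m")
    case True
    then show ?thesis using Suc.prems by (simp add: nth_append length_concat_rows)
  next
    case False
    then have "length ys * Suc i \<le> length ys * m" using Suc.prems(1) by (intro mult_le_mono2) simp
    then have "length ys * i + x < length ys * m" using Suc.prems(2) by simp
    then show ?thesis using Suc False by (simp add: nth_append length_concat_rows)
  qed
qed simp

lemma length_graph_code: "length (graph_code bs \<Gamma> r) = 2 + length (letters bs) * card (verts \<Gamma>)"
  by (simp add: graph_code_def length_concat_rows)

lemma nth_graph_code:
  "graph_code bs \<Gamma> r ! 0 = card (verts \<Gamma>)"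
  "graph_code bs \<Gamma> r ! 1 = r"
  "p < card (verts \<Gamma>) \<Longrightarrow> x < length (letters bs)
    \<Longrightarrow> graph_code bs \<Gamma> r ! (2 + length (letters bs) * p + x) = move_code \<Gamma> p (letters bs ! x)"
  by (simp_all add: graph_code_def nth_concat_rows)

lemma length_pairs_code: "length (pairs_code ps) = 1 + 2 * length ps"
  by (induction ps) (auto simp: pairs_code_def)

lemma nth_pairs_code:
  assumes "i < length ps"
  shows "pairs_code ps ! (1 + 2 * i) = fst (ps ! i) \<and> pairs_code ps ! (2 + 2 * i) = snd (ps ! i)"
proof -
  have "concat (map (\<lambda>(p, q). [p, q]) ps) ! (2 * i) = fst (ps ! i) \<and> concat (map (\<lambda>(p, q). [p, q]) ps) ! Suc (2 * i) = snd (ps ! i)"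
    using assms
  proof (induction ps arbitrary: i)
    case (Cons p ps)
    then show ?case by (cases i) (auto simp: case_prod_beta)
  qed simp
  then show ?thesis by (simp add: pairs_code_def)
qed

text \<open>Cells behind the input contain 0, so an input without pairs is also one with an empty
  list of pairs. Both programs can thus share \<open>partition_prog\<close>.\<close>

lemma input_state_snoc_0: "input_state (xs @ [0]) = input_state xs"
  by (auto simp: input_state_def nth_append)

lemma floor_log_le_ln:
  assumes "n > 0"
  shows "real (floor_log n) * ln 2 \<le> ln (real n)"
proof -
  have "2 ^ floor_log n \<le> n" using floor_log_exp2_le assms by blast
  then have "real (2 ^ floor_log n) \<le> real n" by (simp only: of_nat_le_iff)
  then have "ln (real (2 ^ floor_log n)) \<le> ln (real n)" by (subst ln_le_cancel_iff) (use assms in auto)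
  then show ?thesis by (simp add: ln_realpow)
qed

text \<open>From 3 on, the logarithm of \<open>n\<close> is at least 1, so that the constant and the
  linear term are absorbed; the factor \<open>1 / ln 2\<close> comes from the change of
  base.\<close>

lemma bigo_n_ln_n:
  fixes a b c :: nat
  assumes "\<And>n. T n \<le> a + b * n + c * (n * floor_log n)"
  shows "(\<lambda>n. real (T n)) \<in> O(\<lambda>n. real n * ln (real n))"
proof (rule bigoI)
  show "\<forall>\<^sub>F n in sequentially. norm (real (T n)) \<le> (real a + real b + real c / ln 2) * norm (real n * ln (real n))"
    using eventually_ge_at_top[of 3]
  proof eventually_elim
    case (elim n)
    let ?y = "real n * ln (real n)"
    have "exp 1 \<le> real n" using exp_le elim by linarith
    then have "ln (exp 1) \<le> ln (real n)" by (subst ln_le_cancel_iff) (use elim in auto)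
    then have ln: "1 \<le> ln (real n)" by simp
    then have n_y: "real n \<le> ?y" using mult_left_mono[of 1 "ln (real n)" "real n"] by simp
    then have "1 \<le> ?y" using elim by linarith
    then have a: "real a \<le> real a * ?y" using mult_left_mono[of 1 ?y "real a"] by simp
    have b: "real b * real n \<le> real b * ?y" using n_y by (intro mult_left_mono) simp_all
    have "real (floor_log n) \<le> ln (real n) / ln 2" using floor_log_le_ln[of n] elim by (simp add: pos_le_divide_eq)
    then have "real c * (real n * real (floor_log n)) \<le> real c * (real n * (ln (real n) / ln 2))"
      by (intro mult_left_mono) simp_all
    then have c: "real c * (real n * real (floor_log n)) \<le> (real c / ln 2) * ?y" by simp
    have "real (T n) \<le> real (a + b * n + c * (n * floor_log n))" using assms by (simp only: of_nat_le_iff)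
    also have "\<dots> = real a + real b * real n + real c * (real n * real (floor_log n))" by simp
    also have "\<dots> \<le> (real a + real b + real c / ln 2) * ?y" using a b c by (simp only: distrib_right)
    finally show ?case using \<open>1 \<le> ?y\<close> by simp
  qed
qed

lemma (in layout) time_partition_le:
  "\<exists>a b c. \<forall>n. time_partition n \<le> a + b * n + c * (n * floor_log n)"
proof -
  let ?a = "ccost setup_prog + 3 + (ccost scan + 2 + 3) + (2 + 3 + ccost clsfinish) + 3"
  let ?b = "(ccost initstep + 3) + (ccost prunestep + 3) + (ccost clsstep + 3) + refine_core.cost_class L"
  have "time_partition n \<le> ?a + ?b * n + (refine_core.cost_class L + cost_relabel) * (n * floor_log n)" for n
    unfolding time_partition_def by (simp add: algebra_simps)
  then show ?thesis by blast
qed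

section \<open>The two complete programs\<close>

lemma numbered_graph_intro:
  fixes bs :: "'a::finite list" and \<Gamma> :: "('a, nat) lgraph"
  assumes bs: "distinct bs" "set bs = UNIV" and H: "nontrivial_fg_subgroup H" "stallings H \<Gamma> r" "numbered \<Gamma>"
  obtains h where "numbered_graph H \<Gamma> r (length (letters bs)) (letters bs) (card (verts \<Gamma>)) h"
proof -
  have sub: "subgroup H free_group" using H(1) by (simp add: nontrivial_fg_subgroup_def)
  interpret S: stallings_graph H \<Gamma> r by (rule stallings_graph.intro[OF H(2) sub])
  have "[] \<in> H" by (rule subgroup_free_groupD[OF sub])
  then obtain h where h: "h \<in> H" "h \<noteq> []"
    using H(1) unfolding nontrivial_fg_subgroup_def one_free_group by blast
  have "numbered_graph H \<Gamma> r (length (letters bs)) (letters bs) (card (verts \<Gamma>)) h"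
  proof (intro numbered_graph.intro numbered_graph_axioms.intro S.stallings_graph_axioms)
    show "verts \<Gamma> = {..<card (verts \<Gamma>)}" using H(3) by (simp add: numbered_def)
    show "set (letters bs) = UNIV" using bs(2) by (simp add: set_letters)
    show "distinct (letters bs)" by (rule distinct_letters[OF bs(1)])
    show "reduced h" "path (moves \<Gamma>) r h r" "h \<noteq> []" using h S.H_iff by blast+
  qed simp
  then show ?thesis by (rule that)
qed

lemma exec_partition_output:
  fixes bs :: "'a::finite list" and \<Gamma> :: "('a, nat) lgraph"
  defines "L \<equiv> length (letters bs)"
  assumes bs: "distinct bs" "set bs = UNIV" and H: "nontrivial_fg_subgroup H" "stallings H \<Gamma> r" "numbered \<Gamma>"
  shows "\<exists>t s \<Gamma>' r'. exec (Seq (layout.partition_prog L) (layout.output_prog L)) (input_state (graph_code bs \<Gamma> r)) t s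
    \<and> t \<le> layout.time_partition L (card (verts \<Gamma>))
          + (2 + 3 + card (verts \<Gamma>) * (ccost (layout.outstep L) + 3) + ccost (layout.outfinish L))
    \<and> stallings (H_fi H) \<Gamma>' r' \<and> numbered \<Gamma>' \<and> output_prefix (graph_code bs \<Gamma>' r') s"
proof -
  obtain h where "numbered_graph H \<Gamma> r L (letters bs) (card (verts \<Gamma>)) h"
    unfolding L_def by (rule numbered_graph_intro[OF bs H])
  then interpret numbered_graph H \<Gamma> r L "letters bs" "card (verts \<Gamma>)" h .
  let ?n = "card (verts \<Gamma>)" and ?xs = "graph_code bs \<Gamma> r @ [0]"
  let ?k = "2 + 3 + ?n * (ccost outstep + 3) + ccost outfinish"
  let ?Q = "\<lambda>s k. \<exists>\<Gamma>' r'. stallings (H_fi H) \<Gamma>' r' \<and> numbered \<Gamma>' \<and> output_prefix (graph_code bs \<Gamma>' r') s"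
  have nth: "?xs ! i = graph_code bs \<Gamma> r ! i" if "i < 2 + L * ?n" for i
    using that by (simp add: nth_append length_graph_code L_def)
  have xs: "length ?xs = 3 + L * ?n + 2 * 0" "?xs ! 0 = ?n" "?xs ! 1 = r" "?xs ! (2 + L * ?n) = 0"
    using nth[of 0] nth[of 1] nth_graph_code(1,2)[of bs \<Gamma> r]
    by (simp_all add: length_graph_code L_def nth_append)
  have row: "2 + L * p + x < 2 + L * m" if "p < m" "x < L" for p x m
  proof -
    have "L * Suc p \<le> L * m" using that(1) by (intro mult_le_mono2) simp
    then show ?thesis using that(2) by simp
  qed
  have "wp (Seq partition_prog output_prog) ?Q (input_state ?xs) (time_partition ?n + ?k)"
  proof (rule wp_Seq, rule wp_partition[OF xs, where k' = ?k])
    show "?xs ! (2 + L * p + x) = \<tau> x p" if "p < ?n" "x < L" for p x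
      using nth[OF row[OF that]] nth_graph_code(3)[OF that(1), of x bs r] that(2) by (simp add: \<tau>_def L_def)
    fix \<rho> :: "nat \<Rightarrow> nat" and \<alpha> :: "nat \<Rightarrow> nat \<Rightarrow> nat" and T v
    assume cq: "core_quotient H \<Gamma> r T v (\<alpha> 2)" and part: "partn ?n (\<alpha> 0) (\<alpha> 1) (\<alpha> 2) (\<alpha> 3) (\<alpha> 4) (\<rho> 7)"
      and tab: "tabG \<alpha>" and \<rho>: "\<rho> 2 = length ?xs" "\<rho> 3 = ?n" "\<rho> 4 = r" "\<rho> 21 = 2 + L * ?n"
    let ?\<beta> = "\<lambda>a. if 2 \<le> a \<and> a < 2 + L * ?n then 0 else ?xs ! a"
    show "wp output_prog ?Q (mk \<rho> \<alpha> ?\<beta>) ?k"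
    proof (rule wp_output[OF cq part tab])
      show "3 + L * ?n \<le> \<rho> 2" using \<rho>(1) xs(1) by simp
      fix \<rho>' \<beta>' :: "nat \<Rightarrow> nat"
      assume \<beta>': "\<beta>' 0 = \<rho> 7" "\<beta>' 1 = \<alpha> 2 r" and 2: "\<rho>' 2 = \<rho> 2"
        and t: "\<And>c x. c < \<rho> 7 \<Longrightarrow> x < L \<Longrightarrow> \<beta>' (2 + L * c + x) = move_code (map_graph (\<alpha> 2) \<Gamma>) c (letters bs ! x)"
      let ?\<Gamma>' = "map_graph (\<alpha> 2) \<Gamma>"
      have verts: "verts ?\<Gamma>' = {..<\<rho> 7}" using partn_card(1)[OF part] V_n by simp
      then have card: "card (verts ?\<Gamma>') = \<rho> 7" by simp
      have "output_prefix (graph_code bs ?\<Gamma>' (\<alpha> 2 r)) (mk \<rho>' \<alpha> \<beta>')" unfolding output_prefix_def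
      proof (intro allI impI)
        fix i assume i: "i < length (graph_code bs ?\<Gamma>' (\<alpha> 2 r))"
        then have i: "i < 2 + L * \<rho> 7" unfolding length_graph_code card L_def[symmetric] .
        have "L * \<rho> 7 \<le> L * ?n" using partn_card(2)[OF part] by (rule mult_le_mono2)
        then have "i < \<rho>' 2" using i 2 \<rho>(1) xs(1) by linarith
        then have mem: "snd (mk \<rho>' \<alpha> \<beta>') i = \<beta>' i" by (rule snd_mk_low)
        consider "i = 0" | "i = 1" | "2 \<le> i" by linarith
        then show "snd (mk \<rho>' \<alpha> \<beta>') i = graph_code bs ?\<Gamma>' (\<alpha> 2 r) ! i" unfolding mem
        proof cases
          case 3
          define c x where "c = (i - 2) div L" and "x = (i - 2) mod L"
          have "i - 2 < L * \<rho> 7" using i 3 by simp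
          moreover from this have "0 < L" by (cases L) simp_all
          ultimately have c: "c < \<rho> 7" and x: "x < L" unfolding c_def x_def
            by (simp_all add: less_mult_imp_div_less mult.commute)
          have "L * c + x = i - 2" unfolding c_def x_def by simp
          then have "i = 2 + L * c + x" using 3 by simp
          then show "\<beta>' i = graph_code bs ?\<Gamma>' (\<alpha> 2 r) ! i"
            using t[OF c x] nth_graph_code(3)[of c ?\<Gamma>' x bs "\<alpha> 2 r"] c x card by (simp add: L_def)
        qed (use \<beta>' card nth_graph_code(1,2)[of bs ?\<Gamma>' "\<alpha> 2 r"] in simp_all)
      qed
      moreover have "numbered ?\<Gamma>'" unfolding numbered_def card by (rule verts)
      moreover have "stallings (H_fi H) ?\<Gamma>' (\<alpha> 2 r)" by (rule core_quotient.stallings_quot[OF cq])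
      ultimately show "?Q (mk \<rho>' \<alpha> \<beta>') 0" by blast
    qed (use \<rho> in simp_all)
  qed simp
  then obtain t s k' where ex: "exec (Seq partition_prog output_prog) (input_state (graph_code bs \<Gamma> r)) t s"
    "t + k' \<le> time_partition ?n + ?k" "?Q s k'" unfolding wp_def input_state_snoc_0 by blast
  have "t \<le> time_partition ?n + ?k" using ex(2) by linarith
  then show ?thesis using ex(1,3) by blast
qed

text \<open>No identification is carried out. Finite index is equivalent to \<open>sim\<close> for
  every given pair, and two vertices are related by \<open>sim\<close> exactly if their class
  numbers coincide.\<close>

lemma exec_partition_check:
  fixes bs :: "'a::finite list" and \<Gamma> :: "('a, nat) lgraph"
  defines "L \<equiv> length (letters bs)"
  assumes bs: "distinct bs" "set bs = UNIV" and H: "nontrivial_fg_subgroup H" "stallings H \<Gamma> r" "numbered \<Gamma>"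
    and ps: "set ps \<subseteq> verts \<Gamma> \<times> verts \<Gamma>"
  shows "\<exists>t s. exec (Seq (layout.partition_prog L) (layout.check_prog L)) (input_state (graph_code bs \<Gamma> r @ pairs_code ps)) t s
    \<and> t \<le> layout.time_partition L (card (verts \<Gamma>)) + (ccost layout.checkinit + 4) + (ccost (layout.checkstep L) + 4) * length ps
    \<and> fst s 0 = (if finite_index_ext H (subgroup_after_identification \<Gamma> r (set ps)) then 1 else 0)"
proof -
  obtain h where "numbered_graph H \<Gamma> r L (letters bs) (card (verts \<Gamma>)) h"
    unfolding L_def by (rule numbered_graph_intro[OF bs H])
  then interpret numbered_graph H \<Gamma> r L "letters bs" "card (verts \<Gamma>)" h .
  let ?n = "card (verts \<Gamma>)" and ?xs = "graph_code bs \<Gamma> r @ pairs_code ps"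
  let ?k = "ccost checkinit + 4 + length ps * (ccost checkstep + 4)"
  let ?Q = "\<lambda>s k. fst s 0 = (if finite_index_ext H (subgroup_after_identification \<Gamma> r (List.set ps)) then 1 else 0)"
  have nth: "?xs ! i = graph_code bs \<Gamma> r ! i" if "i < 2 + L * ?n" for i
    using that by (simp add: nth_append length_graph_code L_def)
  have nth2: "?xs ! (2 + L * ?n + i) = pairs_code ps ! i" for i
    using nth_append_length_plus[of "graph_code bs \<Gamma> r" "pairs_code ps" i] by (simp add: length_graph_code L_def)
  have xs: "length ?xs = 3 + L * ?n + 2 * length ps" "?xs ! 0 = ?n" "?xs ! 1 = r" "?xs ! (2 + L * ?n) = length ps"
    using nth[of 0] nth[of 1] nth_graph_code(1,2)[of bs \<Gamma> r] nth2[of 0]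
    by (simp_all add: length_graph_code length_pairs_code L_def) (simp add: pairs_code_def)
  have row: "2 + L * p + x < 2 + L * ?n" if "p < ?n" "x < L" for p x
  proof -
    have "L * Suc p \<le> L * ?n" using that(1) by (intro mult_le_mono2) simp
    then show ?thesis using that(2) by simp
  qed
  have "wp (Seq partition_prog check_prog) ?Q (input_state ?xs) (time_partition ?n + ?k)"
  proof (rule wp_Seq, rule wp_partition[OF xs, where k' = ?k])
    show "?xs ! (2 + L * p + x) = \<tau> x p" if "p < ?n" "x < L" for p x
      using nth[OF row[OF that]] nth_graph_code(3)[OF that(1), of x bs r] that(2) by (simp add: \<tau>_def L_def)
    fix \<rho> :: "nat \<Rightarrow> nat" and \<alpha> :: "nat \<Rightarrow> nat \<Rightarrow> nat" and T v
    assume cq: "core_quotient H \<Gamma> r T v (\<alpha> 2)"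
      and \<rho>: "\<rho> 2 = length ?xs" "\<rho> 3 = ?n" "\<rho> 4 = r" "\<rho> 21 = 2 + L * ?n"
    interpret Q: core_quotient H \<Gamma> r T v "\<alpha> 2" by (rule cq)
    let ?\<beta> = "\<lambda>a. if 2 \<le> a \<and> a < 2 + L * ?n then 0 else ?xs ! a"
    show "wp check_prog ?Q (mk \<rho> \<alpha> ?\<beta>) ?k"
    proof (rule wp_check[where w = "2 + L * ?n" and ps = ps])
      show "2 + L * ?n + 1 + 2 * length ps \<le> \<rho> 2" using \<rho>(1) xs(1) by simp
      show "?\<beta> (2 + L * ?n) = length ps" using xs(4) by simp
      \<comment> \<open>The pairs are stored just behind the erased table and are intact.\<close>
      show "?\<beta> (2 + L * ?n + 1 + 2 * i) = fst (ps ! i) \<and> ?\<beta> (2 + L * ?n + 2 + 2 * i) = snd (ps ! i)" if "i < length ps" for i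
        using nth2[of "1 + 2 * i"] nth2[of "2 + 2 * i"] nth_pairs_code[OF that] by (simp add: add.assoc)
      have "(\<forall>(p, q)\<in>List.set ps. \<alpha> 2 p = \<alpha> 2 q) \<longleftrightarrow> finite_index_ext H (subgroup_after_identification \<Gamma> r (List.set ps))"
        unfolding Q.finite_index_identification[OF ps] using Q.f_eq ps by blast
      then show "?Q (mk \<rho>' \<alpha> ?\<beta>) 0" if "\<rho>' 0 = (if \<forall>(p, q)\<in>List.set ps. \<alpha> 2 p = \<alpha> 2 q then 1 else 0)" for \<rho>' :: "nat \<Rightarrow> nat"
        using that by simp
    qed (use \<rho>(4) in simp_all)
  qed simp
  then obtain t s k' where ex: "exec (Seq partition_prog check_prog) (input_state ?xs) t s"
    "t + k' \<le> time_partition ?n + ?k" "?Q s k'" unfolding wp_def by blast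
  have "t \<le> time_partition ?n + (ccost checkinit + 4) + (ccost checkstep + 4) * length ps" using ex(2) by (simp add: algebra_simps)
  then show ?thesis using ex(1,3) by blast
qed

text \<open>The programs depend only on the number of letters and are thus fixed with the basis. The
  time for reading the pairs is a separate term, since the length of their list is not bounded in
  terms of the number of vertices.\<close>

theorem proposition2p11:
  fixes bs :: "'a::finite list"
  assumes "distinct bs" and "set bs = UNIV"
  shows
    "(\<forall>(H :: 'a word set) (\<Gamma> :: ('a, 'v) lgraph) r (\<Gamma>' :: ('a, 'w) lgraph) r'.
        nontrivial_fg_subgroup H \<and> stallings H \<Gamma> r \<and> stallings (H_fi H) \<Gamma>' r' \<longrightarrow>
        (\<forall>i\<in>verts (core \<Gamma> r).
           accessible_dfa (graph_dfa (core \<Gamma> r) i)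
           \<and> (\<exists>i'\<in>verts (core \<Gamma>' r'). (i = r \<longrightarrow> i' = r')
                \<and> dfa_isomorphic (minimize (graph_dfa (core \<Gamma> r) i)) (graph_dfa (core \<Gamma>' r') i'))))
     \<and>
     (\<exists>(P :: com) (T :: nat \<Rightarrow> nat).
        (\<lambda>n. real (T n)) \<in> O(\<lambda>n. real n * ln (real n))
        \<and> (\<forall>(H :: 'a word set) \<Gamma> r.
             nontrivial_fg_subgroup H \<and> stallings H \<Gamma> r \<and> numbered \<Gamma> \<longrightarrow>
             (\<exists>t s \<Gamma>' r'. exec P (input_state (graph_code bs \<Gamma> r)) t s \<and> t \<le> T (card (verts \<Gamma>))
                \<and> stallings (H_fi H) \<Gamma>' r' \<and> numbered \<Gamma>'
                \<and> output_prefix (graph_code bs \<Gamma>' r') s)))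
     \<and>
     (\<exists>(P :: com) (T :: nat \<Rightarrow> nat) (c :: nat).
        (\<lambda>n. real (T n)) \<in> O(\<lambda>n. real n * ln (real n))
        \<and> (\<forall>(H :: 'a word set) \<Gamma> r ps.
             nontrivial_fg_subgroup H \<and> stallings H \<Gamma> r \<and> numbered \<Gamma>
               \<and> set ps \<subseteq> verts \<Gamma> \<times> verts \<Gamma> \<longrightarrow>
             (\<exists>t s. exec P (input_state (graph_code bs \<Gamma> r @ pairs_code ps)) t s
                \<and> t \<le> T (card (verts \<Gamma>)) + c * length ps
                \<and> fst s 0 = (if finite_index_ext H (subgroup_after_identification \<Gamma> r (set ps))
                             then 1 else 0))))"
proof (intro conjI)
  show "\<forall>(H :: 'a word set) (\<Gamma> :: ('a, 'v) lgraph) r (\<Gamma>' :: ('a, 'w) lgraph) r'.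
        nontrivial_fg_subgroup H \<and> stallings H \<Gamma> r \<and> stallings (H_fi H) \<Gamma>' r' \<longrightarrow>
        (\<forall>i\<in>verts (core \<Gamma> r).
           accessible_dfa (graph_dfa (core \<Gamma> r) i)
           \<and> (\<exists>i'\<in>verts (core \<Gamma>' r'). (i = r \<longrightarrow> i' = r')
                \<and> dfa_isomorphic (minimize (graph_dfa (core \<Gamma> r) i)) (graph_dfa (core \<Gamma>' r') i')))"
    by (intro allI impI ballI, elim conjE) (rule minimized_core)
  define L where "L = length (letters bs)"
  obtain a b c where le: "\<And>n. layout.time_partition L n \<le> a + b * n + c * (n * floor_log n)"
    using layout.time_partition_le[of L] by blast
  have "(\<lambda>n. real (layout.time_partition L n + (2 + 3 + n * (ccost (layout.outstep L) + 3) + ccost (layout.outfinish L))))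
      \<in> O(\<lambda>n. real n * ln (real n))"
  proof (rule bigo_n_ln_n)
    show "layout.time_partition L n + (2 + 3 + n * (ccost (layout.outstep L) + 3) + ccost (layout.outfinish L))
      \<le> (a + 5 + ccost (layout.outfinish L)) + (b + ccost (layout.outstep L) + 3) * n + c * (n * floor_log n)" for n
      using le[of n] by (simp add: algebra_simps)
  qed
  then show "\<exists>(P :: com) (T :: nat \<Rightarrow> nat).
        (\<lambda>n. real (T n)) \<in> O(\<lambda>n. real n * ln (real n))
        \<and> (\<forall>(H :: 'a word set) \<Gamma> r.
             nontrivial_fg_subgroup H \<and> stallings H \<Gamma> r \<and> numbered \<Gamma> \<longrightarrow>
             (\<exists>t s \<Gamma>' r'. exec P (input_state (graph_code bs \<Gamma> r)) t s \<and> t \<le> T (card (verts \<Gamma>))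
                \<and> stallings (H_fi H) \<Gamma>' r' \<and> numbered \<Gamma>'
                \<and> output_prefix (graph_code bs \<Gamma>' r') s))"
    using exec_partition_output[OF assms, folded L_def]
    by (intro exI[of _ "Seq (layout.partition_prog L) (layout.output_prog L)"] exI[of _ "\<lambda>n. layout.time_partition L n
      + (2 + 3 + n * (ccost (layout.outstep L) + 3) + ccost (layout.outfinish L))"] conjI allI impI) (assumption, elim conjE)
  have bigo: "(\<lambda>n. real (layout.time_partition L n + (ccost layout.checkinit + 4))) \<in> O(\<lambda>n. real n * ln (real n))"
  proof (rule bigo_n_ln_n)
    show "layout.time_partition L n + (ccost layout.checkinit + 4)
      \<le> (a + ccost layout.checkinit + 4) + b * n + c * (n * floor_log n)" for n
      using le[of n] by simp
  qed
  show "\<exists>(P :: com) (T :: nat \<Rightarrow> nat) (c :: nat).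
        (\<lambda>n. real (T n)) \<in> O(\<lambda>n. real n * ln (real n))
        \<and> (\<forall>(H :: 'a word set) \<Gamma> r ps.
             nontrivial_fg_subgroup H \<and> stallings H \<Gamma> r \<and> numbered \<Gamma>
               \<and> set ps \<subseteq> verts \<Gamma> \<times> verts \<Gamma> \<longrightarrow>
             (\<exists>t s. exec P (input_state (graph_code bs \<Gamma> r @ pairs_code ps)) t s
                \<and> t \<le> T (card (verts \<Gamma>)) + c * length ps
                \<and> fst s 0 = (if finite_index_ext H (subgroup_after_identification \<Gamma> r (set ps))
                             then 1 else 0)))"
    by (rule exI[of _ "Seq (layout.partition_prog L) (layout.check_prog L)"],
        rule exI[of _ "\<lambda>n. layout.time_partition L n + (ccost layout.checkinit + 4)"],
        rule exI[of _ "ccost (layout.checkstep L) + 4"], intro conjI allI impI, rule bigo, elim conjE)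
      (rule exec_partition_check[OF assms, folded L_def])
qed

end
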